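(* Let $\tau>0$, let $n,m\ge 1$ be integers, let $\widetilde A\colon C([-\tau,0];\mathbb R^n)\to\mathbb R^n$ be a bounded linear operator, and let $A$, $G$, $G^{\wedge m}$, $A^{[\wedge m]}$, $(\mathcal L^\wedge_m)^{\mathbb C}$ and $(\mathbb E^\wedge_m)^{\mathbb C}$ be as in the context. Let $\omega(G^{\wedge m})$ be the growth bound of the semigroup $G^{\wedge m}$, and let $\nu_0\in\mathbb R$ satisfy $-\nu_0>\omega(G^{\wedge m})$. Then for every $p=-\nu_0+i\omega$ with $\omega\in\mathbb R$, every $\Phi\in(\mathcal L^\wedge_m)^{\mathbb C}$ and every $T\ge 0$ we have $$-(A^{[\wedge m]}-pI)^{-1}\Phi=\int_0^T e^{-pt}G^{\wedge m}(t)\Phi\,dt+R_T(p;\Phi),$$ where $R_T(p;\Phi)\in\mathcal D(A^{[\wedge m]})\subset(\mathbb E^\wedge_m)^{\mathbb C}$, and for every $\varkappa\in(0,-\nu_0-\omega(G^{\wedge m}))$ there exists $M_\varkappa>0$ such that $$\|R_T(p;\Phi)\|_{(\mathbb E^\wedge_m)^{\mathbb C}}\le M_\varkappa e^{-\varkappa T}\,|\Phi|_{(\mathcal L^\wedge_m)^{\mathbb C}}$$ for all $\Phi\in(\mathcal L^\wedge_m)^{\mathbb C}$ and $T\ge 0$, uniformly in $p=-\nu_0+i\omega$ with $\omega\in\mathbb R$ (i.e. $M_\varkappa$ does not depend on $\omega$).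
   Context: Complexifications of real spaces are denoted by a superscript $\mathbb C$; the same symbol is used for an operator and its complexification. Delay operator. Let $\mu$ be the sum of Lebesgue measure on $[-\tau,0]$ and the unit point mass at $0$, and $\mathbb H=L_2([-\tau,0];\mu;\mathbb R^n)$. An element $\phi\in\mathbb H$ is a pair consisting of $\phi(0)\in\mathbb R^n$ and $\phi|_{(-\tau,0)}\in L_2(-\tau,0;\mathbb R^n)$. The domain $\mathcal D(A)$ consists of $\phi\in\mathbb H$ such that $\phi|_{(-\tau,0)}$ is (the class of) some $\psi\in W^{1,2}(-\tau,0;\mathbb R^n)\subset C([-\tau,0];\mathbb R^n)$ and $\phi(0)=\psi(0)$; for such $\phi$, $(A\phi)(0)=\widetilde A\psi$ and $(A\phi)|_{(-\tau,0)}=\psi'$. It is known that $A$ generates an eventually compact $C_0$-semigroup $G$ in $\mathbb H$. Exterior powers. The Hilbert tensor power $\mathbb H^{\otimes m}$ is identified with $\mathcal L^\otimes_m=L_2([-\tau,0]^m;\mu^{\otimes m};(\mathbb R^n)^{\otimes m})$ via $(\phi_1\otimes\cdots\otimes\phi_m)(\theta_1,\dots,\theta_m)=\phi_1(\theta_1)\otimes\cdots\otimes\phi_m(\theta_m)$. The exterior power $\mathbb H^{\wedge m}$ is the image of the orthogonal projector $\Pi^\wedge_m=\frac1{m!}\sum_{\sigma\in\mathbb S_m}(-1)^\sigma S_\sigma$, where $S_\sigma(v_1\otimes\cdots\otimes v_m)=v_{\sigma(1)}\otimes\cdots\otimes v_{\sigma(m)}$; its image in $\mathcal L^\otimes_m$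 is denoted $\mathcal L^\wedge_m$. $G^{\wedge m}(t)$ is the restriction of $G(t)^{\otimes m}$ to $\mathcal L^\wedge_m$; $G^{\wedge m}$ is a $C_0$-semigroup and $A^{[\wedge m]}$ is its generator. The space $\mathbb E^\wedge_m$. For $0\le k\le m$ and $1\le j_1<\dots<j_k\le m$, the restriction $R_{j_1\ldots j_k}\Phi\in L_2((-\tau,0)^k;(\mathbb R^n)^{\otimes m})$ of $\Phi\in\mathcal L^\otimes_m$ is the function of $(\theta_{j_1},\dots,\theta_{j_k})$ obtained by setting $\theta_j=0$ for all $j\notin\{j_1,\dots,j_k\}$ (for $k=0$ it is the value at $(0,\dots,0)$); $\Phi$ is uniquely determined by all its restrictions. For $k\ge1$, $\mathbb E_k((\mathbb R^n)^{\otimes m})$ is the Banach space of $\Psi\in L_2((-\tau,0)^k;(\mathbb R^n)^{\otimes m})$ such that for each $j\in\{1,\dots,k\}$ there is $\Psi^b_j\in C([-\tau,0];L_2((-\tau,0)^{k-1};(\mathbb R^n)^{\otimes m}))$ with $\Psi(\dots,\theta_j=\theta,\dots)=\Psi^b_j(\theta)$ (as functions of the remaining variables) for a.e. $\theta\in[-\tau,0]$, with norm $\sup_j\sup_\theta\|\Psi^b_j(\theta)\|_{L_2}$; $\mathbb E_0((\mathbb R^n)^{\otimes m})=(\mathbb R^n)^{\otimes m}$. $\mathbb E^\otimes_m$ is the set of $\Phi\in\mathcal L^\otimes_m$ with $R_{j_1\ldots j_k}\Phi\in\mathbb E_k((\mathbb R^n)^{\otimes m})$ for all $k$ and $j_1<\dots<j_k$,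 normed by the sum (or any equivalent combination) of the norms of all restrictions, and $\mathbb E^\wedge_m=\mathbb E^\otimes_m\cap\mathcal L^\wedge_m$. It is known that $\mathcal D(A^{[\wedge m]})$ (with the graph norm) embeds continuously into $(\mathbb E^\wedge_m)^{\mathbb C}$. *)

theory Defs
  imports "HOL-Analysis.Analysis"
begin

section \<open>Square-integrable functions\<close>

text \<open>
  An element of \<open>L\<^sub>2(M)\<close> is given by a representing function; two functions that agree almost
  everywhere represent the same element.  Accordingly the sets below consist of representatives,
  \<open>l2norm M\<close> is the norm of the represented class (a junk value \<open>0\<close> if the function is not
  square-integrable), and every equation between elements of such a space is stated almost everywhere.
\<close>

definition L2 :: "'a measure \<Rightarrow> ('a \<Rightarrow> 'b::real_normed_vector) set" where
  "L2 M = {f \<in> borel_measurable M. integrable M (\<lambda>x. (norm (f x))\<^sup>2)}"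

definition l2norm :: "'a measure \<Rightarrow> ('a \<Rightarrow> 'b::real_normed_vector) \<Rightarrow> real" where
  "l2norm M f = sqrt (\<integral>x. (norm (f x))\<^sup>2 \<partial>M)"

text \<open>
  The integral over \<open>[0,T]\<close> of an \<open>L\<^sub>2(M)\<close>-valued function: this is the definition of
  \<open>has_integral\<close> with the norm of the type replaced by \<^const>\<open>l2norm\<close>.
\<close>

definition l2_has_integral ::
    "'a measure \<Rightarrow> (real \<Rightarrow> 'a \<Rightarrow> 'b::real_normed_vector) \<Rightarrow> real \<Rightarrow> ('a \<Rightarrow> 'b) \<Rightarrow> bool" where
  "l2_has_integral M f T I \<longleftrightarrow> (\<forall>s\<in>{0..T}. f s \<in> L2 M) \<and> I \<in> L2 M \<and>
     (\<forall>e>0. \<exists>\<gamma>. gauge \<gamma> \<and>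
        (\<forall>D. D tagged_division_of {0..T} \<and> \<gamma> fine D \<longrightarrow>
           l2norm M (\<lambda>x. (\<Sum>(s, K)\<in>D. measure lborel K *\<^sub>R f s x) - I x) < e))"


section \<open>Operators and semigroups on subspaces of \<open>L\<^sub>2\<close>\<close>

text \<open>
  In what follows \<open>X\<close> is a closed linear subspace of \<open>L\<^sub>2(M)\<close>.  Linearity and boundedness imply
  that an operator maps representatives of one class to representatives of one class.  Unbounded
  operators are given by their graphs.
\<close>

definition bounded_op ::
    "'a measure \<Rightarrow> ('a \<Rightarrow> 'b::real_normed_vector) set \<Rightarrow> (('a \<Rightarrow> 'b) \<Rightarrow> 'a \<Rightarrow> 'b) \<Rightarrow> bool" where
  "bounded_op M X T \<longleftrightarrow>
     (\<forall>f\<in>X. T f \<in> X) \<and>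
     (\<forall>f\<in>X. \<forall>g\<in>X. AE x in M. T (\<lambda>y. f y + g y) x = T f x + T g x) \<and>
     (\<forall>c. \<forall>f\<in>X. AE x in M. T (\<lambda>y. c *\<^sub>R f y) x = c *\<^sub>R T f x) \<and>
     (\<exists>K. \<forall>f\<in>X. l2norm M (T f) \<le> K * l2norm M f)"

definition c0_semigroup ::
    "'a measure \<Rightarrow> ('a \<Rightarrow> 'b::real_normed_vector) set \<Rightarrow> (real \<Rightarrow> ('a \<Rightarrow> 'b) \<Rightarrow> 'a \<Rightarrow> 'b) \<Rightarrow> bool" where
  "c0_semigroup M X G \<longleftrightarrow>
     (\<forall>t\<ge>0. bounded_op M X (G t)) \<and>
     (\<forall>f\<in>X. AE x in M. G 0 f x = f x) \<and>
     (\<forall>s\<ge>0. \<forall>t\<ge>0. \<forall>f\<in>X. AE x in M. G (s + t) f x = G s (G t f) x) \<and>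
     (\<forall>f\<in>X. ((\<lambda>t. l2norm M (\<lambda>x. G t f x - f x)) \<longlongrightarrow> 0) (at_right 0))"

definition generator ::
    "'a measure \<Rightarrow> ('a \<Rightarrow> 'b::real_normed_vector) set \<Rightarrow> (real \<Rightarrow> ('a \<Rightarrow> 'b) \<Rightarrow> 'a \<Rightarrow> 'b)
       \<Rightarrow> (('a \<Rightarrow> 'b) \<times> ('a \<Rightarrow> 'b)) set" where
  "generator M X G = {(f, g). f \<in> X \<and> g \<in> X \<and>
     ((\<lambda>h. l2norm M (\<lambda>x. (G h f x - f x) /\<^sub>R h - g x)) \<longlongrightarrow> 0) (at_right 0)}"

text \<open>The growth bound may be \<open>-\<infinity>\<close> (for instance when \<open>G(t)\<close> vanishes for large \<open>t\<close>).\<close>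

definition growth_bound ::
    "'a measure \<Rightarrow> ('a \<Rightarrow> 'b::real_normed_vector) set \<Rightarrow> (real \<Rightarrow> ('a \<Rightarrow> 'b) \<Rightarrow> 'a \<Rightarrow> 'b) \<Rightarrow> ereal" where
  "growth_bound M X G =
     Inf {ereal w |w. \<exists>C. \<forall>t\<ge>0. \<forall>f\<in>X. l2norm M (G t f) \<le> C * exp (w * t) * l2norm M f}"


section \<open>Complexification\<close>

text \<open>
  The complexification of a space of \<open>\<real>\<^sup>k\<close>-valued functions is the space of \<open>\<complex>\<^sup>k\<close>-valued functions
  whose real and imaginary parts lie in the given space.
\<close>

definition re_fun :: "('a \<Rightarrow> complex^'k) \<Rightarrow> 'a \<Rightarrow> real^'k" where
  "re_fun \<Phi> = (\<lambda>x. \<chi> i. Re (\<Phi> x $ i))"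

definition im_fun :: "('a \<Rightarrow> complex^'k) \<Rightarrow> 'a \<Rightarrow> real^'k" where
  "im_fun \<Phi> = (\<lambda>x. \<chi> i. Im (\<Phi> x $ i))"

definition cx_space :: "('a \<Rightarrow> real^'k) set \<Rightarrow> ('a \<Rightarrow> complex^'k) set" where
  "cx_space X = {\<Phi>. re_fun \<Phi> \<in> X \<and> im_fun \<Phi> \<in> X}"

definition cx_op ::
    "(('a \<Rightarrow> real^'k) \<Rightarrow> 'a \<Rightarrow> real^'k) \<Rightarrow> ('a \<Rightarrow> complex^'k) \<Rightarrow> 'a \<Rightarrow> complex^'k" where
  "cx_op T \<Phi> = (\<lambda>x. \<chi> i. Complex (T (re_fun \<Phi>) x $ i) (T (im_fun \<Phi>) x $ i))"

definition cx_graph ::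
    "(('a \<Rightarrow> real^'k) \<times> ('a \<Rightarrow> real^'k)) set \<Rightarrow> (('a \<Rightarrow> complex^'k) \<times> ('a \<Rightarrow> complex^'k)) set" where
  "cx_graph B = {(\<Phi>, \<Psi>). (re_fun \<Phi>, re_fun \<Psi>) \<in> B \<and> (im_fun \<Phi>, im_fun \<Psi>) \<in> B}"

text \<open>
  \<open>B - pI\<close> maps the domain of \<open>B\<close> onto \<open>X\<close>, and its inverse exists and is bounded.
\<close>

definition in_resolvent_set ::
    "'a measure \<Rightarrow> ('a \<Rightarrow> complex^'k) set \<Rightarrow> (('a \<Rightarrow> complex^'k) \<times> ('a \<Rightarrow> complex^'k)) set
       \<Rightarrow> complex \<Rightarrow> bool" where
  "in_resolvent_set M X B p \<longleftrightarrow>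
     (\<forall>\<Phi>\<in>X. \<exists>(\<Psi>, \<Xi>)\<in>B. AE x in M. \<Xi> x - p *s \<Psi> x = \<Phi> x) \<and>
     (\<exists>K. \<forall>(\<Psi>, \<Xi>)\<in>B. l2norm M \<Psi> \<le> K * l2norm M (\<lambda>x. \<Xi> x - p *s \<Psi> x))"

text \<open>A representative of \<open>(B - pI)\<^sup>-\<^sup>1\<Phi>\<close>, meaningful for \<open>p\<close> in the resolvent set.\<close>

definition resolvent ::
    "'a measure \<Rightarrow> (('a \<Rightarrow> complex^'k) \<times> ('a \<Rightarrow> complex^'k)) set
       \<Rightarrow> complex \<Rightarrow> ('a \<Rightarrow> complex^'k) \<Rightarrow> 'a \<Rightarrow> complex^'k" where
  "resolvent M B p \<Phi> = (SOME \<Psi>. \<exists>\<Xi>. (\<Psi>, \<Xi>) \<in> B \<and> (AE x in M. \<Xi> x - p *s \<Psi> x = \<Phi> x))"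


section \<open>The delay operator\<close>

definition leb :: "real \<Rightarrow> real measure" where
  "leb \<tau> = restrict_space lborel {-\<tau><..<0}"

definition delay_measure :: "real \<Rightarrow> real measure" where
  "delay_measure \<tau> = measure_of {-\<tau>..0} (sets (restrict_space borel {-\<tau>..0}))
     (\<lambda>X. emeasure lborel X + indicator X 0)"

lemma space_delay_measure [simp]: "space (delay_measure \<tau>) = {-\<tau>..0}"
  unfolding delay_measure_def
  by (intro space_measure_of) (auto simp: sets_restrict_space)

lemma sets_delay_measure [simp, measurable_cong]:
  "sets (delay_measure \<tau>) = sets (restrict_space borel {-\<tau>..0})"
proof -
  have "space (restrict_space (borel :: real measure) {-\<tau>..0}) = {-\<tau>..0}"
    by (simp add: space_restrict_space)
  then show ?thesis
    unfolding delay_measure_def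
    by (metis sets.sets_measure_of_eq)
qed

lemma emeasure_delay_measure:
  assumes "X \<in> sets (delay_measure \<tau>)"
  shows "emeasure (delay_measure \<tau>) X = emeasure lborel X + indicator X 0"
proof (rule emeasure_measure_of[OF delay_measure_def _ _ _ assms])
  show "sets (restrict_space borel {-\<tau>..0}) \<subseteq> Pow {-\<tau>..0}"
    by (auto simp: sets_restrict_space)
  show "positive (sets (delay_measure \<tau>)) (\<lambda>X. emeasure lborel X + indicator X 0)"
    by (simp add: positive_def)
  show "countably_additive (sets (delay_measure \<tau>)) (\<lambda>X. emeasure lborel X + indicator X 0)"
  proof (rule countably_additiveI)
    fix A :: "nat \<Rightarrow> real set"
    assume A: "range A \<subseteq> sets (delay_measure \<tau>)" and disj: "disjoint_family A"
    then have "range A \<subseteq> sets lborel"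
      by (auto simp: sets_restrict_space)
    then have "(\<Sum>i. emeasure lborel (A i)) = emeasure lborel (\<Union>i. A i)"
      using disj by (intro suminf_emeasure) auto
    moreover have "(\<Sum>i. indicator (A i) 0 :: ennreal) = indicator (\<Union>i. A i) 0"
      using disj by (rule suminf_indicator)
    ultimately show "(\<Sum>i. emeasure lborel (A i) + indicator (A i) 0) =
        emeasure lborel (\<Union>i. A i) + indicator (\<Union>i. A i) 0"
      by (simp add: suminf_add[symmetric])
  qed
qed

text \<open>\<open>\<psi>\<close> is the continuous representative of an element of \<open>W\<^sup>1\<^sup>,\<^sup>2(-\<tau>,0)\<close> and \<open>g\<close> is its weak
  derivative; the test functions are the compactly supported \<open>C\<^sup>1\<close> functions.\<close>

definition W12 :: "real \<Rightarrow> (real \<Rightarrow> real^'n) \<Rightarrow> (real \<Rightarrow> real^'n) \<Rightarrow> bool" where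
  "W12 \<tau> \<psi> g \<longleftrightarrow> continuous_on {-\<tau>..0} \<psi> \<and> \<psi> \<in> L2 (leb \<tau>) \<and> g \<in> L2 (leb \<tau>) \<and>
     (\<forall>\<eta> \<eta>' a b. -\<tau> < a \<and> b < 0 \<and> (\<forall>\<theta>. \<theta> \<notin> {a..b} \<longrightarrow> \<eta> \<theta> = 0) \<and>
         (\<forall>\<theta>. (\<eta> has_real_derivative \<eta>' \<theta>) (at \<theta>)) \<and> continuous_on UNIV \<eta>' \<longrightarrow>
       (\<integral>\<theta>. \<eta>' \<theta> *\<^sub>R \<psi> \<theta> \<partial>leb \<tau>) = - (\<integral>\<theta>. \<eta> \<theta> *\<^sub>R g \<theta> \<partial>leb \<tau>))"

text \<open>Bounded linear operators from \<open>C([-\<tau>,0];\<real>\<^sup>n)\<close> to \<open>\<real>\<^sup>n\<close>; the bound forces the value to depend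
  on the restriction of the argument to \<open>[-\<tau>,0]\<close> only.\<close>

definition bounded_linear_C :: "real \<Rightarrow> ((real \<Rightarrow> real^'n) \<Rightarrow> real^'n) \<Rightarrow> bool" where
  "bounded_linear_C \<tau> L \<longleftrightarrow>
     (\<forall>f g. continuous_on {-\<tau>..0} f \<and> continuous_on {-\<tau>..0} g \<longrightarrow>
        L (\<lambda>\<theta>. f \<theta> + g \<theta>) = L f + L g) \<and>
     (\<forall>c f. continuous_on {-\<tau>..0} f \<longrightarrow> L (\<lambda>\<theta>. c *\<^sub>R f \<theta>) = c *\<^sub>R L f) \<and>
     (\<exists>K. \<forall>f. continuous_on {-\<tau>..0} f \<longrightarrow> norm (L f) \<le> K * (SUP \<theta>\<in>{-\<tau>..0}. norm (f \<theta>)))"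

definition delay_op ::
    "real \<Rightarrow> ((real \<Rightarrow> real^'n) \<Rightarrow> real^'n) \<Rightarrow> ((real \<Rightarrow> real^'n) \<times> (real \<Rightarrow> real^'n)) set" where
  "delay_op \<tau> L = {(\<phi>, \<xi>). \<phi> \<in> L2 (delay_measure \<tau>) \<and> \<xi> \<in> L2 (delay_measure \<tau>) \<and>
     (\<exists>\<psi>. W12 \<tau> \<psi> \<xi> \<and> (AE \<theta> in leb \<tau>. \<phi> \<theta> = \<psi> \<theta>) \<and> \<phi> 0 = \<psi> 0 \<and> \<xi> 0 = L \<psi>)}"


section \<open>Tensor and exterior powers\<close>

text \<open>
  The \<open>m\<close> factors are indexed by a finite type \<open>'m\<close> with \<open>m\<close> elements, and \<open>(\<real>\<^sup>n)\<^sup>\<otimes>\<^sup>m\<close> is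
  \<open>real^('m \<Rightarrow> 'n)\<close>: a multi-index assigns to each factor a coordinate of \<open>\<real>\<^sup>n\<close>.
\<close>

definition pow_measure :: "real \<Rightarrow> ('m::finite \<Rightarrow> real) measure" where
  "pow_measure \<tau> = PiM UNIV (\<lambda>_. delay_measure \<tau>)"

definition L_tensor :: "real \<Rightarrow> (('m::finite \<Rightarrow> real) \<Rightarrow> real^('m \<Rightarrow> 'n::finite)) set" where
  "L_tensor \<tau> = L2 (pow_measure \<tau>)"

definition elem_tensor ::
    "('m::finite \<Rightarrow> real \<Rightarrow> real^'n::finite) \<Rightarrow> ('m \<Rightarrow> real) \<Rightarrow> real^('m \<Rightarrow> 'n)" where
  "elem_tensor \<phi> = (\<lambda>\<theta>. \<chi> i. \<Prod>j\<in>UNIV. \<phi> j (\<theta> j) $ i j)"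

definition perm_op ::
    "('m::finite \<Rightarrow> 'm) \<Rightarrow> (('m \<Rightarrow> real) \<Rightarrow> real^('m \<Rightarrow> 'n::finite)) \<Rightarrow> ('m \<Rightarrow> real) \<Rightarrow> real^('m \<Rightarrow> 'n)" where
  "perm_op \<sigma> \<Phi> = (\<lambda>\<theta>. \<chi> i. \<Phi> (\<theta> \<circ> inv \<sigma>) $ (i \<circ> inv \<sigma>))"

lemma perm_op_elem_tensor:
  assumes "\<sigma> permutes UNIV"
  shows "perm_op \<sigma> (elem_tensor \<phi>) = elem_tensor (\<lambda>j. \<phi> (\<sigma> j))"
proof -
  have bij: "bij \<sigma>"
    using assms by (rule permutes_bij)
  have "(\<Prod>k\<in>UNIV. \<phi> k (\<theta> (inv \<sigma> k)) $ i (inv \<sigma> k)) = (\<Prod>j\<in>UNIV. \<phi> (\<sigma> j) (\<theta> j) $ i j)" for \<theta> i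
    by (rule prod.reindex_bij_witness[where i = \<sigma> and j = "inv \<sigma>"])
       (simp_all add: bij bij_is_inj bij_is_surj surj_f_inv_f)
  then show ?thesis
    by (simp add: perm_op_def elem_tensor_def)
qed

definition alt_proj ::
    "(('m::finite \<Rightarrow> real) \<Rightarrow> real^('m \<Rightarrow> 'n::finite)) \<Rightarrow> ('m \<Rightarrow> real) \<Rightarrow> real^('m \<Rightarrow> 'n)" where
  "alt_proj \<Phi> = (\<lambda>\<theta>. (1 / fact CARD('m)) *\<^sub>R
     (\<Sum>\<sigma> | \<sigma> permutes UNIV. of_int (sign \<sigma>) *\<^sub>R perm_op \<sigma> \<Phi> \<theta>))"

definition L_wedge :: "real \<Rightarrow> (('m::finite \<Rightarrow> real) \<Rightarrow> real^('m \<Rightarrow> 'n::finite)) set" where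
  "L_wedge \<tau> = {\<Phi> \<in> L_tensor \<tau>. \<exists>\<Psi>\<in>L_tensor \<tau>. AE \<theta> in pow_measure \<tau>. \<Phi> \<theta> = alt_proj \<Psi> \<theta>}"

text \<open>\<open>S\<close> is the tensor power \<open>T\<^sup>\<otimes>\<^sup>m\<close>: the bounded operator acting factorwise on elementary tensors
  (unique, since these span a dense subspace).\<close>

definition is_tensor_power ::
    "real \<Rightarrow> ((real \<Rightarrow> real^'n) \<Rightarrow> real \<Rightarrow> real^'n::finite) \<Rightarrow>
     ((('m::finite \<Rightarrow> real) \<Rightarrow> real^('m \<Rightarrow> 'n)) \<Rightarrow> ('m \<Rightarrow> real) \<Rightarrow> real^('m \<Rightarrow> 'n)) \<Rightarrow> bool" where
  "is_tensor_power \<tau> T S \<longleftrightarrow> bounded_op (pow_measure \<tau>) (L_tensor \<tau>) S \<and>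
     (\<forall>\<phi>. (\<forall>j. \<phi> j \<in> L2 (delay_measure \<tau>)) \<longrightarrow>
        (AE \<theta> in pow_measure \<tau>. S (elem_tensor \<phi>) \<theta> = elem_tensor (\<lambda>j. T (\<phi> j)) \<theta>))"


section \<open>The spaces \<open>\<bbbE>\<close>\<close>

text \<open>For a set \<open>J = {j\<^sub>1 < \<dots> < j\<^sub>k}\<close> of factors, functions on \<open>(-\<tau>,0)\<^sup>k\<close> are functions of
  \<open>(\<theta>\<^sub>j)\<^bsub>j \<in> J\<^esub>\<close>.  For \<open>J = {}\<close> the measure space is a single point of mass one.\<close>

definition leb_pow :: "real \<Rightarrow> 'm set \<Rightarrow> ('m \<Rightarrow> real) measure" where
  "leb_pow \<tau> J = PiM J (\<lambda>_. leb \<tau>)"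

definition restr :: "'m set \<Rightarrow> (('m \<Rightarrow> real) \<Rightarrow> 'v) \<Rightarrow> ('m \<Rightarrow> real) \<Rightarrow> 'v" where
  "restr J \<Phi> = (\<lambda>\<theta>. \<Phi> (\<lambda>j. if j \<in> J then \<theta> j else 0))"

text \<open>\<open>b\<close> is the continuous \<open>L\<^sub>2\<close>-valued function \<open>\<Psi>\<^sup>b\<^sub>j\<close>.\<close>

definition is_section ::
    "real \<Rightarrow> 'm set \<Rightarrow> 'm \<Rightarrow> (('m \<Rightarrow> real) \<Rightarrow> 'v::real_normed_vector)
       \<Rightarrow> (real \<Rightarrow> ('m \<Rightarrow> real) \<Rightarrow> 'v) \<Rightarrow> bool" where
  "is_section \<tau> J j \<Psi> b \<longleftrightarrow>
     (\<forall>\<theta>\<in>{-\<tau>..0}. b \<theta> \<in> L2 (leb_pow \<tau> (J - {j}))) \<and>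
     (\<forall>\<theta>\<^sub>0\<in>{-\<tau>..0}. ((\<lambda>\<theta>. l2norm (leb_pow \<tau> (J - {j})) (\<lambda>y. b \<theta> y - b \<theta>\<^sub>0 y)) \<longlongrightarrow> 0)
        (at \<theta>\<^sub>0 within {-\<tau>..0})) \<and>
     (AE \<theta> in leb \<tau>. AE y in leb_pow \<tau> (J - {j}). \<Psi> (y(j := \<theta>)) = b \<theta> y)"

definition E_space :: "real \<Rightarrow> 'm set \<Rightarrow> (('m \<Rightarrow> real) \<Rightarrow> 'v::real_normed_vector) set" where
  "E_space \<tau> J = {\<Psi> \<in> L2 (leb_pow \<tau> J). \<forall>j\<in>J. \<exists>b. is_section \<tau> J j \<Psi> b}"

text \<open>The classes \<open>\<Psi>\<^sup>b\<^sub>j(\<theta>)\<close> are determined by \<open>\<Psi>\<close>, so the choice of sections does not matter.\<close>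

definition E_norm :: "real \<Rightarrow> 'm set \<Rightarrow> (('m \<Rightarrow> real) \<Rightarrow> 'v::real_normed_vector) \<Rightarrow> real" where
  "E_norm \<tau> J \<Psi> = (if J = {} then norm (\<Psi> (\<lambda>_. undefined)) else
     (SUP j\<in>J. SUP \<theta>\<in>{-\<tau>..0}.
        l2norm (leb_pow \<tau> (J - {j})) ((SOME b. is_section \<tau> J j \<Psi> b) \<theta>)))"

definition E_tensor :: "real \<Rightarrow> (('m::finite \<Rightarrow> real) \<Rightarrow> real^('m \<Rightarrow> 'n::finite)) set" where
  "E_tensor \<tau> = {\<Phi> \<in> L_tensor \<tau>. \<forall>J. restr J \<Phi> \<in> E_space \<tau> J}"

definition E_wedge :: "real \<Rightarrow> (('m::finite \<Rightarrow> real) \<Rightarrow> real^('m \<Rightarrow> 'n::finite)) set" where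
  "E_wedge \<tau> = E_tensor \<tau> \<inter> L_wedge \<tau>"

text \<open>For complex-valued functions this is a norm on the complexification of \<open>E_tensor\<close>.\<close>

definition E_tensor_norm :: "real \<Rightarrow> (('m::finite \<Rightarrow> real) \<Rightarrow> 'v::real_normed_vector) \<Rightarrow> real" where
  "E_tensor_norm \<tau> \<Phi> = (\<Sum>J\<in>UNIV. E_norm \<tau> J (restr J \<Phi>))"


section \<open>The additive compound\<close>

text \<open>The complexified generator of the restriction to \<open>L_wedge \<tau>\<close> of a family of operators on
  \<open>L_tensor \<tau>\<close>.\<close>

definition wedge_generator ::
    "real \<Rightarrow> (real \<Rightarrow> (('m::finite \<Rightarrow> real) \<Rightarrow> real^('m \<Rightarrow> 'n::finite)) \<Rightarrow> ('m \<Rightarrow> real) \<Rightarrow> real^('m \<Rightarrow> 'n))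
       \<Rightarrow> ((('m \<Rightarrow> real) \<Rightarrow> complex^('m \<Rightarrow> 'n)) \<times> (('m \<Rightarrow> real) \<Rightarrow> complex^('m \<Rightarrow> 'n))) set" where
  "wedge_generator \<tau> Gm = cx_graph (generator (pow_measure \<tau>) (L_wedge \<tau>) Gm)"

end

theory Submission
  imports Defs "HOL-Probability.Discrete_Topology"
begin

text \<open>
  On the dense set of sums of elementary tensors with factors in the domain of \<open>A\<close>, the semigroup
  \<open>G\<^sup>\<otimes>\<^sup>m\<close> acts for times in \<open>[0, \<tau>]\<close> by translating continuous functions.  Freezing one
  variable of \<open>\<integral>\<^sub>0\<^sup>\<tau> w(t) G\<^sup>\<otimes>\<^sup>m(t)\<Phi> dt\<close> and applying Cauchy-Schwarz in \<open>t\<close>, one sees that the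
  sections of this integral depend continuously on the frozen variable and are bounded in \<open>L\<^sub>2\<close> by
  \<open>C sup |w| |\<Phi>|\<close>; by density this holds for all \<open>\<Phi>\<close>, so that such integrals lie in \<open>\<bbbE>\<^sup>\<otimes>\<^sub>m\<close>.

  Let \<open>S(t) = e\<^sup>-\<^sup>p\<^sup>t G\<^sup>\<and>\<^sup>m(t)\<close>, an exponentially stable semigroup.  With the orbit sum
  \<open>Q\<Phi> = \<Sum>\<^sub>k S(k\<tau>)\<Phi>\<close> one has \<open>-(A\<^sup>[\<^sup>\<and>\<^sup>m\<^sup>] - p)\<^sup>-\<^sup>1\<Phi> = \<integral>\<^sub>0\<^sup>\<tau> S(t)Q\<Phi> dt\<close>, an integral of the above kind with
  weights bounded independently of \<open>\<omega>\<close>.  This shows that the domain embeds into \<open>\<bbbE>\<^sup>\<and>\<^sub>m\<close>; and since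
  the remainder is the same expression with \<open>S(T)\<Phi>\<close> in place of \<open>\<Phi>\<close>, its norm decays like
  \<open>e\<^sup>-\<^sup>\<kappa>\<^sup>T\<close>.
\<close>

section \<open>Square-integrable functions\<close>

abbreviation l2sq :: "'a measure \<Rightarrow> ('a \<Rightarrow> 'b::real_normed_vector) \<Rightarrow> ennreal" where
  "l2sq M f \<equiv> \<integral>\<^sup>+x. ennreal ((norm (f x))\<^sup>2) \<partial>M"

abbreviation "\<D> \<equiv> delay_measure"

lemma L2_measurable [measurable_dest]: "f \<in> L2 M \<Longrightarrow> f \<in> borel_measurable M"
  by (simp add: L2_def)

lemma L2_integrable: "f \<in> L2 M \<Longrightarrow> integrable M (\<lambda>x. (norm (f x))\<^sup>2)"
  by (simp add: L2_def)

lemma l2norm_nonneg [simp]: "0 \<le> l2norm M f"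
  by (simp add: l2norm_def)

lemma l2norm_sq: "(l2norm M f)\<^sup>2 = (\<integral>x. (norm (f x))\<^sup>2 \<partial>M)"
  by (simp add: l2norm_def)

lemma l2norm_squeeze:
  assumes "(g \<longlongrightarrow> 0) (at a within S)" and "\<And>s. s \<in> S \<Longrightarrow> s \<noteq> a \<Longrightarrow> l2norm M (F s) \<le> g s"
  shows "((\<lambda>s. l2norm M (F s)) \<longlongrightarrow> 0) (at a within S)"
  by (rule Lim_null_comparison[OF _ assms(1)]) (use assms(2) in \<open>auto simp: eventually_at_filter\<close>)

lemma L2_zero [simp]: "(\<lambda>x. 0) \<in> L2 M"
  by (simp add: L2_def)

lemma L2_scaleR:
  fixes f :: "'a \<Rightarrow> 'b::real_normed_vector"
  assumes "f \<in> L2 M" shows "(\<lambda>x. c *\<^sub>R f x) \<in> L2 M"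
  using assms by (auto simp: L2_def power_mult_distrib intro!: borel_measurable_scaleR)

lemma norm_add_sq_le: "(norm (x + y :: 'b::real_normed_vector))\<^sup>2 \<le> 2 * (norm x)\<^sup>2 + 2 * (norm y)\<^sup>2"
proof -
  have "(norm (x + y))\<^sup>2 \<le> (norm x + norm y)\<^sup>2"
    by (intro power_mono norm_triangle_ineq norm_ge_zero)
  also have "\<dots> \<le> 2 * (norm x)\<^sup>2 + 2 * (norm y)\<^sup>2"
    using sum_squares_ge_zero[of "norm x - norm y" 0] by (simp add: power2_eq_square algebra_simps)
  finally show ?thesis .
qed

lemma L2_add:
  fixes f g :: "'a \<Rightarrow> 'b::euclidean_space"
  assumes f: "f \<in> L2 M" and g: "g \<in> L2 M" shows "(\<lambda>x. f x + g x) \<in> L2 M"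
proof -
  note [measurable] = L2_measurable[OF f] L2_measurable[OF g]
  have "integrable M (\<lambda>x. (norm (f x + g x))\<^sup>2)"
  proof (rule Bochner_Integration.integrable_bound)
    show "integrable M (\<lambda>x. 2 * (norm (f x))\<^sup>2 + 2 * (norm (g x))\<^sup>2)"
      using L2_integrable[OF f] L2_integrable[OF g] by auto
    show "AE x in M. norm ((norm (f x + g x))\<^sup>2) \<le> norm (2 * (norm (f x))\<^sup>2 + 2 * (norm (g x))\<^sup>2)"
      using norm_add_sq_le by (auto intro: order_trans)
  qed simp
  then show ?thesis by (simp add: L2_def)
qed

lemma L2_diff:
  fixes f g :: "'a \<Rightarrow> 'b::euclidean_space"
  assumes f: "f \<in> L2 M" and g: "g \<in> L2 M" shows "(\<lambda>x. f x - g x) \<in> L2 M"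
  using L2_add[OF f L2_scaleR[OF g, of "-1"]] by simp

lemma L2_sum:
  fixes f :: "'i \<Rightarrow> 'a \<Rightarrow> 'b::euclidean_space"
  assumes "\<And>i. i \<in> I \<Longrightarrow> f i \<in> L2 M" shows "(\<lambda>x. \<Sum>i\<in>I. f i x) \<in> L2 M"
  using assms by (induction I rule: infinite_finite_induct) (auto intro: L2_add)

lemma L2_norm: "f \<in> L2 M \<Longrightarrow> (\<lambda>x. norm (f x)) \<in> L2 M"
  by (auto simp: L2_def)

lemma l2norm_norm: "l2norm M (\<lambda>x. norm (f x)) = l2norm M f"
  by (simp add: l2norm_def)

lemma L2_cong_AE:
  assumes "f \<in> L2 M" "g \<in> borel_measurable M" "AE x in M. f x = g x" shows "g \<in> L2 M"
proof -
  have "integrable M (\<lambda>x. (norm (f x))\<^sup>2) \<longleftrightarrow> integrable M (\<lambda>x. (norm (g x))\<^sup>2)"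
    using assms by (intro integrable_cong_AE) (auto dest: L2_measurable)
  with assms show ?thesis by (auto simp: L2_def)
qed

lemma l2norm_cong_AE:
  assumes "f \<in> borel_measurable M" "g \<in> borel_measurable M" "AE x in M. f x = g x"
  shows "l2norm M f = l2norm M g"
  unfolding l2norm_def using assms by (intro arg_cong[where f=sqrt] integral_cong_AE) auto

lemma L2_inner_integrable:
  fixes f g :: "'a \<Rightarrow> 'b::euclidean_space"
  assumes f: "f \<in> L2 M" and g: "g \<in> L2 M" shows "integrable M (\<lambda>x. f x \<bullet> g x)"
proof (rule Bochner_Integration.integrable_bound)
  show "integrable M (\<lambda>x. (norm (f x))\<^sup>2 + (norm (g x))\<^sup>2)"
    using L2_integrable[OF f] L2_integrable[OF g] by auto
  show "(\<lambda>x. f x \<bullet> g x) \<in> borel_measurable M" using f g by (auto dest: L2_measurable)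
  have "\<bar>x \<bullet> y\<bar> \<le> (norm x)\<^sup>2 + (norm y)\<^sup>2" for x y :: 'b
  proof -
    have "2 * (norm x * norm y) \<le> (norm x)\<^sup>2 + (norm y)\<^sup>2"
      using sum_squares_ge_zero[of "norm x - norm y" 0] by (simp add: power2_eq_square algebra_simps)
    moreover have "\<bar>x \<bullet> y\<bar> \<le> norm x * norm y" by (rule Cauchy_Schwarz_ineq2)
    moreover have "0 \<le> norm x * norm y" by simp
    ultimately show ?thesis by linarith
  qed
  then show "AE x in M. norm (f x \<bullet> g x) \<le> norm ((norm (f x))\<^sup>2 + (norm (g x))\<^sup>2)" by auto
qed

text \<open>The quadratic polynomial |f - t g|^2 in t is nonnegative, and its minimum over t gives
  the bound. If the leading coefficient vanishes, the polynomial is affine and nonnegative, hence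
  without linear term.\<close>

lemma L2_Cauchy_Schwarz:
  fixes f g :: "'a \<Rightarrow> 'b::euclidean_space"
  assumes f: "f \<in> L2 M" and g: "g \<in> L2 M"
  shows "\<bar>\<integral>x. f x \<bullet> g x \<partial>M\<bar> \<le> l2norm M f * l2norm M g"
proof -
  define A B C where "A = (\<integral>x. (norm (f x))\<^sup>2 \<partial>M)" and "B = (\<integral>x. (norm (g x))\<^sup>2 \<partial>M)"
    and "C = (\<integral>x. f x \<bullet> g x \<partial>M)"
  have q: "0 \<le> A - 2 * t * C + t\<^sup>2 * B" for t
  proof -
    have "A - 2 * t * C + t\<^sup>2 * B
        = (\<integral>x. (norm (f x))\<^sup>2 - 2 * t * (f x \<bullet> g x) + t\<^sup>2 * (norm (g x))\<^sup>2 \<partial>M)"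
      unfolding A_def B_def C_def
      using L2_inner_integrable[OF f g] L2_integrable[OF f] L2_integrable[OF g] by simp
    also have "\<dots> = (\<integral>x. (norm (f x - t *\<^sub>R g x))\<^sup>2 \<partial>M)"
      by (intro Bochner_Integration.integral_cong refl,
          simp only: power2_norm_eq_inner,
          simp add: inner_diff_left inner_diff_right inner_commute algebra_simps power2_eq_square)
    finally show ?thesis by simp
  qed
  have "C\<^sup>2 \<le> A * B"
  proof (cases "B = 0")
    case True
    have "C = 0"
    proof (rule ccontr)
      assume "C \<noteq> 0"
      \<comment> \<open>At this t the polynomial, affine in the present case, equals -1.\<close>
      then show False using q[of "(A + 1) / (2 * C)"] True by simp
    qed
    then show ?thesis using True by simp
  next
    case False
    moreover have "0 \<le> B" using Bochner_Integration.integral_nonneg[of M "\<lambda>x. (norm (g x))\<^sup>2"]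
      by (simp add: B_def)
    ultimately have "B > 0" by simp
    then show ?thesis using q[of "C / B"] by (simp add: field_simps power2_eq_square)
  qed
  then have "\<bar>C\<bar> \<le> sqrt (A * B)" using real_le_rsqrt[of "\<bar>C\<bar>"] by simp
  then show ?thesis by (simp add: A_def B_def C_def l2norm_def real_sqrt_mult)
qed

text \<open>The library integrates functions with values in a Banach space type. Pairing with all
  representatives embeds \<open>L\<^sub>2(M)\<close> isometrically into the Banach space of bounded functions
  on the discrete space of representatives.\<close>

definition emb :: "'a measure \<Rightarrow> ('a \<Rightarrow> 'b::euclidean_space) \<Rightarrow> (('a \<Rightarrow> 'b) discrete \<Rightarrow>\<^sub>C real)" where
  "emb M f = Bcontfun (\<lambda>d. if of_discrete d \<in> L2 M
     then (\<integral>x. f x \<bullet> of_discrete d x \<partial>M) / max 1 (l2norm M (of_discrete d)) else 0)"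

text \<open>Norm and completeness are separate instances; the integration theorems ask for their
  conjunction.\<close>

instance bcontfun :: (metric_space, banach) banach ..

text \<open>The denominator keeps each value below the norm of f without a division by zero at null
  functions, and it leaves the pairing with unit vectors unchanged. Continuity is automatic on a
  discrete space.\<close>

lemma emb_apply:
  fixes f :: "'a \<Rightarrow> 'b::euclidean_space"
  assumes f: "f \<in> L2 M"
  shows "apply_bcontfun (emb M f) d = (if of_discrete d \<in> L2 M
     then (\<integral>x. f x \<bullet> of_discrete d x \<partial>M) / max 1 (l2norm M (of_discrete d)) else 0)"
    and "norm (emb M f) \<le> l2norm M f"
proof -
  let ?F = "\<lambda>d. if of_discrete d \<in> L2 M
     then (\<integral>x. f x \<bullet> of_discrete d x \<partial>M) / max 1 (l2norm M (of_discrete d)) else 0"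
  have b: "norm (?F d) \<le> l2norm M f" for d
  proof (cases "of_discrete d \<in> L2 M")
    case True
    have "\<bar>\<integral>x. f x \<bullet> of_discrete d x \<partial>M\<bar> \<le> l2norm M f * l2norm M (of_discrete d)"
      by (rule L2_Cauchy_Schwarz[OF f True])
    also have "\<dots> \<le> l2norm M f * max 1 (l2norm M (of_discrete d))"
      by (intro mult_left_mono) auto
    finally show ?thesis using True by (simp add: divide_simps)
  qed simp
  have "?F \<in> bcontfun"
    by (rule bcontfun_normI[OF _ b]) (auto simp: continuous_on_open_vimage open_discrete)
  then show *: "apply_bcontfun (emb M f) d = ?F d" for d
    unfolding emb_def by (simp add: Bcontfun_inverse)
  show "norm (emb M f) \<le> l2norm M f"
    by (rule norm_bound) (use b * in simp)
qed

text \<open>Among the functionals is the pairing with f divided by its norm; its value is the norm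
  of f, so the supremum is attained.\<close>

lemma norm_emb:
  fixes f :: "'a \<Rightarrow> 'b::euclidean_space"
  assumes f: "f \<in> L2 M"
  shows "norm (emb M f) = l2norm M f"
proof (cases "l2norm M f = 0")
  case False
  define c where "c = l2norm M f"
  have c: "c > 0" using False unfolding c_def by (metis l2norm_nonneg less_eq_real_def)
  define g where "g = (\<lambda>x. (1 / c) *\<^sub>R f x)"
  have g: "g \<in> L2 M" unfolding g_def by (rule L2_scaleR[OF f])
  have "(l2norm M g)\<^sup>2 = (\<integral>x. (1/c)\<^sup>2 * (norm (f x))\<^sup>2 \<partial>M)"
    unfolding l2norm_sq g_def by (simp add: power_mult_distrib power_divide)
  also have "\<dots> = (1/c)\<^sup>2 * c\<^sup>2" by (simp add: c_def l2norm_sq)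
  also have "\<dots> = 1" using c by (simp add: power_divide)
  finally have "l2norm M g = 1" using l2norm_nonneg[of M g] by (simp add: power2_eq_1_iff)
  moreover have "(\<integral>x. f x \<bullet> g x \<partial>M) = c"
  proof -
    have "(\<integral>x. f x \<bullet> g x \<partial>M) = (\<integral>x. (norm (f x))\<^sup>2 / c \<partial>M)"
      unfolding g_def by (simp add: power2_norm_eq_inner)
    also have "\<dots> = c\<^sup>2 / c" by (simp add: c_def l2norm_sq)
    also have "\<dots> = c" using c by (simp add: power2_eq_square)
    finally show ?thesis .
  qed
  ultimately have "apply_bcontfun (emb M f) (discrete g) = c"
    using g by (simp add: emb_apply(1)[OF f] discrete_inverse)
  then have "c \<le> norm (emb M f)" using norm_bounded[of "emb M f" "discrete g"] c by simp
  with emb_apply(2)[OF f] show ?thesis by (simp add: c_def)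
next
  case True
  then show ?thesis using emb_apply(2)[OF f] by (metis norm_le_zero_iff norm_zero)
qed

lemma emb_add:
  fixes f g :: "'a \<Rightarrow> 'b::euclidean_space"
  assumes f: "f \<in> L2 M" and g: "g \<in> L2 M"
  shows "emb M (\<lambda>x. f x + g x) = emb M f + emb M g"
  by (rule bcontfun_eqI)
    (simp add: emb_apply(1) f g L2_add inner_add_left L2_inner_integrable add_divide_distrib)

lemma emb_scaleR:
  fixes f :: "'a \<Rightarrow> 'b::euclidean_space"
  assumes f: "f \<in> L2 M"
  shows "emb M (\<lambda>x. c *\<^sub>R f x) = c *\<^sub>R emb M f"
  by (rule bcontfun_eqI) (simp add: emb_apply(1) f L2_scaleR)

lemma emb_diff:
  fixes f g :: "'a \<Rightarrow> 'b::euclidean_space"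
  assumes f: "f \<in> L2 M" and g: "g \<in> L2 M"
  shows "emb M (\<lambda>x. f x - g x) = emb M f - emb M g"
  using emb_add[OF f L2_scaleR[OF g, of "-1"]] emb_scaleR[OF g, of "-1"] by simp

lemma emb_zero [simp]: "emb M (\<lambda>x. 0) = 0"
  using emb_scaleR[OF L2_zero, where c = 0] by simp

lemma emb_sum:
  fixes f :: "'i \<Rightarrow> 'a \<Rightarrow> 'b::euclidean_space"
  assumes "\<And>i. i \<in> I \<Longrightarrow> f i \<in> L2 M"
  shows "emb M (\<lambda>x. \<Sum>i\<in>I. f i x) = (\<Sum>i\<in>I. emb M (f i))"
  using assms by (induction I rule: infinite_finite_induct) (auto simp: emb_add L2_sum)

lemma l2norm_0_iff_AE:
  fixes f :: "'a \<Rightarrow> 'b::euclidean_space"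
  assumes f: "f \<in> L2 M" shows "l2norm M f = 0 \<longleftrightarrow> (AE x in M. f x = 0)"
  unfolding l2norm_def using integral_nonneg_eq_0_iff_AE[OF L2_integrable[OF f]] by simp

text \<open>Equality of classes becomes equality of points, so uniqueness of limits and of integrals
  can be quoted from the theory of normed spaces.\<close>

lemma emb_eq_iff:
  fixes f g :: "'a \<Rightarrow> 'b::euclidean_space"
  assumes f: "f \<in> L2 M" and g: "g \<in> L2 M"
  shows "emb M f = emb M g \<longleftrightarrow> (AE x in M. f x = g x)"
proof -
  have "emb M f = emb M g \<longleftrightarrow> l2norm M (\<lambda>x. f x - g x) = 0"
    by (simp add: norm_emb[symmetric] L2_diff f g emb_diff)
  then show ?thesis by (simp add: l2norm_0_iff_AE L2_diff f g)
qed

lemma l2norm_emb_diff: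
  fixes f g :: "'a \<Rightarrow> 'b::euclidean_space"
  assumes f: "f \<in> L2 M" and g: "g \<in> L2 M"
  shows "l2norm M (\<lambda>x. f x - g x) = dist (emb M f) (emb M g)"
  by (simp add: norm_emb[symmetric] L2_diff f g emb_diff dist_norm)

lemma l2norm_triangle:
  fixes f g :: "'a \<Rightarrow> 'b::euclidean_space"
  assumes f: "f \<in> L2 M" and g: "g \<in> L2 M"
  shows "l2norm M (\<lambda>x. f x + g x) \<le> l2norm M f + l2norm M g"
  by (simp add: norm_emb[symmetric] L2_add f g emb_add norm_triangle_ineq)

lemma l2norm_scaleR:
  fixes f :: "'a \<Rightarrow> 'b::euclidean_space"
  shows "l2norm M (\<lambda>x. c *\<^sub>R f x) = \<bar>c\<bar> * l2norm M f"
  unfolding l2norm_def by (simp add: power_mult_distrib real_sqrt_mult)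

lemma L2_nn_integral:
  fixes f :: "'a \<Rightarrow> 'b::euclidean_space"
  assumes f: "f \<in> L2 M"
  shows "l2sq M f = ennreal ((l2norm M f)\<^sup>2)"
  using L2_integrable[OF f] unfolding l2norm_sq by (intro nn_integral_eq_integral) auto

text \<open>Estimates are made with \<open>l2sq\<close>, where Tonelli and monotonicity require no
  integrability; this is the way back to \<open>L2\<close> and \<open>l2norm\<close>.\<close>

lemma L2I_nn_integral:
  fixes f :: "'a \<Rightarrow> 'b::euclidean_space"
  assumes [measurable]: "f \<in> borel_measurable M"
    and le: "l2sq M f \<le> ennreal (c\<^sup>2)" and c: "0 \<le> c"
  shows "f \<in> L2 M" and "l2norm M f \<le> c"
proof -
  show f: "f \<in> L2 M" unfolding L2_def mem_Collect_eq
    using le by (intro conjI integrableI_nonneg) (auto intro: le_less_trans)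
  have "(l2norm M f)\<^sup>2 \<le> c\<^sup>2" using le unfolding L2_nn_integral[OF f] by simp
  then show "l2norm M f \<le> c" using c by (rule power2_le_imp_le)
qed

text \<open>A subsequence with geometrically small increments converges almost everywhere, and
  Fatou's lemma turns its pointwise limit into a limit in norm. This is what makes images of closed
  subspaces under \<open>emb\<close> closed.\<close>

lemma Riesz_Fischer:
  fixes f :: "nat \<Rightarrow> 'a \<Rightarrow> 'b::euclidean_space"
  assumes f: "\<And>n. f n \<in> L2 M" and C: "Cauchy (\<lambda>n. emb M (f n))"
  shows "\<exists>g\<in>L2 M. (\<lambda>n. emb M (f n)) \<longlonglongrightarrow> emb M g"
proof -
  note [measurable] = L2_measurable[OF f]
  have "\<exists>r. \<forall>n. (\<forall>m\<ge>r n. dist (emb M (f m)) (emb M (f (r n))) < (1/2)^n) \<and> r n < r (Suc n)"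
  proof (rule dependent_nat_choice)
    show "\<exists>x. \<forall>m\<ge>x. dist (emb M (f m)) (emb M (f x)) < (1/2)^0"
      using C[unfolded Cauchy_altdef2] by (metis power_0 zero_less_one)
    fix x n assume "\<forall>m\<ge>x. dist (emb M (f m)) (emb M (f x)) < (1/2)^n"
    obtain N where N: "\<And>m k. m \<ge> N \<Longrightarrow> k \<ge> N \<Longrightarrow> dist (emb M (f m)) (emb M (f k)) < (1/2)^Suc n"
      using metric_CauchyD[OF C, of "(1/2)^Suc n"] by auto
    show "\<exists>y. (\<forall>m\<ge>y. dist (emb M (f m)) (emb M (f y)) < (1/2)^Suc n) \<and> x < y"
      using N by (intro exI[of _ "max N (Suc x)"]) auto
  qed
  then obtain r where r: "\<And>n m. m \<ge> r n \<Longrightarrow> dist (emb M (f m)) (emb M (f (r n))) < (1/2)^n"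
    and mono: "\<And>n. r n < r (Suc n)" by blast
  define d where "d = (\<lambda>k x. f (r (Suc k)) x - f (r k) x)"
  have [measurable]: "d k \<in> borel_measurable M" for k unfolding d_def by measurable
  have dL: "d k \<in> L2 M" for k unfolding d_def by (rule L2_diff[OF f f])
  have dn: "l2norm M (d k) \<le> (1/2)^k" for k
    unfolding d_def l2norm_emb_diff[OF f f] using r[of k "r (Suc k)"] mono[of k] by (simp add: less_imp_le)
  \<comment> \<open>The weights 2^k are affordable since the k-th increment is at most 4^-k in mean
    square; they buy absolute convergence of the increments.\<close>
  have "(\<integral>\<^sup>+x. (\<Sum>k. ennreal (2^k * (norm (d k x))\<^sup>2)) \<partial>M) = (\<Sum>k. \<integral>\<^sup>+x. ennreal (2^k * (norm (d k x))\<^sup>2) \<partial>M)"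
    by (rule nn_integral_suminf) measurable
  also have "\<dots> \<le> (\<Sum>k. ennreal ((1/2)^k))"
  proof (intro suminf_le summableI)
    fix k
    have "(\<integral>\<^sup>+x. ennreal (2^k * (norm (d k x))\<^sup>2) \<partial>M) = ennreal (2^k) * l2sq M (d k)"
      by (subst nn_integral_cmult[symmetric]) (auto simp: ennreal_mult)
    also have "\<dots> = ennreal (2^k * (l2norm M (d k))\<^sup>2)"
      by (simp add: L2_nn_integral[OF dL] ennreal_mult)
    also have "\<dots> \<le> ennreal (2^k * ((1/2)^k)\<^sup>2)"
      using dn[of k] by (intro ennreal_leI mult_left_mono power_mono) auto
    also have "2^k * ((1/2)^k)\<^sup>2 = ((1/2)^k :: real)"
      by (simp add: power2_eq_square power_one_over field_simps)
    finally show "(\<integral>\<^sup>+x. ennreal (2^k * (norm (d k x))\<^sup>2) \<partial>M) \<le> ennreal ((1/2)^k)" .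
  qed
  also have "\<dots> < \<infinity>"
    by (subst suminf_ennreal2) (auto simp: summable_geometric simp del: power_divide power_one_over)
  finally have "AE x in M. (\<Sum>k. ennreal (2^k * (norm (d k x))\<^sup>2)) \<noteq> \<infinity>"
    by (intro nn_integral_PInf_AE) auto
  then have conv: "AE x in M. convergent (\<lambda>k. f (r k) x)"
  proof (rule AE_mp, intro AE_I2 impI)
    fix x assume "(\<Sum>k. ennreal (2^k * (norm (d k x))\<^sup>2)) \<noteq> \<infinity>"
    then have s: "summable (\<lambda>k. 2^k * (norm (d k x))\<^sup>2)"
      by (intro summable_suminf_not_top) auto
    have "summable (\<lambda>k. d k x)"
    proof (rule summable_comparison_test[OF exI[of _ 0]], intro allI impI)
      fix k :: nat
      \<comment> \<open>Completing the square dominates |d_k| by 2^-k + 2^k |d_k|^2, both of which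
        are summable.\<close>
      have "0 \<le> (1/2)^k * (1 - 2^k * norm (d k x))\<^sup>2" by simp
      also have "\<dots> = (1/2)^k - 2 * norm (d k x) + 2^k * (norm (d k x))\<^sup>2"
        by (simp add: power2_eq_square power_one_over field_simps)
      finally show "norm (d k x) \<le> (1/2)^k + 2^k * (norm (d k x))\<^sup>2"
        using norm_ge_zero[of "d k x"] by linarith
    next
      show "summable (\<lambda>k. (1/2)^k + 2^k * (norm (d k x))\<^sup>2)"
        using s by (intro summable_add) (auto simp: summable_geometric)
    qed
    then have "convergent (\<lambda>n. \<Sum>k<n. d k x)" by (simp add: summable_iff_convergent)
    moreover have "(\<Sum>k<n. d k x) = f (r n) x - f (r 0) x" for n
      unfolding d_def by (rule sum_lessThan_telescope)
    ultimately have "convergent (\<lambda>n. (f (r n) x - f (r 0) x) + f (r 0) x)"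
      by (intro convergent_add convergent_const) simp
    then show "convergent (\<lambda>k. f (r k) x)" by simp
  qed
  define g where "g = (\<lambda>x. lim (\<lambda>k. f (r k) x))"
  have [measurable]: "g \<in> borel_measurable M" unfolding g_def by measurable
  have gl: "AE x in M. (\<lambda>k. f (r k) x) \<longlonglongrightarrow> g x"
    using conv by eventually_elim (simp add: g_def convergent_LIMSEQ_iff)
  \<comment> \<open>Fatou along the subsequence with m fixed: the Cauchy bound e passes to the
    distance from g, and square-integrability of the difference comes with it.\<close>
  have key: "(\<lambda>x. f m x - g x) \<in> L2 M \<and> l2norm M (\<lambda>x. f m x - g x) \<le> e"
    if N: "\<And>m n. m \<ge> N \<Longrightarrow> n \<ge> N \<Longrightarrow> dist (emb M (f m)) (emb M (f n)) < e" and m: "m \<ge> N" for N m e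
  proof -
    have e: "0 \<le> e" using N[OF m m] by simp
    have "l2sq M (\<lambda>x. f m x - g x)
        = (\<integral>\<^sup>+x. liminf (\<lambda>k. ennreal ((norm (f m x - f (r k) x))\<^sup>2)) \<partial>M)"
    proof (intro nn_integral_cong_AE, use gl in eventually_elim)
      fix x assume "(\<lambda>k. f (r k) x) \<longlonglongrightarrow> g x"
      then have "(\<lambda>k. ennreal ((norm (f m x - f (r k) x))\<^sup>2)) \<longlonglongrightarrow> ennreal ((norm (f m x - g x))\<^sup>2)"
        by (intro tendsto_intros)
      then show "ennreal ((norm (f m x - g x))\<^sup>2) = liminf (\<lambda>k. ennreal ((norm (f m x - f (r k) x))\<^sup>2))"
        by (simp add: lim_imp_Liminf[symmetric])
    qed
    also have "\<dots> \<le> liminf (\<lambda>k. \<integral>\<^sup>+x. ennreal ((norm (f m x - f (r k) x))\<^sup>2) \<partial>M)"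
      by (intro nn_integral_liminf) measurable
    also have "\<dots> \<le> ennreal (e\<^sup>2)"
    proof (rule order_trans[OF Liminf_mono[OF eventually_mono[OF eventually_ge_at_top[of N]]]])
      fix k assume "N \<le> k"
      moreover have "k \<le> r k" using mono by (intro seq_suble) (simp add: strict_mono_Suc_iff)
      ultimately have "dist (emb M (f m)) (emb M (f (r k))) < e" using N m by simp
      then have "(l2norm M (\<lambda>x. f m x - f (r k) x))\<^sup>2 \<le> e\<^sup>2"
        unfolding l2norm_emb_diff[OF f f] by (intro power_mono) auto
      then show "l2sq M (\<lambda>x. f m x - f (r k) x) \<le> ennreal (e\<^sup>2)"
        unfolding L2_nn_integral[OF L2_diff[OF f f]] by (rule ennreal_leI)
    qed (simp add: Liminf_const)
    finally have *: "l2sq M (\<lambda>x. f m x - g x) \<le> ennreal (e\<^sup>2)" .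
    show ?thesis using L2I_nn_integral[OF _ * e] by simp
  qed
  obtain N0 where N0: "\<And>m n. m \<ge> N0 \<Longrightarrow> n \<ge> N0 \<Longrightarrow> dist (emb M (f m)) (emb M (f n)) < 1"
    using metric_CauchyD[OF C, of 1] by auto
  have g: "g \<in> L2 M"
    using L2_diff[OF f[of N0] conjunct1[OF key[of N0 1 N0, OF N0]]] by simp
  show ?thesis
  proof (intro bexI[OF _ g] LIMSEQ_I)
    fix e :: real assume "e > 0"
    then obtain N where N: "\<And>m n. m \<ge> N \<Longrightarrow> n \<ge> N \<Longrightarrow> dist (emb M (f m)) (emb M (f n)) < e/2"
      using metric_CauchyD[OF C, of "e/2"] by auto
    show "\<exists>no. \<forall>n\<ge>no. norm (emb M (f n) - emb M g) < e"
    proof (intro exI[of _ N] allI impI)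
      fix n assume n: "N \<le> n"
      have "l2norm M (\<lambda>x. f n x - g x) \<le> e/2" using key[OF N n] by simp
      then show "norm (emb M (f n) - emb M g) < e"
        using \<open>e > 0\<close> by (simp add: l2norm_emb_diff f g dist_norm)
    qed
  qed
qed

text \<open>\<open>emb\<close> is linear and isometric, so it carries tagged sums to tagged sums and
  preserves their distance to the integral. The Henstock-Kurzweil theory for Banach space types
  thereby applies to functions with values in \<open>L2\<close>.\<close>

lemma l2_has_integral_iff:
  fixes f :: "real \<Rightarrow> 'a \<Rightarrow> 'b::euclidean_space"
  shows "l2_has_integral M f T I \<longleftrightarrow> (\<forall>s\<in>{0..T}. f s \<in> L2 M) \<and> I \<in> L2 M \<and>
    ((\<lambda>s. emb M (f s)) has_integral emb M I) {0..T}"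
proof (cases "(\<forall>s\<in>{0..T}. f s \<in> L2 M) \<and> I \<in> L2 M")
  case True
  then have f: "\<And>s. s \<in> {0..T} \<Longrightarrow> f s \<in> L2 M" and I: "I \<in> L2 M" by auto
  have "l2norm M (\<lambda>x. (\<Sum>(s, K)\<in>D. measure lborel K *\<^sub>R f s x) - I x)
      = norm ((\<Sum>(s, K)\<in>D. measure lborel K *\<^sub>R emb M (f s)) - emb M I)"
    if "D tagged_division_of {0..T}" for D
  proof -
    have s: "s \<in> {0..T}" if "(s, K) \<in> D" for s K
      using tag_in_interval[OF \<open>D tagged_division_of {0..T}\<close> that] .
    have L: "(\<lambda>x. case p of (s, K) \<Rightarrow> measure lborel K *\<^sub>R f s x) \<in> L2 M" if "p \<in> D" for p
      using that s f by (cases p) (auto intro!: L2_scaleR)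
    have "emb M (\<lambda>x. \<Sum>(s, K)\<in>D. measure lborel K *\<^sub>R f s x)
        = (\<Sum>p\<in>D. emb M (\<lambda>x. case p of (s, K) \<Rightarrow> measure lborel K *\<^sub>R f s x))"
      by (rule emb_sum[OF L])
    also have "\<dots> = (\<Sum>(s, K)\<in>D. measure lborel K *\<^sub>R emb M (f s))"
      by (intro sum.cong refl) (use s f in \<open>auto simp: emb_scaleR\<close>)
    finally show ?thesis
      using l2norm_emb_diff[OF L2_sum[OF L, where I = D] I] by (simp add: dist_norm)
  qed
  then show ?thesis using True
    unfolding l2_has_integral_def has_integral_real by auto
qed (auto simp: l2_has_integral_def)

section \<open>Semigroups on closed subspaces\<close>

lemma real_tagged_fine_exists:
  assumes "gauge \<gamma>" obtains D where "D tagged_division_of {a..b::real}" "\<gamma> fine D"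
  using fine_division_exists_real[OF assms, of a b] by blast

lemma tagged_sum_in_subspace:
  fixes f :: "real \<Rightarrow> 'v::real_vector"
  assumes V: "subspace V" and D: "D tagged_division_of {a..b}" and f: "\<And>s. s \<in> {a..b} \<Longrightarrow> f s \<in> V"
  shows "(\<Sum>(s, K)\<in>D. measure lborel K *\<^sub>R f s) \<in> V"
  by (intro subspace_sum[OF V]) (auto intro!: subspace_scale[OF V] f dest: tag_in_interval[OF D])

text \<open>Tagged sums stay in the subspace and come arbitrarily close to the integral.\<close>

lemma has_integral_in_closed_subspace:
  fixes f :: "real \<Rightarrow> 'v::real_normed_vector"
  assumes V: "subspace V" "closed V" and I: "(f has_integral I) {a..b}"
    and f: "\<And>s. s \<in> {a..b} \<Longrightarrow> f s \<in> V"
  shows "I \<in> V"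
proof -
  have "I \<in> closure V" unfolding closure_approachable
  proof (intro allI impI)
    fix e :: real assume e: "0 < e"
    obtain \<gamma> where g: "gauge \<gamma>" and d: "\<And>D. D tagged_division_of {a..b} \<and> \<gamma> fine D \<Longrightarrow>
      norm ((\<Sum>(s, K)\<in>D. measure lborel K *\<^sub>R f s) - I) < e"
      using I[unfolded has_integral_real, THEN spec, THEN mp, OF e] by (elim exE conjE) (rule that, assumption, simp)
    obtain D where D: "D tagged_division_of {a..b}" "\<gamma> fine D" by (rule real_tagged_fine_exists[OF g])
    show "\<exists>y\<in>V. dist y I < e"
      using d[OF conjI[OF D]] tagged_sum_in_subspace[OF V(1) D(1) f] by (auto simp: dist_norm)
  qed
  then show ?thesis using V(2) by simp
qed

text \<open>L is linear and bounded on V alone, as lifted operators are on the image of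
  \<open>emb\<close>. All tagged sums stay in V, so it suffices to estimate them there.\<close>

lemma has_integral_linear_on_subspace:
  fixes f :: "real \<Rightarrow> 'v::real_normed_vector" and L :: "'v \<Rightarrow> 'w::real_normed_vector"
  assumes V: "subspace V" "closed V" and I: "(f has_integral I) {a..b}"
    and f: "\<And>s. s \<in> {a..b} \<Longrightarrow> f s \<in> V"
    and add: "\<And>x y. x \<in> V \<Longrightarrow> y \<in> V \<Longrightarrow> L (x + y) = L x + L y"
    and scale: "\<And>c x. x \<in> V \<Longrightarrow> L (c *\<^sub>R x) = c *\<^sub>R L x"
    and bnd: "\<And>x. x \<in> V \<Longrightarrow> norm (L x) \<le> K * norm x"
  shows "((\<lambda>s. L (f s)) has_integral L I) {a..b}"
  unfolding has_integral_real
proof (intro allI impI)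
  have I': "I \<in> V" by (rule has_integral_in_closed_subspace[OF V I f])
  have L0: "L 0 = 0" using scale[OF subspace_0[OF V(1)], of 0] by simp
  have diff: "L (x - y) = L x - L y" if "x \<in> V" "y \<in> V" for x y
    using add[OF that(1) subspace_scale[OF V(1) that(2), of "-1"]] scale[OF that(2), of "-1"] by simp
  have Lsum: "L (\<Sum>i\<in>S. g i) = (\<Sum>i\<in>S. L (g i))" if "\<And>i. i \<in> S \<Longrightarrow> g i \<in> V" for S and g :: "real \<times> real set \<Rightarrow> 'v"
    using that
  proof (induction S rule: infinite_finite_induct)
    case (insert i S)
    have "sum g S \<in> V" by (rule subspace_sum[OF V(1)]) (use insert.prems in blast)
    then show ?case using insert by (simp add: add)
  qed (simp_all add: L0)
  fix e :: real assume e: "0 < e"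
  \<comment> \<open>A bound K that may be zero or negative is replaced by a positive one to divide
    by.\<close>
  define K' where "K' = max K 1"
  have K': "K' > 0" "K \<le> K'" by (auto simp: K'_def)
  have eK: "0 < e / K'" using e K' by simp
  obtain \<gamma> where g: "gauge \<gamma>" and d: "\<And>D. D tagged_division_of {a..b} \<and> \<gamma> fine D \<Longrightarrow>
    norm ((\<Sum>(s, K)\<in>D. measure lborel K *\<^sub>R f s) - I) < e / K'"
    using I[unfolded has_integral_real, THEN spec, THEN mp, OF eK] by (elim exE conjE) (rule that, assumption, simp)
  show "\<exists>\<gamma>. gauge \<gamma> \<and> (\<forall>D. D tagged_division_of {a..b} \<and> \<gamma> fine D \<longrightarrow>
      norm ((\<Sum>(s, K)\<in>D. measure lborel K *\<^sub>R L (f s)) - L I) < e)"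
  proof (intro exI[of _ \<gamma>] conjI g allI impI)
    fix D assume "D tagged_division_of {a..b} \<and> \<gamma> fine D"
    then have D: "D tagged_division_of {a..b}" "\<gamma> fine D" by auto
    have fV: "f s \<in> V" if "(s, K) \<in> D" for s K
      using f[OF tag_in_interval[OF D(1) that]] .
    have mem: "(case p of (s, K) \<Rightarrow> measure lborel K *\<^sub>R f s) \<in> V" if "p \<in> D" for p
    proof -
      obtain t K where tK: "p = (t, K)" by (cases p)
      show ?thesis using subspace_scale[OF V(1) fV] that by (simp add: tK)
    qed
    have "L (\<Sum>(s, K)\<in>D. measure lborel K *\<^sub>R f s)
        = (\<Sum>p\<in>D. L (case p of (s, K) \<Rightarrow> measure lborel K *\<^sub>R f s))"
      by (rule Lsum[OF mem])
    also have "\<dots> = (\<Sum>(s, K)\<in>D. measure lborel K *\<^sub>R L (f s))"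
    proof (rule sum.cong[OF refl])
      fix p assume p: "p \<in> D"
      obtain t K where tK: "p = (t, K)" by (cases p)
      then have "f t \<in> V" using fV p by simp
      then show "L (case p of (s, K) \<Rightarrow> measure lborel K *\<^sub>R f s)
        = (case p of (s, K) \<Rightarrow> measure lborel K *\<^sub>R L (f s))" by (simp add: tK scale)
    qed
    finally have eq: "L (\<Sum>(s, K)\<in>D. measure lborel K *\<^sub>R f s) = (\<Sum>(s, K)\<in>D. measure lborel K *\<^sub>R L (f s))" .
    have "(\<Sum>(s, K)\<in>D. measure lborel K *\<^sub>R L (f s)) - L I = L ((\<Sum>(s, K)\<in>D. measure lborel K *\<^sub>R f s) - I)"
      using diff[OF tagged_sum_in_subspace[OF V(1) D(1) f] I'] eq by simp
    also have "norm \<dots> \<le> K * norm ((\<Sum>(s, K)\<in>D. measure lborel K *\<^sub>R f s) - I)"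
      by (intro bnd subspace_diff[OF V(1)] I' tagged_sum_in_subspace[OF V(1) D(1) f])
    also have "\<dots> \<le> K' * norm ((\<Sum>(s, K)\<in>D. measure lborel K *\<^sub>R f s) - I)"
      using K' by (intro mult_right_mono) auto
    also have "\<dots> < e" using d[OF conjI[OF D]] K' by (simp add: field_simps)
    finally show "norm ((\<Sum>(s, K)\<in>D. measure lborel K *\<^sub>R L (f s)) - L I) < e" .
  qed
qed

section \<open>Strongly continuous semigroups: local bounds, orbits, generator\<close>

lemma eventually_right_pos: "\<forall>\<^sub>F h in at_right 0. 0 < (h::real)"
  by (simp add: eventually_at_right_less)

text \<open>The ambient type contains more than the embedded classes, so the operators are
  constrained on the carrier V only. Boundedness is assumed for each time separately; a locally
  uniform bound has to be derived.\<close>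

locale subspace_semigroup =
  fixes V :: "'v::banach set" and T :: "real \<Rightarrow> 'v \<Rightarrow> 'v"
  assumes subspace_V: "subspace V" and closed_V: "closed V"
    and mem: "0 \<le> t \<Longrightarrow> x \<in> V \<Longrightarrow> T t x \<in> V"
    and add: "0 \<le> t \<Longrightarrow> x \<in> V \<Longrightarrow> y \<in> V \<Longrightarrow> T t (x + y) = T t x + T t y"
    and scale: "0 \<le> t \<Longrightarrow> x \<in> V \<Longrightarrow> T t (c *\<^sub>R x) = c *\<^sub>R T t x"
    and bounded: "0 \<le> t \<Longrightarrow> \<exists>K. \<forall>x\<in>V. norm (T t x) \<le> K * norm x"
    and zero: "x \<in> V \<Longrightarrow> T 0 x = x"
    and semigroup: "0 \<le> s \<Longrightarrow> 0 \<le> t \<Longrightarrow> x \<in> V \<Longrightarrow> T (s + t) x = T s (T t x)"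
    and strong_cont: "x \<in> V \<Longrightarrow> ((\<lambda>h. T h x) \<longlongrightarrow> x) (at_right 0)"
begin

lemma V_simps [simp, intro]:
  shows "x \<in> V \<Longrightarrow> y \<in> V \<Longrightarrow> x + y \<in> V" and "x \<in> V \<Longrightarrow> y \<in> V \<Longrightarrow> x - y \<in> V"
    and "x \<in> V \<Longrightarrow> c *\<^sub>R x \<in> V" and "0 \<in> V" and "x \<in> V \<Longrightarrow> - x \<in> V"
  by (rule subspace_add[OF subspace_V] subspace_diff[OF subspace_V] subspace_scale[OF subspace_V]
    subspace_0[OF subspace_V] subspace_neg[OF subspace_V]; assumption)+

lemma diff: "0 \<le> t \<Longrightarrow> x \<in> V \<Longrightarrow> y \<in> V \<Longrightarrow> T t (x - y) = T t x - T t y"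
  using add[of t x "(-1) *\<^sub>R y"] scale[of t y "-1"] by simp

lemma T_0: "0 \<le> t \<Longrightarrow> T t 0 = 0"
  using scale[of t 0 0] by simp

text \<open>Gliding hump.\<close>

lemma pointwise_unbounded:
  fixes s :: "nat \<Rightarrow> real"
  assumes s: "\<And>n. 0 \<le> s n" and big: "\<And>n. \<exists>x\<in>V. norm (T (s n) x) > 4 ^ n * norm x"
  shows "\<exists>x\<in>V. \<forall>n. norm (T (s n) x) \<ge> (4/3) ^ n / 6"
proof -
  define N where "N = (\<lambda>n. SUP x\<in>{x \<in> V. norm x \<le> 1}. norm (T (s n) x))"
  have bdd: "bdd_above ((\<lambda>x. norm (T (s n) x)) ` {x \<in> V. norm x \<le> 1})" for n
  proof -
    obtain K where K: "\<And>x. x \<in> V \<Longrightarrow> norm (T (s n) x) \<le> K * norm x" using bounded[OF s[of n]] by blast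
    have "norm (T (s n) x) \<le> \<bar>K\<bar>" if "x \<in> V" "norm x \<le> 1" for x
    proof -
      have "K * norm x \<le> \<bar>K\<bar> * 1" using that by (intro mult_mono) auto
      with K[OF that(1)] show ?thesis by simp
    qed
    then show ?thesis by (intro bdd_aboveI2[of _ _ "\<bar>K\<bar>"]) auto
  qed
  have normed: "\<exists>u\<in>V. norm u \<le> 1 \<and> norm (T (s n) x) = norm x * norm (T (s n) u)"
    if "x \<in> V" for n x
  proof (cases "x = 0")
    case True then show ?thesis using T_0[OF s[of n]] by (intro bexI[of _ 0]) auto
  next
    case False
    then show ?thesis using that s
      by (intro bexI[of _ "(1 / norm x) *\<^sub>R x"] conjI) (simp_all add: scale)
  qed
  have N_bound: "norm (T (s n) x) \<le> N n * norm x" if x: "x \<in> V" for n x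
  proof -
    obtain u where u: "u \<in> V" "norm u \<le> 1" "norm (T (s n) x) = norm x * norm (T (s n) u)"
      using normed[OF x] by blast
    have "norm (T (s n) u) \<le> N n" unfolding N_def using u by (intro cSUP_upper bdd) auto
    then show ?thesis using u by (simp add: mult.commute[of "N n"] mult_left_mono)
  qed
  have N_big: "N n \<ge> 4 ^ n" for n
  proof -
    obtain x where x: "x \<in> V" "norm (T (s n) x) > 4 ^ n * norm x" using big by blast
    then have "4 ^ n * norm x < N n * norm x" using N_bound[of x n] by simp
    then show ?thesis by (simp add: mult_less_cancel_right)
  qed
  have hump: "\<exists>u\<in>V. norm u \<le> 1 \<and> norm (T (s n) u) \<ge> 2/3 * N n" for n
  proof -
    have "2/3 * N n < N n" using less_le_trans[OF _ N_big[of n], of 0] by simp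
    moreover have "{x \<in> V. norm x \<le> 1} \<noteq> {}" using V_simps(4) by (metis (mono_tags, lifting) empty_iff mem_Collect_eq norm_zero zero_le_one)
    ultimately have "\<exists>u\<in>{x \<in> V. norm x \<le> 1}. 2/3 * N n < norm (T (s n) u)"
      using less_cSUP_iff[OF _ bdd, of "2/3 * N n" n] unfolding N_def by blast
    then show ?thesis by (auto intro: less_imp_le)
  qed
  have step: "\<exists>y. y \<in> V \<and> (norm (y - x) \<le> (1/3)^n \<and> norm (T (s n) y) \<ge> (1/3)^n * (2/3 * N n))"
    if x: "x \<in> V" for x n
  proof -
    obtain u where u: "u \<in> V" "norm u \<le> 1" "norm (T (s n) u) \<ge> 2/3 * N n" using hump by blast
    define v where "v = (1/3)^n *\<^sub>R u"
    have v: "v \<in> V" "norm v \<le> (1/3)^n"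
      using u mult_left_mono[of "norm u" 1 "(1/3)^n"] by (simp_all add: v_def)
    have "T (s n) v = (1/3)^n *\<^sub>R T (s n) u" unfolding v_def by (rule scale[OF s u(1)])
    then have nv: "norm (T (s n) v) \<ge> (1/3)^n * (2/3 * N n)"
      using u(3) by (simp add: mult_left_mono)
    \<comment> \<open>The difference of the images of x + v and x - v is twice the image of v, so
      for one of the two signs the image is at least as large as that of v, whatever x is.\<close>
    have "2 * norm (T (s n) v) = norm (T (s n) (x + v) - T (s n) (x - v))"
      by (simp add: add diff s x v scaleR_2[symmetric])
    also have "\<dots> \<le> norm (T (s n) (x + v)) + norm (T (s n) (x - v))" by (rule norm_triangle_ineq4)
    finally consider "norm (T (s n) v) \<le> norm (T (s n) (x + v))" | "norm (T (s n) v) \<le> norm (T (s n) (x - v))"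
      by linarith
    then show ?thesis
    proof cases
      case 1 then show ?thesis using nv v x by (intro exI[of _ "x + v"] conjI) simp_all
    next
      case 2 then show ?thesis using nv v x by (intro exI[of _ "x - v"] conjI) simp_all
    qed
  qed
  have "\<exists>X. \<forall>n. X n \<in> V \<and> (norm (X (Suc n) - X n) \<le> (1/3)^n \<and> norm (T (s n) (X (Suc n))) \<ge> (1/3)^n * (2/3 * N n))"
    by (rule dependent_nat_choice) (use step V_simps(4) in blast)+
  then obtain X where XV: "\<And>n. X n \<in> V" and Xd: "\<And>n. norm (X (Suc n) - X n) \<le> (1/3)^n"
    and Xb: "\<And>n. norm (T (s n) (X (Suc n))) \<ge> (1/3)^n * (2/3 * N n)"
    by blast
  have tail: "norm (X (n + m) - X n) \<le> 3/2 * ((1/3)^n - (1/3)^(n + m))" for n m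
  proof (induction m)
    case (Suc m)
    have "norm (X (n + Suc m) - X n) \<le> norm (X (Suc (n + m)) - X (n + m)) + norm (X (n + m) - X n)"
      using norm_triangle_ineq[of "X (Suc (n + m)) - X (n + m)" "X (n + m) - X n"] by simp
    also have "\<dots> \<le> (1/3)^(n+m) + 3/2 * ((1/3)^n - (1/3)^(n + m))" by (intro add_mono Xd Suc)
    also have "\<dots> = 3/2 * ((1/3)^n - (1/3)^(n + Suc m))" by (simp add: field_simps)
    finally show ?case .
  qed simp
  have tail': "norm (X k - X n) \<le> 3/2 * (1/3)^n" if "n \<le> k" for n k
  proof -
    have "norm (X k - X n) \<le> 3/2 * ((1/3)^n - (1/3)^k)" using tail[of n "k - n"] that by simp
    also have "\<dots> \<le> 3/2 * (1/3)^n" by simp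
    finally show ?thesis .
  qed
  have "Cauchy X"
  proof (rule metric_CauchyI)
    fix e :: real assume e: "e > 0"
    then obtain n where n: "(1/3)^n < e/3" using real_arch_pow_inv[of "e/3" "1/3"] by auto
    have "dist (X k) (X l) < e" if "k \<ge> n" "l \<ge> n" for k l
    proof -
      have "norm (X k - X l) \<le> norm (X k - X n) + norm (X l - X n)"
        using norm_triangle_ineq4[of "X k - X n" "X l - X n"] by simp
      also have "\<dots> \<le> 3/2 * (1/3)^n + 3/2 * (1/3)^n" by (intro add_mono tail' that)
      finally show ?thesis using n by (simp add: dist_norm)
    qed
    then show "\<exists>M. \<forall>m\<ge>M. \<forall>n\<ge>M. dist (X m) (X n) < e" by blast
  qed
  then obtain x where lim: "X \<longlonglongrightarrow> x" using Cauchy_convergent convergent_def by blast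
  have xV: "x \<in> V" using closed_V lim XV by (auto simp: closed_sequential_limits)
  have xd: "norm (x - X n) \<le> 3/2 * (1/3)^n" for n
    by (rule LIMSEQ_le_const2[OF tendsto_norm[OF tendsto_diff[OF lim tendsto_const]]]) (use tail' in blast)
  \<comment> \<open>Later humps move \<open>X (Suc n)\<close> by at most half of 3^-n, which costs
    one half of the two thirds of 3^-n \<open>N n\<close> gained at stage n. One sixth remains, and
    \<open>N n\<close> is at least 4^n.\<close>
  have "norm (T (s n) x) \<ge> (4/3)^n / 6" for n
  proof -
    have "norm (T (s n) (X (Suc n) - x)) \<le> N n * norm (X (Suc n) - x)" by (intro N_bound) (use XV xV in auto)
    also have "\<dots> \<le> N n * (3/2 * (1/3)^Suc n)"
      using xd[of "Suc n"] order_trans[OF _ N_big[of n], of 0]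
      by (intro mult_left_mono) (simp_all add: norm_minus_commute)
    finally have 1: "norm (T (s n) (X (Suc n) - x)) \<le> N n * (1/3)^n / 2" by simp
    have "norm (T (s n) (X (Suc n))) \<le> norm (T (s n) x) + norm (T (s n) (X (Suc n) - x))"
      using norm_triangle_ineq[of "T (s n) x" "T (s n) (X (Suc n) - x)"] by (simp add: diff s XV xV)
    with 1 Xb[of n] have "(1/3)^n * N n / 6 \<le> norm (T (s n) x)" by (simp add: mult.commute[of "N n"])
    moreover have "(1/3)^n * 4^n \<le> (1/3)^n * N n" by (intro mult_left_mono N_big) auto
    moreover have "(1/3)^n * 4^n = (4/3::real)^n" by (simp add: power_mult_distrib[symmetric])
    ultimately show ?thesis by linarith
  qed
  then show ?thesis using xV by blast
qed

text \<open>Otherwise there are times s n tending to 0 at which the operators have norms beyond 4^n.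
  The gliding hump yields one vector whose orbit is unbounded along these times, against strong
  continuity at 0.\<close>

lemma local_bound:
  "\<exists>d>0. \<exists>K\<ge>1. \<forall>t\<in>{0..d}. \<forall>x\<in>V. norm (T t x) \<le> K * norm x"
proof (rule ccontr)
  assume neg: "\<not> ?thesis"
  have "\<exists>t. t \<in> {0..1 / real (Suc n)} \<and> (\<exists>x\<in>V. norm (T t x) > 4 ^ n * norm x)" for n
  proof -
    have "1 / real (Suc n) > 0" "4 ^ n \<ge> (1::real)" by auto
    with neg have "\<not> (\<forall>t\<in>{0..1 / real (Suc n)}. \<forall>x\<in>V. norm (T t x) \<le> 4 ^ n * norm x)" by blast
    then show ?thesis by (auto simp: not_le)
  qed
  then obtain s where s: "\<And>n. s n \<in> {0..1 / real (Suc n)}" and big: "\<And>n. \<exists>x\<in>V. norm (T (s n) x) > 4 ^ n * norm x"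
    by metis
  obtain x where x: "x \<in> V" and xb: "\<And>n. norm (T (s n) x) \<ge> (4/3) ^ n / 6"
    using pointwise_unbounded[of s] s big by auto
  have lim: "((\<lambda>h. T h x) \<longlongrightarrow> x) (at 0 within {0..})"
    unfolding at_within_Ici_at_right by (rule strong_cont[OF x])
  have s0: "s \<longlonglongrightarrow> 0"
    by (rule real_tendsto_sandwich[OF _ _ tendsto_const LIMSEQ_inverse_real_of_nat])
      (use s in \<open>auto simp: inverse_eq_divide\<close>)
  have "continuous (at 0 within {0..}) (\<lambda>h. T h x)"
    unfolding continuous_within using lim zero[OF x] by simp
  then have "(\<lambda>n. T (s n) x) \<longlonglongrightarrow> T 0 x"
    by (rule continuous_within_tendsto_compose) (use s s0 in \<open>auto intro!: always_eventually\<close>)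
  then have "Bseq (\<lambda>n. T (s n) x)" by (intro convergent_imp_Bseq) (auto simp: convergent_def)
  then obtain B where B: "\<And>n. norm (T (s n) x) \<le> B" by (auto simp: Bseq_def)
  obtain n where "6 * B < (4/3) ^ n" using real_arch_pow[of "4/3" "6 * B"] by auto
  then show False using xb[of n] B[of n] by linarith
qed

text \<open>A time in [0, n d] is reached by n steps taken from [0, d], each costing a factor
  K.\<close>

lemma bound_on_interval:
  "\<exists>K\<ge>1. \<forall>t\<in>{0..a}. \<forall>x\<in>V. norm (T t x) \<le> K * norm x"
proof -
  obtain d K where d: "d > 0" and K: "K \<ge> 1" and b: "\<And>t x. t \<in> {0..d} \<Longrightarrow> x \<in> V \<Longrightarrow> norm (T t x) \<le> K * norm x"
    using local_bound by blast
  have *: "t \<in> {0..real n * d} \<Longrightarrow> x \<in> V \<Longrightarrow> norm (T t x) \<le> K ^ n * norm x" for n t x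
  proof (induction n arbitrary: t x)
    case (Suc n)
    define r where "r = min t d"
    have r: "r \<in> {0..d}" "t - r \<in> {0..real n * d}" "r \<le> t" using Suc.prems d
      by (auto simp: r_def algebra_simps min_def)
    have "T t x = T (t - r) (T r x)" using semigroup[of "t - r" r x] r Suc.prems by simp
    also have "norm \<dots> \<le> K ^ n * norm (T r x)" using Suc.IH[OF r(2)] mem r Suc.prems by auto
    also have "\<dots> \<le> K ^ n * (K * norm x)" using K by (intro mult_left_mono b r Suc.prems) auto
    finally show ?case by (simp add: mult_ac)
  qed (auto simp: zero)
  obtain n where n: "a < real n * d" using reals_Archimedean3[OF d] by blast
  show ?thesis using * n K by (intro exI[of _ "K ^ n"]) (auto intro: one_le_power)
qed

lemma lim_within_0: "x \<in> V \<Longrightarrow> ((\<lambda>h. T h x) \<longlongrightarrow> x) (at 0 within {0..})"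
  unfolding at_within_Ici_at_right by (rule strong_cont)

lemma T_diff_eq:
  assumes "0 \<le> s" "s \<le> t" "x \<in> V" shows "T t x - T s x = T s (T (t - s) x - x)"
  using semigroup[of s "t - s" x] assms by (simp add: diff mem)

text \<open>For a < b the increment of the orbit is \<open>T a\<close> applied to
  \<open>T (b - a) x - x\<close>. With the bound uniform on [0, t + 1], right continuity at 0 gives
  continuity from both sides at once.\<close>

lemma continuous_orbit:
  assumes x: "x \<in> V" shows "continuous_on {0..} (\<lambda>t. T t x)"
  unfolding continuous_on_iff
proof (intro ballI allI impI)
  fix t e :: real assume t: "t \<in> {0..}" and e: "e > 0"
  obtain K where K: "K \<ge> 1" "\<And>s x. s \<in> {0..t + 1} \<Longrightarrow> x \<in> V \<Longrightarrow> norm (T s x) \<le> K * norm x"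
    using bound_on_interval[of "t + 1"] by blast
  have "e / K > 0" using e K by simp
  then obtain d where d: "d > 0" "\<And>h. 0 < h \<Longrightarrow> h < d \<Longrightarrow> norm (T h x - x) < e / K"
    using lim_within_0[OF x] unfolding Lim_within by (auto simp: dist_norm)
  have main: "norm (T b x - T a x) < e" if "0 \<le> a" "a < b" "b - a < d" "a \<le> t + 1" for a b
  proof -
    have "norm (T b x - T a x) \<le> K * norm (T (b - a) x - x)"
      unfolding T_diff_eq[OF that(1) less_imp_le[OF that(2)] x] using that x mem by (intro K) auto
    also have "\<dots> < e" using d(2)[of "b - a"] that K by (simp add: field_simps)
    finally show ?thesis .
  qed
  show "\<exists>d>0. \<forall>x'\<in>{0..}. dist x' t < d \<longrightarrow> dist (T x' x) (T t x) < e"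
  proof (intro exI[of _ d] conjI ballI impI d(1))
    fix u assume u: "u \<in> {0..}" "dist u t < d"
    consider "u < t" | "u = t" | "t < u" by linarith
    then show "dist (T u x) (T t x) < e"
      using main[of u t] main[of t u] u t e by cases (auto simp: dist_norm norm_minus_commute)
  qed
qed

definition gen :: "('v \<times> 'v) set" where
  "gen = {(x, y). x \<in> V \<and> y \<in> V \<and> ((\<lambda>h. (T h x - x) /\<^sub>R h) \<longlongrightarrow> y) (at_right 0)}"

lemma genD: "(x, y) \<in> gen \<Longrightarrow> x \<in> V" "(x, y) \<in> gen \<Longrightarrow> y \<in> V"
  "(x, y) \<in> gen \<Longrightarrow> ((\<lambda>h. (T h x - x) /\<^sub>R h) \<longlongrightarrow> y) (at_right 0)"
  by (auto simp: gen_def)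

lemma gen_add: assumes "(x, y) \<in> gen" "(x', y') \<in> gen" shows "(x + x', y + y') \<in> gen"
proof -
  have "((\<lambda>h. (T h x - x) /\<^sub>R h + (T h x' - x') /\<^sub>R h) \<longlongrightarrow> y + y') (at_right 0)"
    by (intro tendsto_add genD(3) assms)
  moreover have "\<forall>\<^sub>F h in at_right 0. (T h x - x) /\<^sub>R h + (T h x' - x') /\<^sub>R h = (T h (x + x') - (x + x')) /\<^sub>R h"
    using eventually_right_pos by eventually_elim (simp add: add genD[OF assms(1)] genD[OF assms(2)] algebra_simps)
  ultimately show ?thesis using genD[OF assms(1)] genD[OF assms(2)] by (auto simp: gen_def cong: tendsto_cong)
qed

lemma gen_scale: assumes "(x, y) \<in> gen" shows "(c *\<^sub>R x, c *\<^sub>R y) \<in> gen"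
proof -
  have "((\<lambda>h. c *\<^sub>R ((T h x - x) /\<^sub>R h)) \<longlongrightarrow> c *\<^sub>R y) (at_right 0)"
    by (intro tendsto_scaleR tendsto_const genD(3) assms)
  moreover have "\<forall>\<^sub>F h in at_right 0. c *\<^sub>R ((T h x - x) /\<^sub>R h) = (T h (c *\<^sub>R x) - (c *\<^sub>R x)) /\<^sub>R h"
    using eventually_right_pos by eventually_elim (simp add: scale genD[OF assms(1)] algebra_simps)
  ultimately show ?thesis using genD[OF assms(1)] by (auto simp: gen_def cong: tendsto_cong)
qed

lemma gen_orbit: assumes g: "(x, y) \<in> gen" and t: "0 \<le> t" shows "(T t x, T t y) \<in> gen"
proof -
  note V = genD[OF g]
  obtain K where K: "\<And>x. x \<in> V \<Longrightarrow> norm (T t x) \<le> K * norm x" using bounded[OF t] by blast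
  have "((\<lambda>h. K * norm ((T h x - x) /\<^sub>R h - y)) \<longlongrightarrow> K * norm (y - y)) (at_right 0)"
    by (intro tendsto_intros V(3))
  then have *: "((\<lambda>h. K * norm ((T h x - x) /\<^sub>R h - y)) \<longlongrightarrow> 0) (at_right 0)" by simp
  have "((\<lambda>h. (T h (T t x) - T t x) /\<^sub>R h - T t y) \<longlongrightarrow> 0) (at_right 0)"
  proof (rule Lim_null_comparison[OF _ *], use eventually_right_pos in eventually_elim)
    fix h :: real assume h: "0 < h"
    have "T h (T t x) = T t (T h x)"
      using semigroup[of h t x] semigroup[of t h x] h t V by (simp add: add.commute)
    then have "(T h (T t x) - T t x) /\<^sub>R h - T t y = T t ((T h x - x) /\<^sub>R h - y)"
      using h t V by (simp add: diff scale mem)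
    then show "norm ((T h (T t x) - T t x) /\<^sub>R h - T t y) \<le> K * norm ((T h x - x) /\<^sub>R h - y)"
      using h V mem by (simp add: K)
  qed
  then show ?thesis using V mem t by (auto simp: gen_def Lim_null[symmetric])
qed

text \<open>The generator provides a right derivative at 0 only. Increments are always expanded at
  their left end point; approaching t from the left thus produces \<open>T s y\<close> in place of
  \<open>T t y\<close>, and continuity of the orbit of y absorbs the difference.\<close>

lemma orbit_derivative:
  assumes g: "(x, y) \<in> gen" and t: "0 \<le> t"
  shows "((\<lambda>t. T t x) has_vector_derivative T t y) (at t within {0..})"
proof -
  note V = genD[OF g]
  obtain K where K: "K \<ge> 1" "\<And>s x. s \<in> {0..t + 1} \<Longrightarrow> x \<in> V \<Longrightarrow> norm (T s x) \<le> K * norm x"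
    using bound_on_interval[of "t + 1"] by blast
  show ?thesis unfolding has_vector_derivative_def has_derivative_within_alt
  proof (intro conjI allI impI)
    show "bounded_linear (\<lambda>x. x *\<^sub>R T t y)" by (rule bounded_linear_scaleR_left)
    fix e :: real assume e: "0 < e"
    have "e / (2 * K) > 0" using e K by simp
    then have "\<forall>\<^sub>F h in at_right 0. dist ((T h x - x) /\<^sub>R h) y < e / (2 * K)"
      using V(3) by (auto simp: tendsto_iff)
    then obtain d1 where d1: "d1 > 0" "\<And>h. 0 < h \<Longrightarrow> h < d1 \<Longrightarrow> norm ((T h x - x) /\<^sub>R h - y) < e / (2 * K)"
      unfolding eventually_at_right_field by (auto simp: dist_norm)
    obtain d2 where d2: "d2 > 0" "\<And>s. s \<ge> 0 \<Longrightarrow> dist s t < d2 \<Longrightarrow> norm (T s y - T t y) < e / 2"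
      using continuous_orbit[OF V(2)] t e unfolding continuous_on_iff
      by (metis atLeast_iff dist_norm half_gt_zero)
    have main: "norm (T b x - T a x - (b - a) *\<^sub>R T a y) \<le> (e / 2) * (b - a)"
      if "0 \<le> a" "a < b" "b - a < d1" "a \<le> t + 1" for a b
    proof -
      define h where "h = b - a"
      have h: "0 < h" "h < d1" "b = a + h" using that by (auto simp: h_def)
      have hh: "h *\<^sub>R ((T h x - x) /\<^sub>R h - y) = T h x - x - h *\<^sub>R y"
        using h by (simp add: scaleR_diff_right)
      have "T b x - T a x - (b - a) *\<^sub>R T a y = T a (h *\<^sub>R ((T h x - x) /\<^sub>R h - y))"
        unfolding hh using T_diff_eq[of a b x] that V h by (simp add: diff scale mem)
      also have "norm \<dots> \<le> K * norm (h *\<^sub>R ((T h x - x) /\<^sub>R h - y))"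
        using that V mem h by (intro K) auto
      also have "\<dots> = h * (K * norm ((T h x - x) /\<^sub>R h - y))" using h by simp
      also have "\<dots> \<le> h * (e / 2)"
        using d1(2)[OF h(1,2)] K h by (intro mult_left_mono) (auto simp: field_simps)
      finally show ?thesis by (simp add: h_def mult.commute)
    qed
    show "\<exists>d>0. \<forall>s\<in>{0..}. norm (s - t) < d \<longrightarrow>
        norm (T s x - T t x - (s - t) *\<^sub>R T t y) \<le> e * norm (s - t)"
    proof (intro exI[of _ "min d1 d2"] conjI ballI impI)
      show "0 < min d1 d2" using d1 d2 by simp
      fix s assume s: "s \<in> {0..}" "norm (s - t) < min d1 d2"
      consider "s = t" | "t < s" | "s < t" by linarith
      then show "norm (T s x - T t x - (s - t) *\<^sub>R T t y) \<le> e * norm (s - t)"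
      proof cases
        case 2
        have "norm (T s x - T t x - (s - t) *\<^sub>R T t y) \<le> e / 2 * (s - t)" using main[of t s] 2 s t by auto
        also have "\<dots> \<le> e * norm (s - t)" using 2 e by simp
        finally show ?thesis .
      next
        case 3
        have 1: "norm (T t x - T s x - (t - s) *\<^sub>R T s y) \<le> e / 2 * (t - s)" using main[of s t] 3 s t by auto
        have 2: "norm ((t - s) *\<^sub>R (T s y - T t y)) \<le> e / 2 * (t - s)"
          using d2(2)[of s] s 3 by (simp add: dist_norm mult.commute mult_left_mono less_imp_le)
        have "T s x - T t x - (s - t) *\<^sub>R T t y =
            - ((T t x - T s x - (t - s) *\<^sub>R T s y) + (t - s) *\<^sub>R (T s y - T t y))"
          by (simp add: algebra_simps)
        also have "norm \<dots> \<le> e / 2 * (t - s) + e / 2 * (t - s)"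
          unfolding norm_minus_cancel by (rule norm_triangle_le[OF add_mono[OF 1 2]])
        also have "\<dots> = e * norm (s - t)" using 3 by (simp add: field_simps)
        finally show ?thesis .
      qed simp
    qed
  qed
qed

lemma orbit_integrable: "x \<in> V \<Longrightarrow> 0 \<le> a \<Longrightarrow> (\<lambda>s. T s x) integrable_on {a..b}"
  by (rule integrable_continuous_real, rule continuous_on_subset[OF continuous_orbit]) auto

lemma orbit_integral_mem: "x \<in> V \<Longrightarrow> integral {0..t} (\<lambda>s. T s x) \<in> V"
  by (rule has_integral_in_closed_subspace[OF subspace_V closed_V integrable_integral[OF orbit_integrable]])
    (auto intro: mem)

lemma orbit_integral_quotient:
  assumes x: "x \<in> V" and t: "0 \<le> t"
  shows "((\<lambda>h. (integral {t..t + h} (\<lambda>s. T s x)) /\<^sub>R h) \<longlongrightarrow> T t x) (at_right 0)"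
proof -
  have "((\<lambda>u. integral {t..u} (\<lambda>s. T s x)) has_vector_derivative T t x) (at t within {t..t+1})"
    by (rule integral_has_vector_derivative) (use t in \<open>auto intro!: continuous_on_subset[OF continuous_orbit[OF x]]\<close>)
  then have "((\<lambda>u. integral {t..u} (\<lambda>s. T s x)) has_vector_derivative T t x) (at_right t)"
    by (simp add: at_within_Icc_at_right)
  then have "((\<lambda>u. (integral {t..u} (\<lambda>s. T s x) - (u - t) *\<^sub>R T t x) /\<^sub>R norm (u - t)) \<longlongrightarrow> 0) (at_right t)"
    by (simp add: has_vector_derivative_def has_derivative_within divide_inverse_commute)
  moreover have "\<forall>\<^sub>F u in at_right t. (integral {t..u} (\<lambda>s. T s x) - (u - t) *\<^sub>R T t x) /\<^sub>R norm (u - t)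
      = (integral {t..u} (\<lambda>s. T s x)) /\<^sub>R (u - t) - T t x"
    using eventually_at_right_less[of t] by eventually_elim (simp add: scaleR_diff_right)
  ultimately have "((\<lambda>u. (integral {t..u} (\<lambda>s. T s x)) /\<^sub>R (u - t)) \<longlongrightarrow> T t x) (at_right t)"
    by (subst Lim_null) (simp cong: tendsto_cong)
  then show ?thesis
    by (subst (asm) filterlim_at_right_to_0) (simp add: add.commute)
qed

text \<open>\<open>T h\<close> shifts the window of integration from [0, t] to [h, t + h]. After
  cancellation of the common part two windows of length h remain, one at t and one at 0, and their
  averages converge.\<close>

lemma integral_gen:
  assumes x: "x \<in> V" and t: "0 \<le> t"
  shows "(integral {0..t} (\<lambda>s. T s x), T t x - x) \<in> gen"
proof -
  let ?F = "\<lambda>a b. integral {a..b} (\<lambda>s. T s x)"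
  have "((\<lambda>h. (?F t (t + h)) /\<^sub>R h - (?F 0 (0 + h)) /\<^sub>R h) \<longlongrightarrow> T t x - T 0 x) (at_right 0)"
    by (intro tendsto_diff orbit_integral_quotient x t order_refl)
  moreover have "\<forall>\<^sub>F h in at_right 0. (?F t (t + h)) /\<^sub>R h - (?F 0 (0 + h)) /\<^sub>R h = (T h (?F 0 t) - ?F 0 t) /\<^sub>R h"
    using eventually_right_pos
  proof eventually_elim
    fix h :: real assume h: "0 < h"
    obtain K where K: "\<And>x. x \<in> V \<Longrightarrow> norm (T h x) \<le> K * norm x" using bounded[of h] h by auto
    have "((\<lambda>s. T h (T s x)) has_integral T h (?F 0 t)) {0..t}"
      by (rule has_integral_linear_on_subspace[OF subspace_V closed_V integrable_integral[OF orbit_integrable[OF x]]])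
        (use h x K in \<open>auto intro: mem add scale\<close>)
    then have "((\<lambda>s. T (h + s) x) has_integral T h (?F 0 t)) {0..t}"
      by (rule has_integral_eq[rotated]) (use h x in \<open>auto simp: semigroup\<close>)
    then have "T h (?F 0 t) = ?F h (t + h)"
      using has_integral_shift_Icc_real[of "\<lambda>s. T s x" h "T h (?F 0 t)" 0 t]
      by (simp add: o_def integral_unique)
    moreover have "?F 0 h + ?F h (t + h) = ?F 0 (t + h)"
      by (rule Henstock_Kurzweil_Integration.integral_combine) (use h t in \<open>auto intro: orbit_integrable[OF x]\<close>)
    moreover have "?F 0 t + ?F t (t + h) = ?F 0 (t + h)"
      by (rule Henstock_Kurzweil_Integration.integral_combine) (use h t in \<open>auto intro: orbit_integrable[OF x]\<close>)
    ultimately have "T h (?F 0 t) - ?F 0 t = ?F t (t + h) - ?F 0 h" by (simp add: algebra_simps)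
    then show "(?F t (t + h)) /\<^sub>R h - (?F 0 (0 + h)) /\<^sub>R h = (T h (?F 0 t) - ?F 0 t) /\<^sub>R h"
      by (simp add: scaleR_diff_right)
  qed
  ultimately have "((\<lambda>h. (T h (?F 0 t) - ?F 0 t) /\<^sub>R h) \<longlongrightarrow> T t x - x) (at_right 0)"
    unfolding zero[OF x] by (rule Lim_transform_eventually)
  then show ?thesis using orbit_integral_mem[OF x] mem[OF t x] x by (auto simp: gen_def)
qed

text \<open>The averages of an orbit over [0, h] lie in the domain and tend to its starting
  point.\<close>

lemma gen_dense: assumes x: "x \<in> V" and e: "e > 0" shows "\<exists>y z. (y, z) \<in> gen \<and> dist y x < e"
proof -
  have "\<forall>\<^sub>F h in at_right 0. dist ((integral {0..0 + h} (\<lambda>s. T s x)) /\<^sub>R h) (T 0 x) < e"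
    using orbit_integral_quotient[OF x order_refl] e by (auto simp: tendsto_iff)
  with eventually_right_pos have "\<forall>\<^sub>F h in at_right 0. 0 < h \<and> dist ((integral {0..h} (\<lambda>s. T s x)) /\<^sub>R h) x < e"
    by eventually_elim (simp add: zero[OF x])
  then obtain h :: real where h: "0 < h" "dist ((integral {0..h} (\<lambda>s. T s x)) /\<^sub>R h) x < e"
    using eventually_happens trivial_limit_at_right_real by blast
  then show ?thesis using gen_scale[OF integral_gen[OF x], of h "inverse h"] by auto
qed

end

section \<open>Exponentially stable semigroups and the resolvent at 0\<close>

locale stable_semigroup = subspace_semigroup +
  fixes M \<kappa> :: real
  assumes decay: "0 \<le> t \<Longrightarrow> x \<in> V \<Longrightarrow> norm (T t x) \<le> M * exp (- \<kappa> * t) * norm x" and \<kappa>: "0 < \<kappa>"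
begin

text \<open>An orbit with derivative zero is constant, while decay forces it to 0. Hence the
  generator is injective, and solutions of the resolvent equation at 0 are unique.\<close>

lemma gen_kernel: assumes g: "(x, 0) \<in> gen" shows "x = 0"
proof -
  note V = genD[OF g]
  have "T t x = x" if t: "0 \<le> t" for t
  proof -
    have "((\<lambda>t. T t x) has_derivative (\<lambda>_. 0)) (at s within {0..})" if "s \<in> {0..}" for s
      using orbit_derivative[OF g, of s] T_0[of s] that by (simp add: has_vector_derivative_def)
    then have "T t x = T 0 x"
      by (intro has_derivative_zero_unique[of "{0..}" "\<lambda>t. T t x"]) (use t in auto)
    then show ?thesis using zero V by simp
  qed
  then have *: "norm x \<le> M * exp (- \<kappa> * t) * norm x" if "0 \<le> t" for t using decay[of t x] V that by simp
  have "((\<lambda>t. M * exp (- \<kappa> * t) * norm x) \<longlongrightarrow> M * 0 * norm x) at_top"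
  proof (intro tendsto_intros)
    have "filterlim (\<lambda>t. \<kappa> * t) at_top at_top" using \<kappa> by (simp add: filterlim_tendsto_pos_mult_at_top[OF tendsto_const _ filterlim_ident])
    then show "((\<lambda>t. exp (- \<kappa> * t)) \<longlongrightarrow> 0) at_top"
      by (intro filterlim_compose[OF exp_at_bot]) (simp add: filterlim_uminus_at_bot)
  qed
  then have "norm x \<le> M * 0 * norm x"
    by (rule tendsto_lowerbound) (use * in \<open>auto intro: eventually_mono[OF eventually_ge_at_top[of 0]]\<close>)
  then show ?thesis by simp
qed

lemma gen_inj: assumes "(x, y) \<in> gen" "(x', y) \<in> gen" shows "x = x'"
  using gen_kernel[of "x - x'"] gen_add[OF assms(1) gen_scale[OF assms(2), of "-1"]] by simp

text \<open>If \<open>y\<close> is the orbit sum of \<open>x\<close>, then \<open>T a y = y - x\<close>, so that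
  \<open>integral_gen\<close> expresses the resolvent at \<open>0\<close> by an integral over the bounded interval
  \<open>[0, a]\<close>.\<close>

definition orbit_sum :: "real \<Rightarrow> 'a \<Rightarrow> 'a" where "orbit_sum a x = (\<Sum>k. T (real k * a) x)"

text \<open>The terms are dominated by a geometric series with ratio exp(-\<kappa> a), which gives
  the norm bound. Applying \<open>T a\<close> shifts the partial sums by one index and so drops the
  first term x; boundedness of \<open>T a\<close> carries this to the limit.\<close>

lemma orbit_sum:
  assumes a: "0 < a" and x: "x \<in> V"
  shows "orbit_sum a x \<in> V" and "norm (orbit_sum a x) \<le> M / (1 - exp (- \<kappa> * a)) * norm x"
    and "T a (orbit_sum a x) = orbit_sum a x - x"
proof -
  define q where "q = exp (- \<kappa> * a)"
  have q: "0 < q" "q < 1" using a \<kappa> by (auto simp: q_def)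
  have le: "norm (T (real k * a) x) \<le> M * norm x * q ^ k" for k
    using decay[of "real k * a" x] a x by (simp add: q_def exp_of_nat_mult[symmetric] algebra_simps)
  have sq: "summable (\<lambda>k. M * norm x * q ^ k)" using q by (intro summable_mult summable_geometric) auto
  have s: "summable (\<lambda>k. T (real k * a) x)" by (rule summable_comparison_test'[OF sq]) (use le in auto)
  then have lim: "(\<lambda>n. \<Sum>k<n. T (real k * a) x) \<longlonglongrightarrow> orbit_sum a x"
    unfolding orbit_sum_def by (rule summable_LIMSEQ)
  have memk: "T (real k * a) x \<in> V" for k using a x by (intro mem) auto
  have part: "(\<Sum>k<n. T (real k * a) x) \<in> V" for n by (rule subspace_sum[OF subspace_V]) (rule memk)
  show V: "orbit_sum a x \<in> V" using closed_sequentially[OF closed_V _ lim] part by simp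
  have "norm (orbit_sum a x) \<le> (\<Sum>k. norm (T (real k * a) x))"
    unfolding orbit_sum_def by (rule summable_norm, rule summable_comparison_test'[OF sq]) (use le in auto)
  also have "\<dots> \<le> (\<Sum>k. M * norm x * q ^ k)"
    by (rule suminf_le[OF le _ sq], rule summable_comparison_test'[OF sq]) (use le in auto)
  also have "\<dots> = M / (1 - q) * norm x"
    using q by (simp add: suminf_mult suminf_geometric summable_geometric)
  finally show "norm (orbit_sum a x) \<le> M / (1 - exp (- \<kappa> * a)) * norm x" by (simp add: q_def)
  obtain K where K: "\<And>x. x \<in> V \<Longrightarrow> norm (T a x) \<le> K * norm x" using bounded[of a] a by auto
  have "(\<lambda>n. K * norm ((\<Sum>k<n. T (real k * a) x) - orbit_sum a x)) \<longlonglongrightarrow> K * norm (orbit_sum a x - orbit_sum a x)"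
    by (intro tendsto_intros lim)
  then have "(\<lambda>n. K * norm ((\<Sum>k<n. T (real k * a) x) - orbit_sum a x)) \<longlonglongrightarrow> 0" by simp
  then have "(\<lambda>n. T a (\<Sum>k<n. T (real k * a) x) - T a (orbit_sum a x)) \<longlonglongrightarrow> 0"
  proof (rule Lim_null_comparison[rotated], intro always_eventually allI)
    fix n
    have "T a (\<Sum>k<n. T (real k * a) x) - T a (orbit_sum a x) = T a ((\<Sum>k<n. T (real k * a) x) - orbit_sum a x)"
      using diff[OF _ part[of n] V, of a] a by simp
    then show "norm (T a (\<Sum>k<n. T (real k * a) x) - T a (orbit_sum a x)) \<le> K * norm ((\<Sum>k<n. T (real k * a) x) - orbit_sum a x)"
      using K[OF V_simps(2)[OF part[of n] V]] by simp
  qed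
  then have 1: "(\<lambda>n. T a (\<Sum>k<n. T (real k * a) x)) \<longlonglongrightarrow> T a (orbit_sum a x)" by (simp add: Lim_null[symmetric])
  have "T a (\<Sum>k<n. T (real k * a) x) = (\<Sum>k<Suc n. T (real k * a) x) - x" for n
  proof (induction n)
    case 0 show ?case using T_0[of a] a zero[OF x] by simp
  next
    case (Suc n)
    have "T a (T (real n * a) x) = T (real (Suc n) * a) x"
      using semigroup[of a "real n * a" x] a x by (simp add: algebra_simps)
    then have "T a (\<Sum>k<Suc n. T (real k * a) x) = T a (\<Sum>k<n. T (real k * a) x) + T (real (Suc n) * a) x"
      using add[of a, OF _ part[of n] memk[of n]] a by simp
    then show ?case using Suc by simp
  qed
  moreover have "(\<lambda>n. (\<Sum>k<Suc n. T (real k * a) x) - x) \<longlonglongrightarrow> orbit_sum a x - x"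
    by (intro tendsto_diff tendsto_const LIMSEQ_Suc[OF lim])
  ultimately show "T a (orbit_sum a x) = orbit_sum a x - x" using 1 LIMSEQ_unique by auto
qed

lemma orbit_sum_gen:
  assumes a: "0 < a" and x: "x \<in> V"
  shows "(integral {0..a} (\<lambda>s. T s (orbit_sum a x)), - x) \<in> gen"
  using integral_gen[OF orbit_sum(1)[OF a x] less_imp_le[OF a]] orbit_sum(3)[OF a x] by simp

text \<open>The generator maps both sides to -x: on the right the contributions are
  \<open>T t x - x\<close> and \<open>- T t x\<close>. Injectivity of the generator then replaces
  any manipulation of the integrals.\<close>

lemma orbit_sum_split:
  assumes a: "0 < a" and x: "x \<in> V" and t: "0 \<le> t"
  shows "integral {0..a} (\<lambda>s. T s (orbit_sum a x)) =
    integral {0..t} (\<lambda>s. T s x) + integral {0..a} (\<lambda>s. T s (orbit_sum a (T t x)))"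
  by (rule gen_inj[OF orbit_sum_gen[OF a x]])
    (use gen_add[OF integral_gen[OF x t] orbit_sum_gen[OF a mem[OF t x]]] in simp)

end

section \<open>Semigroups on spaces of square-integrable functions\<close>

text \<open>Closedness is required for sequences of representatives in the seminorm. Applied to
  constant sequences it also makes X saturated: a square-integrable function equal almost everywhere
  to a member is a member.\<close>

definition L2_subspace :: "'a measure \<Rightarrow> ('a \<Rightarrow> 'b::euclidean_space) set \<Rightarrow> bool" where
  "L2_subspace M X \<longleftrightarrow> X \<subseteq> L2 M \<and> (\<lambda>x. 0) \<in> X \<and> (\<forall>f\<in>X. \<forall>g\<in>X. (\<lambda>x. f x + g x) \<in> X) \<and>
     (\<forall>c. \<forall>f\<in>X. (\<lambda>x. c *\<^sub>R f x) \<in> X) \<and>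
     (\<forall>f g. (\<forall>n. f n \<in> X) \<and> g \<in> L2 M \<and> (\<lambda>n. l2norm M (\<lambda>x. f n x - g x)) \<longlonglongrightarrow> 0 \<longrightarrow> g \<in> X)"

lemma L2_subspace_L2: "L2_subspace M (L2 M :: ('a \<Rightarrow> 'b::euclidean_space) set)"
  by (auto simp: L2_subspace_def L2_add L2_scaleR)

lemma L2_subspaceD:
  assumes "L2_subspace M X"
  shows "f \<in> X \<Longrightarrow> f \<in> L2 M" and "(\<lambda>x. 0) \<in> X" and "f \<in> X \<Longrightarrow> g \<in> X \<Longrightarrow> (\<lambda>x. f x + g x) \<in> X"
    and "f \<in> X \<Longrightarrow> (\<lambda>x. c *\<^sub>R f x) \<in> X" and "f \<in> X \<Longrightarrow> g \<in> X \<Longrightarrow> (\<lambda>x. f x - g x) \<in> X"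
    and "(\<And>n. F n \<in> X) \<Longrightarrow> g \<in> L2 M \<Longrightarrow> (\<lambda>n. l2norm M (\<lambda>x. F n x - g x)) \<longlonglongrightarrow> 0 \<Longrightarrow> g \<in> X"
proof -
  show "f \<in> X \<Longrightarrow> f \<in> L2 M" "(\<lambda>x. 0) \<in> X"
    using assms by (auto simp: L2_subspace_def)
  show "(\<And>n. F n \<in> X) \<Longrightarrow> g \<in> L2 M \<Longrightarrow> (\<lambda>n. l2norm M (\<lambda>x. F n x - g x)) \<longlonglongrightarrow> 0 \<Longrightarrow> g \<in> X"
    using assms unfolding L2_subspace_def by blast
  show a: "f \<in> X \<Longrightarrow> g \<in> X \<Longrightarrow> (\<lambda>x. f x + g x) \<in> X" for f g
    using assms by (auto simp: L2_subspace_def)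
  show s: "f \<in> X \<Longrightarrow> (\<lambda>x. c *\<^sub>R f x) \<in> X" for f c
    using assms by (auto simp: L2_subspace_def)
  show "f \<in> X \<Longrightarrow> g \<in> X \<Longrightarrow> (\<lambda>x. f x - g x) \<in> X"
    using a[of f "\<lambda>x. (-1) *\<^sub>R g x"] s[of g "-1"] by simp
qed

text \<open>Closedness rests on completeness: a limit of embedded members is itself embedded by
  Riesz-Fischer, and closedness of X in the seminorm puts the representative into X.\<close>

lemma emb_L2_subspace:
  assumes X: "L2_subspace M X"
  shows "subspace (emb M ` X)" and "closed (emb M ` X)"
proof -
  note XD = L2_subspaceD[OF X]
  show "subspace (emb M ` X)"
  proof (rule subspaceI)
    show "0 \<in> emb M ` X" by (rule image_eqI[OF _ XD(2)]) simp
    show "x + y \<in> emb M ` X" if "x \<in> emb M ` X" "y \<in> emb M ` X" for x y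
    proof -
      from that obtain f g where fg: "f \<in> X" "g \<in> X" "x = emb M f" "y = emb M g" by blast
      then show ?thesis using emb_add[OF XD(1) XD(1), of f g] XD(3)[of f g] by (metis image_eqI)
    qed
    show "c *\<^sub>R x \<in> emb M ` X" if "x \<in> emb M ` X" for c x
    proof -
      from that obtain f where f: "f \<in> X" "x = emb M f" by blast
      then show ?thesis using emb_scaleR[OF XD(1), of f c] XD(4)[of f c] by (metis image_eqI)
    qed
  qed
  show "closed (emb M ` X)"
    unfolding closed_sequential_limits
  proof (intro allI impI)
    fix x l assume "(\<forall>n. x n \<in> emb M ` X) \<and> x \<longlonglongrightarrow> l"
    then have "\<forall>n. \<exists>f. f \<in> X \<and> x n = emb M f" and l: "x \<longlonglongrightarrow> l" by auto
    then obtain f where f: "\<And>n. f n \<in> X" and xf: "x = (\<lambda>n. emb M (f n))" by metis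
    have "Cauchy (\<lambda>n. emb M (f n))" using l LIMSEQ_imp_Cauchy unfolding xf by blast
    then obtain g where g: "g \<in> L2 M" "(\<lambda>n. emb M (f n)) \<longlonglongrightarrow> emb M g"
      using Riesz_Fischer[of f, OF XD(1)[OF f]] by blast
    then have "(\<lambda>n. dist (emb M (f n)) (emb M g)) \<longlonglongrightarrow> 0" by (simp add: tendsto_dist_iff[symmetric])
    then have "g \<in> X" using XD(6)[OF f g(1)] by (simp add: l2norm_emb_diff XD(1)[OF f] g)
    moreover have "l = emb M g" using LIMSEQ_unique[OF l] g unfolding xf by blast
    ultimately show "l \<in> emb M ` X" by blast
  qed
qed

lemma bounded_opD:
  assumes "bounded_op M X T"
  shows "f \<in> X \<Longrightarrow> T f \<in> X"
    and "f \<in> X \<Longrightarrow> g \<in> X \<Longrightarrow> AE x in M. T (\<lambda>y. f y + g y) x = T f x + T g x"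
    and "f \<in> X \<Longrightarrow> AE x in M. T (\<lambda>y. c *\<^sub>R f y) x = c *\<^sub>R T f x"
  using assms by (auto simp: bounded_op_def)

lemma bounded_op_bound:
  assumes "bounded_op M X T" obtains K where "K \<ge> 0" "\<And>f. f \<in> X \<Longrightarrow> l2norm M (T f) \<le> K * l2norm M f"
proof -
  from assms obtain K where K: "\<And>f. f \<in> X \<Longrightarrow> l2norm M (T f) \<le> K * l2norm M f"
    unfolding bounded_op_def by blast
  have "l2norm M (T f) \<le> \<bar>K\<bar> * l2norm M f" if "f \<in> X" for f
    by (rule order_trans[OF K[OF that]]) (intro mult_right_mono, auto)
  then show thesis by (intro that[of "\<bar>K\<bar>"]) auto
qed

lemma bounded_op_diff:
  assumes X: "L2_subspace M X" and T: "bounded_op M X T" and f: "f \<in> X" and g: "g \<in> X"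
  shows "AE x in M. T (\<lambda>y. f y - g y) x = T f x - T g x"
proof -
  have "AE x in M. T (\<lambda>y. f y + (-1) *\<^sub>R g y) x = T f x + T (\<lambda>y. (-1) *\<^sub>R g y) x"
    by (intro bounded_opD[OF T] f L2_subspaceD(4)[OF X g])
  with bounded_opD(3)[OF T g, of "-1"] show ?thesis by eventually_elim simp
qed

text \<open>The difference of two representatives has norm zero, and boundedness sends it to a
  function of norm zero. Operators on representatives are thereby well defined on classes.\<close>

lemma bounded_op_cong:
  assumes X: "L2_subspace M X" and T: "bounded_op M X T" and f: "f \<in> X" and g: "g \<in> X"
    and eq: "AE x in M. f x = g x"
  shows "AE x in M. T f x = T g x"
proof -
  note L = L2_subspaceD(1)[OF X]
  obtain K where K: "K \<ge> 0" "\<And>f. f \<in> X \<Longrightarrow> l2norm M (T f) \<le> K * l2norm M f" using bounded_op_bound[OF T] by blast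
  let ?d = "\<lambda>y. f y - g y"
  have d: "?d \<in> X" by (rule L2_subspaceD(5)[OF X f g])
  have "l2norm M ?d = 0" using eq by (subst l2norm_0_iff_AE[OF L[OF d]]) auto
  then have "l2norm M (T ?d) = 0" using K(2)[OF d] l2norm_nonneg[of M "T ?d"] by simp
  then have "AE x in M. T ?d x = 0" by (subst (asm) l2norm_0_iff_AE[OF L[OF bounded_opD(1)[OF T d]]])
  with bounded_op_diff[OF X T f g] show ?thesis by eventually_elim simp
qed

text \<open>Any representative may be picked, by \<open>bounded_op_cong\<close>. Outside the image
  of X the value is unspecified, which the carrier in \<open>subspace_semigroup\<close> allows
  for.\<close>

definition lift_op :: "'a measure \<Rightarrow> ('a \<Rightarrow> 'b::euclidean_space) set \<Rightarrow> (('a \<Rightarrow> 'b) \<Rightarrow> 'a \<Rightarrow> 'b)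
    \<Rightarrow> (('a \<Rightarrow> 'b) discrete \<Rightarrow>\<^sub>C real) \<Rightarrow> (('a \<Rightarrow> 'b) discrete \<Rightarrow>\<^sub>C real)" where
  "lift_op M X T y = emb M (T (SOME f. f \<in> X \<and> emb M f = y))"

lemma lift_op_emb:
  assumes X: "L2_subspace M X" and T: "bounded_op M X T" and f: "f \<in> X"
  shows "lift_op M X T (emb M f) = emb M (T f)"
proof -
  note L = L2_subspaceD(1)[OF X]
  define g where "g = (SOME g. g \<in> X \<and> emb M g = emb M f)"
  have g: "g \<in> X \<and> emb M g = emb M f" unfolding g_def by (rule someI[of _ f]) (simp add: f)
  then have "AE x in M. g x = f x" using emb_eq_iff[OF L L, of g f] f by simp
  then have "AE x in M. T g x = T f x" using bounded_op_cong[OF X T] g f by blast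
  then have "emb M (T g) = emb M (T f)"
    using emb_eq_iff[OF L L, of "T g" "T f"] bounded_opD(1)[OF T] g f by simp
  then show ?thesis by (simp add: lift_op_def g_def)
qed

locale L2_semigroup =
  fixes M :: "'a measure" and X :: "('a \<Rightarrow> 'b::euclidean_space) set" and G :: "real \<Rightarrow> ('a \<Rightarrow> 'b) \<Rightarrow> 'a \<Rightarrow> 'b"
  assumes X: "L2_subspace M X" and c0: "c0_semigroup M X G"
begin

lemmas XD = L2_subspaceD[OF X]

lemma op: "0 \<le> t \<Longrightarrow> bounded_op M X (G t)"
  using c0 by (auto simp: c0_semigroup_def)

lemma G_mem: "0 \<le> t \<Longrightarrow> f \<in> X \<Longrightarrow> G t f \<in> X"
  using bounded_opD(1)[OF op] by blast

lemma lift_emb: "0 \<le> t \<Longrightarrow> f \<in> X \<Longrightarrow> lift_op M X (G t) (emb M f) = emb M (G t f)"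
  by (rule lift_op_emb[OF X op])

lemma emb_eqI: "f \<in> X \<Longrightarrow> g \<in> X \<Longrightarrow> AE x in M. f x = g x \<Longrightarrow> emb M f = emb M g"
  using emb_eq_iff[OF XD(1) XD(1)] by blast

lemma lift_semigroup: "subspace_semigroup (emb M ` X) (\<lambda>t. lift_op M X (G t))"
proof
  show "subspace (emb M ` X)" "closed (emb M ` X)" by (rule emb_L2_subspace[OF X])+
  fix t :: real and x assume t: "0 \<le> t"
  show "\<exists>K. \<forall>x\<in>emb M ` X. norm (lift_op M X (G t) x) \<le> K * norm x"
  proof -
    obtain K where "K \<ge> 0" "\<And>f. f \<in> X \<Longrightarrow> l2norm M (G t f) \<le> K * l2norm M f" using bounded_op_bound[OF op[OF t]] by blast
    then show ?thesis by (intro exI[of _ K]) (auto simp: lift_emb t norm_emb XD(1) G_mem)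
  qed
  assume "x \<in> emb M ` X"
  then obtain f where f: "f \<in> X" "x = emb M f" by blast
  show "lift_op M X (G t) x \<in> emb M ` X" using f t by (simp add: lift_emb G_mem)
  show "lift_op M X (G t) (c *\<^sub>R x) = c *\<^sub>R lift_op M X (G t) x" for c
  proof -
    have "emb M (G t (\<lambda>x. c *\<^sub>R f x)) = emb M (\<lambda>x. c *\<^sub>R G t f x)"
      by (intro emb_eqI G_mem XD(4) t f bounded_opD(3)[OF op])
    then show ?thesis using f t by (simp add: lift_emb XD(4) emb_scaleR[symmetric] XD(1) G_mem)
  qed
  show "lift_op M X (G t) (x + y) = lift_op M X (G t) x + lift_op M X (G t) y" if "y \<in> emb M ` X" for y
  proof -
    from that obtain g where g: "g \<in> X" "y = emb M g" by blast
    have "emb M (G t (\<lambda>x. f x + g x)) = emb M (\<lambda>x. G t f x + G t g x)"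
      by (intro emb_eqI G_mem XD(3) t f g bounded_opD(2)[OF op])
    then show ?thesis using f g t by (simp add: lift_emb XD(3) emb_add[symmetric] XD(1) G_mem)
  qed
  show "lift_op M X (G (s + t)) x = lift_op M X (G s) (lift_op M X (G t) x)" if s: "0 \<le> s" for s
  proof -
    have "emb M (G (s + t) f) = emb M (G s (G t f))"
      using c0 s t f by (intro emb_eqI G_mem) (auto simp: c0_semigroup_def)
    then show ?thesis using f s t by (simp add: lift_emb G_mem)
  qed
next
  fix x assume "x \<in> emb M ` X"
  then obtain f where f: "f \<in> X" "x = emb M f" by blast
  have "emb M (G 0 f) = emb M f"
    using c0 f by (intro emb_eqI G_mem) (auto simp: c0_semigroup_def)
  then show "lift_op M X (G 0) x = x" using f by (simp add: lift_emb)
  have "((\<lambda>t. l2norm M (\<lambda>x. G t f x - f x)) \<longlongrightarrow> 0) (at_right 0)" using c0 f by (auto simp: c0_semigroup_def)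
  then have "((\<lambda>t. dist (lift_op M X (G t) x) x) \<longlongrightarrow> 0) (at_right 0)"
  proof (rule Lim_transform_eventually)
    show "\<forall>\<^sub>F t in at_right 0. l2norm M (\<lambda>x. G t f x - f x) = dist (lift_op M X (G t) x) x"
      using eventually_at_right_less[of 0]
      by eventually_elim (simp add: f lift_emb l2norm_emb_diff XD(1) G_mem)
  qed
  then show "((\<lambda>h. lift_op M X (G h) x) \<longlongrightarrow> x) (at_right 0)" by (subst tendsto_dist_iff)
qed

sublocale subspace_semigroup "emb M ` X" "\<lambda>t. lift_op M X (G t)"
  by (rule lift_semigroup)

lemma generator_iff:
  "(f, g) \<in> generator M X G \<longleftrightarrow> f \<in> X \<and> g \<in> X \<and> (emb M f, emb M g) \<in> gen"
proof (cases "f \<in> X \<and> g \<in> X")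
  case True
  have "l2norm M (\<lambda>x. (G h f x - f x) /\<^sub>R h - g x) = dist ((lift_op M X (G h) (emb M f) - emb M f) /\<^sub>R h) (emb M g)"
    if h: "0 < h" for h
  proof -
    have "(\<lambda>x. (G h f x - f x)) \<in> X" using True G_mem[of h f] XD(5) h by simp
    then show ?thesis
      using True h by (simp add: l2norm_emb_diff XD emb_scaleR emb_diff G_mem lift_emb)
  qed
  then have "\<forall>\<^sub>F h in at_right 0. l2norm M (\<lambda>x. (G h f x - f x) /\<^sub>R h - g x) = dist ((lift_op M X (G h) (emb M f) - emb M f) /\<^sub>R h) (emb M g)"
    using eventually_at_right_less[of 0] by (auto elim: eventually_mono)
  then have "((\<lambda>h. l2norm M (\<lambda>x. (G h f x - f x) /\<^sub>R h - g x)) \<longlongrightarrow> 0) (at_right 0) \<longleftrightarrow>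
      ((\<lambda>h. dist ((lift_op M X (G h) (emb M f) - emb M f) /\<^sub>R h) (emb M g)) \<longlongrightarrow> 0) (at_right 0)"
    by (rule tendsto_cong)
  then show ?thesis using True by (auto simp: generator_def gen_def tendsto_dist_iff[of _ "emb M g"])
qed (auto simp: generator_def)

lemma gen_ex: assumes "(x, y) \<in> gen" obtains f g where "(f, g) \<in> generator M X G" "x = emb M f" "y = emb M g"
  using genD(1,2)[OF assms] assms generator_iff by blast

lemma has_integral_orbit:
  assumes f: "f \<in> X" and I: "I \<in> X" and eq: "emb M I = integral {0..T} (\<lambda>s. lift_op M X (G s) (emb M f))"
  shows "l2_has_integral M (\<lambda>t. G t f) T I"
  unfolding l2_has_integral_iff
proof (intro conjI ballI)
  show "I \<in> L2 M" by (rule XD(1)[OF I])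
  show "G s f \<in> L2 M" if "s \<in> {0..T}" for s using that f by (simp add: G_mem XD(1))
  have "((\<lambda>s. lift_op M X (G s) (emb M f)) has_integral emb M I) {0..T}"
    unfolding eq by (intro integrable_integral orbit_integrable) (use f in auto)
  then show "((\<lambda>s. emb M (G s f)) has_integral emb M I) {0..T}"
    by (rule has_integral_eq[rotated]) (simp add: f lift_emb)
qed

lemma uniform_bound:
  obtains K where "K \<ge> 1" "\<And>t f. t \<in> {0..a} \<Longrightarrow> f \<in> X \<Longrightarrow> l2norm M (G t f) \<le> K * l2norm M f"
proof -
  obtain K where K: "K \<ge> 1" "\<forall>t\<in>{0..a}. \<forall>x\<in>emb M ` X. norm (lift_op M X (G t) x) \<le> K * norm x"
    using bound_on_interval by blast
  have "l2norm M (G t f) \<le> K * l2norm M f" if "t \<in> {0..a}" "f \<in> X" for t f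
    using K(2) that by (force simp: lift_emb norm_emb XD(1) G_mem)
  with K show thesis by (intro that)
qed

lemma continuous_emb:
  assumes f: "f \<in> X" shows "continuous_on {0..} (\<lambda>t. emb M (G t f))"
  by (subst continuous_on_cong[OF refl, of _ _ "\<lambda>t. lift_op M X (G t) (emb M f)"])
    (use f in \<open>auto simp: lift_emb intro!: continuous_orbit\<close>)

lemma generator_orbit:
  assumes g: "(f, g) \<in> generator M X G" and t: "0 \<le> t"
  shows "(G t f, G t g) \<in> generator M X G"
    and "((\<lambda>t. emb M (G t f)) has_vector_derivative emb M (G t g)) (at t within {0..})"
proof -
  have fg: "f \<in> X" "g \<in> X" "(emb M f, emb M g) \<in> gen" using g by (auto simp: generator_iff)
  show "(G t f, G t g) \<in> generator M X G"
    using gen_orbit[OF fg(3) t] fg t by (simp add: generator_iff lift_emb G_mem)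
  have "((\<lambda>t. lift_op M X (G t) (emb M f)) has_vector_derivative emb M (G t g)) (at t within {0..})"
    using orbit_derivative[OF fg(3) t] fg t by (simp add: lift_emb)
  then show "((\<lambda>t. emb M (G t f)) has_vector_derivative emb M (G t g)) (at t within {0..})"
    by (rule has_vector_derivative_transform_within[OF _ zero_less_one]) (use fg t in \<open>auto simp: lift_emb\<close>)
qed

lemma generator_dense:
  assumes f: "f \<in> X" and e: "0 < e"
  obtains g h where "(g, h) \<in> generator M X G" "l2norm M (\<lambda>x. g x - f x) < e"
proof -
  obtain y z where yz: "(y, z) \<in> gen" "dist y (emb M f) < e" using gen_dense[OF _ e] f by blast
  obtain g h where "(g, h) \<in> generator M X G" "y = emb M g" by (rule gen_ex[OF yz(1)])
  then show thesis using that[of g h] yz(2) f by (simp add: l2norm_emb_diff XD(1) generator_iff)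
qed

end

section \<open>The measures\<close>

lemma measurable_delay_iff: "f \<in> measurable (\<D> \<tau>) N \<longleftrightarrow> f \<in> measurable (restrict_space borel {-\<tau>..0}) N"
  by (rule arg_cong[where f = "\<lambda>A. f \<in> A"], rule measurable_cong_sets) simp_all

lemma measurable_delay_borel [measurable (raw)]: "f \<in> borel_measurable borel \<Longrightarrow> f \<in> borel_measurable (\<D> \<tau>)"
  unfolding measurable_delay_iff by (rule measurable_restrict_space1)

lemma space_leb [simp]: "space (leb \<tau>) = {-\<tau><..<0}"
  by (simp add: leb_def space_restrict_space)

lemma measurable_leb_iff: "f \<in> measurable (leb \<tau>) N \<longleftrightarrow> f \<in> measurable (restrict_space borel {-\<tau><..<0}) N"
  by (rule arg_cong[where f = "\<lambda>A. f \<in> A"], rule measurable_cong_sets) (simp_all add: leb_def sets_restrict_space)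

lemma measurable_delay_leb: "f \<in> measurable (\<D> \<tau>) N \<Longrightarrow> f \<in> measurable (leb \<tau>) N"
  unfolding measurable_delay_iff measurable_leb_iff by (rule measurable_restrict_mono) auto

lemma measurable_leb_borel [measurable (raw)]: "f \<in> borel_measurable borel \<Longrightarrow> f \<in> borel_measurable (leb \<tau>)"
  unfolding measurable_leb_iff by (rule measurable_restrict_space1)

lemma measurable_ident_leb_delay: "(\<lambda>x. x) \<in> measurable (leb \<tau>) (\<D> \<tau>)"
  by (rule measurable_delay_leb) simp

lemma nn_integral_leb:
  "f \<in> borel_measurable (leb \<tau>) \<Longrightarrow> (\<integral>\<^sup>+x. f x \<partial>leb \<tau>) = (\<integral>\<^sup>+x. f x * indicator {-\<tau><..<0} x \<partial>lborel)"
  unfolding leb_def by (rule nn_integral_restrict_space) simp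

text \<open>The end points of [-\<tau>,0] are Lebesgue null, so the open interval used by
  \<open>leb\<close> loses nothing, and the unit atom at 0 contributes the value \<open>f 0\<close>.
  Indicators are the essential case.\<close>

lemma nn_integral_delay:
  assumes \<tau>: "0 < \<tau>" and f: "f \<in> borel_measurable (\<D> \<tau>)"
  shows "(\<integral>\<^sup>+x. f x \<partial>\<D> \<tau>) = (\<integral>\<^sup>+x. f x \<partial>leb \<tau>) + f 0"
  using f
proof (induction rule: borel_measurable_induct)
  case (cong f g)
  then have "(\<integral>\<^sup>+x. f x \<partial>\<D> \<tau>) = (\<integral>\<^sup>+x. g x \<partial>\<D> \<tau>)"
    by (intro nn_integral_cong) auto
  moreover have "(\<integral>\<^sup>+x. f x \<partial>leb \<tau>) = (\<integral>\<^sup>+x. g x \<partial>leb \<tau>)" using cong by (intro nn_integral_cong) auto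
  ultimately show ?case using cong \<tau> by simp
next
  case (set A)
  then have A: "A \<subseteq> {-\<tau>..0}" "A \<in> sets borel" by (auto simp: sets_restrict_space)
  have "(\<integral>\<^sup>+x. indicator A x \<partial>leb \<tau>) = (\<integral>\<^sup>+x. indicator (A \<inter> {-\<tau><..<0}) x \<partial>lborel)"
    using A by (subst nn_integral_leb)
      (auto intro!: measurable_leb_borel nn_integral_cong simp del: nn_integral_indicator split: split_indicator)
  also have "\<dots> = emeasure lborel (A \<inter> {-\<tau><..<0})"
    by (rule nn_integral_indicator) (use A in auto)
  also have "\<dots> = emeasure lborel A"
  proof (rule emeasure_eq_AE)
    have "AE x in lborel. x \<notin> {-\<tau>, 0}" by (intro AE_not_in finite_imp_null_set_lborel) auto
    then show "AE x in lborel. (x \<in> A \<inter> {-\<tau><..<0}) = (x \<in> A)" by eventually_elim (use A in force)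
  qed (use A in auto)
  finally show ?case using set by (simp add: emeasure_delay_measure)
next
  case (mult u c)
  then show ?case by (simp add: nn_integral_cmult measurable_delay_leb distrib_left)
next
  case (add u v)
  then show ?case by (simp add: nn_integral_add measurable_delay_leb ac_simps)
next
  case (seq U)
  have m: "\<And>i. U i \<in> borel_measurable (\<D> \<tau>)" using seq by simp
  have inc: "incseq (\<lambda>i. U i x)" for x using seq(3) by (auto simp: incseq_def le_fun_def)
  have "(\<integral>\<^sup>+x. (SUP i. U i x) \<partial>\<D> \<tau>) = (SUP i. \<integral>\<^sup>+x. U i x \<partial>\<D> \<tau>)"
    by (rule nn_integral_monotone_convergence_SUP) (use seq m in auto)
  also have "\<dots> = (SUP i. (\<integral>\<^sup>+x. U i x \<partial>leb \<tau>) + U i 0)" using seq by simp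
  also have "\<dots> = (SUP i. \<integral>\<^sup>+x. U i x \<partial>leb \<tau>) + (SUP i. U i 0)"
  proof (rule ennreal_SUP_add)
    show "incseq (\<lambda>i. \<integral>\<^sup>+ x. U i x \<partial>leb \<tau>)"
      using inc by (auto simp: incseq_def intro!: nn_integral_mono)
  qed (rule inc)
  also have "(SUP i. \<integral>\<^sup>+x. U i x \<partial>leb \<tau>) = (\<integral>\<^sup>+x. (SUP i. U i x) \<partial>leb \<tau>)"
    by (rule nn_integral_monotone_convergence_SUP[symmetric]) (use seq in \<open>auto intro: measurable_delay_leb[OF m]\<close>)
  finally show ?case by (simp add: image_comp)
qed

text \<open>A null set of \<open>delay_measure\<close> cannot contain the atom 0. Conversely the
  point -\<tau>, which \<open>leb\<close> does not see, is null and can be added to the exceptional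
  set.\<close>

lemma AE_delay_iff:
  assumes \<tau>: "0 < \<tau>"
  shows "(AE x in \<D> \<tau>. P x) \<longleftrightarrow> (AE x in leb \<tau>. P x) \<and> P 0"
proof safe
  assume "AE x in \<D> \<tau>. P x"
  then obtain N where N: "{x \<in> space (\<D> \<tau>). \<not> P x} \<subseteq> N" "emeasure (\<D> \<tau>) N = 0" "N \<in> sets (\<D> \<tau>)"
    by (rule AE_E)
  have "(\<integral>\<^sup>+x. indicator N x \<partial>leb \<tau>) + indicator N 0 = (0::ennreal)"
    using nn_integral_delay[OF \<tau>, of "indicator N"] N by simp
  then have 1: "(\<integral>\<^sup>+x. indicator N x \<partial>leb \<tau>) = 0" "0 \<notin> N" by (auto simp: indicator_def split: if_splits)
  show "P 0" using subsetD[OF N(1), of 0] 1(2) \<tau> by auto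
  have "indicator N \<in> borel_measurable (leb \<tau>)" by (rule measurable_delay_leb) (use N in simp)
  with 1 have "AE x in leb \<tau>. indicator N x = (0::ennreal)" by (subst (asm) nn_integral_0_iff_AE) auto
  with AE_space show "AE x in leb \<tau>. P x"
  proof eventually_elim
    case (elim x)
    then show ?case using subsetD[OF N(1), of x] by (auto simp: indicator_def split: if_splits)
  qed
next
  assume ae: "AE x in leb \<tau>. P x" and 0: "P 0"
  from ae obtain N where N: "{x \<in> space (leb \<tau>). \<not> P x} \<subseteq> N" "emeasure (leb \<tau>) N = 0" "N \<in> sets (leb \<tau>)"
    by (rule AE_E)
  have Nb: "N \<in> sets borel" "N \<subseteq> {-\<tau><..<0}" using N(3) by (auto simp: leb_def sets_restrict_space)
  show "AE x in \<D> \<tau>. P x"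
  proof (rule AE_I)
    show "{x \<in> space (\<D> \<tau>). \<not> P x} \<subseteq> N \<union> {-\<tau>}"
    proof
      fix x assume x: "x \<in> {x \<in> space (\<D> \<tau>). \<not> P x}"
      then have "x \<noteq> 0" using 0 by auto
      then show "x \<in> N \<union> {-\<tau>}" using x subsetD[OF N(1), of x] by (cases "x = -\<tau>") auto
    qed
    have s: "N \<union> {-\<tau>} \<in> sets (\<D> \<tau>)"
      using Nb \<tau> by (auto simp: sets_restrict_space_iff)
    then show "N \<union> {-\<tau>} \<in> sets (\<D> \<tau>)" .
    have "emeasure lborel (N \<union> {-\<tau>}) = 0"
    proof -
      have "emeasure lborel N = emeasure (leb \<tau>) N"
        unfolding leb_def using Nb by (subst emeasure_restrict_space) auto
      then have "N \<in> null_sets lborel" using N(2) Nb by (auto simp: null_sets_def)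
      then have "N \<union> {-\<tau>} \<in> null_sets lborel" by (rule null_sets.Un[OF _ finite_imp_null_set_lborel]) auto
      then show ?thesis by auto
    qed
    then show "emeasure (\<D> \<tau>) (N \<union> {-\<tau>}) = 0"
      unfolding emeasure_delay_measure[OF s] using Nb(2) \<tau> by (auto simp: indicator_def)
  qed
qed

lemma finite_measure_delay: "0 < \<tau> \<Longrightarrow> emeasure (\<D> \<tau>) {-\<tau>..0} = ennreal (\<tau> + 1)"
  by (subst emeasure_delay_measure) (auto simp: sets_restrict_space_iff)

lemma delay_finite_measure: "0 < \<tau> \<Longrightarrow> finite_measure (\<D> \<tau>)"
  by (rule finite_measureI) (simp add: finite_measure_delay)

lemma leb_finite_measure: "finite_measure (leb \<tau>)"
  by (rule finite_measureI, cases "0 \<le> \<tau>")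
    (simp_all add: leb_def emeasure_restrict_space space_restrict_space)

lemma product_sigma_finite_delay: "0 < \<tau> \<Longrightarrow> product_sigma_finite (\<lambda>_. \<D> \<tau>)"
  unfolding product_sigma_finite_def by (simp add: delay_finite_measure finite_measure.axioms(1))

lemma product_sigma_finite_leb: "product_sigma_finite (\<lambda>_. leb \<tau>)"
  unfolding product_sigma_finite_def by (simp add: leb_finite_measure finite_measure.axioms(1))

lemma nn_integral_leb_le_delay:
  assumes "0 < \<tau>" "f \<in> borel_measurable (\<D> \<tau>)"
  shows "(\<integral>\<^sup>+x. f x \<partial>leb \<tau>) \<le> (\<integral>\<^sup>+x. f x \<partial>\<D> \<tau>)" "f 0 \<le> (\<integral>\<^sup>+x. f x \<partial>\<D> \<tau>)"
  by (simp_all add: nn_integral_delay[OF assms])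

text \<open>Parametrizes the face of the cube on which the coordinates outside J are 0. Outside K
  the value is \<open>undefined\<close>, as points of a product over K require.\<close>

definition zero_ext :: "'m set \<Rightarrow> 'm set \<Rightarrow> ('m \<Rightarrow> real) \<Rightarrow> 'm \<Rightarrow> real" where
  "zero_ext K J y = (\<lambda>k\<in>K. if k \<in> J then y k else 0)"

lemma measurable_zero_ext:
  assumes \<tau>: "0 < \<tau>" and J: "K \<inter> J \<subseteq> J'"
  shows "zero_ext K J \<in> measurable (PiM J' (\<lambda>_. leb \<tau>)) (PiM K (\<lambda>_. \<D> \<tau>))"
  unfolding zero_ext_def
proof (rule measurable_restrict)
  fix k assume k: "k \<in> K"
  show "(\<lambda>y. if k \<in> J then y k else 0) \<in> measurable (PiM J' (\<lambda>_. leb \<tau>)) (\<D> \<tau>)"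
  proof (cases "k \<in> J")
    case True
    then have "(\<lambda>y. y k) \<in> measurable (PiM J' (\<lambda>_. leb \<tau>)) (leb \<tau>)"
      using J k by (intro measurable_component_singleton) auto
    then show ?thesis using True measurable_compose[OF _ measurable_ident_leb_delay] by simp
  next
    case False then show ?thesis using \<tau> by simp
  qed
qed

text \<open>On each coordinate, \<open>leb\<close> and the unit mass at 0 are two summands of
  \<open>delay_measure\<close>. Choosing the first for the indices in J and the second for the
  others selects one nonnegative summand of the product measure.\<close>

lemma nn_integral_zero_ext_le:
  fixes f :: "('m \<Rightarrow> real) \<Rightarrow> ennreal"
  assumes \<tau>: "0 < \<tau>" and K: "finite K" and f: "f \<in> borel_measurable (PiM K (\<lambda>_. \<D> \<tau>))"
  shows "(\<integral>\<^sup>+y. f (zero_ext K J y) \<partial>PiM (K \<inter> J) (\<lambda>_. leb \<tau>)) \<le> (\<integral>\<^sup>+x. f x \<partial>PiM K (\<lambda>_. \<D> \<tau>))"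
  using K f
proof (induction K arbitrary: f rule: finite_induct)
  case empty
  have "zero_ext {} J y = (\<lambda>_. undefined)" for y by (auto simp: zero_ext_def restrict_def)
  then show ?case by (simp add: PiM_empty nn_integral_count_space_finite)
next
  case (insert k K f)
  interpret D: product_sigma_finite "\<lambda>_. \<D> \<tau>" by (rule product_sigma_finite_delay[OF \<tau>])
  interpret L: product_sigma_finite "\<lambda>_. leb \<tau>" by (rule product_sigma_finite_leb)
  interpret D1: sigma_finite_measure "\<D> \<tau>" by (rule D.sigma_finite_measures)
  note [measurable] = insert.prems
  define h where "h x = (\<integral>\<^sup>+z. f (x(k := z)) \<partial>\<D> \<tau>)" for x
  have hm: "h \<in> borel_measurable (PiM K (\<lambda>_. \<D> \<tau>))" unfolding h_def by measurable
  have R: "(\<integral>\<^sup>+x. f x \<partial>PiM (insert k K) (\<lambda>_. \<D> \<tau>)) = (\<integral>\<^sup>+x. h x \<partial>PiM K (\<lambda>_. \<D> \<tau>))"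
    unfolding h_def using insert by (intro D.product_nn_integral_insert) auto
  have ms: "(\<lambda>z. f (x(k := z))) \<in> borel_measurable (\<D> \<tau>)"
    if "x \<in> space (PiM K (\<lambda>_. \<D> \<tau>))" for x
    using measurable_comp[OF measurable_component_update[OF that insert(2)] insert.prems] by (simp add: o_def)
  have zs: "zero_ext K J y \<in> space (PiM K (\<lambda>_. \<D> \<tau>))" if "y \<in> space (PiM (K \<inter> J) (\<lambda>_. leb \<tau>))" for y
    using measurable_space[OF measurable_zero_ext[OF \<tau>] that] by auto
  have "(\<integral>\<^sup>+y. f (zero_ext (insert k K) J y) \<partial>PiM (insert k K \<inter> J) (\<lambda>_. leb \<tau>))
      \<le> (\<integral>\<^sup>+y. h (zero_ext K J y) \<partial>PiM (K \<inter> J) (\<lambda>_. leb \<tau>))"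
  proof (cases "k \<in> J")
    case True
    then have eq: "insert k K \<inter> J = insert k (K \<inter> J)" by auto
    have m: "(\<lambda>y. f (zero_ext (insert k K) J y)) \<in> borel_measurable (PiM (insert k (K \<inter> J)) (\<lambda>_. leb \<tau>))"
      by (rule measurable_compose[OF measurable_zero_ext[OF \<tau>] insert.prems]) (use True in auto)
    have "(\<integral>\<^sup>+y. f (zero_ext (insert k K) J y) \<partial>PiM (insert k (K \<inter> J)) (\<lambda>_. leb \<tau>))
      = (\<integral>\<^sup>+y. (\<integral>\<^sup>+z. f (zero_ext (insert k K) J (y(k := z))) \<partial>leb \<tau>) \<partial>PiM (K \<inter> J) (\<lambda>_. leb \<tau>))"
      using insert m by (intro L.product_nn_integral_insert) auto
    also have "\<dots> = (\<integral>\<^sup>+y. (\<integral>\<^sup>+z. f ((zero_ext K J y)(k := z)) \<partial>leb \<tau>) \<partial>PiM (K \<inter> J) (\<lambda>_. leb \<tau>))"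
      using True insert by (intro nn_integral_cong arg_cong[where f = f]) (auto simp: zero_ext_def)
    also have "\<dots> \<le> (\<integral>\<^sup>+y. h (zero_ext K J y) \<partial>PiM (K \<inter> J) (\<lambda>_. leb \<tau>))"
      unfolding h_def by (intro nn_integral_mono nn_integral_leb_le_delay \<tau> ms zs)
    finally show ?thesis unfolding eq .
  next
    case False
    then have eq: "insert k K \<inter> J = K \<inter> J" by auto
    have "zero_ext (insert k K) J y = (zero_ext K J y)(k := 0)" for y using False insert by (auto simp: zero_ext_def)
    then show ?thesis unfolding eq h_def by (auto intro!: nn_integral_mono nn_integral_leb_le_delay \<tau> ms zs)
  qed
  also have "\<dots> \<le> (\<integral>\<^sup>+x. h x \<partial>PiM K (\<lambda>_. \<D> \<tau>))" by (rule insert.IH[OF hm])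
  finally show ?case unfolding R .
qed

text \<open>The measure of a face is dominated by the product measure, so null sets meet the face in
  null sets. Equations that hold almost everywhere thus survive restriction, although Lebesgue
  measure would not see a face with vanishing coordinates.\<close>

lemma AE_zero_ext:
  assumes \<tau>: "0 < \<tau>" and K: "finite K" and P: "AE x in PiM K (\<lambda>_. \<D> \<tau>). P x"
  shows "AE y in PiM (K \<inter> J) (\<lambda>_. leb \<tau>). P (zero_ext K J y)"
proof -
  let ?D = "PiM K (\<lambda>_. \<D> \<tau>)" and ?L = "PiM (K \<inter> J) (\<lambda>_. leb \<tau>)"
  from P obtain N where N: "{x \<in> space ?D. \<not> P x} \<subseteq> N" "emeasure ?D N = 0" "N \<in> sets ?D" by (rule AE_E)
  have m: "zero_ext K J \<in> measurable ?L ?D" by (rule measurable_zero_ext[OF \<tau>]) auto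
  have "(\<integral>\<^sup>+y. indicator N (zero_ext K J y) \<partial>?L) = (0::ennreal)"
    using nn_integral_zero_ext_le[OF \<tau> K, of "indicator N" J] N by simp
  moreover have "(\<lambda>y. indicator N (zero_ext K J y) :: ennreal) \<in> borel_measurable ?L"
    by (rule measurable_compose[OF m]) (use N in simp)
  ultimately have "AE y in ?L. indicator N (zero_ext K J y) = (0::ennreal)"
    by (subst (asm) nn_integral_0_iff_AE) auto
  with AE_space show ?thesis
  proof eventually_elim
    case (elim y)
    then show ?case using subsetD[OF N(1), of "zero_ext K J y"] measurable_space[OF m, of y] by (auto simp: indicator_def split: if_splits)
  qed
qed

abbreviation slice_measure :: "real \<Rightarrow> 'm::finite \<Rightarrow> ('m \<Rightarrow> real) measure" where
  "slice_measure \<tau> k \<equiv> PiM (UNIV - {k}) (\<lambda>_. \<D> \<tau>)"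

lemma pow_measure_insert: "(pow_measure \<tau> :: ('m::finite \<Rightarrow> real) measure) = PiM (insert k (UNIV - {k})) (\<lambda>_. \<D> \<tau>)"
  by (simp add: pow_measure_def insert_absorb)

lemma nn_integral_slice:
  fixes f :: "('m::finite \<Rightarrow> real) \<Rightarrow> ennreal"
  assumes \<tau>: "0 < \<tau>" and f: "f \<in> borel_measurable (pow_measure \<tau>)"
  shows "(\<integral>\<^sup>+x. f x \<partial>pow_measure \<tau>) = (\<integral>\<^sup>+x. (\<integral>\<^sup>+y. f (x(k := y)) \<partial>\<D> \<tau>) \<partial>slice_measure \<tau> k)"
    and "(\<integral>\<^sup>+x. f x \<partial>pow_measure \<tau>) = (\<integral>\<^sup>+y. (\<integral>\<^sup>+x. f (x(k := y)) \<partial>slice_measure \<tau> k) \<partial>\<D> \<tau>)"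
  using product_sigma_finite.product_nn_integral_insert[OF product_sigma_finite_delay[OF \<tau>], of "UNIV - {k}" k f]
    product_sigma_finite.product_nn_integral_insert_rev[OF product_sigma_finite_delay[OF \<tau>], of "UNIV - {k}" k f] f
  by (simp_all add: pow_measure_insert[symmetric] insert_absorb pow_measure_def)

lemma sigma_finite_slice: "0 < \<tau> \<Longrightarrow> sigma_finite_measure (slice_measure \<tau> k)"
  by (rule product_sigma_finite.sigma_finite[OF product_sigma_finite_delay]) auto

lemma measurable_slice_pair [measurable]:
  "(\<lambda>(x, y). x(k := y)) \<in> measurable (slice_measure \<tau> k \<Otimes>\<^sub>M \<D> \<tau>) (pow_measure \<tau>)"
  unfolding pow_measure_insert[of \<tau> k] by (rule measurable_add_dim)

lemma measurable_slice:
  assumes "y \<in> {-\<tau>..0}"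
  shows "(\<lambda>x. x(k := y)) \<in> measurable (slice_measure \<tau> k) (pow_measure \<tau>)"
proof -
  have "(\<lambda>x. (\<lambda>(x, y). x(k := y)) (x, y)) \<in> measurable (slice_measure \<tau> k) (pow_measure \<tau>)"
    by (rule measurable_compose[OF _ measurable_slice_pair]) (use assms in simp)
  then show ?thesis by simp
qed

text \<open>Tonelli applied to the indicator of a null set that contains the exceptional
  points.\<close>

lemma AE_slice:
  assumes \<tau>: "0 < \<tau>" and P: "AE x in pow_measure \<tau>. P x"
  shows "AE y in \<D> \<tau>. AE x in slice_measure \<tau> k. P (x(k := y))"
proof -
  from P obtain N where N: "{x \<in> space (pow_measure \<tau>). \<not> P x} \<subseteq> N" "emeasure (pow_measure \<tau>) N = 0" "N \<in> sets (pow_measure \<tau>)"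
    by (rule AE_E)
  interpret S: sigma_finite_measure "slice_measure \<tau> k" by (rule sigma_finite_slice[OF \<tau>])
  let ?f = "\<lambda>y x. indicator N (x(k := y)) :: ennreal"
  have m2: "(\<lambda>(y, x). ?f y x) \<in> borel_measurable (\<D> \<tau> \<Otimes>\<^sub>M slice_measure \<tau> k)"
  proof -
    have "(\<lambda>p. indicator N ((\<lambda>(x, y). x(k := y)) (snd p, fst p)) :: ennreal) \<in> borel_measurable (\<D> \<tau> \<Otimes>\<^sub>M slice_measure \<tau> k)"
      by (rule measurable_compose[OF measurable_compose[OF _ measurable_slice_pair[where \<tau> = \<tau>]]]) (use N(3) in auto)
    then show ?thesis by (simp add: case_prod_beta')
  qed
  have "(\<integral>\<^sup>+y. (\<integral>\<^sup>+x. ?f y x \<partial>slice_measure \<tau> k) \<partial>\<D> \<tau>) = 0"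
    using nn_integral_slice(2)[OF \<tau>, of "indicator N" k] N by simp
  then have "AE y in \<D> \<tau>. (\<integral>\<^sup>+x. ?f y x \<partial>slice_measure \<tau> k) = 0"
    by (subst (asm) nn_integral_0_iff_AE) (use m2 in \<open>auto intro: S.borel_measurable_nn_integral\<close>)
  with AE_space show ?thesis
  proof eventually_elim
    fix y assume y: "y \<in> space (\<D> \<tau>)" and 0: "(\<integral>\<^sup>+x. ?f y x \<partial>slice_measure \<tau> k) = 0"
    have m: "(\<lambda>x. x(k := y)) \<in> measurable (slice_measure \<tau> k) (pow_measure \<tau>)" using y by (intro measurable_slice) simp
    have "AE x in slice_measure \<tau> k. ?f y x = 0"
      using 0 by (subst (asm) nn_integral_0_iff_AE) (use N(3) m in \<open>auto intro: measurable_compose\<close>)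
    with AE_space show "AE x in slice_measure \<tau> k. P (x(k := y))"
    proof eventually_elim
      case (elim x)
      then show ?case using subsetD[OF N(1), of "x(k := y)"] measurable_space[OF m, of x]
        by (auto simp: indicator_def split: if_splits)
    qed
  qed
qed

text \<open>The cylinder over a null set is a box with one factor of measure zero.\<close>

lemma AE_component:
  fixes k :: "'m" and A :: "'m set"
  assumes \<tau>: "0 < \<tau>" and A: "finite A" and k: "k \<in> A" and P: "AE y in \<D> \<tau>. P y"
  shows "AE x in PiM A (\<lambda>_. \<D> \<tau>). P (x k)"
proof -
  interpret D: product_sigma_finite "\<lambda>_. \<D> \<tau>" by (rule product_sigma_finite_delay[OF \<tau>])
  from P obtain N where N: "{x \<in> space (\<D> \<tau>). \<not> P x} \<subseteq> N" "emeasure (\<D> \<tau>) N = 0" "N \<in> sets (\<D> \<tau>)"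
    by (rule AE_E)
  let ?E = "\<lambda>l. if l = k then N else space (\<D> \<tau>)"
  show ?thesis
  proof (rule AE_I)
    show "{x \<in> space (PiM A (\<lambda>_. \<D> \<tau>)). \<not> P (x k)} \<subseteq> PiE A ?E"
    proof
      fix x assume x: "x \<in> {x \<in> space (PiM A (\<lambda>_. \<D> \<tau>)). \<not> P (x k)}"
      then have xs: "x l \<in> space (\<D> \<tau>)" if "l \<in> A" for l
        using that unfolding space_PiM by (blast dest: PiE_mem)
      have "x k \<in> N" using subsetD[OF N(1), of "x k"] xs[OF k] x by blast
      then show "x \<in> PiE A ?E" using x xs unfolding space_PiM by (intro PiE_I) (auto simp: PiE_def extensional_def)
    qed
    show "PiE A ?E \<in> sets (PiM A (\<lambda>_. \<D> \<tau>))" using A N(3) sets.top[of "\<D> \<tau>"]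
      by (intro sets_PiM_I_finite) (simp_all split: if_split)
    have "emeasure (PiM A (\<lambda>_. \<D> \<tau>)) (PiE A ?E) = (\<Prod>l\<in>A. emeasure (\<D> \<tau>) (?E l))"
      using A N(3) sets.top[of "\<D> \<tau>"] by (intro D.emeasure_PiM) (simp_all split: if_split)
    also have "\<dots> = 0" using A k N(2) by (auto intro!: prod_zero)
    finally show "emeasure (PiM A (\<lambda>_. \<D> \<tau>)) (PiE A ?E) = 0" .
  qed
qed

text \<open>Both parts of \<open>delay_measure\<close> are dominated by the whole. The last bound,
  evaluation at the atom 0, later gives continuity in time of the head of a solution.\<close>

lemma L2_leb: fixes f :: "real \<Rightarrow> 'b::euclidean_space"
  assumes \<tau>: "0 < \<tau>" and f: "f \<in> L2 (\<D> \<tau>)"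
  shows "f \<in> L2 (leb \<tau>)" and "l2norm (leb \<tau>) f \<le> l2norm (\<D> \<tau>) f"
    and "norm (f 0) \<le> l2norm (\<D> \<tau>) f"
proof -
  note [measurable] = L2_measurable[OF f]
  have le: "l2sq (leb \<tau>) f \<le> ennreal ((l2norm (\<D> \<tau>) f)\<^sup>2)"
    "ennreal ((norm (f 0))\<^sup>2) \<le> ennreal ((l2norm (\<D> \<tau>) f)\<^sup>2)"
    using nn_integral_leb_le_delay[OF \<tau>, of "\<lambda>x. ennreal ((norm (f x))\<^sup>2)"] by (simp_all add: L2_nn_integral[OF f])
  show "f \<in> L2 (leb \<tau>)" "l2norm (leb \<tau>) f \<le> l2norm (\<D> \<tau>) f"
    using L2I_nn_integral[OF measurable_delay_leb[OF L2_measurable[OF f]] le(1)] by simp_all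
  have "(norm (f 0))\<^sup>2 \<le> (l2norm (\<D> \<tau>) f)\<^sup>2" using le(2) by simp
  then show "norm (f 0) \<le> l2norm (\<D> \<tau>) f" by (rule power2_le_imp_le) simp
qed

section \<open>Differentiation of inner products and the fundamental lemma of the calculus of
  variations\<close>

lemma has_vector_derivative_quotient:
  fixes f :: "real \<Rightarrow> 'v::real_normed_vector"
  assumes "(f has_vector_derivative f') (at s within S)"
  shows "((\<lambda>t. norm ((f t - f s) /\<^sub>R (t - s) - f')) \<longlongrightarrow> 0) (at s within S)"
proof -
  have "((\<lambda>t. norm ((1 / norm (t - s)) *\<^sub>R (f t - (f s + (t - s) *\<^sub>R f')))) \<longlongrightarrow> 0) (at s within S)"
    by (rule tendsto_norm_zero) (use assms in \<open>simp add: has_vector_derivative_def has_derivative_within\<close>)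
  moreover have "\<forall>\<^sub>F t in at s within S. norm ((1 / norm (t - s)) *\<^sub>R (f t - (f s + (t - s) *\<^sub>R f')))
     = norm ((f t - f s) /\<^sub>R (t - s) - f')"
  proof (unfold eventually_at_filter, intro always_eventually allI impI)
    fix t assume t: "t \<noteq> s"
    have "(f t - f s) /\<^sub>R (t - s) - f' = (1 / (t - s)) *\<^sub>R (f t - (f s + (t - s) *\<^sub>R f'))"
      using t by (simp only: diff_diff_eq[symmetric] scaleR_diff_right[of "1 / (t - s)" "f t - f s"])
        (simp add: inverse_eq_divide)
    then show "norm ((1 / norm (t - s)) *\<^sub>R (f t - (f s + (t - s) *\<^sub>R f'))) = norm ((f t - f s) /\<^sub>R (t - s) - f')"
      by simp
  qed
  ultimately show ?thesis by (rule Lim_transform_eventually)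
qed

lemma l2norm_diff_commute: "l2norm M (\<lambda>x. f x - g x) = l2norm M (\<lambda>x. g x - (f x :: 'b::real_normed_vector))"
  by (simp add: l2norm_def norm_minus_commute)

text \<open>The difference of the pairings splits into three pairings, each with an argument tending
  to 0; Cauchy-Schwarz bounds them.\<close>

lemma tendsto_L2_inner:
  fixes f :: "'i \<Rightarrow> 'a \<Rightarrow> 'b::euclidean_space"
  assumes f: "\<forall>\<^sub>F i in F. f i \<in> L2 M" and g: "\<forall>\<^sub>F i in F. g i \<in> L2 M"
    and f0: "f0 \<in> L2 M" and g0: "g0 \<in> L2 M"
    and fl: "((\<lambda>i. l2norm M (\<lambda>x. f i x - f0 x)) \<longlongrightarrow> 0) F"
    and gl: "((\<lambda>i. l2norm M (\<lambda>x. g i x - g0 x)) \<longlongrightarrow> 0) F"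
  shows "((\<lambda>i. \<integral>x. f i x \<bullet> g i x \<partial>M) \<longlongrightarrow> (\<integral>x. f0 x \<bullet> g0 x \<partial>M)) F"
proof -
  let ?a = "\<lambda>i. l2norm M (\<lambda>x. f i x - f0 x)" and ?b = "\<lambda>i. l2norm M (\<lambda>x. g i x - g0 x)"
  have "((\<lambda>i. ?a i * ?b i + ?a i * l2norm M g0 + l2norm M f0 * ?b i) \<longlongrightarrow> 0 * 0 + 0 * l2norm M g0 + l2norm M f0 * 0) F"
    by (intro tendsto_intros fl gl)
  then have lim: "((\<lambda>i. ?a i * ?b i + ?a i * l2norm M g0 + l2norm M f0 * ?b i) \<longlongrightarrow> 0) F" by simp
  have "((\<lambda>i. (\<integral>x. f i x \<bullet> g i x \<partial>M) - (\<integral>x. f0 x \<bullet> g0 x \<partial>M)) \<longlongrightarrow> 0) F"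
  proof (rule Lim_null_comparison[OF _ lim], use f g in eventually_elim)
    fix i assume fi: "f i \<in> L2 M" and gi: "g i \<in> L2 M"
    let ?F = "\<lambda>x. f i x - f0 x" and ?G = "\<lambda>x. g i x - g0 x"
    have F: "?F \<in> L2 M" and G: "?G \<in> L2 M" by (intro L2_diff fi gi f0 g0)+
    have "(\<integral>x. f i x \<bullet> g i x \<partial>M) - (\<integral>x. f0 x \<bullet> g0 x \<partial>M)
        = (\<integral>x. ?F x \<bullet> ?G x + ?F x \<bullet> g0 x + f0 x \<bullet> ?G x \<partial>M)"
      by (subst Bochner_Integration.integral_diff[symmetric])
        (auto intro!: L2_inner_integrable fi gi f0 g0 Bochner_Integration.integral_cong simp: inner_diff_left inner_diff_right)
    also have "\<dots> = (\<integral>x. ?F x \<bullet> ?G x \<partial>M) + (\<integral>x. ?F x \<bullet> g0 x \<partial>M) + (\<integral>x. f0 x \<bullet> ?G x \<partial>M)"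
      using L2_inner_integrable[OF F G] L2_inner_integrable[OF F g0] L2_inner_integrable[OF f0 G] by simp
    finally show "norm ((\<integral>x. f i x \<bullet> g i x \<partial>M) - (\<integral>x. f0 x \<bullet> g0 x \<partial>M))
        \<le> ?a i * ?b i + ?a i * l2norm M g0 + l2norm M f0 * ?b i"
      using L2_Cauchy_Schwarz[OF F G] L2_Cauchy_Schwarz[OF F g0] L2_Cauchy_Schwarz[OF f0 G] by simp
  qed
  then show ?thesis by (subst Lim_null)
qed

text \<open>The product rule comes from splitting the increment into \<open>f t - f s\<close> paired
  with \<open>g t\<close> and \<open>f s\<close> paired with \<open>g t - g s\<close>. Convergence
  of \<open>g t\<close> to \<open>g s\<close> is a consequence of the convergence of its difference
  quotients.\<close>

lemma L2_inner_derivative: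
  fixes f g :: "real \<Rightarrow> 'a \<Rightarrow> 'b::euclidean_space"
  assumes f: "\<And>t. t \<in> S \<Longrightarrow> f t \<in> L2 M" and g: "\<And>t. t \<in> S \<Longrightarrow> g t \<in> L2 M" and s: "s \<in> S"
    and f': "f' \<in> L2 M" and g': "g' \<in> L2 M"
    and fd: "((\<lambda>t. l2norm M (\<lambda>x. (f t x - f s x) /\<^sub>R (t - s) - f' x)) \<longlongrightarrow> 0) (at s within S)"
    and gd: "((\<lambda>t. l2norm M (\<lambda>x. (g t x - g s x) /\<^sub>R (t - s) - g' x)) \<longlongrightarrow> 0) (at s within S)"
  shows "((\<lambda>t. \<integral>x. f t x \<bullet> g t x \<partial>M) has_field_derivative
     ((\<integral>x. f' x \<bullet> g s x \<partial>M) + (\<integral>x. f s x \<bullet> g' x \<partial>M))) (at s within S)"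
proof -
  have inS: "\<forall>\<^sub>F t in at s within S. t \<in> S \<and> t \<noteq> s" by (simp add: eventually_at_filter)
  have gc: "((\<lambda>t. l2norm M (\<lambda>x. g t x - g s x)) \<longlongrightarrow> 0) (at s within S)"
  proof -
    have "((\<lambda>t. \<bar>t - s\<bar> * (l2norm M (\<lambda>x. (g t x - g s x) /\<^sub>R (t - s) - g' x) + l2norm M g')) \<longlongrightarrow> \<bar>s - s\<bar> * (0 + l2norm M g')) (at s within S)"
      by (intro tendsto_intros gd)
    then have lim: "((\<lambda>t. \<bar>t - s\<bar> * (l2norm M (\<lambda>x. (g t x - g s x) /\<^sub>R (t - s) - g' x) + l2norm M g')) \<longlongrightarrow> 0) (at s within S)" by simp
    show ?thesis
    proof (rule Lim_null_comparison[OF _ lim], use inS in eventually_elim)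
      fix t assume t: "t \<in> S \<and> t \<noteq> s"
      let ?q = "\<lambda>x. (g t x - g s x) /\<^sub>R (t - s)"
      have q: "?q \<in> L2 M" using t g s by (intro L2_scaleR L2_diff) auto
      have "l2norm M (\<lambda>x. g t x - g s x) = l2norm M (\<lambda>x. (t - s) *\<^sub>R ?q x)" using t by simp
      also have "\<dots> = \<bar>t - s\<bar> * l2norm M ?q" by (rule l2norm_scaleR)
      also have "\<dots> = \<bar>t - s\<bar> * l2norm M (\<lambda>x. (?q x - g' x) + g' x)" by simp
      also have "\<dots> \<le> \<bar>t - s\<bar> * (l2norm M (\<lambda>x. ?q x - g' x) + l2norm M g')"
        by (intro mult_left_mono l2norm_triangle L2_diff q g') auto
      finally show "norm (l2norm M (\<lambda>x. g t x - g s x)) \<le> \<bar>t - s\<bar> * (l2norm M (\<lambda>x. ?q x - g' x) + l2norm M g')" by simp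
    qed
  qed
  have ev: "\<forall>\<^sub>F t in at s within S. (\<lambda>x. (f t x - f s x) /\<^sub>R (t - s)) \<in> L2 M"
    "\<forall>\<^sub>F t in at s within S. (\<lambda>x. (g t x - g s x) /\<^sub>R (t - s)) \<in> L2 M"
    "\<forall>\<^sub>F t in at s within S. g t \<in> L2 M" "\<forall>\<^sub>F t in at s within S. f s \<in> L2 M"
    by (rule eventually_mono[OF inS], intro L2_scaleR L2_diff f g s, simp_all add: f g s)+
  have L1: "((\<lambda>t. \<integral>x. ((f t x - f s x) /\<^sub>R (t - s)) \<bullet> g t x \<partial>M) \<longlongrightarrow> (\<integral>x. f' x \<bullet> g s x \<partial>M)) (at s within S)"
    by (rule tendsto_L2_inner[OF ev(1,3) f' g[OF s] fd gc])
  have L2: "((\<lambda>t. \<integral>x. f s x \<bullet> ((g t x - g s x) /\<^sub>R (t - s)) \<partial>M) \<longlongrightarrow> (\<integral>x. f s x \<bullet> g' x \<partial>M)) (at s within S)"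
    by (rule tendsto_L2_inner[OF ev(4,2) f[OF s] g' _ gd]) (simp add: l2norm_def)
  show ?thesis unfolding has_field_derivative_iff
  proof (rule Lim_transform_eventually[OF tendsto_add[OF L1 L2]], use inS in eventually_elim)
    fix t assume t: "t \<in> S \<and> t \<noteq> s"
    have ft: "f t \<in> L2 M" "g t \<in> L2 M" "f s \<in> L2 M" "g s \<in> L2 M" using t f g s by auto
    have "(\<integral>x. ((f t x - f s x) /\<^sub>R (t - s)) \<bullet> g t x \<partial>M) + (\<integral>x. f s x \<bullet> ((g t x - g s x) /\<^sub>R (t - s)) \<partial>M)
       = (\<integral>x. ((f t x - f s x) /\<^sub>R (t - s)) \<bullet> g t x + f s x \<bullet> ((g t x - g s x) /\<^sub>R (t - s)) \<partial>M)"
      by (rule Bochner_Integration.integral_add[symmetric]) (intro L2_inner_integrable L2_scaleR L2_diff ft)+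
    also have "\<dots> = (\<integral>x. (1 / (t - s)) * (f t x \<bullet> g t x - f s x \<bullet> g s x) \<partial>M)"
      by (intro Bochner_Integration.integral_cong refl) (simp add: inner_diff_left inner_diff_right inverse_eq_divide diff_divide_distrib)
    also have "\<dots> = ((\<integral>x. f t x \<bullet> g t x \<partial>M) - (\<integral>x. f s x \<bullet> g s x \<partial>M)) / (t - s)"
      by (subst integral_mult_right_zero, subst Bochner_Integration.integral_diff)
        (auto intro!: L2_inner_integrable ft)
    finally show "(\<integral>x. ((f t x - f s x) /\<^sub>R (t - s)) \<bullet> g t x \<partial>M) + (\<integral>x. f s x \<bullet> ((g t x - g s x) /\<^sub>R (t - s)) \<partial>M)
      = ((\<integral>x. f t x \<bullet> g t x \<partial>M) - (\<integral>x. f s x \<bullet> g s x \<partial>M)) / (t - s)" .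
  qed
qed

lemma bounded_measurable_L2:
  fixes f :: "'a \<Rightarrow> 'b::euclidean_space"
  assumes M: "finite_measure M" and f: "f \<in> borel_measurable M"
    and b: "\<And>x. x \<in> space M \<Longrightarrow> norm (f x) \<le> B" and B: "0 \<le> B"
  shows "f \<in> L2 M" and "l2norm M f \<le> B * sqrt (measure M (space M))"
proof -
  interpret finite_measure M by fact
  have "l2sq M f \<le> (\<integral>\<^sup>+x. ennreal (B\<^sup>2) \<partial>M)"
    by (intro nn_integral_mono ennreal_leI power_mono b) auto
  also have "\<dots> = ennreal ((B * sqrt (measure M (space M)))\<^sup>2)"
    by (simp add: emeasure_eq_measure ennreal_mult power_mult_distrib)
  finally have *: "l2sq M f \<le> ennreal ((B * sqrt (measure M (space M)))\<^sup>2)" .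
  show "f \<in> L2 M" "l2norm M f \<le> B * sqrt (measure M (space M))"
    using L2I_nn_integral[OF f *] B by simp_all
qed

text \<open>By the mean value theorem the quotient is \<zeta>' at an intermediate point. Uniform
  continuity of \<zeta>' on a compact interval makes the convergence uniform in u, and the measure
  is finite.\<close>

lemma translate_derivative_L2:
  fixes \<zeta> \<zeta>' :: "real \<Rightarrow> real" and e :: "'b::euclidean_space"
  assumes d: "\<And>u. (\<zeta> has_real_derivative \<zeta>' u) (at u)" and c: "continuous_on UNIV \<zeta>'"
  shows "((\<lambda>t. l2norm (leb \<tau>) (\<lambda>u. (\<zeta> (u + t) *\<^sub>R e - \<zeta> (u + s) *\<^sub>R e) /\<^sub>R (t - s) - \<zeta>' (u + s) *\<^sub>R e)) \<longlongrightarrow> 0) (at s within S)"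
proof (rule tendstoI)
  fix \<epsilon> :: real assume \<epsilon>: "\<epsilon> > 0"
  define \<mu> where "\<mu> = sqrt (measure (leb \<tau>) (space (leb \<tau>)))"
  \<comment> \<open>The summand 1 keeps the denominator positive when e or the measure
    vanishes.\<close>
  define \<epsilon>' where "\<epsilon>' = \<epsilon> / (norm e * \<mu> + 1)"
  have pos: "norm e * \<mu> + 1 > 0" by (simp add: \<mu>_def add_nonneg_pos)
  have \<epsilon>': "\<epsilon>' > 0" using pos \<epsilon> by (simp add: \<epsilon>'_def)
  have zc: "continuous_on UNIV \<zeta>" using d by (intro DERIV_continuous_on) auto
  have "uniformly_continuous_on {-\<bar>\<tau>\<bar> - \<bar>s\<bar> - 1..\<bar>s\<bar> + 1} \<zeta>'"
    by (intro compact_uniformly_continuous continuous_on_subset[OF c]) auto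
  then obtain \<delta> where \<delta>: "\<delta> > 0" and uc: "\<And>x y. x \<in> {-\<bar>\<tau>\<bar> - \<bar>s\<bar> - 1..\<bar>s\<bar> + 1} \<Longrightarrow> y \<in> {-\<bar>\<tau>\<bar> - \<bar>s\<bar> - 1..\<bar>s\<bar> + 1} \<Longrightarrow>
      dist y x < \<delta> \<Longrightarrow> dist (\<zeta>' y) (\<zeta>' x) < \<epsilon>'"
    using \<epsilon>' unfolding uniformly_continuous_on_def by metis
  have est: "\<bar>(\<zeta> (u + t) - \<zeta> (u + s)) / (t - s) - \<zeta>' (u + s)\<bar> \<le> \<epsilon>'"
    if t: "t \<noteq> s" "dist t s < min \<delta> 1" and u: "u \<in> {-\<tau><..<0}" for t u
  proof -
    obtain z where z: "dist z (u + s) \<le> dist t s" "(\<zeta> (u + t) - \<zeta> (u + s)) = (t - s) * \<zeta>' z"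
    proof (cases "s < t")
      case True
      then have "\<exists>z. u + s < z \<and> z < u + t \<and> \<zeta> (u + t) - \<zeta> (u + s) = (u + t - (u + s)) * \<zeta>' z"
        using d by (intro MVT2) auto
      then obtain z where "u + s < z" "z < u + t" "\<zeta> (u + t) - \<zeta> (u + s) = (u + t - (u + s)) * \<zeta>' z" by blast
      then show thesis by (intro that[of z]) (auto simp: dist_real_def)
    next
      case False
      then have "\<exists>z. u + t < z \<and> z < u + s \<and> \<zeta> (u + s) - \<zeta> (u + t) = (u + s - (u + t)) * \<zeta>' z"
        using d t by (intro MVT2) auto
      then obtain z where "u + t < z" "z < u + s" "\<zeta> (u + s) - \<zeta> (u + t) = (u + s - (u + t)) * \<zeta>' z" by blast
      then show thesis by (intro that[of z]) (auto simp: dist_real_def algebra_simps)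
    qed
    have "dist (\<zeta>' z) (\<zeta>' (u + s)) < \<epsilon>'"
      by (rule uc) (use z(1) t u in \<open>auto simp: dist_real_def\<close>)
    then show ?thesis using z(2) t by (simp add: dist_real_def)
  qed
  show "\<forall>\<^sub>F t in at s within S. dist (l2norm (leb \<tau>) (\<lambda>u. (\<zeta> (u + t) *\<^sub>R e - \<zeta> (u + s) *\<^sub>R e) /\<^sub>R (t - s) - \<zeta>' (u + s) *\<^sub>R e)) 0 < \<epsilon>"
    unfolding eventually_at
  proof (intro exI[of _ "min \<delta> 1"] conjI ballI impI)
    show "0 < min \<delta> 1" using \<delta> by simp
    fix t assume t: "t \<noteq> s \<and> dist t s < min \<delta> 1"
    let ?f = "\<lambda>u. (\<zeta> (u + t) *\<^sub>R e - \<zeta> (u + s) *\<^sub>R e) /\<^sub>R (t - s) - \<zeta>' (u + s) *\<^sub>R e"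
    have "l2norm (leb \<tau>) ?f \<le> (\<epsilon>' * norm e) * \<mu>" unfolding \<mu>_def
    proof (rule bounded_measurable_L2(2)[OF leb_finite_measure])
      show "?f \<in> borel_measurable (leb \<tau>)"
        by (intro measurable_leb_borel borel_measurable_continuous_onI continuous_intros
          continuous_on_compose2[OF zc] continuous_on_compose2[OF c]) auto
      fix u assume "u \<in> space (leb \<tau>)"
      then have u: "u \<in> {-\<tau><..<0}" by simp
      have "?f u = ((\<zeta> (u + t) - \<zeta> (u + s)) / (t - s) - \<zeta>' (u + s)) *\<^sub>R e"
        by (simp add: algebra_simps divide_inverse)
      then show "norm (?f u) \<le> \<epsilon>' * norm e" using est[of t u] t u by (auto intro: mult_right_mono)
    qed (use \<epsilon>' in simp)
    also have "\<dots> < \<epsilon>" using \<epsilon> pos by (simp add: \<epsilon>'_def field_simps)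
    finally show "dist (l2norm (leb \<tau>) ?f) 0 < \<epsilon>" by (simp add: l2norm_nonneg)
  qed
qed

text \<open>Near a point where D does not vanish its sign is constant, and a nonnegative bump
  supported there has a nonzero integral against D.\<close>

lemma continuous_zero_of_test_integrals:
  fixes D :: "real \<Rightarrow> real"
  assumes D: "continuous_on {a<..<b} D"
    and test: "\<And>\<zeta> \<zeta>' c d. a < c \<Longrightarrow> c < d \<Longrightarrow> d < b \<Longrightarrow> (\<And>u. u \<notin> {c..d} \<Longrightarrow> \<zeta> u = 0) \<Longrightarrow>
      (\<And>u. (\<zeta> has_real_derivative \<zeta>' u) (at u)) \<Longrightarrow> continuous_on UNIV \<zeta>' \<Longrightarrow>
      (\<integral>u. \<zeta> u * D u \<partial>lborel) = 0"
    and p: "p \<in> {a<..<b}"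
  shows "D p = 0"
proof (rule ccontr)
  assume Dp: "D p \<noteq> 0"
  define \<sigma> where "\<sigma> = sgn (D p)"
  have \<sigma>: "\<sigma> * D p > 0" using Dp by (simp add: \<sigma>_def sgn_mult_self_eq sgn_if)
  have "isCont (\<lambda>u. \<sigma> * D u) p"
    using D p by (intro continuous_intros) (simp add: continuous_on_eq_continuous_at)
  then have "((\<lambda>u. \<sigma> * D u) \<longlongrightarrow> (\<lambda>u. \<sigma> * D u) p) (nhds p)"
    by (subst tendsto_at_iff_tendsto_nhds[symmetric]) (simp add: isCont_def)
  then have "\<forall>\<^sub>F u in nhds p. \<sigma> * D u > 0"
    by (rule order_tendstoD) (use \<sigma> in simp)
  moreover have "\<forall>\<^sub>F u in nhds p. u \<in> {a<..<b}"
    using p by (intro eventually_nhds_in_open) auto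
  ultimately have "\<forall>\<^sub>F u in nhds p. \<sigma> * D u > 0 \<and> u \<in> {a<..<b}" by (rule eventually_conj)
  then obtain r0 where r0: "r0 > 0" "\<And>u. dist u p < r0 \<Longrightarrow> \<sigma> * D u > 0 \<and> u \<in> {a<..<b}"
    unfolding eventually_nhds_metric by blast
  define r where "r = r0 / 2"
  have r: "r > 0" "\<And>u. u \<in> {p - r..p + r} \<Longrightarrow> \<sigma> * D u > 0" "\<And>u. u \<in> {p - r..p + r} \<Longrightarrow> u \<in> {a<..<b}"
    using r0 by (auto simp: r_def dist_real_def)
  \<comment> \<open>The positive part of a parabola has kinks; its square is of class C^1, as the
    test functions must be.\<close>
  define k where "k = (\<lambda>u. max 0 (r\<^sup>2 - (u - p)\<^sup>2))"
  define \<zeta> where "\<zeta> = (\<lambda>u. (k u)\<^sup>2)"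
  define \<zeta>' where "\<zeta>' = (\<lambda>u. - 4 * (u - p) * k u)"
  have sq: "((\<lambda>y. (max 0 y)\<^sup>2) has_real_derivative 2 * max 0 x) (at x)" for x :: real
  proof -
    consider "x > 0" | "x < 0" | "x = 0" by linarith
    then show ?thesis
    proof cases
      case 1
      have "((\<lambda>y. y\<^sup>2) has_real_derivative 2 * max 0 x) (at x)" using 1 by (auto intro!: derivative_eq_intros)
      then show ?thesis
        by (rule has_field_derivative_transform_within_open[where S = "{0<..}"]) (use 1 in auto)
    next
      case 2
      have "((\<lambda>y. 0) has_real_derivative 2 * max 0 x) (at x)" using 2 by (auto intro!: derivative_eq_intros)
      then show ?thesis
        by (rule has_field_derivative_transform_within_open[where S = "{..<0}"]) (use 2 in auto)
    next
      case 3
      have "((\<lambda>y. max 0 y * (max 0 y / y)) \<longlongrightarrow> 0) (at (0::real))"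
      proof (rule Lim_null_comparison)
        show "((\<lambda>y. \<bar>y\<bar>) \<longlongrightarrow> 0) (at (0::real))" by (auto intro!: tendsto_eq_intros)
        show "\<forall>\<^sub>F y in at 0. norm (max 0 y * (max 0 y / y)) \<le> \<bar>y :: real\<bar>"
          by (rule always_eventually) (auto simp: max_def)
      qed
      then show ?thesis using 3 by (simp add: has_field_derivative_iff power2_eq_square)
    qed
  qed
  have "(\<integral>u. \<zeta> u * D u \<partial>lborel) = 0"
  proof (rule test)
    show "a < p - r" "p - r < p + r" "p + r < b" using r(1) r(3)[of "p - r"] r(3)[of "p + r"] by auto
    show "\<zeta> u = 0" if "u \<notin> {p - r..p + r}" for u
    proof -
      have "\<bar>r\<bar> \<le> \<bar>u - p\<bar>" using that r(1) by auto
      then have "r\<^sup>2 \<le> (u - p)\<^sup>2" by (simp add: abs_le_square_iff)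
      then show ?thesis by (simp add: \<zeta>_def k_def)
    qed
    show "(\<zeta> has_real_derivative \<zeta>' u) (at u)" for u
    proof -
      have i: "((\<lambda>u. r\<^sup>2 - (u - p)\<^sup>2) has_real_derivative - 2 * (u - p)) (at u)"
        by (auto intro!: derivative_eq_intros)
      show ?thesis unfolding \<zeta>_def k_def
        by (rule DERIV_cong[OF DERIV_chain2[OF sq i]]) (simp add: \<zeta>'_def k_def algebra_simps)
    qed
    show "continuous_on UNIV \<zeta>'" unfolding \<zeta>'_def k_def by (intro continuous_intros)
  qed
  then have 0: "(\<integral>u. \<zeta> u * (\<sigma> * D u) \<partial>lborel) = 0" by (simp add: mult.left_commute)
  let ?I = "{p - r..p + r}"
  have \<zeta>0: "\<zeta> u = 0" if "u \<notin> ?I" for u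
  proof -
    have "\<bar>r\<bar> \<le> \<bar>u - p\<bar>" using that r(1) by auto
    then have "r\<^sup>2 \<le> (u - p)\<^sup>2" by (simp add: abs_le_square_iff)
    then show ?thesis by (simp add: \<zeta>_def k_def)
  qed
  have cont: "continuous_on ?I (\<lambda>u. \<zeta> u * (\<sigma> * D u))"
    unfolding \<zeta>_def k_def by (intro continuous_intros continuous_on_subset[OF D]) (use r(3) in auto)
  have int: "integrable lborel (\<lambda>u. \<zeta> u * (\<sigma> * D u))"
  proof -
    have "integrable lborel (\<lambda>u. indicator ?I u *\<^sub>R (\<zeta> u * (\<sigma> * D u)))"
      by (rule borel_integrable_compact[OF _ cont]) simp
    moreover have "(\<lambda>u. indicator ?I u *\<^sub>R (\<zeta> u * (\<sigma> * D u))) = (\<lambda>u. \<zeta> u * (\<sigma> * D u))"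
    proof (rule ext)
      fix u show "indicator ?I u *\<^sub>R (\<zeta> u * (\<sigma> * D u)) = \<zeta> u * (\<sigma> * D u)"
        by (cases "u \<in> ?I") (simp_all add: \<zeta>0)
    qed
    ultimately show ?thesis by simp
  qed
  have nn: "AE u in lborel. 0 \<le> \<zeta> u * (\<sigma> * D u)"
  proof (rule AE_I2)
    fix u show "0 \<le> \<zeta> u * (\<sigma> * D u)"
      using \<zeta>0[of u] r(2)[of u] by (cases "u \<in> ?I") (auto simp: \<zeta>_def)
  qed
  have ae0: "AE u in lborel. \<zeta> u * (\<sigma> * D u) = 0"
    using integral_nonneg_eq_0_iff_AE[OF int nn] 0 by simp
  have pos: "\<zeta> u * (\<sigma> * D u) > 0" if "u \<in> {p - r<..<p + r}" for u
  proof -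
    have "\<bar>u - p\<bar> < \<bar>r\<bar>" using that by auto
    then have "(u - p)\<^sup>2 < r\<^sup>2" using abs_le_square_iff[of r "u - p"] by linarith
    then have "\<zeta> u > 0" by (simp add: \<zeta>_def k_def)
    then show ?thesis using r(2)[of u] that by simp
  qed
  from ae0 have "AE u in lborel. u \<notin> {p - r<..<p + r}"
    by eventually_elim (metis pos less_irrefl)
  then have "emeasure lborel {p - r<..<p + r} = 0"
    by (subst (asm) AE_iff_measurable[of "{p - r<..<p + r}"]) auto
  then show False using r(1) by simp
qed

lemma integral_leb:
  fixes f :: "real \<Rightarrow> 'b::{banach, second_countable_topology}"
  shows "(\<integral>x. f x \<partial>leb \<tau>) = (\<integral>x. indicator {-\<tau><..<0} x *\<^sub>R f x \<partial>lborel)"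
  unfolding leb_def by (rule integral_restrict_space) simp

section \<open>Trajectories of the delay semigroup\<close>

locale delay_semigroup =
  fixes \<tau> :: real and At :: "(real \<Rightarrow> real^'n::finite) \<Rightarrow> real^'n" and G :: "real \<Rightarrow> (real \<Rightarrow> real^'n) \<Rightarrow> real \<Rightarrow> real^'n"
  assumes \<tau>: "0 < \<tau>"
    and c0_G: "c0_semigroup (\<D> \<tau>) (L2 (\<D> \<tau>)) G"
    and gen_G: "generator (\<D> \<tau>) (L2 (\<D> \<tau>)) G = delay_op \<tau> At"
begin

sublocale G: L2_semigroup "\<D> \<tau>" "L2 (\<D> \<tau>)" G
  by standard (rule L2_subspace_L2, rule c0_G)

abbreviation "\<A> \<equiv> generator (\<D> \<tau>) (L2 (\<D> \<tau>)) G"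

lemma domain_rep:
  assumes "(\<phi>, \<xi>) \<in> \<A>"
  obtains \<psi> where "W12 \<tau> \<psi> \<xi>" "AE \<theta> in leb \<tau>. \<phi> \<theta> = \<psi> \<theta>" "\<phi> 0 = \<psi> 0"
  using assms unfolding gen_G delay_op_def by blast

text \<open>The derivative in s of the pairing of \<open>G s \<phi>\<close> with the translated test
  function is the pairing of \<open>G s \<xi>\<close> with that function plus the pairing of
  \<open>G s \<phi>\<close> with its derivative. These cancel, since on (-\<tau>,0) the function
  \<open>G s \<xi>\<close> is the weak derivative of \<open>G s \<phi>\<close>. In effect the
  semigroup solves a transport equation weakly.\<close>

lemma test_pairing_constant:
  assumes A: "(\<phi>, \<xi>) \<in> \<A>" and h: "0 \<le> h"
    and d: "\<And>u. (\<zeta> has_real_derivative \<zeta>' u) (at u)" and c: "continuous_on UNIV \<zeta>'"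
    and supp: "\<And>u. u \<notin> {a..b} \<Longrightarrow> \<zeta> u = 0" and ab: "-\<tau> + h < a" "b < 0"
  shows "(\<integral>u. G h \<phi> u \<bullet> (\<zeta> (u + h) *\<^sub>R e) \<partial>leb \<tau>) = (\<integral>u. G 0 \<phi> u \<bullet> (\<zeta> (u + 0) *\<^sub>R e) \<partial>leb \<tau>)"
proof -
  let ?E = "emb (\<D> \<tau>)"
  let ?q = "\<lambda>s. \<integral>u. G s \<phi> u \<bullet> (\<zeta> (u + s) *\<^sub>R e) \<partial>leb \<tau>"
  have zc: "continuous_on UNIV \<zeta>" using d by (intro DERIV_continuous_on) auto
  have L: "\<phi> \<in> L2 (\<D> \<tau>)" "\<xi> \<in> L2 (\<D> \<tau>)" using A by (auto simp: generator_def)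
  have bdd0: "(\<lambda>u. f (u + s)) \<in> L2 (leb \<tau>)" if f: "continuous_on UNIV f" for f :: "real \<Rightarrow> real" and s
  proof -
    have "compact (f ` {-\<tau> + s..s})"
      by (intro compact_continuous_image continuous_on_subset[OF f]) auto
    then obtain B where B: "\<And>x. x \<in> {-\<tau> + s..s} \<Longrightarrow> norm (f x) \<le> B"
      using compact_imp_bounded[THEN bounded_iff[THEN iffD1]] by fastforce
    show ?thesis
    proof (rule bounded_measurable_L2(1)[OF leb_finite_measure])
      show "(\<lambda>u. f (u + s)) \<in> borel_measurable (leb \<tau>)"
        by (intro measurable_leb_borel borel_measurable_continuous_onI continuous_intros continuous_on_compose2[OF f]) auto
      show "norm (f (u + s)) \<le> \<bar>B\<bar>" if "u \<in> space (leb \<tau>)" for u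
        using B[of "u + s"] that by auto
    qed simp
  qed
  have bdd: "(\<lambda>u. f (u + s) *\<^sub>R e) \<in> L2 (leb \<tau>)" if f: "continuous_on UNIV f" for f :: "real \<Rightarrow> real" and s
    using bdd0[OF f, of s] by (auto simp: L2_def power_mult_distrib)
  have "(?q has_field_derivative 0) (at s within {0..h})" if s: "s \<in> {0..h}" for s
  proof -
    have s0: "0 \<le> s" using s by simp
    have GL: "G t \<phi> \<in> L2 (\<D> \<tau>)" "G t \<xi> \<in> L2 (\<D> \<tau>)" if "t \<in> {0..h}" for t
      using G.G_mem that L by auto
    have GA: "(G s \<phi>, G s \<xi>) \<in> \<A>" by (rule G.generator_orbit(1)[OF A s0])
    have "((\<lambda>t. norm ((?E (G t \<phi>) - ?E (G s \<phi>)) /\<^sub>R (t - s) - ?E (G s \<xi>))) \<longlongrightarrow> 0) (at s within {0..h})"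
      using has_vector_derivative_quotient[OF has_vector_derivative_within_subset[OF G.generator_orbit(2)[OF A s0], of "{0..h}"]] by auto
    then have fd: "((\<lambda>t. l2norm (leb \<tau>) (\<lambda>x. (G t \<phi> x - G s \<phi> x) /\<^sub>R (t - s) - G s \<xi> x)) \<longlongrightarrow> 0) (at s within {0..h})"
    proof (rule Lim_null_comparison[rotated])
      show "\<forall>\<^sub>F t in at s within {0..h}. norm (l2norm (leb \<tau>) (\<lambda>x. (G t \<phi> x - G s \<phi> x) /\<^sub>R (t - s) - G s \<xi> x))
        \<le> norm ((?E (G t \<phi>) - ?E (G s \<phi>)) /\<^sub>R (t - s) - ?E (G s \<xi>))"
        unfolding eventually_at_filter
      proof (intro always_eventually allI impI)
        fix t assume t: "t \<noteq> s" "t \<in> {0..h}"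
        have q: "(\<lambda>x. (G t \<phi> x - G s \<phi> x)) \<in> L2 (\<D> \<tau>)" by (intro L2_diff GL t s)
        have "l2norm (\<D> \<tau>) (\<lambda>x. (G t \<phi> x - G s \<phi> x) /\<^sub>R (t - s) - G s \<xi> x)
           = norm ((?E (G t \<phi>) - ?E (G s \<phi>)) /\<^sub>R (t - s) - ?E (G s \<xi>))"
          using l2norm_emb_diff[OF L2_scaleR[OF q] GL(2)[OF s], of "inverse (t - s)"]
          by (simp add: emb_scaleR[OF q] emb_diff[OF GL(1)[OF t(2)] GL(1)[OF s]] dist_norm)
        then show "norm (l2norm (leb \<tau>) (\<lambda>x. (G t \<phi> x - G s \<phi> x) /\<^sub>R (t - s) - G s \<xi> x))
          \<le> norm ((?E (G t \<phi>) - ?E (G s \<phi>)) /\<^sub>R (t - s) - ?E (G s \<xi>))"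
          using L2_leb(2)[OF \<tau> L2_diff[OF L2_scaleR[OF q] GL(2)[OF s]], of "inverse (t - s)"] by simp
      qed
    qed
    obtain \<psi> where W: "W12 \<tau> \<psi> (G s \<xi>)" and ae: "AE u in leb \<tau>. G s \<phi> u = \<psi> u" by (rule domain_rep[OF GA])
    have "(?q has_field_derivative ((\<integral>u. G s \<xi> u \<bullet> (\<zeta> (u + s) *\<^sub>R e) \<partial>leb \<tau>) + (\<integral>u. G s \<phi> u \<bullet> (\<zeta>' (u + s) *\<^sub>R e) \<partial>leb \<tau>))) (at s within {0..h})"
      by (rule L2_inner_derivative[OF _ _ s _ _ fd translate_derivative_L2[OF d c]])
        (use GL s in \<open>auto intro!: L2_leb(1)[OF \<tau>] bdd zc c\<close>)
    moreover have "(\<integral>u. G s \<xi> u \<bullet> (\<zeta> (u + s) *\<^sub>R e) \<partial>leb \<tau>) + (\<integral>u. G s \<phi> u \<bullet> (\<zeta>' (u + s) *\<^sub>R e) \<partial>leb \<tau>) = 0"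
    proof -
      have psiL: "\<psi> \<in> L2 (leb \<tau>)" and gL: "G s \<xi> \<in> L2 (leb \<tau>)" using W by (auto simp: W12_def)
      have "(\<integral>u. \<zeta>' (u + s) *\<^sub>R \<psi> u \<partial>leb \<tau>) = - (\<integral>u. \<zeta> (u + s) *\<^sub>R G s \<xi> u \<partial>leb \<tau>)"
      proof -
        \<comment> \<open>Translation by at most h keeps the support [a - s, b - s] inside
          (-\<tau>,0); this is why the support has to start beyond -\<tau> + h.\<close>
        have "-\<tau> < a - s \<and> b - s < 0 \<and> (\<forall>u. u \<notin> {a - s..b - s} \<longrightarrow> \<zeta> (u + s) = 0) \<and>
          (\<forall>u. ((\<lambda>u. \<zeta> (u + s)) has_real_derivative \<zeta>' (u + s)) (at u)) \<and> continuous_on UNIV (\<lambda>u. \<zeta>' (u + s))"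
          using ab s supp d by (auto intro!: continuous_on_compose2[OF c] continuous_intros DERIV_shift[THEN iffD1])
        then show ?thesis
          by (rule W[unfolded W12_def, THEN conjunct2, THEN conjunct2, THEN conjunct2, THEN spec[of _ "\<lambda>u. \<zeta> (u + s)"],
            THEN spec[of _ "\<lambda>u. \<zeta>' (u + s)"], THEN spec[of _ "a - s"], THEN spec[of _ "b - s"], THEN mp])
      qed
      then have eq: "(\<integral>u. \<zeta>' (u + s) *\<^sub>R \<psi> u \<partial>leb \<tau>) \<bullet> e = - ((\<integral>u. \<zeta> (u + s) *\<^sub>R G s \<xi> u \<partial>leb \<tau>) \<bullet> e)" by simp
      have int: "integrable (leb \<tau>) (\<lambda>u. f (u + s) *\<^sub>R g u)" if f: "continuous_on UNIV f" and g: "g \<in> L2 (leb \<tau>)"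
        for f :: "real \<Rightarrow> real" and g :: "real \<Rightarrow> real^'n"
      proof -
        note f' = bdd0[OF f, of s]
        show ?thesis
        proof (rule Bochner_Integration.integrable_bound)
          show "integrable (leb \<tau>) (\<lambda>u. norm (f (u + s)) * norm (g u))"
            using L2_inner_integrable[OF L2_norm[OF f'] L2_norm[OF g]] by simp
          show "(\<lambda>u. f (u + s) *\<^sub>R g u) \<in> borel_measurable (leb \<tau>)"
            by (intro borel_measurable_scaleR L2_measurable f' g)
        qed (simp add: abs_mult)
      qed
      have "(\<integral>u. G s \<phi> u \<bullet> (\<zeta>' (u + s) *\<^sub>R e) \<partial>leb \<tau>) = (\<integral>u. (\<zeta>' (u + s) *\<^sub>R \<psi> u) \<bullet> e \<partial>leb \<tau>)"
      proof (rule integral_cong_AE)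
        show "AE u in leb \<tau>. G s \<phi> u \<bullet> (\<zeta>' (u + s) *\<^sub>R e) = (\<zeta>' (u + s) *\<^sub>R \<psi> u) \<bullet> e"
          using ae by eventually_elim simp
        show "(\<lambda>u. G s \<phi> u \<bullet> (\<zeta>' (u + s) *\<^sub>R e)) \<in> borel_measurable (leb \<tau>)"
          by (intro borel_measurable_inner L2_measurable[OF L2_leb(1)[OF \<tau> GL(1)[OF s]]] L2_measurable[OF bdd[OF c, of s]])
        show "(\<lambda>u. (\<zeta>' (u + s) *\<^sub>R \<psi> u) \<bullet> e) \<in> borel_measurable (leb \<tau>)"
          by (rule borel_measurable_inner[OF borel_measurable_integrable[OF int[OF c psiL]] borel_measurable_const])
      qed
      also have "\<dots> = (\<integral>u. \<zeta>' (u + s) *\<^sub>R \<psi> u \<partial>leb \<tau>) \<bullet> e"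
        by (rule integral_inner_left) (rule int[OF c psiL])
      also have "\<dots> = - ((\<integral>u. \<zeta> (u + s) *\<^sub>R G s \<xi> u \<partial>leb \<tau>) \<bullet> e)" by (rule eq)
      also have "(\<integral>u. \<zeta> (u + s) *\<^sub>R G s \<xi> u \<partial>leb \<tau>) \<bullet> e = (\<integral>u. (\<zeta> (u + s) *\<^sub>R G s \<xi> u) \<bullet> e \<partial>leb \<tau>)"
        by (rule integral_inner_left[symmetric]) (rule int[OF zc gL])
      finally show ?thesis by simp
    qed
    ultimately show ?thesis by simp
  qed
  then obtain k where k: "\<And>s. s \<in> {0..h} \<Longrightarrow> ?q s = k"
    using has_field_derivative_zero_constant[of "{0..h}" ?q] by auto
  show ?thesis using k[of h] k[of 0] h by simp
qed

text \<open>Constancy of the pairing between the times 0 and h says that \<psi>0 and the translate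
  of \<psi>h have the same integrals against all test functions supported in (-\<tau> + h, 0). They
  agree there by the fundamental lemma, and at the end points by continuity.\<close>

lemma transport:
  assumes A: "(\<phi>, \<xi>) \<in> \<A>" and h: "0 < h" "h < \<tau>"
    and c0: "continuous_on {-\<tau>..0} \<psi>0" and ae0: "AE y in leb \<tau>. \<phi> y = \<psi>0 y"
    and ch: "continuous_on {-\<tau>..0} \<psi>h" and aeh: "AE y in leb \<tau>. G h \<phi> y = \<psi>h y"
    and y: "y \<in> {-\<tau>..-h}"
  shows "\<psi>h y = \<psi>0 (y + h)"
proof -
  have L: "\<phi> \<in> L2 (\<D> \<tau>)" using A by (auto simp: generator_def)
  have GL: "G t \<phi> \<in> L2 (leb \<tau>)" if "0 \<le> t" for t using G.G_mem[OF that L] L2_leb(1)[OF \<tau>] by blast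
  have int: "integrable lborel (\<lambda>u. \<zeta> u * (f u \<bullet> e))"
    if "continuous_on UNIV \<zeta>" "\<And>u. u \<notin> {c..d} \<Longrightarrow> \<zeta> u = 0" "continuous_on {c..d} f" for \<zeta> c d and f :: "real \<Rightarrow> real^'n" and e
  proof -
    have "integrable lborel (\<lambda>u. indicator {c..d} u *\<^sub>R (\<zeta> u * (f u \<bullet> e)))"
      by (rule borel_integrable_compact) (auto intro!: continuous_intros continuous_on_subset[OF that(1)] that(3))
    moreover have "(\<lambda>u. indicator {c..d} u *\<^sub>R (\<zeta> u * (f u \<bullet> e))) = (\<lambda>u. \<zeta> u * (f u \<bullet> e))"
    proof (rule ext)
      fix u show "indicator {c..d} u *\<^sub>R (\<zeta> u * (f u \<bullet> e)) = \<zeta> u * (f u \<bullet> e)"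
        by (cases "u \<in> {c..d}") (simp_all add: that(2))
    qed
    ultimately show ?thesis by simp
  qed
  have "(\<psi>0 u - \<psi>h (u - h)) \<bullet> e = 0" if u: "u \<in> {-\<tau> + h<..<0}" for u e
  proof (rule continuous_zero_of_test_integrals[where D = "\<lambda>u. (\<psi>0 u - \<psi>h (u - h)) \<bullet> e", OF _ _ u])
    show "continuous_on {-\<tau> + h<..<0} (\<lambda>u. (\<psi>0 u - \<psi>h (u - h)) \<bullet> e)"
      using h by (intro continuous_intros continuous_on_subset[OF c0] continuous_on_compose2[OF ch]) auto
    fix \<zeta> \<zeta>' :: "real \<Rightarrow> real" and c d
    assume cd: "-\<tau> + h < c" "c < d" "d < 0" and supp: "\<And>u. u \<notin> {c..d} \<Longrightarrow> \<zeta> u = 0"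
      and der: "\<And>u. (\<zeta> has_real_derivative \<zeta>' u) (at u)" and c': "continuous_on UNIV \<zeta>'"
    have zc: "continuous_on UNIV \<zeta>" using der by (intro DERIV_continuous_on) auto
    have G00: "AE y in leb \<tau>. G 0 \<phi> y = \<phi> y"
      using c0_G L unfolding c0_semigroup_def AE_delay_iff[OF \<tau>] by blast
    have pair: "(\<integral>y. G t \<phi> y \<bullet> (\<zeta> (y + t) *\<^sub>R e) \<partial>leb \<tau>) = (\<integral>y. \<zeta> (y + t) * (\<psi> y \<bullet> e) \<partial>lborel)"
      if t: "t = 0 \<or> t = h" and ae: "AE y in leb \<tau>. G t \<phi> y = \<psi> y" and c: "continuous_on {-\<tau>..0} \<psi>" for t \<psi>
    proof -
      have m: "(\<lambda>y. \<zeta> (y + t) * (\<psi> y \<bullet> e)) \<in> borel_measurable (leb \<tau>)"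
        unfolding measurable_leb_iff by (rule borel_measurable_continuous_on_restrict)
          (intro continuous_intros continuous_on_subset[OF c] continuous_on_compose2[OF zc], auto)
      have m2: "(\<lambda>y. G t \<phi> y \<bullet> (\<zeta> (y + t) *\<^sub>R e)) \<in> borel_measurable (leb \<tau>)"
        by (intro borel_measurable_inner L2_measurable[OF GL] borel_measurable_scaleR measurable_leb_borel
            borel_measurable_continuous_onI continuous_intros continuous_on_compose2[OF zc]) (use t h in auto)
      have "(\<integral>y. G t \<phi> y \<bullet> (\<zeta> (y + t) *\<^sub>R e) \<partial>leb \<tau>) = (\<integral>y. \<zeta> (y + t) * (\<psi> y \<bullet> e) \<partial>leb \<tau>)"
        by (rule integral_cong_AE[OF m2 m]) (use ae in eventually_elim, simp)
      also have "\<dots> = (\<integral>y. \<zeta> (y + t) * (\<psi> y \<bullet> e) \<partial>lborel)"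
        unfolding integral_leb
      proof (intro Bochner_Integration.integral_cong refl)
        fix y show "indicator {-\<tau><..<0} y *\<^sub>R (\<zeta> (y + t) * (\<psi> y \<bullet> e)) = \<zeta> (y + t) * (\<psi> y \<bullet> e)"
        proof (cases "y \<in> {-\<tau><..<0}")
          case False
          then have "y + t \<notin> {c..d}" using cd t h by auto
          then have "\<zeta> (y + t) = 0" by (rule supp)
          then show ?thesis by simp
        qed simp
      qed
      finally show ?thesis .
    qed
    have "(\<integral>u. \<zeta> u * ((\<psi>0 u - \<psi>h (u - h)) \<bullet> e) \<partial>lborel)
        = (\<integral>u. \<zeta> u * (\<psi>0 u \<bullet> e) \<partial>lborel) - (\<integral>u. \<zeta> u * (\<psi>h (u - h) \<bullet> e) \<partial>lborel)"
      unfolding inner_diff_left right_diff_distrib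
      by (rule Bochner_Integration.integral_diff; rule int[OF zc supp])
        (use cd h in \<open>auto intro!: continuous_on_subset[OF c0] continuous_on_compose2[OF ch] continuous_intros\<close>)
    also have "(\<integral>u. \<zeta> u * (\<psi>h (u - h) \<bullet> e) \<partial>lborel) = (\<integral>y. \<zeta> (y + h) * (\<psi>h y \<bullet> e) \<partial>lborel)"
      using lborel_integral_real_affine[of 1 "\<lambda>u. \<zeta> u * (\<psi>h (u - h) \<bullet> e)" h] by (simp add: add.commute)
    also have "\<dots> = (\<integral>y. G h \<phi> y \<bullet> (\<zeta> (y + h) *\<^sub>R e) \<partial>leb \<tau>)" by (rule pair[symmetric]) (use aeh ch in auto)
    also have "\<dots> = (\<integral>y. G 0 \<phi> y \<bullet> (\<zeta> (y + 0) *\<^sub>R e) \<partial>leb \<tau>)"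
      by (rule test_pairing_constant[OF A _ der c' supp]) (use cd h in auto)
    also have "\<dots> = (\<integral>y. \<zeta> (y + 0) * (\<psi>0 y \<bullet> e) \<partial>lborel)"
    proof (rule pair)
      show "AE y in leb \<tau>. G 0 \<phi> y = \<psi>0 y" using G00 ae0 by eventually_elim simp
    qed (use c0 in auto)
    finally show "(\<integral>u. \<zeta> u * ((\<psi>0 u - \<psi>h (u - h)) \<bullet> e) \<partial>lborel) = 0" by simp
  qed
  then have "\<psi>0 u - \<psi>h (u - h) = 0" if "u \<in> {-\<tau> + h<..<0}" for u
    using that inner_eq_zero_iff by blast
  then have open_eq: "\<psi>0 (x + h) - \<psi>h x = 0" if "x \<in> {-\<tau><..<-h}" for x
    using that by (force dest: spec[of _ "x + h"])
  have cl: "closure {-\<tau><..<-h} = {-\<tau>..-h}" using h by (intro closure_greaterThanLessThan) auto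
  have "\<psi>0 (y + h) - \<psi>h y = 0"
  proof (rule continuous_constant_on_closure[where S = "{-\<tau><..<-h}" and f = "\<lambda>x. \<psi>0 (x + h) - \<psi>h x"])
    show "continuous_on (closure {-\<tau><..<-h}) (\<lambda>x. \<psi>0 (x + h) - \<psi>h x)"
      unfolding cl using h by (intro continuous_intros continuous_on_compose2[OF c0] continuous_on_subset[OF ch]) auto
  qed (use open_eq y cl in auto)
  then show ?thesis by simp
qed

text \<open>For \<open>\<phi>\<close> in the domain of the generator, \<open>G t \<phi>\<close> is the segment at time \<open>t\<close> of one continuous
  function.\<close>

definition is_traj :: "(real \<Rightarrow> real^'n) \<Rightarrow> (real \<Rightarrow> real^'n) \<Rightarrow> bool" where
  "is_traj \<phi> X \<longleftrightarrow> \<phi> \<in> L2 (\<D> \<tau>) \<and> continuous_on UNIV X \<and> bounded (range X) \<and>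
     (\<forall>t\<in>{0..\<tau>}. AE \<theta> in \<D> \<tau>. G t \<phi> \<theta> = X (t + \<theta>))"

text \<open>The initial history is glued to the values \<open>\<psi> s 0\<close> at the head. The
  head depends continuously on s because evaluation at the atom 0 is bounded, and transport along
  characteristics identifies every later history with a piece of this one curve.\<close>

lemma traj_exists:
  assumes A: "(\<phi>, \<xi>) \<in> \<A>" shows "\<exists>X. is_traj \<phi> X"
proof -
  have L: "\<phi> \<in> L2 (\<D> \<tau>)" using A by (auto simp: generator_def)
  have "\<exists>\<psi>. continuous_on {-\<tau>..0} \<psi> \<and> (AE u in leb \<tau>. G t \<phi> u = \<psi> u) \<and> G t \<phi> 0 = \<psi> 0" if "0 \<le> t" for t
    by (rule domain_rep[OF G.generator_orbit(1)[OF A that]]) (auto simp: W12_def)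
  then obtain \<psi> where \<psi>: "\<And>t. 0 \<le> t \<Longrightarrow> continuous_on {-\<tau>..0} (\<psi> t)"
    "\<And>t. 0 \<le> t \<Longrightarrow> AE u in leb \<tau>. G t \<phi> u = \<psi> t u" "\<And>t. 0 \<le> t \<Longrightarrow> G t \<phi> 0 = \<psi> t 0" by metis
  have trans: "\<psi> (s + h) u = \<psi> s (u + h)" if s: "0 \<le> s" and h: "0 < h" "h < \<tau>" and u: "u \<in> {-\<tau>..-h}" for s h u
  proof (rule transport[OF G.generator_orbit(1)[OF A s] h \<psi>(1)[OF s] \<psi>(2)[OF s] _ _ u])
    show "continuous_on {-\<tau>..0} (\<psi> (s + h))" using s h by (intro \<psi>(1)) simp
    have "AE u in \<D> \<tau>. G (h + s) \<phi> u = G h (G s \<phi>) u"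
      using c0_G s h L unfolding c0_semigroup_def by simp
    then have "AE u in leb \<tau>. G (h + s) \<phi> u = G h (G s \<phi>) u" by (simp add: AE_delay_iff[OF \<tau>])
    moreover have "AE u in leb \<tau>. G (s + h) \<phi> u = \<psi> (s + h) u" using s h by (intro \<psi>(2)) simp
    ultimately show "AE u in leb \<tau>. G h (G s \<phi>) u = \<psi> (s + h) u"
      by eventually_elim (simp add: add.commute)
  qed
  define Y where "Y = (\<lambda>s. if s \<le> 0 then \<psi> 0 s else \<psi> s 0)"
  \<comment> \<open>Clamping to [-\<tau>,\<tau>], which contains all the sums t + \<theta> in
    question, makes the curve bounded and continuous on the whole line.\<close>
  define X where "X = (\<lambda>s. Y (max (-\<tau>) (min \<tau> s)))"
  have c1: "continuous_on {0..} (\<lambda>s. \<psi> s 0)"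
    unfolding continuous_on_iff
  proof (intro ballI allI impI)
    fix s \<epsilon> :: real assume s: "s \<in> {0..}" and "0 < \<epsilon>"
    then obtain \<delta> where \<delta>: "\<delta> > 0" "\<And>r. r \<in> {0..} \<Longrightarrow> dist r s < \<delta> \<Longrightarrow>
        dist (emb (\<D> \<tau>) (G r \<phi>)) (emb (\<D> \<tau>) (G s \<phi>)) < \<epsilon>"
      using G.continuous_emb[OF L, unfolded continuous_on_iff] by metis
    show "\<exists>\<delta>>0. \<forall>r\<in>{0..}. dist r s < \<delta> \<longrightarrow> dist (\<psi> r 0) (\<psi> s 0) < \<epsilon>"
    proof (intro exI[of _ \<delta>] conjI \<delta>(1) ballI impI)
      fix r assume r: "r \<in> {0..}" "dist r s < \<delta>"
      have GL: "G r \<phi> \<in> L2 (\<D> \<tau>)" "G s \<phi> \<in> L2 (\<D> \<tau>)" using r s G.G_mem L by auto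
      have "dist (\<psi> r 0) (\<psi> s 0) = norm (G r \<phi> 0 - G s \<phi> 0)" using \<psi>(3) r s by (simp add: dist_norm)
      also have "\<dots> \<le> dist (emb (\<D> \<tau>) (G r \<phi>)) (emb (\<D> \<tau>) (G s \<phi>))"
        using L2_leb(3)[OF \<tau> L2_diff[OF GL]] l2norm_emb_diff[OF GL] by simp
      also have "\<dots> < \<epsilon>" using \<delta>(2) r by blast
      finally show "dist (\<psi> r 0) (\<psi> s 0) < \<epsilon>" .
    qed
  qed
  have Yc: "continuous_on {-\<tau>..\<tau>} Y"
  proof -
    have "continuous_on ({-\<tau>..0} \<union> {0..\<tau>}) Y"
      unfolding Y_def
      by (rule continuous_on_If) (auto intro: \<psi>(1) continuous_on_subset[OF c1])
    moreover have "{-\<tau>..0} \<union> {0..\<tau>} = {-\<tau>..\<tau>}" using \<tau> by auto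
    ultimately show ?thesis by simp
  qed
  have Xc: "continuous_on UNIV X" unfolding X_def
    using \<tau> by (intro continuous_on_compose2[OF Yc] continuous_intros) auto
  have "range X \<subseteq> Y ` {-\<tau>..\<tau>}" unfolding X_def using \<tau> by auto
  moreover have "bounded (Y ` {-\<tau>..\<tau>})" by (intro compact_imp_bounded compact_continuous_image Yc) simp
  ultimately have Xb: "bounded (range X)" using bounded_subset by blast
  have "AE u in \<D> \<tau>. G t \<phi> u = X (t + u)" if t: "t \<in> {0..\<tau>}" for t
    unfolding AE_delay_iff[OF \<tau>]
  proof
    have "AE u in leb \<tau>. \<psi> t u = X (t + u)"
    proof (rule AE_I2)
      fix u assume "u \<in> space (leb \<tau>)"
      then have u: "-\<tau> < u" "u < 0" by auto
      show "\<psi> t u = X (t + u)"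
      proof (cases "t + u \<le> 0")
        case True
        \<comment> \<open>\<open>transport\<close> needs a shift strictly below \<tau>; strictness
          comes from u > -\<tau>.\<close>
        then have tl: "t < \<tau>" using u by linarith
        have "X (t + u) = \<psi> 0 (t + u)" using True t u tl by (simp add: X_def Y_def max_def min_def)
        also have "\<dots> = \<psi> t u" using trans[of 0 t u] t tl True u by (cases "t = 0") (auto simp: add.commute)
        finally show ?thesis by simp
      next
        case False
        have "X (t + u) = \<psi> (t + u) 0" using False t u by (simp add: X_def Y_def max_def min_def)
        \<comment> \<open>Starting at time t + u and shifting by -u, position u traces back to the
          head.\<close>
        also have "\<dots> = \<psi> t u" using trans[of "t + u" "-u" u] False u by auto
        finally show ?thesis by simp
      qed
    qed
    moreover have "AE u in leb \<tau>. G t \<phi> u = \<psi> t u" using t by (intro \<psi>(2)) simp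
    ultimately show "AE u in leb \<tau>. G t \<phi> u = X (t + u)" by eventually_elim simp
    show "G t \<phi> 0 = X (t + 0)"
      using t \<tau> \<psi>(3)[of t] by (cases "t = 0") (auto simp: X_def Y_def max_def min_def)
  qed
  then show ?thesis using L Xc Xb by (auto simp: is_traj_def)
qed

end

section \<open>Sums of elementary tensors\<close>

lemma bounded_op_sum:
  fixes f :: "nat \<Rightarrow> 'a \<Rightarrow> 'b::euclidean_space"
  assumes X: "L2_subspace M X" and T: "bounded_op M X T" and f: "\<And>i. i < N \<Longrightarrow> f i \<in> X"
  shows "(\<lambda>y. \<Sum>i<N. c i *\<^sub>R f i y) \<in> X \<and> (AE x in M. T (\<lambda>y. \<Sum>i<N. c i *\<^sub>R f i y) x = (\<Sum>i<N. c i *\<^sub>R T (f i) x))"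
  using f
proof (induction N)
  case 0
  have z: "(\<lambda>x. 0) \<in> X" by (rule L2_subspaceD(2)[OF X])
  have "AE x in M. T (\<lambda>y. 0 *\<^sub>R (0::'b)) x = 0 *\<^sub>R T (\<lambda>y. 0) x" using bounded_opD(3)[OF T z, of 0] by simp
  with z show ?case by simp
next
  case (Suc N)
  then have IH: "(\<lambda>y. \<Sum>i<N. c i *\<^sub>R f i y) \<in> X" "AE x in M. T (\<lambda>y. \<Sum>i<N. c i *\<^sub>R f i y) x = (\<Sum>i<N. c i *\<^sub>R T (f i) x)"
    and fN: "f N \<in> X" by auto
  have "AE x in M. T (\<lambda>y. (\<Sum>i<N. c i *\<^sub>R f i y) + c N *\<^sub>R f N y) x
      = T (\<lambda>y. \<Sum>i<N. c i *\<^sub>R f i y) x + T (\<lambda>y. c N *\<^sub>R f N y) x"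
    by (intro bounded_opD(2)[OF T] IH L2_subspaceD(4)[OF X fN])
  with IH(2) bounded_opD(3)[OF T fN, of "c N"]
  have "AE x in M. T (\<lambda>y. (\<Sum>i<N. c i *\<^sub>R f i y) + c N *\<^sub>R f N y) x = (\<Sum>i<N. c i *\<^sub>R T (f i) x) + c N *\<^sub>R T (f N) x"
    by eventually_elim simp
  moreover have "(\<lambda>y. (\<Sum>i<N. c i *\<^sub>R f i y) + c N *\<^sub>R f N y) \<in> X"
    by (intro L2_subspaceD(3)[OF X] IH L2_subspaceD(4)[OF X fN])
  ultimately show ?case by simp
qed

lemma norm_vec_sq: "(norm (x :: real^'k::finite))\<^sup>2 = (\<Sum>i\<in>UNIV. (x $ i)\<^sup>2)"
  unfolding power2_norm_eq_inner inner_vec_def by (simp add: power2_eq_square)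

lemma elem_tensor_component: "elem_tensor \<phi> \<theta> $ i = (\<Prod>j\<in>UNIV. \<phi> j (\<theta> j) $ i j)"
  by (simp add: elem_tensor_def)

lemma norm_elem_tensor: "(norm (elem_tensor \<phi> \<theta>))\<^sup>2 = (\<Prod>j\<in>UNIV. (norm (\<phi> j (\<theta> j)))\<^sup>2)"
proof -
  have "(norm (elem_tensor \<phi> \<theta>))\<^sup>2 = (\<Sum>i\<in>UNIV. \<Prod>j\<in>UNIV. (\<phi> j (\<theta> j) $ i j)\<^sup>2)"
    by (simp add: norm_vec_sq elem_tensor_component prod_power_distrib)
  also have "\<dots> = (\<Prod>j\<in>UNIV. \<Sum>a\<in>UNIV. (\<phi> j (\<theta> j) $ a)\<^sup>2)"
    by (subst prod_sum_PiE) auto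
  finally show ?thesis by (simp add: norm_vec_sq)
qed

lemma measurable_pow_component: "(\<lambda>\<theta>. \<theta> j) \<in> measurable (pow_measure \<tau>) (\<D> \<tau>)"
  unfolding pow_measure_def by (rule measurable_component_singleton) simp

lemma borel_measurable_vec_lambda:
  fixes f :: "'a \<Rightarrow> 'k::finite \<Rightarrow> real"
  assumes "\<And>i. (\<lambda>x. f x i) \<in> borel_measurable M" shows "(\<lambda>x. \<chi> i. f x i) \<in> borel_measurable M"
proof -
  have "(\<lambda>x. \<chi> i. f x i) = (\<lambda>x. \<Sum>i\<in>UNIV. f x i *\<^sub>R axis i 1)"
    by (rule ext, rule vec_eq_iff[THEN iffD2]) (simp add: axis_def if_distrib cong: if_cong)
  then show ?thesis using assms by simp
qed

lemma borel_measurable_vec_nth': "f \<in> borel_measurable M \<Longrightarrow> (\<lambda>x. (f x :: real^'k::finite) $ i) \<in> borel_measurable M"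
  by (rule measurable_compose[of f M borel]) (auto intro!: borel_measurable_continuous_onI continuous_intros)

abbreviation "tensor_sum N \<phi> \<equiv> \<lambda>\<theta>. \<Sum>i<N::nat. elem_tensor (\<phi> i) \<theta>"
abbreviation "translate_sum N X \<equiv> \<lambda>t \<theta>. \<Sum>i<N::nat. elem_tensor (\<lambda>l u. X i l (t + u :: real)) \<theta>"

lemma measurable_elem_tensor:
  assumes "\<And>j. \<phi> j \<in> borel_measurable (\<D> \<tau>)"
  shows "elem_tensor \<phi> \<in> borel_measurable (pow_measure \<tau>)"
  unfolding elem_tensor_def
  by (intro borel_measurable_vec_lambda borel_measurable_prod borel_measurable_vec_nth'
    measurable_compose[OF measurable_pow_component assms])

lemma measurable_tensor_sum:
  assumes "\<And>i j. i < N \<Longrightarrow> \<phi> i j \<in> borel_measurable (\<D> \<tau>)"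
  shows "tensor_sum N \<phi> \<in> borel_measurable (pow_measure \<tau>)"
    and "(\<lambda>\<theta>. ennreal ((norm (tensor_sum N \<phi> \<theta>))\<^sup>2)) \<in> borel_measurable (pow_measure \<tau>)"
proof -
  show "tensor_sum N \<phi> \<in> borel_measurable (pow_measure \<tau>)"
    using assms by (intro borel_measurable_sum measurable_elem_tensor) auto
  then have [measurable]: "tensor_sum N \<phi> \<in> borel_measurable (pow_measure \<tau>)" .
  show "(\<lambda>\<theta>. ennreal ((norm (tensor_sum N \<phi> \<theta>))\<^sup>2)) \<in> borel_measurable (pow_measure \<tau>)"
    by measurable
qed

lemma nn_integral_elem_tensor:
  assumes \<tau>: "0 < \<tau>" and "\<And>j. \<phi> j \<in> L2 (\<D> \<tau>)"
  shows "l2sq (pow_measure \<tau>) (\<lambda>\<theta>. elem_tensor \<phi> \<theta>) = ennreal ((\<Prod>j\<in>UNIV. l2norm (\<D> \<tau>) (\<phi> j))\<^sup>2)"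
proof -
  have m: "(\<lambda>y. ennreal ((norm (\<phi> j y))\<^sup>2)) \<in> borel_measurable (\<D> \<tau>)" for j
    using L2_measurable[OF assms(2)] by measurable
  have "l2sq (pow_measure \<tau>) (\<lambda>\<theta>. elem_tensor \<phi> \<theta>)
      = (\<integral>\<^sup>+\<theta>. (\<Prod>j\<in>UNIV. ennreal ((norm (\<phi> j (\<theta> j)))\<^sup>2)) \<partial>pow_measure \<tau>)"
    by (simp add: norm_elem_tensor prod_ennreal)
  also have "\<dots> = (\<Prod>j\<in>UNIV. \<integral>\<^sup>+y. ennreal ((norm (\<phi> j y))\<^sup>2) \<partial>\<D> \<tau>)"
    unfolding pow_measure_def
    by (rule product_sigma_finite.product_nn_integral_prod[OF product_sigma_finite_delay[OF \<tau>]]) (use m in auto)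
  also have "\<dots> = ennreal ((\<Prod>j\<in>UNIV. l2norm (\<D> \<tau>) (\<phi> j))\<^sup>2)"
    by (simp add: L2_nn_integral[OF assms(2)] prod_ennreal prod_power_distrib)
  finally show ?thesis .
qed

lemma elem_tensor_L2:
  assumes \<tau>: "0 < \<tau>" and \<phi>: "\<And>j. \<phi> j \<in> L2 (\<D> \<tau>)"
  shows "elem_tensor \<phi> \<in> L2 (pow_measure \<tau>)"
    and "l2norm (pow_measure \<tau>) (elem_tensor \<phi>) \<le> (\<Prod>j\<in>UNIV. l2norm (\<D> \<tau>) (\<phi> j))"
  using L2I_nn_integral[OF measurable_elem_tensor[OF L2_measurable[OF \<phi>]] eq_refl[OF nn_integral_elem_tensor[OF \<tau> \<phi>]]]
  by (simp_all add: prod_nonneg)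

lemma sum_fun_upd_average:
  fixes f :: "('m::finite \<Rightarrow> 'n::finite) \<Rightarrow> real"
  shows "(\<Sum>i\<in>UNIV. \<Sum>a\<in>UNIV. f (i(k := a))) = real CARD('n) * (\<Sum>i\<in>UNIV. f i)"
proof -
  have "(\<Sum>i\<in>UNIV. \<Sum>a\<in>UNIV. f (i(k := a))) = (\<Sum>(i, a)\<in>UNIV \<times> UNIV. f (i(k := a)))"
    by (rule sum.cartesian_product)
  also have "\<dots> = (\<Sum>(i, a)\<in>UNIV \<times> (UNIV :: 'n set). f i)"
    \<comment> \<open>Exchanging a with the k-th entry of the index is an involution on pairs, and
      it turns the first component into \<open>i(k := a)\<close>.\<close>
    by (rule sum.reindex_bij_witness[where i = "\<lambda>(i, a). (i(k := a), i k)" and j = "\<lambda>(i, a). (i(k := a), i k)"])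
      auto
  also have "\<dots> = (\<Sum>i\<in>UNIV. \<Sum>a\<in>(UNIV :: 'n set). f i)" by (rule sum.cartesian_product[symmetric])
  finally show ?thesis by (simp add: sum_distrib_left)
qed

text \<open>The factor \<open>CARD('n)\<close> appears because \<open>idx k\<close> is a dummy index on the right-hand side.\<close>

lemma norm_elem_tensor_sum_slot:
  fixes \<phi> :: "nat \<Rightarrow> 'm::finite \<Rightarrow> real \<Rightarrow> real^'n::finite" and k :: 'm
  defines "c \<equiv> \<lambda>x i idx. \<Prod>l\<in>UNIV - {k}. \<phi> i l (x l) $ idx l"
  shows "real CARD('n) * (norm (\<Sum>i<N. elem_tensor ((\<phi> i)(k := \<lambda>_. v i)) x))\<^sup>2
    = (\<Sum>idx\<in>UNIV. (norm (\<Sum>i<N. c x i idx *\<^sub>R v i))\<^sup>2)"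
proof -
  have comp: "(\<Sum>i<N. elem_tensor ((\<phi> i)(k := \<lambda>_. v i)) x) $ idx = (\<Sum>i<N. c x i idx *\<^sub>R v i) $ idx k" for idx
  proof -
    have "elem_tensor ((\<phi> i)(k := \<lambda>_. v i)) x $ idx = c x i idx * v i $ idx k" for i
    proof -
      have "elem_tensor ((\<phi> i)(k := \<lambda>_. v i)) x $ idx
          = (v i $ idx k) * (\<Prod>l\<in>UNIV - {k}. ((\<phi> i)(k := \<lambda>_. v i)) l (x l) $ idx l)"
        unfolding elem_tensor_component by (subst prod.remove[of UNIV k]) auto
      also have "(\<Prod>l\<in>UNIV - {k}. ((\<phi> i)(k := \<lambda>_. v i)) l (x l) $ idx l) = c x i idx"
        unfolding c_def by (intro prod.cong) auto
      finally show ?thesis by (subst mult.commute)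
    qed
    then show ?thesis by simp
  qed
  have cu: "c x i (idx(k := a)) = c x i idx" for i idx a unfolding c_def by (intro prod.cong) auto
  have "real CARD('n) * (norm (\<Sum>i<N. elem_tensor ((\<phi> i)(k := \<lambda>_. v i)) x))\<^sup>2
      = real CARD('n) * (\<Sum>idx\<in>UNIV. ((\<Sum>i<N. c x i idx *\<^sub>R v i) $ idx k)\<^sup>2)"
    unfolding norm_vec_sq comp ..
  also have "\<dots> = (\<Sum>idx\<in>UNIV. \<Sum>a\<in>UNIV. ((\<Sum>i<N. c x i (idx(k := a)) *\<^sub>R v i) $ ((idx(k := a)) k))\<^sup>2)"
    by (rule sum_fun_upd_average[symmetric])
  also have "\<dots> = (\<Sum>idx\<in>UNIV. (norm (\<Sum>i<N. c x i idx *\<^sub>R v i))\<^sup>2)"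
    by (simp only: cu norm_vec_sq fun_upd_same)
  finally show ?thesis .
qed

lemma elem_tensor_fun_upd: "elem_tensor (\<phi>(k := f)) (x(k := y)) = elem_tensor (\<phi>(k := \<lambda>_. f y)) x"
  unfolding elem_tensor_def by (intro arg_cong[where f = vec_lambda] ext prod.cong) auto

lemma elem_tensor_slot: "elem_tensor \<phi> (x(k := y)) = elem_tensor (\<phi>(k := \<lambda>_. \<phi> k y)) x"
  using elem_tensor_fun_upd[of \<phi> k "\<phi> k" x y] by simp

text \<open>The preceding identity is integrated with the vector in slot k depending on z. Since x
  stays fixed, the same identity also yields measurability in z of the tensor expression.\<close>

lemma nn_integral_slot:
  fixes \<phi> :: "nat \<Rightarrow> 'm::finite \<Rightarrow> real \<Rightarrow> real^'n::finite" and k :: 'm and V :: "nat \<Rightarrow> 'w \<Rightarrow> real^'n"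
  defines "c \<equiv> \<lambda>x i idx. \<Prod>l\<in>UNIV - {k}. \<phi> i l (x l) $ idx l"
  assumes V: "\<And>i. i < N \<Longrightarrow> V i \<in> borel_measurable W"
  shows "ennreal (real CARD('n)) * l2sq W (\<lambda>z. \<Sum>i<N. elem_tensor ((\<phi> i)(k := \<lambda>_. V i z)) x)
      = (\<Sum>idx\<in>UNIV. \<integral>\<^sup>+z. ennreal ((norm (\<Sum>i<N. c x i idx *\<^sub>R V i z))\<^sup>2) \<partial>W)"
proof -
  have m: "(\<lambda>z. ennreal ((norm (\<Sum>i<N. c x i idx *\<^sub>R V i z))\<^sup>2)) \<in> borel_measurable W" for idx
    using V by (intro measurable_compose[OF _ measurable_ennreal] borel_measurable_power borel_measurable_norm
      borel_measurable_sum borel_measurable_scaleR) auto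
  have eq: "ennreal (real CARD('n)) * ennreal ((norm (\<Sum>i<N. elem_tensor ((\<phi> i)(k := \<lambda>_. V i z)) x))\<^sup>2)
      = (\<Sum>idx\<in>UNIV. ennreal ((norm (\<Sum>i<N. c x i idx *\<^sub>R V i z))\<^sup>2))" for z
    using norm_elem_tensor_sum_slot[where N = N and \<phi> = \<phi> and k = k and v = "\<lambda>i. V i z" and x = x]
    by (simp add: ennreal_mult[symmetric] c_def)
  have meas: "(\<lambda>z. ennreal ((norm (\<Sum>i<N. elem_tensor ((\<phi> i)(k := \<lambda>_. V i z)) x))\<^sup>2)) \<in> borel_measurable W"
  proof -
    have "(norm (\<Sum>i<N. elem_tensor ((\<phi> i)(k := \<lambda>_. V i z)) x))\<^sup>2
      = (\<Sum>idx\<in>UNIV. (norm (\<Sum>i<N. c x i idx *\<^sub>R V i z))\<^sup>2) / real CARD('n)" for z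
      using norm_elem_tensor_sum_slot[where N = N and \<phi> = \<phi> and k = k and v = "\<lambda>i. V i z" and x = x]
      by (simp add: c_def nonzero_eq_divide_eq mult.commute)
    then have "(\<lambda>z. ennreal ((norm (\<Sum>i<N. elem_tensor ((\<phi> i)(k := \<lambda>_. V i z)) x))\<^sup>2))
      = (\<lambda>z. ennreal ((\<Sum>idx\<in>UNIV. (norm (\<Sum>i<N. c x i idx *\<^sub>R V i z))\<^sup>2) / real CARD('n)))"
      by simp
    also have "\<dots> \<in> borel_measurable W"
      using V by (intro measurable_compose[OF _ measurable_ennreal] borel_measurable_divide borel_measurable_power borel_measurable_norm
        borel_measurable_sum borel_measurable_scaleR) auto
    finally show ?thesis .
  qed
  show ?thesis
    unfolding nn_integral_cmult[OF meas, symmetric] eq by (rule nn_integral_sum) (rule m)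
qed

text \<open>An inequality between quadratic expressions in one factor, valid for all scalar combinations of
  that factor, carries over to sums of tensors because the other factors act as coefficients.\<close>

lemma slot_bound:
  fixes \<phi> :: "nat \<Rightarrow> 'm::finite \<Rightarrow> real \<Rightarrow> real^'n::finite" and Y :: "nat \<Rightarrow> 'z \<Rightarrow> real^'n"
  assumes \<tau>: "0 < \<tau>" and \<phi>: "\<And>i l. i < N \<Longrightarrow> \<phi> i l \<in> borel_measurable (\<D> \<tau>)"
    and Y: "\<And>i. i < N \<Longrightarrow> Y i \<in> borel_measurable Z"
    and bound: "\<And>c. l2sq Z (\<lambda>z. \<Sum>i<N. c i *\<^sub>R Y i z)
      \<le> B * l2sq (\<D> \<tau>) (\<lambda>y. \<Sum>i<N. c i *\<^sub>R \<phi> i k y)"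
  shows "(\<integral>\<^sup>+x. l2sq Z (\<lambda>z. \<Sum>i<N. elem_tensor ((\<phi> i)(k := \<lambda>_. Y i z)) x) \<partial>slice_measure \<tau> k)
    \<le> B * l2sq (pow_measure \<tau>) (tensor_sum N \<phi>)"
proof -
  let ?n = "ennreal (real CARD('n))"
  define c where "c = (\<lambda>x i idx. \<Prod>l\<in>UNIV - {k}. \<phi> i l (x l) $ idx l)"
  \<comment> \<open>With the other variables fixed, the hypothesis applies for each multi-index
    separately. The factor \<open>CARD('n)\<close> appears on both sides and cancels.\<close>
  have pt: "l2sq Z (\<lambda>z. \<Sum>i<N. elem_tensor ((\<phi> i)(k := \<lambda>_. Y i z)) x)
    \<le> B * l2sq (\<D> \<tau>) (\<lambda>y. tensor_sum N \<phi> (x(k := y)))" for x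
  proof -
    have "?n * l2sq Z (\<lambda>z. \<Sum>i<N. elem_tensor ((\<phi> i)(k := \<lambda>_. Y i z)) x)
      \<le> (\<Sum>idx\<in>UNIV. B * l2sq (\<D> \<tau>) (\<lambda>y. \<Sum>i<N. c x i idx *\<^sub>R \<phi> i k y))"
      unfolding c_def by (subst nn_integral_slot[OF Y], assumption) (intro sum_mono bound)
    also have "\<dots> = B * (\<Sum>idx\<in>UNIV. \<integral>\<^sup>+y. ennreal ((norm (\<Sum>i<N. c x i idx *\<^sub>R \<phi> i k y))\<^sup>2) \<partial>\<D> \<tau>)"
      by (rule sum_distrib_left[symmetric])
    also have "(\<Sum>idx\<in>UNIV. \<integral>\<^sup>+y. ennreal ((norm (\<Sum>i<N. c x i idx *\<^sub>R \<phi> i k y))\<^sup>2) \<partial>\<D> \<tau>)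
      = ?n * l2sq (\<D> \<tau>) (\<lambda>y. \<Sum>i<N. elem_tensor ((\<phi> i)(k := \<lambda>_. \<phi> i k y)) x)"
      unfolding c_def by (rule nn_integral_slot[symmetric]) (rule \<phi>)
    finally show ?thesis
      unfolding elem_tensor_slot mult.left_commute[of B]
      by (subst (asm) ennreal_mult_le_mult_iff) auto
  qed
  have m: "(\<lambda>\<theta>. ennreal ((norm (tensor_sum N \<phi> \<theta>))\<^sup>2)) \<in> borel_measurable (pow_measure \<tau>)"
    by (rule measurable_tensor_sum(2)) (rule \<phi>)
  have m2: "(\<lambda>x. \<integral>\<^sup>+y. ennreal ((norm (tensor_sum N \<phi> (x(k := y))))\<^sup>2) \<partial>\<D> \<tau>) \<in> borel_measurable (slice_measure \<tau> k)"
  proof (rule sigma_finite_measure.borel_measurable_nn_integral)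
    show "sigma_finite_measure (\<D> \<tau>)" by (rule finite_measure.axioms(1)[OF delay_finite_measure[OF \<tau>]])
    show "(\<lambda>(x, y). ennreal ((norm (tensor_sum N \<phi> (x(k := y))))\<^sup>2)) \<in> borel_measurable (slice_measure \<tau> k \<Otimes>\<^sub>M \<D> \<tau>)"
      using measurable_compose[OF measurable_slice_pair m] by (simp add: case_prod_beta')
  qed
  have "(\<integral>\<^sup>+x. l2sq Z (\<lambda>z. \<Sum>i<N. elem_tensor ((\<phi> i)(k := \<lambda>_. Y i z)) x) \<partial>slice_measure \<tau> k)
    \<le> (\<integral>\<^sup>+x. B * l2sq (\<D> \<tau>) (\<lambda>y. tensor_sum N \<phi> (x(k := y))) \<partial>slice_measure \<tau> k)"
    by (intro nn_integral_mono pt)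
  also have "\<dots> = B * l2sq (pow_measure \<tau>) (tensor_sum N \<phi>)"
    unfolding nn_integral_cmult[OF m2] nn_integral_slice(1)[OF \<tau> m, of k] ..
  finally show ?thesis .
qed

text \<open>T tensored with identities inherits the bound of T. This is \<open>slot_bound\<close>
  with \<open>delay_measure\<close> in the role of Z; linearity of T supplies the estimate for all
  scalar combinations.\<close>

lemma slot_op_bound:
  fixes \<phi> :: "nat \<Rightarrow> 'm::finite \<Rightarrow> real \<Rightarrow> real^'n::finite"
  assumes \<tau>: "0 < \<tau>" and \<phi>: "\<And>i l. i < N \<Longrightarrow> \<phi> i l \<in> L2 (\<D> \<tau>)"
    and T: "bounded_op (\<D> \<tau>) (L2 (\<D> \<tau>)) T"
    and K: "\<And>f. f \<in> L2 (\<D> \<tau>) \<Longrightarrow> l2norm (\<D> \<tau>) (T f) \<le> K * l2norm (\<D> \<tau>) f"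
  shows "l2sq (pow_measure \<tau>) (\<lambda>\<theta>. \<Sum>i<N. elem_tensor ((\<phi> i)(k := T (\<phi> i k))) \<theta>)
    \<le> ennreal (K\<^sup>2) * l2sq (pow_measure \<tau>) (tensor_sum N \<phi>)"
proof -
  note T_L2 = bounded_opD(1)[OF T]
  have m: "(\<lambda>\<theta>. ennreal ((norm (\<Sum>i<N. elem_tensor ((\<phi> i)(k := T (\<phi> i k))) \<theta>))\<^sup>2)) \<in> borel_measurable (pow_measure \<tau>)"
    using L2_measurable[OF \<phi>] L2_measurable[OF T_L2[OF \<phi>]]
    by (intro measurable_tensor_sum(2)) (simp split: if_split)
  have "(\<integral>\<^sup>+x. l2sq (\<D> \<tau>) (\<lambda>z. \<Sum>i<N. elem_tensor ((\<phi> i)(k := \<lambda>_. T (\<phi> i k) z)) x) \<partial>slice_measure \<tau> k)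
    \<le> ennreal (K\<^sup>2) * l2sq (pow_measure \<tau>) (tensor_sum N \<phi>)"
  proof (rule slot_bound[OF \<tau>])
    show "i < N \<Longrightarrow> \<phi> i l \<in> borel_measurable (\<D> \<tau>)" for i l by (rule L2_measurable[OF \<phi>])
    show "i < N \<Longrightarrow> T (\<phi> i k) \<in> borel_measurable (\<D> \<tau>)" for i by (rule L2_measurable[OF T_L2[OF \<phi>]])
    fix c :: "nat \<Rightarrow> real"
    let ?s = "\<lambda>y. \<Sum>i<N. c i *\<^sub>R \<phi> i k y"
    have s: "?s \<in> L2 (\<D> \<tau>)" "AE x in \<D> \<tau>. T ?s x = (\<Sum>i<N. c i *\<^sub>R T (\<phi> i k) x)"
      using bounded_op_sum[OF L2_subspace_L2 T, of N "\<lambda>i. \<phi> i k" c] \<phi> by auto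
    have "l2sq (\<D> \<tau>) (\<lambda>z. \<Sum>i<N. c i *\<^sub>R T (\<phi> i k) z) = l2sq (\<D> \<tau>) (T ?s)"
      using s(2) by (intro nn_integral_cong_AE) auto
    also have "\<dots> = ennreal ((l2norm (\<D> \<tau>) (T ?s))\<^sup>2)" by (rule L2_nn_integral[OF T_L2[OF s(1)]])
    also have "\<dots> \<le> ennreal ((K * l2norm (\<D> \<tau>) ?s)\<^sup>2)"
      by (intro ennreal_leI power_mono K s) simp
    also have "\<dots> = ennreal (K\<^sup>2) * l2sq (\<D> \<tau>) ?s"
      by (simp add: L2_nn_integral[OF s(1)] power_mult_distrib ennreal_mult)
    finally show "l2sq (\<D> \<tau>) (\<lambda>z. \<Sum>i<N. c i *\<^sub>R T (\<phi> i k) z)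
      \<le> ennreal (K\<^sup>2) * l2sq (\<D> \<tau>) ?s" .
  qed
  then show ?thesis
    by (subst nn_integral_slice(1)[OF \<tau> m, of k]) (simp add: elem_tensor_fun_upd)
qed

text \<open>The slots are treated one at a time, each at the price K^2. Estimating the summands of
  the tensor separately would not leave the norm of the whole sum on the right.\<close>

lemma slots_op_bound:
  fixes \<phi> :: "nat \<Rightarrow> 'm::finite \<Rightarrow> real \<Rightarrow> real^'n::finite"
  assumes \<tau>: "0 < \<tau>" and \<phi>: "\<And>i l. i < N \<Longrightarrow> \<phi> i l \<in> L2 (\<D> \<tau>)"
    and T: "bounded_op (\<D> \<tau>) (L2 (\<D> \<tau>)) T"
    and K: "\<And>f. f \<in> L2 (\<D> \<tau>) \<Longrightarrow> l2norm (\<D> \<tau>) (T f) \<le> K * l2norm (\<D> \<tau>) f"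
  shows "l2sq (pow_measure \<tau>) (\<lambda>\<theta>. \<Sum>i<N. elem_tensor (\<lambda>l. if l \<in> S then T (\<phi> i l) else \<phi> i l) \<theta>)
    \<le> ennreal ((K\<^sup>2) ^ card S) * l2sq (pow_measure \<tau>) (tensor_sum N \<phi>)"
  using finite[of S]
proof (induction S rule: finite_induct)
  case (insert k S)
  let ?\<psi> = "\<lambda>i l. if l \<in> S then T (\<phi> i l) else \<phi> i l"
  have upd: "(\<lambda>l. if l \<in> insert k S then T (\<phi> i l) else \<phi> i l) = (?\<psi> i)(k := T (?\<psi> i k))" for i
    using insert(2) by auto
  have "l2sq (pow_measure \<tau>) (\<lambda>\<theta>. \<Sum>i<N. elem_tensor ((?\<psi> i)(k := T (?\<psi> i k))) \<theta>)
    \<le> ennreal (K\<^sup>2) * l2sq (pow_measure \<tau>) (\<lambda>\<theta>. \<Sum>i<N. elem_tensor (?\<psi> i) \<theta>)"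
    by (rule slot_op_bound[OF \<tau> _ T K]) (use \<phi> bounded_opD(1)[OF T] in auto)
  also have "\<dots> \<le> ennreal (K\<^sup>2) * (ennreal ((K\<^sup>2) ^ card S) * l2sq (pow_measure \<tau>) (tensor_sum N \<phi>))"
    by (intro mult_left_mono insert.IH) auto
  also have "\<dots> = ennreal ((K\<^sup>2) ^ card (insert k S)) * l2sq (pow_measure \<tau>) (tensor_sum N \<phi>)"
    using insert by (simp add: ennreal_mult mult.assoc)
  finally show ?case unfolding upd .
qed simp

section \<open>Square-integrable traces of trajectories\<close>

abbreviation time_measure :: "real \<Rightarrow> real measure" where
  "time_measure \<tau> \<equiv> restrict_space lborel {0..\<tau>}"

lemma sigma_finite_time_measure: "sigma_finite_measure (time_measure \<tau>)"
  by (rule finite_measure.axioms(1), rule finite_measureI, cases "0 \<le> \<tau>")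
    (simp_all add: emeasure_restrict_space space_restrict_space)

lemma borel_measurable_time [measurable (raw)]: "f \<in> borel_measurable borel \<Longrightarrow> f \<in> borel_measurable (time_measure \<tau>)"
  by (rule measurable_restrict_space1) simp

lemma measurable_fst_time: "(\<lambda>p. snd p) \<in> borel_measurable (M \<Otimes>\<^sub>M time_measure \<tau>)"
  by (rule measurable_compose[OF measurable_snd borel_measurable_time]) simp

lemma borel_measurable_delay_ident: "(\<lambda>x. x) \<in> borel_measurable (\<D> \<tau>)"
  by (rule measurable_delay_borel) simp

text \<open>The ignored coordinate contributes the total mass \<tau> + 1 of
  \<open>delay_measure\<close>. In this way estimates on the full product can be used on a slice,
  where the factor cancels.\<close>

lemma nn_integral_slice_const_slot:
  fixes F :: "('m::finite \<Rightarrow> real) \<Rightarrow> ennreal"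
  assumes \<tau>: "0 < \<tau>" and F: "F \<in> borel_measurable (pow_measure \<tau>)" and indep: "\<And>x y. F (x(j := y)) = F x"
  shows "(\<integral>\<^sup>+\<theta>. F \<theta> \<partial>pow_measure \<tau>) = ennreal (\<tau> + 1) * (\<integral>\<^sup>+x. F x \<partial>slice_measure \<tau> j)"
proof -
  have "F = (\<lambda>x. F (x(j := 0)))" by (simp add: indep)
  moreover have "(\<lambda>x. F (x(j := 0))) \<in> borel_measurable (slice_measure \<tau> j)"
    by (rule measurable_compose[OF measurable_slice F]) (use \<tau> in simp)
  ultimately have m: "F \<in> borel_measurable (slice_measure \<tau> j)" by simp
  show ?thesis
    by (subst nn_integral_slice(1)[OF \<tau> F, of j])
      (simp add: indep finite_measure_delay[OF \<tau>] nn_integral_cmult[OF m, symmetric] mult.commute)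
qed

context delay_semigroup
begin

lemma trajD:
  assumes "is_traj \<phi> X"
  shows "\<phi> \<in> L2 (\<D> \<tau>)" "continuous_on UNIV X" "bounded (range X)"
    "t \<in> {0..\<tau>} \<Longrightarrow> AE \<theta> in \<D> \<tau>. G t \<phi> \<theta> = X (t + \<theta>)" "X \<in> borel_measurable borel"
  using assms by (auto simp: is_traj_def intro: borel_measurable_continuous_onI)

text \<open>\<open>slot_bound\<close> asks for estimates of all linear combinations of a factor;
  these are again trajectories.\<close>

lemma traj_sum:
  fixes N :: nat
  assumes "\<And>i. i < N \<Longrightarrow> is_traj (\<phi> i) (X i)"
  shows "is_traj (\<lambda>\<theta>. \<Sum>i<N. c i *\<^sub>R \<phi> i \<theta>) (\<lambda>s. \<Sum>i<N. c i *\<^sub>R X i s)"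
  unfolding is_traj_def
proof (intro conjI ballI)
  note D = trajD[OF assms]
  show "(\<lambda>\<theta>. \<Sum>i<N. c i *\<^sub>R \<phi> i \<theta>) \<in> L2 (\<D> \<tau>)" by (intro L2_sum L2_scaleR D(1)) auto
  show "continuous_on UNIV (\<lambda>s. \<Sum>i<N. c i *\<^sub>R X i s)" by (intro continuous_intros D(2)) auto
  have "N' \<le> N \<Longrightarrow> bounded (range (\<lambda>s. \<Sum>i<N'. c i *\<^sub>R X i s))" for N'
  proof (induction N')
    case (Suc N')
    then show ?case using bounded_plus_comp[OF _ bounded_scaleR_comp[OF D(3)[of N']]] by simp
  qed simp
  then show "bounded (range (\<lambda>s. \<Sum>i<N. c i *\<^sub>R X i s))" by simp
  fix t assume t: "t \<in> {0..\<tau>}"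
  have "AE x in \<D> \<tau>. \<forall>i\<in>{..<N}. G t (\<phi> i) x = X i (t + x)"
    by (intro AE_finite_allI) (use D(4)[OF _ t] in auto)
  moreover have "AE x in \<D> \<tau>. G t (\<lambda>y. \<Sum>i<N. c i *\<^sub>R \<phi> i y) x = (\<Sum>i<N. c i *\<^sub>R G t (\<phi> i) x)"
    using bounded_op_sum[OF L2_subspace_L2 G.op, of t N \<phi> c] t D(1) by auto
  ultimately show "AE \<theta> in \<D> \<tau>. G t (\<lambda>\<theta>. \<Sum>i<N. c i *\<^sub>R \<phi> i \<theta>) \<theta> = (\<Sum>i<N. c i *\<^sub>R X i (t + \<theta>))"
    by eventually_elim simp
qed

definition GK :: real where
  "GK = (SOME K. K \<ge> 1 \<and> (\<forall>t\<in>{0..\<tau>}. \<forall>f\<in>L2 (\<D> \<tau>). l2norm (\<D> \<tau>) (G t f) \<le> K * l2norm (\<D> \<tau>) f))"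

lemma GK: "GK \<ge> 1" "\<And>t f. t \<in> {0..\<tau>} \<Longrightarrow> f \<in> L2 (\<D> \<tau>) \<Longrightarrow> l2norm (\<D> \<tau>) (G t f) \<le> GK * l2norm (\<D> \<tau>) f"
proof -
  have "\<exists>K. K \<ge> 1 \<and> (\<forall>t\<in>{0..\<tau>}. \<forall>f\<in>L2 (\<D> \<tau>). l2norm (\<D> \<tau>) (G t f) \<le> K * l2norm (\<D> \<tau>) f)"
  proof (rule G.uniform_bound[of \<tau>])
    fix K :: real
    assume "1 \<le> K" and "\<And>t f. t \<in> {0..\<tau>} \<Longrightarrow> f \<in> L2 (\<D> \<tau>) \<Longrightarrow> l2norm (\<D> \<tau>) (G t f) \<le> K * l2norm (\<D> \<tau>) f"
    then show ?thesis by (intro exI[of _ K]) simp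
  qed
  then have "GK \<ge> 1 \<and> (\<forall>t\<in>{0..\<tau>}. \<forall>f\<in>L2 (\<D> \<tau>). l2norm (\<D> \<tau>) (G t f) \<le> GK * l2norm (\<D> \<tau>) f)"
    unfolding GK_def by (rule someI_ex)
  then show "GK \<ge> 1" "\<And>t f. t \<in> {0..\<tau>} \<Longrightarrow> f \<in> L2 (\<D> \<tau>) \<Longrightarrow> l2norm (\<D> \<tau>) (G t f) \<le> GK * l2norm (\<D> \<tau>) f"
    by auto
qed

text \<open>For t in [0,\<tau>] the argument t + s sweeps a window inside [-\<tau>,\<tau>]. Up to
  null sets (-\<tau>,0) and (0,\<tau>) cover it, and there X is the segment at time 0 and at time
  \<tau>. Each contributes at most \<open>GK\<^sup>2\<close> times the squared norm of \<phi>,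
  whence the factor 2.\<close>

lemma traj_integral:
  assumes X: "is_traj \<phi> X" and s: "s \<in> {-\<tau>..0}"
  shows "l2sq (time_measure \<tau>) (\<lambda>t. X (t + s))
    \<le> ennreal (2 * GK\<^sup>2) * l2sq (\<D> \<tau>) \<phi>"
proof -
  note D = trajD[OF X]
  note [measurable] = D(5)
  let ?h = "\<lambda>u. ennreal ((norm (X u))\<^sup>2)"
  have half: "(\<integral>\<^sup>+\<theta>. ?h (t + \<theta>) \<partial>leb \<tau>) \<le> ennreal (GK\<^sup>2) * l2sq (\<D> \<tau>) \<phi>"
    if t: "t \<in> {0..\<tau>}" for t
  proof -
    have G: "G t \<phi> \<in> L2 (\<D> \<tau>)" using t D(1) by (intro G.G_mem) auto
    have "(\<integral>\<^sup>+\<theta>. ?h (t + \<theta>) \<partial>leb \<tau>) \<le> (\<integral>\<^sup>+\<theta>. ?h (t + \<theta>) \<partial>\<D> \<tau>)"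
      by (intro nn_integral_leb_le_delay \<tau> measurable_delay_borel) simp
    also have "\<dots> = l2sq (\<D> \<tau>) (G t \<phi>)"
      using D(4)[OF t] by (intro nn_integral_cong_AE) auto
    also have "\<dots> = ennreal ((l2norm (\<D> \<tau>) (G t \<phi>))\<^sup>2)" by (rule L2_nn_integral[OF G])
    also have "\<dots> \<le> ennreal ((GK * l2norm (\<D> \<tau>) \<phi>)\<^sup>2)"
      by (intro ennreal_leI power_mono GK t D(1)) simp
    also have "\<dots> = ennreal (GK\<^sup>2) * l2sq (\<D> \<tau>) \<phi>"
      by (simp add: L2_nn_integral[OF D(1)] power_mult_distrib ennreal_mult)
    finally show ?thesis .
  qed
  have "(\<integral>\<^sup>+t. ?h (t + s) \<partial>time_measure \<tau>) = (\<integral>\<^sup>+t. ?h (t + s) * indicator {0..\<tau>} t \<partial>lborel)"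
    by (subst nn_integral_restrict_space) simp_all
  also have "\<dots> = (\<integral>\<^sup>+u. ?h u * indicator {s..\<tau> + s} u \<partial>lborel)"
    by (subst (2) nn_integral_real_affine[of _ 1 s])
      (auto simp: add.commute intro!: nn_integral_cong split: split_indicator)
  also have "\<dots> \<le> (\<integral>\<^sup>+u. ?h u * indicator {-\<tau><..<0} u + ?h u * indicator {0<..<\<tau>} u \<partial>lborel)"
  proof (rule nn_integral_mono_AE)
    have "AE u in lborel. u \<notin> {-\<tau>, 0, \<tau>}" by (intro AE_not_in finite_imp_null_set_lborel) auto
    then show "AE u in lborel. ?h u * indicator {s..\<tau> + s} u \<le> ?h u * indicator {-\<tau><..<0} u + ?h u * indicator {0<..<\<tau>} u"
      by eventually_elim (use s in \<open>auto split: split_indicator\<close>)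
  qed
  also have "\<dots> = (\<integral>\<^sup>+u. ?h u * indicator {-\<tau><..<0} u \<partial>lborel) + (\<integral>\<^sup>+u. ?h u * indicator {0<..<\<tau>} u \<partial>lborel)"
    by (rule nn_integral_add) auto
  also have "(\<integral>\<^sup>+u. ?h u * indicator {0<..<\<tau>} u \<partial>lborel) = (\<integral>\<^sup>+u. ?h (\<tau> + u) * indicator {-\<tau><..<0} u \<partial>lborel)"
    by (subst nn_integral_real_affine[of _ 1 \<tau>])
      (auto intro!: nn_integral_cong split: split_indicator)
  also have "(\<integral>\<^sup>+u. ?h u * indicator {-\<tau><..<0} u \<partial>lborel) = (\<integral>\<^sup>+\<theta>. ?h (0 + \<theta>) \<partial>leb \<tau>)"
    by (subst nn_integral_leb) (auto intro!: measurable_leb_borel)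
  also have "(\<integral>\<^sup>+u. ?h (\<tau> + u) * indicator {-\<tau><..<0} u \<partial>lborel) = (\<integral>\<^sup>+\<theta>. ?h (\<tau> + \<theta>) \<partial>leb \<tau>)"
    by (subst nn_integral_leb) (auto intro!: measurable_leb_borel)
  also have "(\<integral>\<^sup>+\<theta>. ?h (0 + \<theta>) \<partial>leb \<tau>) + (\<integral>\<^sup>+\<theta>. ?h (\<tau> + \<theta>) \<partial>leb \<tau>)
    \<le> ennreal (GK\<^sup>2) * l2sq (\<D> \<tau>) \<phi>
      + ennreal (GK\<^sup>2) * l2sq (\<D> \<tau>) \<phi>"
    by (intro add_mono half) (use \<tau> in auto)
  also have "\<dots> = ennreal (2 * GK\<^sup>2) * l2sq (\<D> \<tau>) \<phi>"
    by (simp add: distrib_right[symmetric] ennreal_plus[symmetric] del: ennreal_plus)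
  finally show ?thesis .
qed

text \<open>At a fixed t the slots other than j carry \<open>G t\<close>, bounded by
  \<open>GK\<close> each, while slot j holds a vector that is constant in space. After this
  reduction the integral over t sees only a trajectory window in slot j, which costs twice
  \<open>GK\<^sup>2\<close>. Tonelli switches between the two orders of integration.\<close>

lemma trace_bound:
  fixes \<phi> :: "nat \<Rightarrow> 'm::finite \<Rightarrow> real \<Rightarrow> real^'n" and X :: "nat \<Rightarrow> 'm \<Rightarrow> real \<Rightarrow> real^'n" and j :: 'm
  assumes X: "\<And>i l. i < N \<Longrightarrow> is_traj (\<phi> i l) (X i l)" and s: "s \<in> {-\<tau>..0}"
  shows "(\<integral>\<^sup>+x. l2sq (time_measure \<tau>) (\<lambda>t. translate_sum N X t (x(j := s))) \<partial>slice_measure \<tau> j)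
    \<le> ennreal ((GK\<^sup>2) ^ card (UNIV - {j}) * (2 * GK\<^sup>2)) * l2sq (pow_measure \<tau>) (tensor_sum N \<phi>)"
proof -
  note D = trajD[OF X]
  let ?S = "slice_measure \<tau> j" and ?T = "time_measure \<tau>" and ?KS = "ennreal ((GK\<^sup>2) ^ card (UNIV - {j}))"
  interpret S: sigma_finite_measure ?S by (rule sigma_finite_slice[OF \<tau>])
  interpret T: sigma_finite_measure ?T by (rule sigma_finite_time_measure)
  interpret P: pair_sigma_finite ?S ?T ..
  have comp_d: "(\<lambda>p. fst p l) \<in> measurable (?S \<Otimes>\<^sub>M ?T) (\<D> \<tau>)" if "l \<noteq> j" for l
    by (rule measurable_compose[OF measurable_fst measurable_component_singleton]) (use that in auto)
  have comp_m: "(\<lambda>p. fst p l) \<in> borel_measurable (?S \<Otimes>\<^sub>M ?T)" if "l \<noteq> j" for l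
    by (rule measurable_compose[OF comp_d[OF that] borel_measurable_delay_ident])
  have mX: "(\<lambda>p. X i l (snd p + (if l = j then s else fst p l)) $ a) \<in> borel_measurable (?S \<Otimes>\<^sub>M ?T)" if "i < N" for i l a
    by (intro borel_measurable_vec_nth' measurable_compose[OF _ D(5)[OF that]] borel_measurable_add measurable_fst_time)
      (use comp_m in \<open>cases "l = j"; simp\<close>)
  have m1: "(\<lambda>p. ennreal ((norm (\<Sum>i<N. elem_tensor (\<lambda>l \<theta>. X i l (snd p + \<theta>)) ((fst p)(j := s))))\<^sup>2)) \<in> borel_measurable (?S \<Otimes>\<^sub>M ?T)"
  proof -
    have [measurable]: "(\<lambda>p. \<Sum>i<N. elem_tensor (\<lambda>l \<theta>. X i l (snd p + \<theta>)) ((fst p)(j := s))) \<in> borel_measurable (?S \<Otimes>\<^sub>M ?T)"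
      unfolding elem_tensor_def
      by (intro borel_measurable_sum borel_measurable_vec_lambda borel_measurable_prod) (use mX in \<open>simp add: fun_upd_def\<close>)
    show ?thesis by measurable
  qed
  have mC: "(\<lambda>p. ennreal ((norm (\<Sum>i<N. elem_tensor ((\<phi> i)(j := \<lambda>_. X i j (snd p + s))) (fst p)))\<^sup>2)) \<in> borel_measurable (?S \<Otimes>\<^sub>M ?T)"
  proof -
    have c: "(\<lambda>p. ((\<phi> i)(j := \<lambda>_. X i j (snd p + s))) l (fst p l) $ a) \<in> borel_measurable (?S \<Otimes>\<^sub>M ?T)" if i: "i < N" for i l a
    proof (cases "l = j")
      case True
      then show ?thesis using mX[OF i, of j a] by simp
    next
      case False
      have "(\<lambda>p. \<phi> i l (fst p l) $ a) \<in> borel_measurable (?S \<Otimes>\<^sub>M ?T)"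
        by (intro borel_measurable_vec_nth' measurable_compose[OF comp_d[OF False] L2_measurable[OF D(1)[OF i]]])
      then show ?thesis using False by simp
    qed
    have [measurable]: "(\<lambda>p. \<Sum>i<N. elem_tensor ((\<phi> i)(j := \<lambda>_. X i j (snd p + s))) (fst p)) \<in> borel_measurable (?S \<Otimes>\<^sub>M ?T)"
      unfolding elem_tensor_def
      by (intro borel_measurable_sum borel_measurable_vec_lambda borel_measurable_prod c) simp
    show ?thesis by measurable
  qed
  have inner: "l2sq ?S (\<lambda>x. translate_sum N X t (x(j := s)))
    \<le> ?KS * l2sq ?S (\<lambda>x. \<Sum>i<N. elem_tensor ((\<phi> i)(j := \<lambda>_. X i j (t + s))) x)"
    if t: "t \<in> {0..\<tau>}" for t
  proof -
    \<comment> \<open>Slot j is filled with a constant function, so that the operator bound on the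
      full product can be used although j is frozen.\<close>
    define \<psi> where "\<psi> = (\<lambda>i. (\<phi> i)(j := \<lambda>_. X i j (t + s)))"
    define \<psi>' where "\<psi>' = (\<lambda>i l. if l \<in> UNIV - {j} then G t (\<psi> i l) else \<psi> i l)"
    have constL: "(\<lambda>_. v) \<in> L2 (\<D> \<tau>)" for v :: "real^'n"
      by (rule bounded_measurable_L2(1)[OF delay_finite_measure[OF \<tau>], of _ "norm v"]) auto
    have \<psi>L: "\<psi> i l \<in> L2 (\<D> \<tau>)" if "i < N" for i l
      using D(1)[OF that] constL by (simp add: \<psi>_def)
    have \<psi>'L: "\<psi>' i l \<in> L2 (\<D> \<tau>)" if "i < N" for i l
      using \<psi>L[OF that] t by (auto simp: \<psi>'_def intro!: G.G_mem)
    have ind: "elem_tensor (\<psi> i) (x(j := y)) = elem_tensor (\<psi> i) x" "elem_tensor (\<psi>' i) (x(j := y)) = elem_tensor (\<psi>' i) x" for i x y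
      using elem_tensor_fun_upd[of "\<psi> i" j "\<lambda>_. X i j (t + s)" x y] elem_tensor_fun_upd[of "\<psi>' i" j "\<lambda>_. X i j (t + s)" x y]
      by (simp_all add: \<psi>_def \<psi>'_def fun_upd_idem)
    have m\<psi>: "(\<lambda>x. ennreal ((norm (tensor_sum N \<psi> x))\<^sup>2)) \<in> borel_measurable (pow_measure \<tau>)"
      "(\<lambda>x. ennreal ((norm (tensor_sum N \<psi>' x))\<^sup>2)) \<in> borel_measurable (pow_measure \<tau>)"
      by (intro measurable_tensor_sum(2) L2_measurable[OF \<psi>L] L2_measurable[OF \<psi>'L]; assumption)+
    have "ennreal (\<tau> + 1) * l2sq ?S (tensor_sum N \<psi>')
      = l2sq (pow_measure \<tau>) (tensor_sum N \<psi>')"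
      by (rule nn_integral_slice_const_slot[OF \<tau> m\<psi>(2), symmetric]) (simp add: ind)
    also have "\<dots> \<le> ?KS * l2sq (pow_measure \<tau>) (tensor_sum N \<psi>)"
      unfolding \<psi>'_def by (rule slots_op_bound[OF \<tau> \<psi>L]) (use t GK(2) in \<open>auto intro: G.op\<close>)
    also have "l2sq (pow_measure \<tau>) (tensor_sum N \<psi>)
      = ennreal (\<tau> + 1) * l2sq ?S (tensor_sum N \<psi>)"
      by (rule nn_integral_slice_const_slot[OF \<tau> m\<psi>(1)]) (simp add: ind)
    finally have le: "l2sq ?S (tensor_sum N \<psi>')
      \<le> ?KS * l2sq ?S (tensor_sum N \<psi>)"
      unfolding mult.left_commute[of ?KS] by (subst (asm) ennreal_mult_le_mult_iff) (use \<tau> in auto)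
    have "AE x in ?S. \<forall>p\<in>{..<N} \<times> (UNIV - {j}). G t (\<phi> (fst p) (snd p)) (x (snd p)) = X (fst p) (snd p) (t + x (snd p))"
      by (intro AE_finite_allI) (auto intro!: AE_component[OF \<tau>] D(4)[OF _ t])
    then have "AE x in ?S. (translate_sum N X t (x(j := s))) = (tensor_sum N \<psi>' x)"
    proof eventually_elim
      case (elim x)
      show ?case
      proof (intro sum.cong refl)
        fix i assume i: "i \<in> {..<N}"
        have "X i l (t + (x(j := s)) l) = \<psi>' i l (x l)" for l
          using elim i by (cases "l = j") (auto simp: \<psi>'_def \<psi>_def dest!: bspec[of _ _ "(i, l)"])
        then show "elem_tensor (\<lambda>l \<theta>. X i l (t + \<theta>)) (x(j := s)) = elem_tensor (\<psi>' i) x"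
          by (simp only: elem_tensor_def)
      qed
    qed
    then have "l2sq ?S (\<lambda>x. translate_sum N X t (x(j := s)))
      = l2sq ?S (tensor_sum N \<psi>')"
      by (intro nn_integral_cong_AE) auto
    then show ?thesis using le by (simp add: \<psi>_def)
  qed
  have "(\<integral>\<^sup>+x. l2sq ?T (\<lambda>t. translate_sum N X t (x(j := s))) \<partial>?S)
    = (\<integral>\<^sup>+t. l2sq ?S (\<lambda>x. translate_sum N X t (x(j := s))) \<partial>?T)"
    using P.Fubini'[symmetric] m1 by (simp add: case_prod_beta')
  also have "\<dots> \<le> (\<integral>\<^sup>+t. ?KS * l2sq ?S (\<lambda>x. \<Sum>i<N. elem_tensor ((\<phi> i)(j := \<lambda>_. X i j (t + s))) x) \<partial>?T)"
    by (intro nn_integral_mono inner) (simp add: space_restrict_space)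
  also have "\<dots> = ?KS * (\<integral>\<^sup>+t. l2sq ?S (\<lambda>x. \<Sum>i<N. elem_tensor ((\<phi> i)(j := \<lambda>_. X i j (t + s))) x) \<partial>?T)"
  proof (rule nn_integral_cmult)
    show "(\<lambda>t. \<integral>\<^sup>+x. ennreal ((norm (\<Sum>i<N. elem_tensor ((\<phi> i)(j := \<lambda>_. X i j (t + s))) x))\<^sup>2) \<partial>?S) \<in> borel_measurable ?T"
      using S.borel_measurable_nn_integral[of "\<lambda>t x. ennreal ((norm (\<Sum>i<N. elem_tensor ((\<phi> i)(j := \<lambda>_. X i j (t + s))) x))\<^sup>2)" ?T]
        measurable_compose[OF measurable_pair_swap' mC] by (simp add: case_prod_beta')
  qed
  also have "(\<integral>\<^sup>+t. l2sq ?S (\<lambda>x. \<Sum>i<N. elem_tensor ((\<phi> i)(j := \<lambda>_. X i j (t + s))) x) \<partial>?T)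
    = (\<integral>\<^sup>+x. l2sq ?T (\<lambda>t. \<Sum>i<N. elem_tensor ((\<phi> i)(j := \<lambda>_. X i j (t + s))) x) \<partial>?S)"
    using P.Fubini' mC by (simp add: case_prod_beta')
  \<comment> \<open>The roles are exchanged here: the other slots act as coefficients and slot j is
    integrated over t.\<close>
  also have "?KS * \<dots> \<le> ?KS * (ennreal (2 * GK\<^sup>2) * l2sq (pow_measure \<tau>) (tensor_sum N \<phi>))"
  proof (intro mult_left_mono slot_bound[OF \<tau>])
    show "i < N \<Longrightarrow> \<phi> i l \<in> borel_measurable (\<D> \<tau>)" for i l by (rule L2_measurable[OF D(1)])
    show "i < N \<Longrightarrow> (\<lambda>t. X i j (t + s)) \<in> borel_measurable ?T" for i
      by (intro borel_measurable_time measurable_compose[OF _ D(5)]) simp_all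
    show "l2sq ?T (\<lambda>t. \<Sum>i<N. c i *\<^sub>R X i j (t + s))
      \<le> ennreal (2 * GK\<^sup>2) * l2sq (\<D> \<tau>) (\<lambda>y. \<Sum>i<N. c i *\<^sub>R \<phi> i j y)" for c
      by (rule traj_integral[OF traj_sum s]) (rule X)
  qed simp
  also have "\<dots> = ennreal ((GK\<^sup>2) ^ card (UNIV - {j}) * (2 * GK\<^sup>2)) * l2sq (pow_measure \<tau>) (tensor_sum N \<phi>)"
    by (subst ennreal_mult) (simp_all only: mult.assoc, simp_all)
  finally show ?thesis .
qed

end

section \<open>Density of elementary tensors and of tensors built from trajectories\<close>

lemma L2_dominated_limit:
  fixes F :: "nat \<Rightarrow> 'a \<Rightarrow> 'b::euclidean_space"
  assumes F: "\<And>n. F n \<in> borel_measurable M" and f: "f \<in> borel_measurable M"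
    and lim: "AE x in M. (\<lambda>n. F n x) \<longlonglongrightarrow> f x"
    and g: "g \<in> L2 M" and dom: "\<And>n. AE x in M. norm (F n x - f x) \<le> norm (g x :: 'c::euclidean_space)"
  shows "(\<lambda>n. l2norm M (\<lambda>x. F n x - f x)) \<longlonglongrightarrow> 0"
proof -
  note [measurable] = F f
  have "(\<lambda>n. \<integral>x. (norm (F n x - f x))\<^sup>2 \<partial>M) \<longlonglongrightarrow> (\<integral>x. 0 \<partial>M)"
  proof (rule integral_dominated_convergence[where w = "\<lambda>x. (norm (g x))\<^sup>2"])
    show "integrable M (\<lambda>x. (norm (g x))\<^sup>2)" by (rule L2_integrable[OF g])
    show "AE x in M. (\<lambda>n. (norm (F n x - f x))\<^sup>2) \<longlonglongrightarrow> 0"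
      using lim
    proof eventually_elim
      case (elim x)
      have "(\<lambda>n. (norm (F n x - f x))\<^sup>2) \<longlonglongrightarrow> (norm (f x - f x))\<^sup>2" by (intro tendsto_intros elim)
      then show ?case by simp
    qed
    show "AE x in M. norm ((norm (F n x - f x))\<^sup>2) \<le> (norm (g x))\<^sup>2" for n
      using dom[of n] by eventually_elim (simp add: power_mono)
  qed measurable
  then have "(\<lambda>n. sqrt (\<integral>x. (norm (F n x - f x))\<^sup>2 \<partial>M)) \<longlonglongrightarrow> sqrt 0" by (intro tendsto_real_sqrt) simp
  then show ?thesis by (simp add: l2norm_def)
qed

lemma PiM_delay_finite_measure:
  assumes \<tau>: "0 < \<tau>" and A: "finite A" shows "finite_measure (PiM A (\<lambda>_. \<D> \<tau>))"
proof (rule finite_measureI)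
  interpret D: product_sigma_finite "\<lambda>_. \<D> \<tau>" by (rule product_sigma_finite_delay[OF \<tau>])
  show "emeasure (PiM A (\<lambda>_. \<D> \<tau>)) (space (PiM A (\<lambda>_. \<D> \<tau>))) \<noteq> \<infinity>"
    unfolding space_PiM by (subst D.emeasure_PiM[OF A sets.top])
      (use \<tau> in \<open>simp add: finite_measure_delay[OF \<tau>] ennreal_power del: ennreal_plus\<close>)
qed

lemma pow_finite_measure: "0 < \<tau> \<Longrightarrow> finite_measure (pow_measure \<tau>)"
  unfolding pow_measure_def by (rule PiM_delay_finite_measure) simp_all

lemma slice_finite_measure: "0 < \<tau> \<Longrightarrow> finite_measure (slice_measure \<tau> k)"
  by (rule PiM_delay_finite_measure) simp_all

text \<open>Density of the span of elementary tensors, cast as an induction rule. Indicators of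
  measurable boxes times basis vectors are elementary tensors. Boxes generate the sigma-algebra and
  are stable under intersection, so Dynkin's argument reaches all indicators, and from there simple
  and general functions follow.\<close>

lemma L_tensor_induct [consumes 2, case_names elem add scale limit]:
  fixes P :: "(('m::finite \<Rightarrow> real) \<Rightarrow> real^('m \<Rightarrow> 'n::finite)) \<Rightarrow> bool"
  assumes \<tau>: "0 < \<tau>" and \<Phi>: "\<Phi> \<in> L_tensor \<tau>"
    and elem: "\<And>\<phi>. (\<And>j. \<phi> j \<in> L2 (\<D> \<tau>)) \<Longrightarrow> P (elem_tensor \<phi>)"
    and add: "\<And>f g. f \<in> L_tensor \<tau> \<Longrightarrow> g \<in> L_tensor \<tau> \<Longrightarrow> P f \<Longrightarrow> P g \<Longrightarrow> P (\<lambda>u. f u + g u)"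
    and scale: "\<And>c f. f \<in> L_tensor \<tau> \<Longrightarrow> P f \<Longrightarrow> P (\<lambda>u. c *\<^sub>R f u)"
    and limit: "\<And>F f. (\<And>n. F n \<in> L_tensor \<tau>) \<Longrightarrow> (\<And>n. P (F n)) \<Longrightarrow> f \<in> L_tensor \<tau> \<Longrightarrow>
      (\<lambda>n. l2norm (pow_measure \<tau>) (\<lambda>u. F n u - f u)) \<longlonglongrightarrow> 0 \<Longrightarrow> P f"
  shows "P \<Phi>"
proof -
  let ?M = "pow_measure \<tau> :: ('m \<Rightarrow> real) measure"
  interpret finite_measure ?M by (rule pow_finite_measure[OF \<tau>])
  define Q where "Q f \<longleftrightarrow> f \<in> L_tensor \<tau> \<and> P f" for f
  have Qadd: "Q (\<lambda>u. f u + g u)" if "Q f" "Q g" for f g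
    using that add by (auto simp: Q_def L_tensor_def L2_add)
  have Qscale: "Q (\<lambda>u. c *\<^sub>R f u)" if "Q f" for f c
    using that scale by (auto simp: Q_def L_tensor_def L2_scaleR)
  have Qlimit: "Q f" if "\<And>n. Q (F n)" "f \<in> L_tensor \<tau>" "(\<lambda>n. l2norm ?M (\<lambda>u. F n u - f u)) \<longlonglongrightarrow> 0" for F f
    using that limit[of F f] by (auto simp: Q_def)
  have Q0: "Q (\<lambda>u. 0)"
  proof -
    have "Q (elem_tensor (\<lambda>j u. 0))" unfolding Q_def L_tensor_def by (intro conjI elem elem_tensor_L2(1)[OF \<tau>]) simp_all
    from Qscale[OF this, of 0] show ?thesis by simp
  qed
  have Qsum': "Q (\<lambda>u. \<Sum>i\<in>I. f i u)" if "\<And>i. i \<in> I \<Longrightarrow> Q (f i)" for I :: "('m \<Rightarrow> 'n) set" and f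
    using that by (induction I rule: infinite_finite_induct) (simp_all add: Q0 Qadd)
  have Qsum'': "Q (\<lambda>u. \<Sum>i\<in>I. f i u)" if "\<And>i. i \<in> I \<Longrightarrow> Q (f i)" for I :: "(real^('m \<Rightarrow> 'n)) set" and f
    using that by (induction I rule: infinite_finite_induct) (simp_all add: Q0 Qadd)
  have Qsum3: "Q (\<lambda>u. \<Sum>i\<in>I. f i u)" if "\<And>i. i \<in> I \<Longrightarrow> Q (f i)" for I :: "nat set" and f
    using that by (induction I rule: infinite_finite_induct) (simp_all add: Q0 Qadd)
  \<comment> \<open>Closure under limits, applied to a constant sequence, gives invariance under
    changes on null sets.\<close>
  have Qcong: "Q g" if "Q f" "g \<in> borel_measurable ?M" "AE u in ?M. f u = g u" for f g
  proof (rule Qlimit[of "\<lambda>_. f"])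
    have fL: "f \<in> L2 ?M" using that by (simp add: Q_def L_tensor_def)
    show "g \<in> L_tensor \<tau>" unfolding L_tensor_def by (rule L2_cong_AE[OF fL that(2,3)])
    then have "l2norm ?M (\<lambda>u. f u - g u) = 0"
      using that(3) fL by (subst l2norm_0_iff_AE) (auto simp: L_tensor_def L2_diff)
    then show "(\<lambda>n. l2norm ?M (\<lambda>u. f u - g u)) \<longlonglongrightarrow> 0" by simp
  qed (rule that(1))
  have indL: "(\<lambda>u. indicator E u *\<^sub>R v) \<in> L2 ?M" if "E \<in> sets ?M" for E and v :: "real^('m \<Rightarrow> 'n)"
    by (rule bounded_measurable_L2(1)[OF finite_measure_axioms, of _ "norm v"]) (use that in \<open>auto simp: indicator_def\<close>)
  have ind: "Q (\<lambda>u. indicator E u *\<^sub>R axis idx 1)" if E: "E \<in> sets ?M" for E idx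
  proof -
    let ?ind = "\<lambda>A u. indicator A u *\<^sub>R axis idx 1 :: real^('m \<Rightarrow> 'n)"
    have sp: "space ?M = (\<Pi>\<^sub>E i\<in>UNIV. space (\<D> \<tau>))" by (simp add: pow_measure_def space_PiM)
    have E': "E \<in> sigma_sets (\<Pi>\<^sub>E i\<in>UNIV. space (\<D> \<tau>)) (prod_algebra UNIV (\<lambda>_. \<D> \<tau>))"
      using E by (simp add: pow_measure_def sets_PiM)
    have rect: "Q (?ind A)" if "A \<in> prod_algebra UNIV (\<lambda>_::'m. \<D> \<tau>)" for A
    proof -
      from that obtain B where B: "A = PiE UNIV B" "\<And>j. B j \<in> sets (\<D> \<tau>)"
        by (auto simp: prod_algebra_eq_finite)
      interpret D: finite_measure "\<D> \<tau>" by (rule delay_finite_measure[OF \<tau>])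
      let ?\<phi> = "\<lambda>j y. indicator (B j) y *\<^sub>R axis (idx j) 1 :: real^'n"
      have \<phi>: "?\<phi> j \<in> L2 (\<D> \<tau>)" for j
        by (rule bounded_measurable_L2(1)[OF D.finite_measure_axioms, of _ 1]) (use B(2)[of j] in \<open>auto simp: indicator_def\<close>)
      have "elem_tensor ?\<phi> = (?ind A)"
      proof (rule ext, rule vec_eq_iff[THEN iffD2], rule allI)
        fix u :: "'m \<Rightarrow> real" and i :: "'m \<Rightarrow> 'n"
        have "(\<Prod>j\<in>UNIV. indicator (B j) (u j) * (if i j = idx j then 1 else 0)) = (indicator A u * (if i = idx then 1 else 0) :: real)"
        proof (cases "u \<in> A \<and> i = idx")
          case True then show ?thesis by (auto simp: B(1) PiE_iff)
        next
          case False
          then obtain j where "u j \<notin> B j \<or> i j \<noteq> idx j" by (auto simp: B(1) PiE_iff extensional_def)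
          then have "indicator (B j) (u j) * (if i j = idx j then 1 else 0 :: real) = 0" by (auto simp: indicator_def)
          then have "(\<Prod>j\<in>UNIV. indicator (B j) (u j) * (if i j = idx j then 1 else 0 :: real)) = 0"
            by (intro prod_zero bexI[OF _ UNIV_I]) simp_all
          then show ?thesis using False by (auto simp: indicator_def)
        qed
        then show "elem_tensor ?\<phi> u $ i = (?ind A u) $ i"
          by (simp add: elem_tensor_def axis_def)
      qed
      moreover have "Q (elem_tensor ?\<phi>)" unfolding Q_def L_tensor_def by (intro conjI elem elem_tensor_L2(1)[OF \<tau>] \<phi>)
      ultimately show ?thesis by simp
    qed
    show ?thesis using E'
    proof (induction rule: sigma_sets_induct_disjoint[OF Int_stable_prod_algebra prod_algebra_sets_into_space, consumes 1, case_names basic empty compl union])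
      case (basic A) then show ?case by (rule rect)
    next
      case empty show ?case using Q0 by simp
    next
      case (compl A)
      have top: "Q (?ind (space ?M))"
        unfolding sp by (rule rect) (rule space_in_prod_algebra)
      have Asub: "A \<subseteq> space ?M" unfolding sp using compl(1) by (rule sigma_sets_into_sp[OF prod_algebra_sets_into_space])
      have eq: "(\<lambda>u. ?ind (space ?M) u + (-1) *\<^sub>R (?ind A u))
        = (?ind (space ?M - A))"
      proof (rule ext)
        fix u show "?ind (space ?M) u + (-1) *\<^sub>R (?ind A u)
          = ?ind (space ?M - A) u"
          using Asub by (cases "u \<in> A"; cases "u \<in> space ?M") (auto simp: subset_iff)
      qed
      have neg: "Q (\<lambda>u. (-1) *\<^sub>R (?ind A u))" by (rule Qscale) (rule compl(2))
      have "Q (?ind (space ?M - A))" unfolding eq[symmetric] by (rule Qadd[OF top neg])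
      then show ?case by (simp only: sp)
    next
      case (union A)
      have As: "A i \<in> sets ?M" for i using union(2) by (auto simp: pow_measure_def sets_PiM)
      \<comment> \<open>By disjointness the partial sums are indicators of finite unions, so the
        indicator of the full union dominates the error.\<close>
      have "(\<lambda>n. l2norm ?M (\<lambda>u. (\<Sum>i<n. ?ind (A i) u) - ?ind (\<Union>i. A i) u)) \<longlonglongrightarrow> 0"
      proof (rule L2_dominated_limit)
        show "?ind (\<Union>i. A i) \<in> L2 ?M" by (rule indL) (use As in auto)
        then show "?ind (\<Union>i. A i) \<in> borel_measurable ?M" by (rule L2_measurable)
        show "(\<lambda>u. \<Sum>i<n. ?ind (A i) u) \<in> borel_measurable ?M" for n
          using As by measurable
        have part: "(\<Sum>i<n. ?ind (A i) u) = ?ind (\<Union>i<n. A i) u" for n u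
        proof -
          have "(\<Sum>i<n. indicator (A i) u :: real) = indicator (\<Union>i<n. A i) u"
            using union(1) by (intro indicator_UN_disjoint[symmetric]) (auto intro: disjoint_family_on_mono)
          then show ?thesis by (simp add: scaleR_sum_left[symmetric])
        qed
        show "AE u in ?M. (\<lambda>n. \<Sum>i<n. ?ind (A i) u) \<longlonglongrightarrow> ?ind (\<Union>i. A i) u"
          unfolding part by (intro AE_I2 tendsto_intros LIMSEQ_indicator_UN)
        show "AE u in ?M. norm ((\<Sum>i<n. ?ind (A i) u) - ?ind (\<Union>i. A i) u)
          \<le> norm (?ind (\<Union>i. A i) u)" for n
          unfolding part by (intro AE_I2) (auto simp: indicator_def)
      qed
      then show ?case
      proof (rule Qlimit[rotated 2])
        show "Q (\<lambda>u. \<Sum>i<n. ?ind (A i) u)" for n by (rule Qsum3) (rule union(3))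
        show "?ind (\<Union>i. A i) \<in> L_tensor \<tau>"
          unfolding L_tensor_def by (rule indL) (use As in auto)
      qed
    qed
  qed
  have simple: "Q s" if s: "simple_function ?M s" for s :: "('m \<Rightarrow> real) \<Rightarrow> real^('m \<Rightarrow> 'n)"
  proof -
    let ?E = "\<lambda>v. s -` {v} \<inter> space ?M"
    have fin: "finite (s ` space ?M)" and Em: "\<And>v. v \<in> s ` space ?M \<Longrightarrow> ?E v \<in> sets ?M"
      using s by (auto simp: simple_function_def)
    have "Q (\<lambda>u. \<Sum>v\<in>s ` space ?M. \<Sum>i\<in>UNIV. (v $ i) *\<^sub>R (indicator (?E v) u *\<^sub>R axis i 1))"
      by (intro Qsum'' Qsum' Qscale ind Em)
    then show ?thesis
    proof (rule Qcong)
      show "s \<in> borel_measurable ?M" by (rule borel_measurable_simple_function[OF s])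
      show "AE u in ?M. (\<Sum>v\<in>s ` space ?M. \<Sum>i\<in>UNIV. (v $ i) *\<^sub>R (indicator (?E v) u *\<^sub>R axis i 1)) = s u"
      proof (rule AE_I2)
        fix u assume u: "u \<in> space ?M"
        have basis: "(\<Sum>i\<in>UNIV. (v $ i) *\<^sub>R (c *\<^sub>R axis i 1)) = c *\<^sub>R v" for c and v :: "real^('m \<Rightarrow> 'n)"
          by (rule vec_eq_iff[THEN iffD2]) (simp add: axis_def if_distrib cong: if_cong)
        have "(\<Sum>v\<in>s ` space ?M. \<Sum>i\<in>UNIV. (v $ i) *\<^sub>R (indicator (?E v) u *\<^sub>R axis i 1))
          = (\<Sum>v\<in>s ` space ?M. if v = s u then v else 0)"
          unfolding basis using u by (intro sum.cong) (auto simp: indicator_def)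
        then show "(\<Sum>v\<in>s ` space ?M. \<Sum>i\<in>UNIV. (v $ i) *\<^sub>R (indicator (?E v) u *\<^sub>R axis i 1)) = s u"
          using fin u by simp
      qed
    qed
  qed
  have \<Phi>L: "\<Phi> \<in> L2 ?M" using \<Phi> by (simp add: L_tensor_def)
  \<comment> \<open>The simple functions are dominated by twice |\<Phi>|, hence the error by three
    times |\<Phi>|.\<close>
  obtain F where F: "\<And>n. simple_function ?M (F n)" "\<And>u. u \<in> space ?M \<Longrightarrow> (\<lambda>n. F n u) \<longlonglongrightarrow> \<Phi> u"
    "\<And>n u. u \<in> space ?M \<Longrightarrow> dist (F n u) 0 \<le> 2 * dist (\<Phi> u) 0"
    using borel_measurable_implies_sequence_metric[OF L2_measurable[OF \<Phi>L], of 0] by blast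
  have "Q \<Phi>"
  proof (rule Qlimit[of F])
    show "(\<lambda>n. l2norm ?M (\<lambda>u. F n u - \<Phi> u)) \<longlonglongrightarrow> 0"
    proof (rule L2_dominated_limit[where g = "\<lambda>u. 3 *\<^sub>R \<Phi> u"])
      show "F n \<in> borel_measurable ?M" for n by (rule borel_measurable_simple_function[OF F(1)])
      show "AE u in ?M. norm (F n u - \<Phi> u) \<le> norm (3 *\<^sub>R \<Phi> u)" for n
      proof (rule AE_I2)
        fix u assume "u \<in> space ?M"
        then show "norm (F n u - \<Phi> u) \<le> norm (3 *\<^sub>R \<Phi> u)"
          using F(3)[of u n] norm_triangle_ineq4[of "F n u" "\<Phi> u"] by simp
      qed
    qed (use F(2) \<Phi>L in \<open>auto intro: L2_scaleR L2_measurable\<close>)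
  qed (use simple F(1) \<Phi> in auto)
  then show ?thesis by (simp add: Q_def)
qed

context delay_semigroup
begin

lemma traj_scaleR: "is_traj \<phi> X \<Longrightarrow> is_traj (\<lambda>\<theta>. c *\<^sub>R \<phi> \<theta>) (\<lambda>s. c *\<^sub>R X s)"
  using traj_sum[of 1 "\<lambda>_. \<phi>" "\<lambda>_. X" "\<lambda>_. c"] by simp

lemma traj_dense:
  assumes f: "f \<in> L2 (\<D> \<tau>)" and e: "0 < e"
  obtains g X where "is_traj g X" "l2norm (\<D> \<tau>) (\<lambda>x. g x - f x) < e"
  using G.generator_dense[OF f e] traj_exists by metis

end

lemma elem_tensor_diff_slot: "elem_tensor (\<phi>(k := \<lambda>y. f y - g y)) \<theta> = elem_tensor (\<phi>(k := f)) \<theta> - elem_tensor (\<phi>(k := g)) \<theta>"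
proof (rule vec_eq_iff[THEN iffD2], rule allI)
  fix i
  have rem: "(\<Prod>j\<in>UNIV. (\<phi>(k := h)) j (\<theta> j) $ i j) = h (\<theta> k) $ i k * (\<Prod>j\<in>UNIV - {k}. \<phi> j (\<theta> j) $ i j)" for h
    by (subst prod.remove[of UNIV k]) (auto intro!: prod.cong)
  show "elem_tensor (\<phi>(k := \<lambda>y. f y - g y)) \<theta> $ i = (elem_tensor (\<phi>(k := f)) \<theta> - elem_tensor (\<phi>(k := g)) \<theta>) $ i"
    unfolding vector_minus_component elem_tensor_component rem by (simp add: left_diff_distrib)
qed

lemma elem_tensor_scaleR_slot: "elem_tensor (\<phi>(k := \<lambda>y. c *\<^sub>R \<phi> k y)) \<theta> = c *\<^sub>R elem_tensor \<phi> \<theta>"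
proof (rule vec_eq_iff[THEN iffD2], rule allI)
  fix i
  have rem: "(\<Prod>j\<in>UNIV. (\<phi>(k := h)) j (\<theta> j) $ i j) = h (\<theta> k) $ i k * (\<Prod>j\<in>UNIV - {k}. \<phi> j (\<theta> j) $ i j)" for h
    by (subst prod.remove[of UNIV k]) (auto intro!: prod.cong)
  show "elem_tensor (\<phi>(k := \<lambda>y. c *\<^sub>R \<phi> k y)) \<theta> $ i = (c *\<^sub>R elem_tensor \<phi> \<theta>) $ i"
    using rem[of "\<lambda>y. c *\<^sub>R \<phi> k y"] rem[of "\<phi> k"] by (simp add: elem_tensor_component)
qed

lemma sum_lessThan_add: "(\<Sum>i<N + M. f i) = (\<Sum>i<N. f i) + (\<Sum>i<M. f (N + i :: nat))" for f :: "nat \<Rightarrow> 'a::comm_monoid_add"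
  by (induction M) (simp_all add: add.assoc)

text \<open>A dense class of tensors on which the tensor power semigroup acts, for \<open>t \<in> {0..\<tau>}\<close>, by translating
  continuous functions, so that pointwise values make sense.\<close>

definition (in delay_semigroup) traj_tensor ::
    "(('m::finite \<Rightarrow> real) \<Rightarrow> real^('m \<Rightarrow> 'n)) \<Rightarrow> (real \<Rightarrow> ('m \<Rightarrow> real) \<Rightarrow> real^('m \<Rightarrow> 'n)) \<Rightarrow> bool" where
  "traj_tensor \<Phi> \<Xi> \<longleftrightarrow> (\<exists>N \<phi> X. (\<forall>i<N. \<forall>l. is_traj (\<phi> i l) (X i l)) \<and>
     \<Phi> = tensor_sum N \<phi> \<and>
     \<Xi> = translate_sum N X)"

context delay_semigroup
begin

lemma traj_tensor_add:
  assumes "traj_tensor \<Phi> \<Xi>" "traj_tensor \<Phi>' \<Xi>'"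
  shows "traj_tensor (\<lambda>\<theta>. \<Phi> \<theta> + \<Phi>' \<theta>) (\<lambda>t \<theta>. \<Xi> t \<theta> + \<Xi>' t \<theta>)"
proof -
  obtain N \<phi> X where 1: "\<forall>i<N. \<forall>l. is_traj (\<phi> i l) (X i l)" "\<Phi> = tensor_sum N \<phi>" "\<Xi> = translate_sum N X" using assms(1) by (auto simp: traj_tensor_def)
  obtain N' \<phi>' X' where 2: "\<forall>i<N'. \<forall>l. is_traj (\<phi>' i l) (X' i l)" "\<Phi>' = (\<lambda>\<theta>. \<Sum>i<N'::nat. elem_tensor (\<phi>' i) \<theta>)"
     "\<Xi>' = (\<lambda>t \<theta>. \<Sum>i<N'. elem_tensor (\<lambda>l \<theta>. X' i l (t + \<theta>)) \<theta>)" using assms(2) by (auto simp: traj_tensor_def)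
  let ?\<phi> = "\<lambda>i. if i < N then \<phi> i else \<phi>' (i - N)" and ?X = "\<lambda>i. if i < N then X i else X' (i - N)"
  show ?thesis unfolding traj_tensor_def
  proof (intro exI conjI)
    show "\<forall>i<N + N'. \<forall>l. is_traj (?\<phi> i l) (?X i l)" using 1(1) 2(1) by auto
    show "(\<lambda>\<theta>. \<Phi> \<theta> + \<Phi>' \<theta>) = (\<lambda>\<theta>. \<Sum>i<N + N'. elem_tensor (?\<phi> i) \<theta>)"
      by (rule ext) (simp add: 1(2) 2(2) sum_lessThan_add)
    show "(\<lambda>t \<theta>. \<Xi> t \<theta> + \<Xi>' t \<theta>) = (\<lambda>t \<theta>. \<Sum>i<N + N'. elem_tensor (\<lambda>l \<theta>. ?X i l (t + \<theta>)) \<theta>)"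
      by (intro ext) (simp add: 1(3) 2(3) sum_lessThan_add)
  qed
qed

lemma traj_tensor_scaleR:
  fixes \<Phi> :: "('m::finite \<Rightarrow> real) \<Rightarrow> real^('m \<Rightarrow> 'n)"
  assumes "traj_tensor \<Phi> \<Xi>"
  shows "traj_tensor (\<lambda>\<theta>. c *\<^sub>R \<Phi> \<theta>) (\<lambda>t \<theta>. c *\<^sub>R \<Xi> t \<theta>)"
proof -
  obtain N \<phi> X where 1: "\<forall>i<N. \<forall>l. is_traj (\<phi> i l) (X i l)" "\<Phi> = tensor_sum N \<phi>" "\<Xi> = translate_sum N X" using assms(1) by (auto simp: traj_tensor_def)
  define k :: 'm where "k = undefined"
  let ?\<phi> = "\<lambda>i. (\<phi> i)(k := \<lambda>y. c *\<^sub>R \<phi> i k y)" and ?X = "\<lambda>i. (X i)(k := \<lambda>y. c *\<^sub>R X i k y)"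
  show ?thesis unfolding traj_tensor_def
  proof (intro exI conjI)
    show "\<forall>i<N. \<forall>l. is_traj (?\<phi> i l) (?X i l)" using 1(1) by (auto intro: traj_scaleR)
    show "(\<lambda>\<theta>. c *\<^sub>R \<Phi> \<theta>) = (\<lambda>\<theta>. \<Sum>i<N. elem_tensor (?\<phi> i) \<theta>)"
      by (rule ext) (simp only: 1(2) elem_tensor_scaleR_slot scaleR_sum_right)
    have "elem_tensor (\<lambda>l \<theta>. ?X i l (t + \<theta>)) \<theta> = c *\<^sub>R elem_tensor (\<lambda>l \<theta>. X i l (t + \<theta>)) \<theta>" for i t \<theta>
    proof -
      define Y where "Y = (\<lambda>l \<theta>. X i l (t + \<theta>))"
      have "(\<lambda>l \<theta>. ?X i l (t + \<theta>)) = Y(k := \<lambda>y. c *\<^sub>R Y k y)" by (auto simp: Y_def fun_eq_iff)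
      then have "elem_tensor (\<lambda>l \<theta>. ?X i l (t + \<theta>)) \<theta> = c *\<^sub>R elem_tensor Y \<theta>" by (simp only: elem_tensor_scaleR_slot)
      then show ?thesis by (simp only: Y_def)
    qed
    then show "(\<lambda>t \<theta>. c *\<^sub>R \<Xi> t \<theta>) = (\<lambda>t \<theta>. \<Sum>i<N. elem_tensor (\<lambda>l \<theta>. ?X i l (t + \<theta>)) \<theta>)"
      by (intro ext) (simp only: 1(3) scaleR_sum_right)
  qed
qed

lemma traj_tensor_diff:
  assumes "traj_tensor \<Phi> \<Xi>" "traj_tensor \<Phi>' \<Xi>'"
  shows "traj_tensor (\<lambda>\<theta>. \<Phi> \<theta> - \<Phi>' \<theta>) (\<lambda>t \<theta>. \<Xi> t \<theta> - \<Xi>' t \<theta>)"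
  using traj_tensor_add[OF assms(1) traj_tensor_scaleR[OF assms(2), of "-1"]] by simp

lemma traj_tensor_L2:
  assumes "traj_tensor \<Phi> \<Xi>" shows "\<Phi> \<in> L2 (pow_measure \<tau>)"
  using assms unfolding traj_tensor_def by (auto intro!: L2_sum elem_tensor_L2(1)[OF \<tau>] dest: trajD(1))

text \<open>The factors are replaced one after another. Changing one factor alters the tensor by an
  elementary tensor, whose norm is the distance in that slot times the norms of the other
  factors.\<close>

lemma elem_tensor_traj_dense:
  fixes \<phi> :: "'m::finite \<Rightarrow> real \<Rightarrow> real^'n"
  assumes \<phi>: "\<And>l. \<phi> l \<in> L2 (\<D> \<tau>)" and e: "0 < e"
  shows "\<exists>\<psi>. (\<forall>l\<in>S. \<exists>X. is_traj (\<psi> l) X) \<and> (\<forall>l. l \<notin> S \<longrightarrow> \<psi> l = \<phi> l) \<and> (\<forall>l. \<psi> l \<in> L2 (\<D> \<tau>)) \<and>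
    l2norm (pow_measure \<tau>) (\<lambda>\<theta>. elem_tensor \<psi> \<theta> - elem_tensor \<phi> \<theta>) < e"
  using finite[of S] e
proof (induction S arbitrary: e rule: finite_induct)
  case empty
  then show ?case using \<phi> by (intro exI[of _ \<phi>]) (simp add: l2norm_def)
next
  case (insert k S)
  then obtain \<psi> where \<psi>: "\<forall>l\<in>S. \<exists>X. is_traj (\<psi> l) X" "\<forall>l. l \<notin> S \<longrightarrow> \<psi> l = \<phi> l" "\<And>l. \<psi> l \<in> L2 (\<D> \<tau>)"
    "l2norm (pow_measure \<tau>) (\<lambda>\<theta>. elem_tensor \<psi> \<theta> - elem_tensor \<phi> \<theta>) < e / 2" using insert.IH[of "e/2"] by auto
  define C where "C = (\<Prod>l\<in>UNIV - {k}. l2norm (\<D> \<tau>) (\<psi> l))"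
  have C: "C \<ge> 0" by (simp add: C_def prod_nonneg)
  \<comment> \<open>The other factors may have norm zero, hence C + 1 in the denominator.\<close>
  have "0 < e / (2 * (C + 1))" using insert.prems C by simp
  then obtain g X where g: "is_traj g X" "l2norm (\<D> \<tau>) (\<lambda>x. g x - \<psi> k x) < e / (2 * (C + 1))"
    by (rule traj_dense[OF \<psi>(3)])
  let ?\<psi> = "\<psi>(k := g)"
  have \<psi>L: "?\<psi> l \<in> L2 (\<D> \<tau>)" for l using \<psi>(3) trajD(1)[OF g(1)] by simp
  have dL: "(\<psi>(k := \<lambda>y. g y - \<psi> k y)) l \<in> L2 (\<D> \<tau>)" for l
    using \<psi>(3) trajD(1)[OF g(1)] by (simp add: L2_diff)
  have eq: "elem_tensor ?\<psi> \<theta> - elem_tensor \<phi> \<theta> = elem_tensor (\<psi>(k := \<lambda>y. g y - \<psi> k y)) \<theta> + (elem_tensor \<psi> \<theta> - elem_tensor \<phi> \<theta>)" for \<theta>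
    unfolding elem_tensor_diff_slot by simp
  have "l2norm (pow_measure \<tau>) (elem_tensor (\<psi>(k := \<lambda>y. g y - \<psi> k y)))
    \<le> (\<Prod>l\<in>UNIV. l2norm (\<D> \<tau>) ((\<psi>(k := \<lambda>y. g y - \<psi> k y)) l))"
    by (rule elem_tensor_L2(2)[OF \<tau> dL])
  also have "\<dots> = l2norm (\<D> \<tau>) (\<lambda>y. g y - \<psi> k y) * C"
    unfolding C_def by (subst prod.remove[of UNIV k]) (auto intro!: prod.cong)
  also have "\<dots> \<le> e / (2 * (C + 1)) * C" using g(2) C by (intro mult_right_mono) auto
  also have "\<dots> \<le> e / 2" using C insert.prems by (simp add: field_simps)
  finally have "l2norm (pow_measure \<tau>) (elem_tensor (\<psi>(k := \<lambda>y. g y - \<psi> k y))) \<le> e / 2" .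
  moreover have "l2norm (pow_measure \<tau>) (\<lambda>\<theta>. elem_tensor ?\<psi> \<theta> - elem_tensor \<phi> \<theta>)
    \<le> l2norm (pow_measure \<tau>) (elem_tensor (\<psi>(k := \<lambda>y. g y - \<psi> k y))) + l2norm (pow_measure \<tau>) (\<lambda>\<theta>. elem_tensor \<psi> \<theta> - elem_tensor \<phi> \<theta>)"
    unfolding eq by (intro l2norm_triangle L2_diff elem_tensor_L2(1)[OF \<tau>] dL \<psi>(3) \<phi>)
  ultimately have "l2norm (pow_measure \<tau>) (\<lambda>\<theta>. elem_tensor ?\<psi> \<theta> - elem_tensor \<phi> \<theta>) < e" using \<psi>(4) by linarith
  then show ?case
  proof (intro exI[of _ ?\<psi>] conjI)
    show "\<forall>l\<in>insert k S. \<exists>X. is_traj (?\<psi> l) X" "\<forall>l. l \<notin> insert k S \<longrightarrow> ?\<psi> l = \<phi> l" using \<psi>(1,2) g(1) by auto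
    show "\<forall>l. ?\<psi> l \<in> L2 (\<D> \<tau>)" using \<psi>L by blast
  qed
qed

lemma traj_tensor_dense:
  fixes \<Phi> :: "('m::finite \<Rightarrow> real) \<Rightarrow> real^('m \<Rightarrow> 'n)"
  assumes "\<Phi> \<in> L_tensor \<tau>" and "0 < e"
  shows "\<exists>\<Psi> \<Xi>. traj_tensor \<Psi> \<Xi> \<and> l2norm (pow_measure \<tau>) (\<lambda>u. \<Psi> u - \<Phi> u) < e"
  using \<tau> assms
proof (induction \<Phi> arbitrary: e rule: L_tensor_induct)
  case (elem \<phi>)
  then obtain \<psi> where \<psi>: "\<And>l. \<exists>X. is_traj (\<psi> l) X" "l2norm (pow_measure \<tau>) (\<lambda>u. elem_tensor \<psi> u - elem_tensor \<phi> u) < e"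
    using elem_tensor_traj_dense[of \<phi> e UNIV] by auto
  then obtain X where X: "\<And>l. is_traj (\<psi> l) (X l)" by metis
  have "traj_tensor (elem_tensor \<psi>) (\<lambda>t u. elem_tensor (\<lambda>l u. X l (t + u)) u)"
    unfolding traj_tensor_def by (intro exI[of _ 1] exI[of _ "\<lambda>_. \<psi>"] exI[of _ "\<lambda>_. X"]) (simp add: X)
  with \<psi>(2) show ?case by blast
next
  case (add f g)
  obtain \<Psi> \<Xi> where 1: "traj_tensor \<Psi> \<Xi>" "l2norm (pow_measure \<tau>) (\<lambda>u. \<Psi> u - f u) < e / 2" using add.IH(1)[of "e/2"] add.prems by auto
  obtain \<Psi>' \<Xi>' where 2: "traj_tensor \<Psi>' \<Xi>'" "l2norm (pow_measure \<tau>) (\<lambda>u. \<Psi>' u - g u) < e / 2" using add.IH(2)[of "e/2"] add.prems by auto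
  have "l2norm (pow_measure \<tau>) (\<lambda>u. (\<Psi> u - f u) + (\<Psi>' u - g u)) < e"
    using l2norm_triangle[OF L2_diff[OF traj_tensor_L2[OF 1(1)], of f] L2_diff[OF traj_tensor_L2[OF 2(1)], of g]] add.hyps 1(2) 2(2)
    by (simp add: L_tensor_def)
  then show ?case using traj_tensor_add[OF 1(1) 2(1)] by (intro exI conjI) (auto simp: algebra_simps)
next
  case (scale c f)
  have "0 < e / (\<bar>c\<bar> + 1)" using scale.prems by simp
  then obtain \<Psi> \<Xi> where 1: "traj_tensor \<Psi> \<Xi>" "l2norm (pow_measure \<tau>) (\<lambda>u. \<Psi> u - f u) < e / (\<bar>c\<bar> + 1)" using scale.IH by blast
  have "l2norm (pow_measure \<tau>) (\<lambda>u. c *\<^sub>R \<Psi> u - c *\<^sub>R f u) = \<bar>c\<bar> * l2norm (pow_measure \<tau>) (\<lambda>u. \<Psi> u - f u)"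
    unfolding scaleR_diff_right[symmetric] by (rule l2norm_scaleR)
  also have "\<dots> \<le> \<bar>c\<bar> * (e / (\<bar>c\<bar> + 1))" using 1(2) by (intro mult_left_mono) auto
  also have "\<dots> < e" using scale.prems by (simp add: field_simps)
  finally show ?case using traj_tensor_scaleR[OF 1(1)] by blast
next
  case (limit F f)
  have "\<forall>\<^sub>F n in sequentially. l2norm (pow_measure \<tau>) (\<lambda>u. F n u - f u) < e / 2"
    using order_tendstoD(2)[OF limit.hyps(3), of "e / 2"] limit.prems by simp
  then obtain n where n: "l2norm (pow_measure \<tau>) (\<lambda>u. F n u - f u) < e / 2" using eventually_happens'[of sequentially] by auto
  obtain \<Psi> \<Xi> where 1: "traj_tensor \<Psi> \<Xi>" "l2norm (pow_measure \<tau>) (\<lambda>u. \<Psi> u - F n u) < e / 2"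
    using limit.IH[OF half_gt_zero[OF limit.prems], of n] by blast
  have "l2norm (pow_measure \<tau>) (\<lambda>u. (\<Psi> u - F n u) + (F n u - f u)) < e"
    using l2norm_triangle[OF L2_diff[OF traj_tensor_L2[OF 1(1)], of "F n"] L2_diff[of "F n" _ f]] limit.hyps 1(2) n
    by (simp add: L_tensor_def)
  then show ?case using 1(1) by auto
qed

end

section \<open>Operator identities on tensors, permutations and antisymmetrization\<close>

lemma bounded_op_comp:
  assumes X: "L2_subspace M X" and A: "bounded_op M X A" and B: "bounded_op M X B"
  shows "bounded_op M X (\<lambda>f. A (B f))"
  unfolding bounded_op_def
proof (intro conjI ballI allI)
  note XD = L2_subspaceD[OF X]
  show "A (B f) \<in> X" if "f \<in> X" for f using bounded_opD(1)[OF A] bounded_opD(1)[OF B] that by blast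
  fix f assume f: "f \<in> X"
  have Bf: "B f \<in> X" by (rule bounded_opD(1)[OF B f])
  show "AE x in M. A (B (\<lambda>y. c *\<^sub>R f y)) x = c *\<^sub>R A (B f) x" for c
  proof -
    \<comment> \<open>B is homogeneous almost everywhere only; \<open>bounded_op_cong\<close> lets A
      act on such an equation.\<close>
    have "AE x in M. A (B (\<lambda>y. c *\<^sub>R f y)) x = A (\<lambda>y. c *\<^sub>R B f y) x"
      by (rule bounded_op_cong[OF X A bounded_opD(1)[OF B XD(4)[OF f]] XD(4)[OF Bf] bounded_opD(3)[OF B f]])
    with bounded_opD(3)[OF A Bf, of c] show ?thesis by eventually_elim simp
  qed
  fix g assume g: "g \<in> X"
  have Bg: "B g \<in> X" by (rule bounded_opD(1)[OF B g])
  have "AE x in M. A (B (\<lambda>y. f y + g y)) x = A (\<lambda>y. B f y + B g y) x"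
    by (rule bounded_op_cong[OF X A bounded_opD(1)[OF B XD(3)[OF f g]] XD(3)[OF Bf Bg] bounded_opD(2)[OF B f g]])
  with bounded_opD(2)[OF A Bf Bg] show "AE x in M. A (B (\<lambda>y. f y + g y)) x = A (B f) x + A (B g) x"
    by eventually_elim simp
next
  obtain K1 where K1: "K1 \<ge> 0" "\<And>f. f \<in> X \<Longrightarrow> l2norm M (A f) \<le> K1 * l2norm M f" using bounded_op_bound[OF A] by blast
  obtain K2 where K2: "K2 \<ge> 0" "\<And>f. f \<in> X \<Longrightarrow> l2norm M (B f) \<le> K2 * l2norm M f" using bounded_op_bound[OF B] by blast
  have "l2norm M (A (B f)) \<le> K1 * K2 * l2norm M f" if f: "f \<in> X" for f
  proof -
    have "l2norm M (A (B f)) \<le> K1 * l2norm M (B f)" by (rule K1(2)[OF bounded_opD(1)[OF B f]])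
    also have "\<dots> \<le> K1 * (K2 * l2norm M f)" by (rule mult_left_mono[OF K2(2)[OF f] K1(1)])
    finally show ?thesis by (simp add: mult.assoc)
  qed
  then show "\<exists>K. \<forall>f\<in>X. l2norm M (A (B f)) \<le> K * l2norm M f" by blast
qed

lemma bounded_op_ident: "bounded_op M X (\<lambda>f. f)"
  unfolding bounded_op_def by (auto intro: exI[of _ 1])

lemma bounded_op_tendsto:
  assumes X: "L2_subspace M X" and A: "bounded_op M X A" and F: "\<And>n. F n \<in> X" and f: "f \<in> X"
    and lim: "(\<lambda>n. emb M (F n)) \<longlonglongrightarrow> emb M f"
  shows "(\<lambda>n. emb M (A (F n))) \<longlonglongrightarrow> emb M (A f)"
proof -
  note XD = L2_subspaceD[OF X]
  obtain K where K: "K \<ge> 0" "\<And>f. f \<in> X \<Longrightarrow> l2norm M (A f) \<le> K * l2norm M f" using bounded_op_bound[OF A] by blast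
  have "dist (emb M (A (F n))) (emb M (A f)) \<le> K * dist (emb M (F n)) (emb M f)" for n
  proof -
    have d: "(\<lambda>x. F n x - f x) \<in> X" by (rule XD(5)[OF F f])
    note AL = XD(1)[OF bounded_opD(1)[OF A F[of n]]] XD(1)[OF bounded_opD(1)[OF A f]] XD(1)[OF bounded_opD(1)[OF A d]]
    have "dist (emb M (A (F n))) (emb M (A f)) = l2norm M (\<lambda>x. A (F n) x - A f x)"
      by (rule l2norm_emb_diff[symmetric, OF AL(1,2)])
    also have "\<dots> = l2norm M (A (\<lambda>x. F n x - f x))"
    proof (rule l2norm_cong_AE)
      show "AE x in M. A (F n) x - A f x = A (\<lambda>x. F n x - f x) x"
        using bounded_op_diff[OF X A F f, of n] by eventually_elim simp
    qed (intro borel_measurable_diff L2_measurable[OF AL(1)] L2_measurable[OF AL(2)] L2_measurable[OF AL(3)])+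
    also have "\<dots> \<le> K * l2norm M (\<lambda>x. F n x - f x)" by (rule K(2)[OF d])
    also have "\<dots> = K * dist (emb M (F n)) (emb M f)" by (simp only: l2norm_emb_diff[OF XD(1)[OF F[of n]] XD(1)[OF f]])
    finally show ?thesis .
  qed
  note le = this
  have "(\<lambda>n. K * dist (emb M (F n)) (emb M f)) \<longlonglongrightarrow> K * dist (emb M f) (emb M f)"
    by (intro tendsto_intros lim)
  then have "(\<lambda>n. K * dist (emb M (F n)) (emb M f)) \<longlonglongrightarrow> 0" by simp
  then have "(\<lambda>n. dist (emb M (A (F n))) (emb M (A f))) \<longlonglongrightarrow> 0"
    by (rule Lim_null_comparison[rotated]) (simp add: le)
  then show ?thesis by (subst tendsto_dist_iff)
qed

lemma L_tensor_subspace: "L2_subspace (pow_measure \<tau>) (L_tensor \<tau>)"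
  unfolding L_tensor_def by (rule L2_subspace_L2)

text \<open>The functions on which two bounded operators agree form a closed subspace, so elementary
  tensors suffice. The semigroup law, the value at time 0 and the commutation with
  \<open>alt_proj\<close> are obtained in this way.\<close>

lemma bounded_op_eqI:
  fixes A B :: "(('m::finite \<Rightarrow> real) \<Rightarrow> real^('m \<Rightarrow> 'n::finite)) \<Rightarrow> ('m \<Rightarrow> real) \<Rightarrow> real^('m \<Rightarrow> 'n)"
  assumes \<tau>: "0 < \<tau>" and A: "bounded_op (pow_measure \<tau>) (L_tensor \<tau>) A" and B: "bounded_op (pow_measure \<tau>) (L_tensor \<tau>) B"
    and eq: "\<And>\<phi>. (\<And>j. \<phi> j \<in> L2 (\<D> \<tau>)) \<Longrightarrow> AE \<theta> in pow_measure \<tau>. A (elem_tensor \<phi>) \<theta> = B (elem_tensor \<phi>) \<theta>"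
    and \<Phi>: "\<Phi> \<in> L_tensor \<tau>"
  shows "AE \<theta> in pow_measure \<tau>. A \<Phi> \<theta> = B \<Phi> \<theta>"
  using \<tau> \<Phi>
proof (induction \<Phi> rule: L_tensor_induct)
  case (elem \<phi>) then show ?case by (rule eq)
next
  case (add f g)
  show ?case using add.IH bounded_opD(2)[OF A add.hyps(1,2)] bounded_opD(2)[OF B add.hyps(1,2)]
    by eventually_elim simp
next
  case (scale c f)
  show ?case using scale.IH bounded_opD(3)[OF A scale.hyps(1), of c] bounded_opD(3)[OF B scale.hyps(1), of c]
    by eventually_elim simp
next
  case (limit F f)
  let ?M = "pow_measure \<tau> :: ('m \<Rightarrow> real) measure"
  have L: "g \<in> L_tensor \<tau> \<Longrightarrow> g \<in> L2 ?M" for g :: "('m \<Rightarrow> real) \<Rightarrow> real^('m \<Rightarrow> 'n)" by (simp add: L_tensor_def)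
  have "(\<lambda>n. emb ?M (F n)) \<longlonglongrightarrow> emb ?M f"
    using limit.hyps(3) by (subst tendsto_dist_iff) (simp add: l2norm_emb_diff L limit.hyps)
  then have "(\<lambda>n. emb ?M (A (F n))) \<longlonglongrightarrow> emb ?M (A f)" "(\<lambda>n. emb ?M (B (F n))) \<longlonglongrightarrow> emb ?M (B f)"
    by (intro bounded_op_tendsto[OF L_tensor_subspace A] bounded_op_tendsto[OF L_tensor_subspace B] limit.hyps; assumption)+
  moreover have "emb ?M (A (F n)) = emb ?M (B (F n))" for n
    using emb_eq_iff[OF L[OF bounded_opD(1)[OF A limit.hyps(1)[of n]]] L[OF bounded_opD(1)[OF B limit.hyps(1)[of n]]]] limit.IH[of n]
    by blast
  ultimately have "emb ?M (A f) = emb ?M (B f)" using LIMSEQ_unique by auto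
  then show ?case
    using emb_eq_iff[OF L[OF bounded_opD(1)[OF A limit.hyps(2)]] L[OF bounded_opD(1)[OF B limit.hyps(2)]]] by blast
qed

lemma measurable_comp_perm:
  fixes \<pi> :: "'m::finite \<Rightarrow> 'm"
  shows "(\<lambda>\<theta>. \<theta> \<circ> \<pi>) \<in> measurable (pow_measure \<tau>) (pow_measure \<tau> :: ('m \<Rightarrow> real) measure)"
proof -
  have eq: "(\<lambda>\<theta>. \<theta> \<circ> \<pi>) = (\<lambda>\<theta>. \<lambda>i\<in>UNIV. \<theta> (\<pi> i))" by (auto simp: fun_eq_iff)
  have "(\<lambda>\<theta>. \<lambda>i\<in>UNIV. \<theta> (\<pi> i)) \<in> measurable (pow_measure \<tau>) (PiM UNIV (\<lambda>_. \<D> \<tau>) :: ('m \<Rightarrow> real) measure)"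
    by (rule measurable_restrict) (rule measurable_pow_component)
  then show ?thesis unfolding eq pow_measure_def .
qed

text \<open>All factors carry the same measure, so a box and its permuted preimage have equal
  measure, and boxes determine the product measure. This is why \<open>perm_op\<close> does not
  increase norms.\<close>

lemma distr_comp_perm:
  fixes \<pi> :: "'m::finite \<Rightarrow> 'm"
  assumes \<tau>: "0 < \<tau>" and \<pi>: "bij \<pi>"
  shows "distr (pow_measure \<tau>) (pow_measure \<tau>) (\<lambda>\<theta>. \<theta> \<circ> \<pi>) = pow_measure \<tau>"
proof -
  interpret D: product_sigma_finite "\<lambda>_::'m. \<D> \<tau>" by (rule product_sigma_finite_delay[OF \<tau>])
  have "distr (pow_measure \<tau>) (pow_measure \<tau>) (\<lambda>\<theta>. \<theta> \<circ> \<pi>) = PiM UNIV (\<lambda>_. \<D> \<tau>)"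
  proof (rule D.PiM_eqI)
    fix A :: "'m \<Rightarrow> real set" assume "\<And>i. i \<in> UNIV \<Longrightarrow> A i \<in> sets (\<D> \<tau>)"
    then have A: "A i \<in> sets (\<D> \<tau>)" for i by simp
    have box: "PiE UNIV B \<in> sets (pow_measure \<tau> :: ('m \<Rightarrow> real) measure)" if "\<And>i. B i \<in> sets (\<D> \<tau>)" for B
      unfolding pow_measure_def by (rule sets_PiM_I_finite) (use that in auto)
    have pre: "(\<lambda>\<theta>. \<theta> \<circ> \<pi>) -` PiE UNIV A \<inter> space (pow_measure \<tau>) = PiE UNIV (\<lambda>k. A (inv \<pi> k))"
    proof (intro set_eqI iffI)
      fix \<theta> assume "\<theta> \<in> (\<lambda>\<theta>. \<theta> \<circ> \<pi>) -` PiE UNIV A \<inter> space (pow_measure \<tau>)"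
      then have "\<theta> (\<pi> i) \<in> A i" for i by auto
      then have "\<theta> k \<in> A (inv \<pi> k)" for k using bij_inv_eq_iff[OF \<pi>] by (metis)
      then show "\<theta> \<in> PiE UNIV (\<lambda>k. A (inv \<pi> k))" by (auto simp: PiE_UNIV_domain)
    next
      fix \<theta> assume "\<theta> \<in> PiE UNIV (\<lambda>k. A (inv \<pi> k))"
      then have k: "\<theta> k \<in> A (inv \<pi> k)" for k by auto
      have "\<theta> (\<pi> i) \<in> A i" for i using k[of "\<pi> i"] inv_f_f[OF bij_is_inj[OF \<pi>]] by simp
      moreover have "\<theta> k \<in> space (\<D> \<tau>)" for k using k sets.sets_into_space[OF A] by blast
      ultimately show "\<theta> \<in> (\<lambda>\<theta>. \<theta> \<circ> \<pi>) -` PiE UNIV A \<inter> space (pow_measure \<tau>)"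
        by (simp add: pow_measure_def space_PiM PiE_iff)
    qed
    have "emeasure (distr (pow_measure \<tau>) (pow_measure \<tau>) (\<lambda>\<theta>. \<theta> \<circ> \<pi>)) (PiE UNIV A)
      = emeasure (pow_measure \<tau>) (PiE UNIV (\<lambda>k. A (inv \<pi> k)))"
      by (subst emeasure_distr[OF measurable_comp_perm box[OF A]]) (simp only: pre)
    also have "\<dots> = (\<Prod>k\<in>UNIV. emeasure (\<D> \<tau>) (A (inv \<pi> k)))"
      unfolding pow_measure_def by (rule D.emeasure_PiM) (use A in auto)
    also have "\<dots> = (\<Prod>k\<in>UNIV. emeasure (\<D> \<tau>) (A k))"
      by (rule prod.reindex_bij_betw[of "inv \<pi>" UNIV UNIV "\<lambda>k. emeasure (\<D> \<tau>) (A k)"]) (rule bij_imp_bij_inv[OF \<pi>])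
    finally show "emeasure (distr (pow_measure \<tau>) (pow_measure \<tau>) (\<lambda>\<theta>. \<theta> \<circ> \<pi>)) (PiE UNIV A) = (\<Prod>k\<in>UNIV. emeasure (\<D> \<tau>) (A k))" .
  qed (simp_all add: pow_measure_def)
  then show ?thesis by (simp add: pow_measure_def)
qed

lemma norm_perm_op:
  assumes \<sigma>: "bij \<sigma>" shows "norm (perm_op \<sigma> \<Phi> \<theta>) = norm (\<Phi> (\<theta> \<circ> inv \<sigma>))"
proof -
  have "(norm (perm_op \<sigma> \<Phi> \<theta>))\<^sup>2 = (\<Sum>i\<in>UNIV. (\<Phi> (\<theta> \<circ> inv \<sigma>) $ (i \<circ> inv \<sigma>))\<^sup>2)" by (simp add: norm_vec_sq perm_op_def)
  also have "\<dots> = (\<Sum>i\<in>UNIV. (\<Phi> (\<theta> \<circ> inv \<sigma>) $ i)\<^sup>2)"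
    by (rule sum.reindex_bij_witness[where i = "\<lambda>i. i \<circ> \<sigma>" and j = "\<lambda>i. i \<circ> inv \<sigma>"])
      (use \<sigma> in \<open>auto simp: fun_eq_iff inv_f_f[OF bij_is_inj] surj_f_inv_f[OF bij_is_surj]\<close>)
  finally have "(norm (perm_op \<sigma> \<Phi> \<theta>))\<^sup>2 = (norm (\<Phi> (\<theta> \<circ> inv \<sigma>)))\<^sup>2" by (simp add: norm_vec_sq)
  then show ?thesis by simp
qed

lemma perm_op_L2:
  fixes \<Phi> :: "('m::finite \<Rightarrow> real) \<Rightarrow> real^('m \<Rightarrow> 'n::finite)"
  assumes \<tau>: "0 < \<tau>" and \<sigma>: "bij \<sigma>" and \<Phi>: "\<Phi> \<in> L2 (pow_measure \<tau>)"
  shows "perm_op \<sigma> \<Phi> \<in> L2 (pow_measure \<tau>)" and "l2norm (pow_measure \<tau>) (perm_op \<sigma> \<Phi>) \<le> l2norm (pow_measure \<tau>) \<Phi>"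
proof -
  note m = L2_measurable[OF \<Phi>]
  have m1: "perm_op \<sigma> \<Phi> \<in> borel_measurable (pow_measure \<tau>)"
    unfolding perm_op_def
    by (intro borel_measurable_vec_lambda borel_measurable_vec_nth' measurable_compose[OF measurable_comp_perm m])
  have "l2sq (pow_measure \<tau>) (\<lambda>\<theta>. perm_op \<sigma> \<Phi> \<theta>) = l2sq (pow_measure \<tau>) (\<lambda>\<theta>. \<Phi> (\<theta> \<circ> inv \<sigma>))"
    by (simp add: norm_perm_op[OF \<sigma>])
  also have "\<dots> = l2sq (distr (pow_measure \<tau>) (pow_measure \<tau>) (\<lambda>\<theta>. \<theta> \<circ> inv \<sigma>)) (\<lambda>\<theta>. \<Phi> \<theta>)"
    by (rule nn_integral_distr[symmetric]) (use m measurable_comp_perm in measurable)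
  also have "\<dots> = ennreal ((l2norm (pow_measure \<tau>) \<Phi>)\<^sup>2)"
    unfolding distr_comp_perm[OF \<tau> bij_imp_bij_inv[OF \<sigma>]] by (rule L2_nn_integral[OF \<Phi>])
  finally have e: "l2sq (pow_measure \<tau>) (\<lambda>\<theta>. perm_op \<sigma> \<Phi> \<theta>) = ennreal ((l2norm (pow_measure \<tau>) \<Phi>)\<^sup>2)" .
  show "perm_op \<sigma> \<Phi> \<in> L2 (pow_measure \<tau>)" "l2norm (pow_measure \<tau>) (perm_op \<sigma> \<Phi>) \<le> l2norm (pow_measure \<tau>) \<Phi>"
    using L2I_nn_integral[OF m1 eq_refl[OF e]] by simp_all
qed

lemma perm_op_linear:
  "perm_op \<sigma> (\<lambda>\<theta>. f \<theta> + g \<theta>) \<theta> = perm_op \<sigma> f \<theta> + perm_op \<sigma> g \<theta>"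
  "perm_op \<sigma> (\<lambda>\<theta>. c *\<^sub>R f \<theta>) \<theta> = c *\<^sub>R perm_op \<sigma> f \<theta>"
  by (simp_all add: perm_op_def vec_eq_iff)

lemma perm_op_sum: "perm_op \<sigma> (\<lambda>\<theta>. \<Sum>i\<in>I. f i \<theta>) \<theta> = (\<Sum>i\<in>I. perm_op \<sigma> (f i) \<theta>)"
  by (simp add: perm_op_def vec_eq_iff)

text \<open>The order is reversed: relabelling the factors is an action from the right.\<close>

lemma perm_op_comp:
  assumes "bij \<sigma>" "bij \<rho>" shows "perm_op \<sigma> (perm_op \<rho> \<Phi>) = perm_op (\<rho> \<circ> \<sigma>) \<Phi>"
  using o_inv_distrib[OF assms(2,1)] by (simp add: perm_op_def o_assoc)

text \<open>The sign is multiplicative, and composition with a fixed permutation permutes the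
  summands, so each outer term reproduces the whole inner sum. The number of outer terms is the
  factorial in the denominator.\<close>

lemma alt_proj_idem: "alt_proj (alt_proj \<Psi>) = alt_proj (\<Psi> :: ('m::finite \<Rightarrow> real) \<Rightarrow> real^('m \<Rightarrow> 'n::finite))"
proof (rule ext)
  fix \<theta> :: "'m \<Rightarrow> real"
  let ?P = "{\<sigma>::'m \<Rightarrow> 'm. \<sigma> permutes UNIV}" and ?f = "fact CARD('m) :: real"
  let ?S = "\<Sum>\<rho>\<in>?P. of_int (sign \<rho>) *\<^sub>R perm_op \<rho> \<Psi> \<theta>"
  have fac: "?f \<noteq> 0" by simp
  have "of_int (sign \<sigma>) *\<^sub>R perm_op \<sigma> (alt_proj \<Psi>) \<theta> = (1 / ?f) *\<^sub>R ?S" if \<sigma>: "\<sigma> \<in> ?P" for \<sigma>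
  proof -
    have b: "bij \<sigma>" "permutation \<sigma>" using \<sigma> by (auto intro: permutes_bij simp: permutation_permutes)
    have "of_int (sign \<sigma>) *\<^sub>R perm_op \<sigma> (alt_proj \<Psi>) \<theta>
      = (1 / ?f) *\<^sub>R (\<Sum>\<rho>\<in>?P. (of_int (sign \<sigma>) * of_int (sign \<rho>)) *\<^sub>R perm_op \<sigma> (perm_op \<rho> \<Psi>) \<theta>)"
      unfolding alt_proj_def perm_op_linear perm_op_sum by (simp add: scaleR_sum_right mult.left_commute mult.commute)
    also have "(\<Sum>\<rho>\<in>?P. (of_int (sign \<sigma>) * of_int (sign \<rho>)) *\<^sub>R perm_op \<sigma> (perm_op \<rho> \<Psi>) \<theta>)
      = (\<Sum>\<rho>\<in>?P. of_int (sign (\<rho> \<circ> \<sigma>)) *\<^sub>R perm_op (\<rho> \<circ> \<sigma>) \<Psi> \<theta>)"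
    proof (rule sum.cong[OF refl])
      fix \<rho> assume \<rho>: "\<rho> \<in> ?P"
      then have "bij \<rho>" "permutation \<rho>" by (auto intro: permutes_bij simp: permutation_permutes)
      then show "(of_int (sign \<sigma>) * of_int (sign \<rho>)) *\<^sub>R perm_op \<sigma> (perm_op \<rho> \<Psi>) \<theta> = of_int (sign (\<rho> \<circ> \<sigma>)) *\<^sub>R perm_op (\<rho> \<circ> \<sigma>) \<Psi> \<theta>"
        using b by (simp add: perm_op_comp sign_compose mult.commute)
    qed
    also have "\<dots> = ?S"
      using sum_permutations_compose_right[of \<sigma> UNIV "\<lambda>\<rho>. of_int (sign \<rho>) *\<^sub>R perm_op \<rho> \<Psi> \<theta>"] \<sigma> by simp
    finally show ?thesis .
  qed
  then have "alt_proj (alt_proj \<Psi>) \<theta> = (1 / ?f) *\<^sub>R (\<Sum>\<sigma>\<in>?P. (1 / ?f) *\<^sub>R ?S)"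
    unfolding alt_proj_def[of "alt_proj \<Psi>"] by simp
  also have "\<dots> = (1 / ?f) *\<^sub>R ?S"
    unfolding sum_constant_scaleR card_permutations[OF refl finite] scaleR_scaleR using fac by simp
  finally show "alt_proj (alt_proj \<Psi>) \<theta> = alt_proj \<Psi> \<theta>" by (simp add: alt_proj_def)
qed

lemma bounded_op_alt_proj:
  assumes \<tau>: "0 < \<tau>"
  shows "bounded_op (pow_measure \<tau>) (L_tensor \<tau>) (alt_proj :: (('m::finite \<Rightarrow> real) \<Rightarrow> real^('m \<Rightarrow> 'n::finite)) \<Rightarrow> _)"
proof -
  let ?P = "{\<sigma>::'m \<Rightarrow> 'm. \<sigma> permutes UNIV}" and ?f = "fact CARD('m) :: real"
  let ?M = "pow_measure \<tau> :: ('m \<Rightarrow> real) measure"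
  have b: "bij \<sigma>" if "\<sigma> \<in> ?P" for \<sigma> using that by (auto intro: permutes_bij)
  have part: "(\<lambda>\<theta>. \<Sum>\<sigma>\<in>S. of_int (sign \<sigma>) *\<^sub>R perm_op \<sigma> f \<theta>) \<in> L2 ?M \<and>
      l2norm ?M (\<lambda>\<theta>. \<Sum>\<sigma>\<in>S. of_int (sign \<sigma>) *\<^sub>R perm_op \<sigma> f \<theta>) \<le> real (card S) * l2norm ?M f"
    if f: "f \<in> L2 ?M" and S: "finite S" "S \<subseteq> ?P" for f :: "('m \<Rightarrow> real) \<Rightarrow> real^('m \<Rightarrow> 'n)" and S
    using S
  proof (induction S rule: finite_induct)
    case empty then show ?case by (simp add: l2norm_def)
  next
    case (insert \<sigma> S)
    have p: "(\<lambda>\<theta>. of_int (sign \<sigma>) *\<^sub>R perm_op \<sigma> f \<theta>) \<in> L2 ?M" using insert f b by (intro L2_scaleR perm_op_L2(1)[OF \<tau>]) auto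
    have "l2norm ?M (\<lambda>\<theta>. of_int (sign \<sigma>) *\<^sub>R perm_op \<sigma> f \<theta>) = \<bar>of_int (sign \<sigma>)\<bar> * l2norm ?M (perm_op \<sigma> f)"
      by (rule l2norm_scaleR)
    also have "\<dots> \<le> l2norm ?M f" using perm_op_L2(2)[OF \<tau> b f, of \<sigma>] insert by (simp add: sign_def)
    finally have le: "l2norm ?M (\<lambda>\<theta>. of_int (sign \<sigma>) *\<^sub>R perm_op \<sigma> f \<theta>) \<le> l2norm ?M f" .
    have IH: "(\<lambda>\<theta>. \<Sum>\<sigma>\<in>S. of_int (sign \<sigma>) *\<^sub>R perm_op \<sigma> f \<theta>) \<in> L2 ?M"
      "l2norm ?M (\<lambda>\<theta>. \<Sum>\<sigma>\<in>S. of_int (sign \<sigma>) *\<^sub>R perm_op \<sigma> f \<theta>) \<le> real (card S) * l2norm ?M f" using insert by auto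
    show ?case
      using L2_add[OF p IH(1)] l2norm_triangle[OF p IH(1)] le IH(2) insert(1,2) by (simp add: algebra_simps)
  qed
  show ?thesis unfolding bounded_op_def
  proof (intro conjI ballI allI)
    fix f :: "('m \<Rightarrow> real) \<Rightarrow> real^('m \<Rightarrow> 'n)" assume f: "f \<in> L_tensor \<tau>"
    show "alt_proj f \<in> L_tensor \<tau>"
      unfolding L_tensor_def alt_proj_def using f part[of f ?P] by (intro L2_scaleR) (simp add: L_tensor_def)
    show "AE x in ?M. alt_proj (\<lambda>y. c *\<^sub>R f y) x = c *\<^sub>R alt_proj f x" for c
      by (simp add: alt_proj_def perm_op_linear scaleR_sum_right mult.left_commute mult.commute)
    show "AE x in ?M. alt_proj (\<lambda>y. f y + g y) x = alt_proj f x + alt_proj g x" for g :: "('m \<Rightarrow> real) \<Rightarrow> real^('m \<Rightarrow> 'n)"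
      by (simp add: alt_proj_def perm_op_linear scaleR_add_right sum.distrib)
  next
    show "\<exists>K. \<forall>f\<in>L_tensor \<tau>. l2norm ?M (alt_proj f :: ('m \<Rightarrow> real) \<Rightarrow> real^('m \<Rightarrow> 'n)) \<le> K * l2norm ?M f"
    proof (intro exI ballI)
      fix f :: "('m \<Rightarrow> real) \<Rightarrow> real^('m \<Rightarrow> 'n)" assume f: "f \<in> L_tensor \<tau>"
      show "l2norm ?M (alt_proj f) \<le> (\<bar>1 / ?f\<bar> * real (card ?P)) * l2norm ?M f"
        unfolding alt_proj_def l2norm_scaleR mult.assoc
        using f part[of f ?P] by (intro mult_left_mono) (simp_all add: L_tensor_def)
    qed
  qed
qed

text \<open>The range of an idempotent is its fixed space. In this form closedness under limits and
  invariance under operators commuting with \<open>alt_proj\<close> become visible.\<close>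

lemma L_wedge_iff:
  assumes \<tau>: "0 < \<tau>"
  shows "\<Phi> \<in> L_wedge \<tau> \<longleftrightarrow> \<Phi> \<in> L_tensor \<tau> \<and> (AE \<theta> in pow_measure \<tau>. alt_proj \<Phi> \<theta> = \<Phi> \<theta>)"
proof safe
  assume "\<Phi> \<in> L_wedge \<tau>"
  then obtain \<Psi> where L: "\<Phi> \<in> L_tensor \<tau>" "\<Psi> \<in> L_tensor \<tau>" and eq: "AE \<theta> in pow_measure \<tau>. \<Phi> \<theta> = alt_proj \<Psi> \<theta>"
    by (auto simp: L_wedge_def)
  then show "\<Phi> \<in> L_tensor \<tau>" by simp
  have "AE \<theta> in pow_measure \<tau>. alt_proj \<Phi> \<theta> = alt_proj (alt_proj \<Psi>) \<theta>"
    by (rule bounded_op_cong[OF L_tensor_subspace bounded_op_alt_proj[OF \<tau>] L(1) bounded_opD(1)[OF bounded_op_alt_proj[OF \<tau>] L(2)] eq])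
  with eq show "AE \<theta> in pow_measure \<tau>. alt_proj \<Phi> \<theta> = \<Phi> \<theta>" by eventually_elim (simp add: alt_proj_idem)
next
  assume "\<Phi> \<in> L_tensor \<tau>" "AE \<theta> in pow_measure \<tau>. alt_proj \<Phi> \<theta> = \<Phi> \<theta>"
  then show "\<Phi> \<in> L_wedge \<tau>" unfolding L_wedge_def by (auto elim!: eventually_mono intro!: bexI[of _ \<Phi>])
qed

lemma L_wedge_subspace:
  assumes \<tau>: "0 < \<tau>"
  shows "L2_subspace (pow_measure \<tau>) (L_wedge \<tau> :: (('m::finite \<Rightarrow> real) \<Rightarrow> real^('m \<Rightarrow> 'n::finite)) set)"
proof -
  let ?M = "pow_measure \<tau> :: ('m \<Rightarrow> real) measure"
  let ?W = "L_wedge \<tau> :: (('m \<Rightarrow> real) \<Rightarrow> real^('m \<Rightarrow> 'n)) set"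
  note A = bounded_op_alt_proj[OF \<tau>, where ?'m = 'm and ?'n = 'n]
  note TD = L2_subspaceD[OF L_tensor_subspace]
  show ?thesis unfolding L2_subspace_def
  proof (intro conjI ballI allI impI)
    show "?W \<subseteq> L2 ?M" by (auto simp: L_wedge_def L_tensor_def)
    show "(\<lambda>x. 0) \<in> ?W"
      using TD(2)[of \<tau>] bounded_opD(3)[OF A TD(2), of 0] unfolding L_wedge_iff[OF \<tau>] by simp
    show "(\<lambda>x. f x + g x) \<in> ?W" if f: "f \<in> ?W" and g: "g \<in> ?W" for f g
    proof -
      have fL: "f \<in> L_tensor \<tau>" "AE \<theta> in ?M. alt_proj f \<theta> = f \<theta>" and gL: "g \<in> L_tensor \<tau>" "AE \<theta> in ?M. alt_proj g \<theta> = g \<theta>"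
        using f g by (auto simp: L_wedge_iff[OF \<tau>])
      have "AE \<theta> in ?M. alt_proj (\<lambda>x. f x + g x) \<theta> = f \<theta> + g \<theta>"
        using bounded_opD(2)[OF A fL(1) gL(1)] fL(2) gL(2) by eventually_elim simp
      then show ?thesis using TD(3)[OF fL(1) gL(1)] by (simp add: L_wedge_iff[OF \<tau>])
    qed
    show "(\<lambda>x. c *\<^sub>R f x) \<in> ?W" if f: "f \<in> ?W" for c f
    proof -
      have fL: "f \<in> L_tensor \<tau>" "AE \<theta> in ?M. alt_proj f \<theta> = f \<theta>" using f by (auto simp: L_wedge_iff[OF \<tau>])
      have "AE \<theta> in ?M. alt_proj (\<lambda>x. c *\<^sub>R f x) \<theta> = c *\<^sub>R f \<theta>"
        using bounded_opD(3)[OF A fL(1), of c] fL(2) by eventually_elim simp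
      then show ?thesis using TD(4)[OF fL(1)] by (simp add: L_wedge_iff[OF \<tau>])
    qed
    fix F :: "nat \<Rightarrow> ('m \<Rightarrow> real) \<Rightarrow> real^('m \<Rightarrow> 'n)" and g
    assume "(\<forall>n. F n \<in> ?W) \<and> g \<in> L2 ?M \<and> (\<lambda>n. l2norm ?M (\<lambda>x. F n x - g x)) \<longlonglongrightarrow> 0"
    then have F: "\<And>n. F n \<in> L_tensor \<tau>" "\<And>n. AE \<theta> in ?M. alt_proj (F n) \<theta> = F n \<theta>" and g: "g \<in> L_tensor \<tau>"
      and lim: "(\<lambda>n. l2norm ?M (\<lambda>x. F n x - g x)) \<longlonglongrightarrow> 0"
      by (auto simp: L_wedge_iff[OF \<tau>] L_tensor_def)
    have L: "f \<in> L_tensor \<tau> \<Longrightarrow> f \<in> L2 ?M" for f :: "('m \<Rightarrow> real) \<Rightarrow> real^('m \<Rightarrow> 'n)" by (simp add: L_tensor_def)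
    have e: "(\<lambda>n. emb ?M (F n)) \<longlonglongrightarrow> emb ?M g"
      using lim by (subst tendsto_dist_iff) (simp add: l2norm_emb_diff L F(1) g)
    then have "(\<lambda>n. emb ?M (alt_proj (F n))) \<longlonglongrightarrow> emb ?M (alt_proj g)"
      by (rule bounded_op_tendsto[OF L_tensor_subspace A F(1) g])
    moreover have "emb ?M (alt_proj (F n)) = emb ?M (F n)" for n
      using emb_eq_iff[OF L[OF bounded_opD(1)[OF A F(1)[of n]]] L[OF F(1)[of n]]] F(2)[of n] by blast
    ultimately have "emb ?M (alt_proj g) = emb ?M g" using e LIMSEQ_unique by auto
    then have "AE \<theta> in ?M. alt_proj g \<theta> = g \<theta>"
      using emb_eq_iff[OF L[OF bounded_opD(1)[OF A g]] L[OF g]] by blast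
    then show "g \<in> ?W" using g by (simp add: L_wedge_iff[OF \<tau>])
  qed
qed

section \<open>The tensor power of the semigroup\<close>

locale delay_tensor = delay_semigroup \<tau> At G
  for \<tau> and At :: "(real \<Rightarrow> real^'n::finite) \<Rightarrow> real^'n" and G +
  fixes Gm :: "real \<Rightarrow> (('m::finite \<Rightarrow> real) \<Rightarrow> real^('m \<Rightarrow> 'n)) \<Rightarrow> ('m \<Rightarrow> real) \<Rightarrow> real^('m \<Rightarrow> 'n)"
  assumes tensor_power: "0 \<le> t \<Longrightarrow> is_tensor_power \<tau> (G t) (Gm t)"
begin

abbreviation "\<P> \<equiv> pow_measure \<tau> :: ('m \<Rightarrow> real) measure"

lemma Gm_op: "0 \<le> t \<Longrightarrow> bounded_op \<P> (L_tensor \<tau>) (Gm t)"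
  using tensor_power by (auto simp: is_tensor_power_def)

lemma Gm_elem:
  assumes "0 \<le> t" "\<And>j. \<phi> j \<in> L2 (\<D> \<tau>)"
  shows "AE \<theta> in \<P>. Gm t (elem_tensor \<phi>) \<theta> = elem_tensor (\<lambda>j. G t (\<phi> j)) \<theta>"
  using tensor_power assms by (auto simp: is_tensor_power_def)

lemma L_tensor_L2: "f \<in> L_tensor \<tau> \<Longrightarrow> f \<in> L2 \<P>"
  by (simp add: L_tensor_def)

lemma AE_elem_tensor_cong:
  assumes "\<And>j. AE y in \<D> \<tau>. f j y = g j y"
  shows "AE \<theta> in \<P>. elem_tensor f \<theta> = elem_tensor g \<theta>"
proof -
  have "AE \<theta> in \<P>. \<forall>j\<in>UNIV. f j (\<theta> j) = g j (\<theta> j)"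
    unfolding pow_measure_def by (intro AE_finite_allI AE_component[OF \<tau>] assms) auto
  then show ?thesis by eventually_elim (simp add: elem_tensor_def)
qed

lemma Gm_sum:
  assumes t: "0 \<le> t" and \<phi>: "\<And>i j. i < N \<Longrightarrow> \<phi> i j \<in> L2 (\<D> \<tau>)"
  shows "AE \<theta> in \<P>. Gm t (tensor_sum N \<phi>) \<theta> = (\<Sum>i<N. elem_tensor (\<lambda>j. G t (\<phi> i j)) \<theta>)"
proof -
  have "AE \<theta> in \<P>. Gm t (tensor_sum N \<phi>) \<theta> = (\<Sum>i<N. Gm t (elem_tensor (\<phi> i)) \<theta>)"
    using bounded_op_sum[OF L_tensor_subspace Gm_op[OF t], of N "\<lambda>i. elem_tensor (\<phi> i)" "\<lambda>_. 1"]
      elem_tensor_L2(1)[OF \<tau>, of "\<phi> i" for i] \<phi> by (simp add: L_tensor_def)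
  moreover have "AE \<theta> in \<P>. \<forall>i\<in>{..<N}. Gm t (elem_tensor (\<phi> i)) \<theta> = elem_tensor (\<lambda>j. G t (\<phi> i j)) \<theta>"
    by (intro AE_finite_allI Gm_elem[OF t]) (use \<phi> in auto)
  ultimately show ?thesis by eventually_elim simp
qed

lemma traj_tensorE:
  assumes "traj_tensor \<Phi> \<Xi>"
  obtains N \<phi> X where "\<forall>i<N. \<forall>l. is_traj (\<phi> i l) (X i l)" "\<Phi> = tensor_sum N \<phi>" "\<Xi> = translate_sum N X"
  using assms unfolding traj_tensor_def by blast

lemma Gm_traj:
  assumes tr: "traj_tensor \<Phi> \<Xi>" and t: "t \<in> {0..\<tau>}"
  shows "AE \<theta> in \<P>. Gm t \<Phi> \<theta> = \<Xi> t \<theta>"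
proof -
  obtain N \<phi> X where 1: "\<forall>i<N. \<forall>l. is_traj (\<phi> i l) (X i l)" "\<Phi> = tensor_sum N \<phi>" "\<Xi> = translate_sum N X" by (rule traj_tensorE[OF tr])
  have X: "\<And>i l. i < N \<Longrightarrow> is_traj (\<phi> i l) (X i l)" using 1(1) by blast
  have t0: "0 \<le> t" using t by simp
  have "AE \<theta> in \<P>. \<forall>i\<in>{..<N}. elem_tensor (\<lambda>j. G t (\<phi> i j)) \<theta> = elem_tensor (\<lambda>l \<theta>. X i l (t + \<theta>)) \<theta>"
    by (intro AE_finite_allI AE_elem_tensor_cong) (use trajD(4)[OF X t] in auto)
  moreover have "AE \<theta> in \<P>. Gm t \<Phi> \<theta> = (\<Sum>i<N. elem_tensor (\<lambda>j. G t (\<phi> i j)) \<theta>)"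
    unfolding 1(2) by (rule Gm_sum[OF t0]) (rule trajD(1)[OF X])
  ultimately show ?thesis unfolding 1(3) by eventually_elim simp
qed

definition GmK :: real where "GmK = GK ^ CARD('m)"

lemma GmK_ge_1: "1 \<le> GmK"
  unfolding GmK_def by (rule one_le_power[OF GK(1)])

lemma Gm_bound_traj:
  assumes tr: "traj_tensor \<Phi> \<Xi>" and t: "t \<in> {0..\<tau>}"
  shows "l2norm \<P> (Gm t \<Phi>) \<le> GmK * l2norm \<P> \<Phi>"
proof -
  obtain N \<phi> X where 1: "\<forall>i<N. \<forall>l. is_traj (\<phi> i l) (X i l)" "\<Phi> = tensor_sum N \<phi>" "\<Xi> = translate_sum N X"
    by (rule traj_tensorE[OF tr])
  have X: "\<And>i l. i < N \<Longrightarrow> is_traj (\<phi> i l) (X i l)" using 1(1) by blast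
  have t0: "0 \<le> t" using t by simp
  have \<Phi>: "\<Phi> \<in> L2 \<P>" by (rule traj_tensor_L2[OF tr])
  have Gm\<Phi>: "Gm t \<Phi> \<in> L2 \<P>" using bounded_opD(1)[OF Gm_op[OF t0]] \<Phi> by (simp add: L_tensor_def)
  have "l2sq \<P> (\<lambda>\<theta>. Gm t \<Phi> \<theta>) = l2sq \<P> (\<lambda>\<theta>. \<Sum>i<N. elem_tensor (\<lambda>j. G t (\<phi> i j)) \<theta>)"
    using Gm_sum[OF t0, of N \<phi>] trajD(1)[OF X] unfolding 1(2) by (intro nn_integral_cong_AE) auto
  also have "\<dots> \<le> ennreal ((GK\<^sup>2) ^ card (UNIV :: 'm set)) * l2sq \<P> (\<lambda>\<theta>. \<Phi> \<theta>)"
    using slots_op_bound[OF \<tau> trajD(1)[OF X] G.op[OF t0] GK(2)[OF t], where N = N and S = UNIV] by (simp add: 1(2))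
  also have "\<dots> = ennreal ((GmK * l2norm \<P> \<Phi>)\<^sup>2)"
    unfolding L2_nn_integral[OF \<Phi>]
    by (subst ennreal_mult[symmetric]) (use GK(1) in \<open>simp_all add: GmK_def power_mult_distrib power_mult[symmetric] mult.commute\<close>)
  finally show ?thesis
    by (intro L2I_nn_integral(2)[OF L2_measurable[OF Gm\<Phi>]]) (use GmK_ge_1 in auto)
qed

text \<open>A tensor power comes with some bound for each t, not with a uniform one. The constant
  \<open>GmK\<close> holds on a dense set; in the approximation of \<Phi> the uncontrolled K
  multiplies only an error that may be chosen small in dependence on t.\<close>

lemma Gm_bound:
  assumes \<Phi>: "\<Phi> \<in> L_tensor \<tau>" and t: "t \<in> {0..\<tau>}"
  shows "l2norm \<P> (Gm t \<Phi>) \<le> GmK * l2norm \<P> \<Phi>"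
proof (rule field_le_epsilon)
  fix e :: real assume e: "0 < e"
  have t0: "0 \<le> t" using t by simp
  note TD = L2_subspaceD[OF L_tensor_subspace[of \<tau>]]
  obtain K where K: "K \<ge> 0" "\<And>f. f \<in> L_tensor \<tau> \<Longrightarrow> l2norm \<P> (Gm t f) \<le> K * l2norm \<P> f" using bounded_op_bound[OF Gm_op[OF t0]] by blast
  define d where "d = e / (K + GmK)"
  have pos: "K + GmK > 0" using K(1) GmK_ge_1 by linarith
  have d: "d > 0" using e pos by (simp add: d_def)
  obtain \<Psi> \<Xi> where tr: "traj_tensor \<Psi> \<Xi>" and close: "l2norm \<P> (\<lambda>\<theta>. \<Psi> \<theta> - \<Phi> \<theta>) < d"
    using traj_tensor_dense[OF \<Phi> d] by blast
  have \<Psi>: "\<Psi> \<in> L_tensor \<tau>" using traj_tensor_L2[OF tr] by (simp add: L_tensor_def)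
  have D: "(\<lambda>\<theta>. \<Phi> \<theta> - \<Psi> \<theta>) \<in> L_tensor \<tau>" by (rule TD(5)[OF \<Phi> \<Psi>])
  note Gmem = bounded_opD(1)[OF Gm_op[OF t0]]
  have "l2norm \<P> (Gm t \<Phi>) = l2norm \<P> (\<lambda>\<theta>. Gm t (\<lambda>\<theta>. \<Phi> \<theta> - \<Psi> \<theta>) \<theta> + Gm t \<Psi> \<theta>)"
  proof (rule l2norm_cong_AE)
    show "AE \<theta> in \<P>. Gm t \<Phi> \<theta> = Gm t (\<lambda>\<theta>. \<Phi> \<theta> - \<Psi> \<theta>) \<theta> + Gm t \<Psi> \<theta>"
      using bounded_op_diff[OF L_tensor_subspace Gm_op[OF t0] \<Phi> \<Psi>] by eventually_elim simp
  qed (intro borel_measurable_add L2_measurable L_tensor_L2 Gmem \<Phi> \<Psi> D)+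
  also have "\<dots> \<le> l2norm \<P> (Gm t (\<lambda>\<theta>. \<Phi> \<theta> - \<Psi> \<theta>)) + l2norm \<P> (Gm t \<Psi>)"
    by (intro l2norm_triangle L_tensor_L2 Gmem \<Psi> D)
  also have "\<dots> \<le> K * l2norm \<P> (\<lambda>\<theta>. \<Phi> \<theta> - \<Psi> \<theta>) + GmK * l2norm \<P> \<Psi>"
    by (intro add_mono K(2)[OF D] Gm_bound_traj[OF tr t])
  also have "l2norm \<P> \<Psi> = l2norm \<P> (\<lambda>\<theta>. \<Phi> \<theta> + (\<Psi> \<theta> - \<Phi> \<theta>))" by simp
  also have "\<dots> \<le> l2norm \<P> \<Phi> + l2norm \<P> (\<lambda>\<theta>. \<Psi> \<theta> - \<Phi> \<theta>)"
    by (intro l2norm_triangle L2_diff L_tensor_L2 \<Phi> \<Psi>)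
  finally have "l2norm \<P> (Gm t \<Phi>) \<le> K * l2norm \<P> (\<lambda>\<theta>. \<Psi> \<theta> - \<Phi> \<theta>) + GmK * (l2norm \<P> \<Phi> + l2norm \<P> (\<lambda>\<theta>. \<Psi> \<theta> - \<Phi> \<theta>))"
    using GmK_ge_1 by (simp add: l2norm_diff_commute[of \<P> \<Phi> \<Psi>] mult_left_mono)
  also have "\<dots> \<le> K * d + GmK * (l2norm \<P> \<Phi> + d)"
    using close K(1) GmK_ge_1 by (intro add_mono mult_left_mono) auto
  also have "\<dots> = GmK * l2norm \<P> \<Phi> + (K + GmK) * d" by (simp add: algebra_simps)
  also have "(K + GmK) * d = e" using pos by (simp add: d_def)
  finally show "l2norm \<P> (Gm t \<Phi>) \<le> GmK * l2norm \<P> \<Phi> + e" .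
qed

lemma Gm_semigroup:
  assumes s: "0 \<le> s" and t: "0 \<le> t" and \<Phi>: "\<Phi> \<in> L_tensor \<tau>"
  shows "AE \<theta> in \<P>. Gm (s + t) \<Phi> \<theta> = Gm s (Gm t \<Phi>) \<theta>"
proof (rule bounded_op_eqI[OF \<tau> _ _ _ \<Phi>])
  show "bounded_op \<P> (L_tensor \<tau>) (Gm (s + t))" using s t by (intro Gm_op) simp
  show "bounded_op \<P> (L_tensor \<tau>) (\<lambda>f. Gm s (Gm t f))"
    by (rule bounded_op_comp[OF L_tensor_subspace Gm_op[OF s] Gm_op[OF t]])
  fix \<phi> :: "'m \<Rightarrow> real \<Rightarrow> real^'n" assume \<phi>: "\<And>j. \<phi> j \<in> L2 (\<D> \<tau>)"
  have G\<phi>: "G t (\<phi> j) \<in> L2 (\<D> \<tau>)" for j by (rule G.G_mem[OF t \<phi>])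
  have T: "elem_tensor \<phi> \<in> L_tensor \<tau>" "elem_tensor (\<lambda>j. G t (\<phi> j)) \<in> L_tensor \<tau>"
    unfolding L_tensor_def by (intro elem_tensor_L2(1)[OF \<tau>] \<phi> G\<phi>)+
  have "AE \<theta> in \<P>. Gm s (Gm t (elem_tensor \<phi>)) \<theta> = Gm s (elem_tensor (\<lambda>j. G t (\<phi> j))) \<theta>"
    by (rule bounded_op_cong[OF L_tensor_subspace Gm_op[OF s] bounded_opD(1)[OF Gm_op[OF t] T(1)] T(2) Gm_elem[of t \<phi>, OF t \<phi>]])
  moreover have "AE \<theta> in \<P>. Gm s (elem_tensor (\<lambda>j. G t (\<phi> j))) \<theta> = elem_tensor (\<lambda>j. G s (G t (\<phi> j))) \<theta>"
    by (rule Gm_elem[of s "\<lambda>j. G t (\<phi> j)", OF s G\<phi>])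
  moreover have "AE \<theta> in \<P>. elem_tensor (\<lambda>j. G (s + t) (\<phi> j)) \<theta> = elem_tensor (\<lambda>j. G s (G t (\<phi> j))) \<theta>"
    using c0_G s t \<phi> by (intro AE_elem_tensor_cong) (auto simp: c0_semigroup_def)
  moreover have "AE \<theta> in \<P>. Gm (s + t) (elem_tensor \<phi>) \<theta> = elem_tensor (\<lambda>j. G (s + t) (\<phi> j)) \<theta>"
    using s t by (intro Gm_elem \<phi>) simp
  ultimately show "AE \<theta> in \<P>. Gm (s + t) (elem_tensor \<phi>) \<theta> = Gm s (Gm t (elem_tensor \<phi>)) \<theta>"
    by eventually_elim simp
qed

lemma Gm_zero:
  assumes \<Phi>: "\<Phi> \<in> L_tensor \<tau>" shows "AE \<theta> in \<P>. Gm 0 \<Phi> \<theta> = \<Phi> \<theta>"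
proof (rule bounded_op_eqI[OF \<tau> Gm_op[OF order_refl] bounded_op_ident _ \<Phi>])
  fix \<phi> :: "'m \<Rightarrow> real \<Rightarrow> real^'n" assume \<phi>: "\<And>j. \<phi> j \<in> L2 (\<D> \<tau>)"
  have "AE \<theta> in \<P>. elem_tensor (\<lambda>j. G 0 (\<phi> j)) \<theta> = elem_tensor \<phi> \<theta>"
    using c0_G \<phi> by (intro AE_elem_tensor_cong) (auto simp: c0_semigroup_def)
  with Gm_elem[of 0 \<phi>, OF order_refl \<phi>] show "AE \<theta> in \<P>. Gm 0 (elem_tensor \<phi>) \<theta> = elem_tensor \<phi> \<theta>"
    by eventually_elim simp
qed

text \<open>On an elementary tensor both sides apply \<open>G t\<close> to every factor and permute
  the factors; the order is immaterial because all factors see the same operator.\<close>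

lemma Gm_alt_proj:
  assumes t: "0 \<le> t" and \<Phi>: "\<Phi> \<in> L_tensor \<tau>"
  shows "AE \<theta> in \<P>. Gm t (alt_proj \<Phi>) \<theta> = alt_proj (Gm t \<Phi>) \<theta>"
proof (rule bounded_op_eqI[OF \<tau> _ _ _ \<Phi>])
  note AP = bounded_op_alt_proj[OF \<tau>, where ?'m = 'm and ?'n = 'n]
  note TD = L2_subspaceD[OF L_tensor_subspace[of \<tau>]]
  show "bounded_op \<P> (L_tensor \<tau>) (\<lambda>f. Gm t (alt_proj f))"
    by (rule bounded_op_comp[OF L_tensor_subspace Gm_op[OF t] AP])
  show "bounded_op \<P> (L_tensor \<tau>) (\<lambda>f. alt_proj (Gm t f))"
    by (rule bounded_op_comp[OF L_tensor_subspace AP Gm_op[OF t]])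
  fix \<phi> :: "'m \<Rightarrow> real \<Rightarrow> real^'n" assume \<phi>: "\<And>j. \<phi> j \<in> L2 (\<D> \<tau>)"
  have G\<phi>: "G t (\<phi> j) \<in> L2 (\<D> \<tau>)" for j by (rule G.G_mem[OF t \<phi>])
  let ?P = "{\<sigma>::'m \<Rightarrow> 'm. \<sigma> permutes UNIV}"
  \<comment> \<open>The permutations are enumerated to match \<open>bounded_op_sum\<close>, which
    treats sums over initial segments of the naturals.\<close>
  obtain \<sigma> where \<sigma>: "bij_betw \<sigma> {..<card ?P} ?P" using ex_bij_betw_nat_finite[of ?P] by (auto simp: lessThan_atLeast0)
  have \<sigma>P: "\<sigma> i permutes UNIV" if "i < card ?P" for i using bij_betwE[OF \<sigma>] that by auto
  have T: "elem_tensor (\<lambda>j. \<phi> (\<rho> j)) \<in> L_tensor \<tau>" for \<rho> unfolding L_tensor_def by (intro elem_tensor_L2(1)[OF \<tau>] \<phi>)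
  have T2: "elem_tensor (\<lambda>j. G t (\<phi> j)) \<in> L_tensor \<tau>" unfolding L_tensor_def by (intro elem_tensor_L2(1)[OF \<tau>] G\<phi>)
  have ap: "alt_proj (elem_tensor \<psi>) = (\<lambda>\<theta>. \<Sum>i<card ?P. (1 / fact CARD('m) * of_int (sign (\<sigma> i))) *\<^sub>R elem_tensor (\<lambda>j. \<psi> (\<sigma> i j)) \<theta>)"
    for \<psi> :: "'m \<Rightarrow> real \<Rightarrow> real^'n"
  proof (rule ext)
    fix \<theta>
    have "alt_proj (elem_tensor \<psi>) \<theta> = (\<Sum>\<rho>\<in>?P. (1 / fact CARD('m) * of_int (sign \<rho>)) *\<^sub>R elem_tensor (\<lambda>j. \<psi> (\<rho> j)) \<theta>)"
      unfolding alt_proj_def scaleR_sum_right by (intro sum.cong) (auto simp: perm_op_elem_tensor)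
    also have "\<dots> = (\<Sum>i<card ?P. (1 / fact CARD('m) * of_int (sign (\<sigma> i))) *\<^sub>R elem_tensor (\<lambda>j. \<psi> (\<sigma> i j)) \<theta>)"
      by (rule sum.reindex_bij_betw[OF \<sigma>, symmetric])
    finally show "alt_proj (elem_tensor \<psi>) \<theta> = (\<Sum>i<card ?P. (1 / fact CARD('m) * of_int (sign (\<sigma> i))) *\<^sub>R elem_tensor (\<lambda>j. \<psi> (\<sigma> i j)) \<theta>)" .
  qed
  have "AE \<theta> in \<P>. Gm t (alt_proj (elem_tensor \<phi>)) \<theta>
    = (\<Sum>i<card ?P. (1 / fact CARD('m) * of_int (sign (\<sigma> i))) *\<^sub>R Gm t (elem_tensor (\<lambda>j. \<phi> (\<sigma> i j))) \<theta>)"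
    unfolding ap
    by (rule bounded_op_sum[OF L_tensor_subspace Gm_op[OF t], where f = "\<lambda>i. elem_tensor (\<lambda>j. \<phi> (\<sigma> i j))", THEN conjunct2]) (rule T)
  moreover have "AE \<theta> in \<P>. \<forall>i\<in>{..<card ?P}. Gm t (elem_tensor (\<lambda>j. \<phi> (\<sigma> i j))) \<theta> = elem_tensor (\<lambda>j. G t (\<phi> (\<sigma> i j))) \<theta>"
    by (intro AE_finite_allI Gm_elem[OF t] \<phi>) simp
  moreover have "AE \<theta> in \<P>. alt_proj (Gm t (elem_tensor \<phi>)) \<theta> = alt_proj (elem_tensor (\<lambda>j. G t (\<phi> j))) \<theta>"
    by (rule bounded_op_cong[OF L_tensor_subspace AP bounded_opD(1)[OF Gm_op[OF t] T[of id, unfolded id_def]] T2 Gm_elem[of t \<phi>, OF t \<phi>]])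
  ultimately show "AE \<theta> in \<P>. Gm t (alt_proj (elem_tensor \<phi>)) \<theta> = alt_proj (Gm t (elem_tensor \<phi>)) \<theta>"
    by eventually_elim (simp add: ap)
qed

lemma Gm_wedge:
  assumes t: "0 \<le> t" and \<Phi>: "\<Phi> \<in> L_wedge \<tau>" shows "Gm t \<Phi> \<in> L_wedge \<tau>"
proof -
  have T: "\<Phi> \<in> L_tensor \<tau>" and ae: "AE \<theta> in \<P>. alt_proj \<Phi> \<theta> = \<Phi> \<theta>" using \<Phi> by (auto simp: L_wedge_iff[OF \<tau>])
  have "AE \<theta> in \<P>. Gm t (alt_proj \<Phi>) \<theta> = Gm t \<Phi> \<theta>"
    by (rule bounded_op_cong[OF L_tensor_subspace Gm_op[OF t] bounded_opD(1)[OF bounded_op_alt_proj[OF \<tau>] T] T ae])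
  with Gm_alt_proj[OF t T] have "AE \<theta> in \<P>. alt_proj (Gm t \<Phi>) \<theta> = Gm t \<Phi> \<theta>" by eventually_elim simp
  then show ?thesis using bounded_opD(1)[OF Gm_op[OF t] T] by (simp add: L_wedge_iff[OF \<tau>])
qed

text \<open>Boundedness, continuity and joint measurability are what dominated convergence and
  Fubini require. They are properties of the concrete function \<Xi>, at every point, and not of a
  class.\<close>

lemma traj_tensor_props:
  assumes tr: "traj_tensor \<Phi> \<Xi>"
  shows "\<exists>B\<ge>0. \<forall>t (\<theta> :: 'm \<Rightarrow> real). norm (\<Xi> t \<theta>) \<le> B"
    and "continuous_on UNIV (\<lambda>t. \<Xi> t \<theta>)"
    and "continuous_on UNIV (\<lambda>s. \<Xi> t (\<theta>(j := s)))"
    and "(\<lambda>p. \<Xi> (fst p) (snd p)) \<in> borel_measurable (time_measure \<tau> \<Otimes>\<^sub>M \<P>)"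
    and "(\<lambda>\<theta>. \<Xi> t \<theta>) \<in> borel_measurable \<P>"
proof -
  obtain N \<phi> X where 1: "\<forall>i<N. \<forall>l. is_traj (\<phi> i l) (X i l)"
    and "\<Phi> = tensor_sum N \<phi>" and \<Xi>: "\<Xi> = translate_sum N X" by (rule traj_tensorE[OF tr])
  have X: "\<And>i l. i < N \<Longrightarrow> is_traj (\<phi> i l) (X i l)" using 1(1) by blast
  note D = trajD[OF X]
  have cvec: "continuous_on UNIV (\<lambda>t. \<chi> i. f t i)" if "\<And>i. continuous_on UNIV (\<lambda>t. f t i)" for f :: "real \<Rightarrow> ('m \<Rightarrow> 'n) \<Rightarrow> real"
    using that by (intro continuous_on_vec_lambda) simp
  have "\<exists>B. \<forall>i<N. \<forall>l s. norm (X i l s) \<le> B"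
  proof -
    have "\<forall>i l. \<exists>b. i < N \<longrightarrow> (\<forall>s. norm (X i l s) \<le> b)" using D(3) by (fastforce simp: bounded_iff)
    then obtain b where b: "\<And>i l s. i < N \<Longrightarrow> norm (X i l s) \<le> b i l" by metis
    have "norm (X i l s) \<le> (\<Sum>i<N. \<Sum>l\<in>UNIV. \<bar>b i l\<bar>)" if i: "i < N" for i l s
    proof -
      have "norm (X i l s) \<le> \<bar>b i l\<bar>" using b[OF i, of l s] by simp
      also have "\<dots> \<le> (\<Sum>l\<in>UNIV. \<bar>b i l\<bar>)" by (rule member_le_sum) auto
      also have "\<dots> \<le> (\<Sum>i<N. \<Sum>l\<in>UNIV. \<bar>b i l\<bar>)" using i by (intro member_le_sum) (auto intro: sum_nonneg)
      finally show ?thesis .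
    qed
    then show ?thesis by blast
  qed
  then obtain B where B: "\<And>i l s. i < N \<Longrightarrow> norm (X i l s) \<le> B" by blast
  define C where "C = max B 0"
  have C: "C \<ge> 0" "\<And>i l s. i < N \<Longrightarrow> norm (X i l s) \<le> C" using B by (simp_all add: C_def le_max_iff_disj)
  have "norm (\<Xi> t \<theta>) \<le> real N * C ^ CARD('m)" for t \<theta>
  proof -
    have "norm (elem_tensor (\<lambda>l \<theta>. X i l (t + \<theta>)) \<theta>) \<le> C ^ CARD('m)" if i: "i < N" for i
    proof (rule power2_le_imp_le)
      have "(norm (elem_tensor (\<lambda>l \<theta>. X i l (t + \<theta>)) \<theta>))\<^sup>2 \<le> (\<Prod>j\<in>(UNIV::'m set). C\<^sup>2)"
        unfolding norm_elem_tensor using C(2)[OF i] C(1) by (intro prod_mono) (auto intro!: power_mono intro: order_trans)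
      then show "(norm (elem_tensor (\<lambda>l \<theta>. X i l (t + \<theta>)) \<theta>))\<^sup>2 \<le> (C ^ CARD('m))\<^sup>2"
        by (simp add: power_mult[symmetric] mult.commute)
    qed (use C(1) in simp)
    then show ?thesis unfolding \<Xi> by (intro order_trans[OF norm_sum] order_trans[OF sum_bounded_above]) auto
  qed
  then show "\<exists>B\<ge>0. \<forall>t (\<theta> :: 'm \<Rightarrow> real). norm (\<Xi> t \<theta>) \<le> B" by (intro exI[of _ "real N * C ^ CARD('m)"]) (use C(1) in auto)
  show "continuous_on UNIV (\<lambda>t. \<Xi> t \<theta>)"
    unfolding \<Xi> elem_tensor_def
    by (intro continuous_intros cvec) (auto intro!: continuous_intros continuous_on_compose2[OF D(2)])
  show "continuous_on UNIV (\<lambda>s. \<Xi> t (\<theta>(j := s)))"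
  proof -
    have "continuous_on UNIV (\<lambda>s. X i l (t + (\<theta>(j := s)) l) $ a)" if "i < N" for i l a
      by (cases "l = j") (auto intro!: continuous_intros continuous_on_compose2[OF D(2)[OF that]])
    then show ?thesis unfolding \<Xi> elem_tensor_def by (intro continuous_on_sum cvec continuous_on_prod) auto
  qed
  have md: "(\<lambda>\<theta>. \<theta> l) \<in> borel_measurable \<P>" for l :: 'm
    by (rule measurable_compose[OF measurable_pow_component borel_measurable_delay_ident])
  have m1: "(\<lambda>p. X i l (fst p + snd p l) $ a) \<in> borel_measurable (time_measure \<tau> \<Otimes>\<^sub>M \<P>)" if "i < N" for i l a
    by (intro borel_measurable_vec_nth' measurable_compose[OF _ D(5)[OF that]] borel_measurable_add
      measurable_compose[OF measurable_snd md] measurable_compose[OF measurable_fst borel_measurable_time]) simp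
  show "(\<lambda>p. \<Xi> (fst p) (snd p)) \<in> borel_measurable (time_measure \<tau> \<Otimes>\<^sub>M \<P>)"
    unfolding \<Xi> elem_tensor_def by (intro borel_measurable_sum borel_measurable_vec_lambda borel_measurable_prod m1) simp
  have m2: "(\<lambda>\<theta>. X i l (t + \<theta> l) $ a) \<in> borel_measurable \<P>" if "i < N" for i l a
    by (intro borel_measurable_vec_nth' measurable_compose[OF _ D(5)[OF that]] borel_measurable_add md) simp
  show "(\<lambda>\<theta>. \<Xi> t \<theta>) \<in> borel_measurable \<P>"
    unfolding \<Xi> elem_tensor_def by (intro borel_measurable_sum borel_measurable_vec_lambda borel_measurable_prod m2) simp
qed

text \<open>Pointwise continuity in t and boundedness on a finite measure space give convergence in
  mean square.\<close>

lemma traj_tensor_strong_cont: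
  assumes tr: "traj_tensor \<Phi> \<Xi>"
  shows "((\<lambda>t. l2norm \<P> (\<lambda>x. Gm t \<Phi> x - \<Phi> x)) \<longlongrightarrow> 0) (at_right 0)"
proof -
  note P = traj_tensor_props[OF tr]
  have \<Phi>: "\<Phi> \<in> L_tensor \<tau>" using traj_tensor_L2[OF tr] by (simp add: L_tensor_def)
  interpret finite_measure \<P> by (rule pow_finite_measure[OF \<tau>])
  obtain B where B: "B \<ge> 0" "\<And>t x. norm (\<Xi> t x) \<le> B" using P(1) by blast
  have "((\<lambda>t. l2norm \<P> (\<lambda>x. \<Xi> t x - \<Xi> 0 x)) \<longlongrightarrow> 0) (at_right 0)"
    unfolding tendsto_at_iff_sequentially
  proof (intro allI impI)
    fix u :: "nat \<Rightarrow> real" assume "u \<longlonglongrightarrow> 0"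
    then have "(\<lambda>n. l2norm \<P> (\<lambda>x. \<Xi> (u n) x - \<Xi> 0 x)) \<longlonglongrightarrow> 0"
    proof (intro L2_dominated_limit[where g = "\<lambda>_. 2 * B"] P(5) AE_I2)
      show "(\<lambda>_. 2 * B) \<in> L2 \<P>" by (rule bounded_measurable_L2(1)[OF finite_measure_axioms, of _ "2 * B"]) (use B in auto)
      show "norm (\<Xi> (u n) x - \<Xi> 0 x) \<le> norm (2 * B)" for n x
        using norm_triangle_ineq4[of "\<Xi> (u n) x" "\<Xi> 0 x"] B(2)[of "u n" x] B(2)[of 0 x] B(1) by simp
      show "(\<lambda>n. \<Xi> (u n) x) \<longlonglongrightarrow> \<Xi> 0 x" if "u \<longlonglongrightarrow> 0" for x
        using P(2)[of x] that by (auto simp: continuous_on_eq_continuous_at intro: isCont_tendsto_compose[of 0 "\<lambda>t. \<Xi> t x"])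
    qed
    then show "((\<lambda>t. l2norm \<P> (\<lambda>x. \<Xi> t x - \<Xi> 0 x)) \<circ> u) \<longlonglongrightarrow> 0" by (simp add: o_def)
  qed
  moreover have "\<forall>\<^sub>F t in at_right 0. l2norm \<P> (\<lambda>x. \<Xi> t x - \<Xi> 0 x) = l2norm \<P> (\<lambda>x. Gm t \<Phi> x - \<Phi> x)"
    unfolding eventually_at_right_field
  proof (intro exI[of _ \<tau>] conjI allI impI \<tau>)
    fix t :: real assume "0 < t" "t < \<tau>"
    then have t: "t \<in> {0..\<tau>}" "0 \<le> t" by auto
    have G: "Gm t \<Phi> \<in> L2 \<P>" by (rule L_tensor_L2[OF bounded_opD(1)[OF Gm_op[OF t(2)] \<Phi>]])
    have "AE x in \<P>. \<Xi> 0 x = \<Phi> x"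
      using Gm_traj[OF tr, of 0] Gm_zero[OF \<Phi>] \<tau> by (auto elim: AE_mp)
    then have "AE x in \<P>. \<Xi> t x - \<Xi> 0 x = Gm t \<Phi> x - \<Phi> x"
      using Gm_traj[OF tr t(1)] by eventually_elim simp
    then show "l2norm \<P> (\<lambda>x. \<Xi> t x - \<Xi> 0 x) = l2norm \<P> (\<lambda>x. Gm t \<Phi> x - \<Phi> x)"
      by (intro l2norm_cong_AE borel_measurable_diff P(5) L2_measurable[OF G] L2_measurable[OF L_tensor_L2[OF \<Phi>]])
  qed
  ultimately show ?thesis by (rule Lim_transform_eventually)
qed

text \<open>Strong continuity extends from a dense set by the bound \<open>GmK\<close>, uniform on
  [0,\<tau>]. Replacing \<Phi> by \<Psi> costs (\<open>GmK\<close> + 1) d, which explains the choice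
  of d.\<close>

lemma Gm_strong_cont:
  assumes \<Phi>: "\<Phi> \<in> L_tensor \<tau>"
  shows "((\<lambda>t. l2norm \<P> (\<lambda>x. Gm t \<Phi> x - \<Phi> x)) \<longlongrightarrow> 0) (at_right 0)"
proof (rule tendstoI)
  fix e :: real assume e: "0 < e"
  define d where "d = (e / 2) / (GmK + 1)"
  have d: "0 < d" using e GmK_ge_1 by (simp add: d_def)
  obtain \<Psi> \<Xi> where tr: "traj_tensor \<Psi> \<Xi>" and close: "l2norm \<P> (\<lambda>x. \<Psi> x - \<Phi> x) < d"
    using traj_tensor_dense[OF \<Phi> d] by blast
  have \<Psi>: "\<Psi> \<in> L_tensor \<tau>" using traj_tensor_L2[OF tr] by (simp add: L_tensor_def)
  have "\<forall>\<^sub>F t in at_right 0. l2norm \<P> (\<lambda>x. Gm t \<Psi> x - \<Psi> x) < e / 2"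
    using order_tendstoD(2)[OF traj_tensor_strong_cont[OF tr], of "e / 2"] e by simp
  moreover have "\<forall>\<^sub>F t in at_right 0. t \<in> {0..\<tau>}"
    unfolding eventually_at_right_field by (intro exI[of _ \<tau>]) (use \<tau> in auto)
  ultimately show "\<forall>\<^sub>F t in at_right 0. dist (l2norm \<P> (\<lambda>x. Gm t \<Phi> x - \<Phi> x)) 0 < e"
  proof eventually_elim
    case (elim t)
    then have t0: "0 \<le> t" by simp
    note Gmem = bounded_opD(1)[OF Gm_op[OF t0]]
    let ?D = "\<lambda>x. \<Phi> x - \<Psi> x"
    have D: "?D \<in> L_tensor \<tau>" by (rule L2_subspaceD(5)[OF L_tensor_subspace \<Phi> \<Psi>])
    have close': "l2norm \<P> ?D < d" using close by (simp add: l2norm_diff_commute[of \<P> \<Phi> \<Psi>])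
    have "l2norm \<P> (\<lambda>x. Gm t \<Phi> x - \<Phi> x) = l2norm \<P> (\<lambda>x. Gm t ?D x + ((Gm t \<Psi> x - \<Psi> x) + (\<Psi> x - \<Phi> x)))"
    proof (rule l2norm_cong_AE)
      show "AE x in \<P>. Gm t \<Phi> x - \<Phi> x = Gm t ?D x + ((Gm t \<Psi> x - \<Psi> x) + (\<Psi> x - \<Phi> x))"
        using bounded_op_diff[OF L_tensor_subspace Gm_op[OF t0] \<Phi> \<Psi>] by eventually_elim simp
    qed (intro borel_measurable_add borel_measurable_diff L2_measurable L_tensor_L2 Gmem \<Phi> \<Psi> D)+
    also have "\<dots> \<le> l2norm \<P> (Gm t ?D) + l2norm \<P> (\<lambda>x. (Gm t \<Psi> x - \<Psi> x) + (\<Psi> x - \<Phi> x))"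
      by (intro l2norm_triangle L2_add L2_diff L_tensor_L2 Gmem \<Phi> \<Psi> D)
    also have "l2norm \<P> (\<lambda>x. (Gm t \<Psi> x - \<Psi> x) + (\<Psi> x - \<Phi> x)) \<le> l2norm \<P> (\<lambda>x. Gm t \<Psi> x - \<Psi> x) + l2norm \<P> (\<lambda>x. \<Psi> x - \<Phi> x)"
      by (intro l2norm_triangle L2_add L2_diff L_tensor_L2 Gmem \<Phi> \<Psi> D)
    also have "l2norm \<P> (Gm t ?D) \<le> GmK * l2norm \<P> ?D" by (rule Gm_bound[OF D elim(2)])
    also have "GmK * l2norm \<P> ?D \<le> GmK * d" using close' GmK_ge_1 by (intro mult_left_mono) auto
    finally have "l2norm \<P> (\<lambda>x. Gm t \<Phi> x - \<Phi> x) < GmK * d + (e / 2 + d)" using elim(1) close by simp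
    also have "\<dots> = (GmK + 1) * d + e / 2" by (simp add: algebra_simps)
    also have "(GmK + 1) * d = e / 2"
    proof -
      have "GmK + 1 \<noteq> 0" using GmK_ge_1 by linarith
      then show ?thesis unfolding d_def times_divide_eq_right[of _ "e / 2"] by (rule nonzero_mult_div_cancel_left)
    qed
    finally show ?case by (simp add: dist_real_def)
  qed
qed

lemma c0_tensor: "c0_semigroup \<P> (L_tensor \<tau>) Gm"
  unfolding c0_semigroup_def using Gm_op Gm_zero Gm_semigroup Gm_strong_cont by blast

lemma bounded_op_wedge: "0 \<le> t \<Longrightarrow> bounded_op \<P> (L_wedge \<tau>) (Gm t)"
  using Gm_op[of t] Gm_wedge[of t] by (auto simp: bounded_op_def L_wedge_def)

lemma c0_wedge: "c0_semigroup \<P> (L_wedge \<tau>) Gm"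
  unfolding c0_semigroup_def using bounded_op_wedge Gm_zero Gm_semigroup Gm_strong_cont
  by (auto simp: L_wedge_def)

sublocale T: L2_semigroup \<P> "L_tensor \<tau>" Gm
  by standard (rule L_tensor_subspace, rule c0_tensor)

end

section \<open>Sections of weighted time integrals\<close>

text \<open>The requirements on \<open>\<Phi>\<^sup>b\<^sub>j\<close> with respect to \<open>\<mu>\<close> in the remaining variables cover
  those for all restrictions of \<open>\<Phi>\<close> at once, because \<open>\<mu>\<close> charges the point \<open>0\<close>.\<close>

definition slice_section ::
    "real \<Rightarrow> 'm \<Rightarrow> real \<Rightarrow> (('m::finite \<Rightarrow> real) \<Rightarrow> 'v::euclidean_space) \<Rightarrow> (real \<Rightarrow> ('m \<Rightarrow> real) \<Rightarrow> 'v) \<Rightarrow> bool" where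
  "slice_section \<tau> j c I b \<longleftrightarrow>
     (\<forall>s\<in>{-\<tau>..0}. b s \<in> L2 (slice_measure \<tau> j) \<and> l2norm (slice_measure \<tau> j) (b s) \<le> c) \<and>
     (\<forall>s0\<in>{-\<tau>..0}. ((\<lambda>s. l2norm (slice_measure \<tau> j) (\<lambda>x. b s x - b s0 x)) \<longlongrightarrow> 0) (at s0 within {-\<tau>..0})) \<and>
     (AE s in \<D> \<tau>. AE x in slice_measure \<tau> j. I (x(j := s)) = b s x)"

definition has_sections :: "real \<Rightarrow> real \<Rightarrow> (('m::finite \<Rightarrow> real) \<Rightarrow> 'v::euclidean_space) \<Rightarrow> bool" where
  "has_sections \<tau> c I \<longleftrightarrow> (\<forall>j. \<exists>b. slice_section \<tau> j c I b)"

lemma slice_sectionD: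
  assumes "slice_section \<tau> j c I b"
  shows "\<forall>s\<in>{-\<tau>..0}. b s \<in> L2 (slice_measure \<tau> j)" and "\<forall>s\<in>{-\<tau>..0}. l2norm (slice_measure \<tau> j) (b s) \<le> c"
    and "\<forall>s0\<in>{-\<tau>..0}. ((\<lambda>s. l2norm (slice_measure \<tau> j) (\<lambda>x. b s x - b s0 x)) \<longlongrightarrow> 0) (at s0 within {-\<tau>..0})"
    and "AE s in \<D> \<tau>. AE x in slice_measure \<tau> j. I (x(j := s)) = b s x"
  using assms by (auto simp: slice_section_def)

lemma has_sectionsE:
  assumes "has_sections \<tau> c I" obtains b where "slice_section \<tau> j c I b"
  using assms by (auto simp: has_sections_def)

lemma time_measure_finite: "finite_measure (time_measure \<tau>)"
  by (rule finite_measureI, cases "0 \<le> \<tau>") (simp_all add: emeasure_restrict_space space_restrict_space)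

lemma space_time_measure [simp]: "space (time_measure \<tau>) = {0..\<tau>}"
  by (simp add: space_restrict_space)

text \<open>The middle estimate is Cauchy-Schwarz on [0,\<tau>] and is later integrated over the
  remaining variables. The last one is a crude supremum bound that makes pointwise time integrals
  bounded functions.\<close>

lemma integral_time_bound:
  fixes f :: "real \<Rightarrow> 'b::euclidean_space" and w :: "real \<Rightarrow> real" and W B :: real
  assumes \<tau>: "0 < \<tau>" and f: "f \<in> borel_measurable (time_measure \<tau>)" and B: "\<And>t. t \<in> {0..\<tau>} \<Longrightarrow> norm (f t) \<le> B"
    and w: "w \<in> borel_measurable (time_measure \<tau>)" and W: "\<And>t. t \<in> {0..\<tau>} \<Longrightarrow> \<bar>w t\<bar> \<le> W"
  shows "integrable (time_measure \<tau>) (\<lambda>t. w t *\<^sub>R f t)"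
    and "ennreal ((norm (\<integral>t. w t *\<^sub>R f t \<partial>time_measure \<tau>))\<^sup>2) \<le> ennreal (W\<^sup>2 * \<tau>) * l2sq (time_measure \<tau>) f"
    and "norm (\<integral>t. w t *\<^sub>R f t \<partial>time_measure \<tau>) \<le> W * B * \<tau>"
proof -
  interpret finite_measure "time_measure \<tau>" by (rule time_measure_finite)
  note [measurable] = f w
  have B0: "0 \<le> B" and W0: "0 \<le> W" using B[of 0] W[of 0] \<tau> by (auto intro: order_trans[OF norm_ge_zero] order_trans[OF abs_ge_zero])
  have meas: "measure (time_measure \<tau>) (space (time_measure \<tau>)) = \<tau>"
    using \<tau> by (simp add: measure_restrict_space space_restrict_space)
  have fL: "f \<in> L2 (time_measure \<tau>)" by (rule bounded_measurable_L2(1)[OF time_measure_finite f _ B0]) (use B in auto)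
  have nL: "(\<lambda>t. norm (f t)) \<in> L2 (time_measure \<tau>)" by (rule L2_norm[OF fL])
  have oL: "(\<lambda>t. 1::real) \<in> L2 (time_measure \<tau>)" "l2norm (time_measure \<tau>) (\<lambda>t. 1::real) \<le> sqrt \<tau>"
    using bounded_measurable_L2[OF time_measure_finite, of "\<lambda>_. 1::real" \<tau> 1] meas by auto
  have intn: "integrable (time_measure \<tau>) (\<lambda>t. norm (f t))"
    using L2_inner_integrable[OF nL oL(1)] by simp
  show int: "integrable (time_measure \<tau>) (\<lambda>t. w t *\<^sub>R f t)"
    by (rule Bochner_Integration.integrable_bound[of _ "\<lambda>t. W * norm (f t)"])
      (use intn W W0 in \<open>auto intro!: AE_I2 mult_right_mono simp: abs_mult\<close>)
  have "norm (\<integral>t. w t *\<^sub>R f t \<partial>time_measure \<tau>) \<le> (\<integral>t. norm (w t *\<^sub>R f t) \<partial>time_measure \<tau>)"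
    by (rule integral_norm_bound)
  also have "\<dots> \<le> (\<integral>t. W * norm (f t) \<partial>time_measure \<tau>)"
    by (rule integral_mono[OF integrable_norm[OF int]]) (use intn W W0 in \<open>auto intro!: mult_right_mono\<close>)
  finally have le1: "norm (\<integral>t. w t *\<^sub>R f t \<partial>time_measure \<tau>) \<le> W * (\<integral>t. norm (f t) \<partial>time_measure \<tau>)" by simp
  have "(\<integral>t. norm (f t) \<partial>time_measure \<tau>) \<le> l2norm (time_measure \<tau>) f * l2norm (time_measure \<tau>) (\<lambda>t. 1::real)"
    using L2_Cauchy_Schwarz[OF nL oL(1)] by (simp add: l2norm_norm)
  also have "\<dots> \<le> l2norm (time_measure \<tau>) f * sqrt \<tau>" by (intro mult_left_mono oL) simp
  finally have le2: "norm (\<integral>t. w t *\<^sub>R f t \<partial>time_measure \<tau>) \<le> W * (l2norm (time_measure \<tau>) f * sqrt \<tau>)"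
    by (rule order_trans[OF le1 mult_left_mono[OF _ W0]])
  have "(norm (\<integral>t. w t *\<^sub>R f t \<partial>time_measure \<tau>))\<^sup>2 \<le> (W * (l2norm (time_measure \<tau>) f * sqrt \<tau>))\<^sup>2"
    by (rule power_mono[OF le2]) simp
  also have "\<dots> = (W\<^sup>2 * \<tau>) * (l2norm (time_measure \<tau>) f)\<^sup>2" using \<tau> by (simp add: power_mult_distrib)
  finally show "ennreal ((norm (\<integral>t. w t *\<^sub>R f t \<partial>time_measure \<tau>))\<^sup>2) \<le> ennreal (W\<^sup>2 * \<tau>) * l2sq (time_measure \<tau>) f"
    unfolding L2_nn_integral[OF fL] using \<tau> by (subst ennreal_mult[symmetric]) (auto intro: ennreal_leI)
  have "(\<integral>t. norm (f t) \<partial>time_measure \<tau>) \<le> (\<integral>t. B \<partial>time_measure \<tau>)"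
    by (rule integral_mono[OF intn]) (use B in auto)
  also have "\<dots> = B * \<tau>" by (simp add: meas[unfolded space_time_measure])
  finally have "(\<integral>t. norm (f t) \<partial>time_measure \<tau>) \<le> B * \<tau>" .
  from order_trans[OF le1 mult_left_mono[OF this W0]]
  show "norm (\<integral>t. w t *\<^sub>R f t \<partial>time_measure \<tau>) \<le> W * B * \<tau>" by (simp only: mult.assoc)
qed

context delay_tensor
begin

abbreviation "\<T> \<equiv> time_measure \<tau>"

text \<open>The embedded integrand is continuous in t, so its integral exists in the Banach space;
  the image of \<open>L_tensor\<close> being closed, the integral has a representative
  there.\<close>

lemma weighted_integral:
  fixes w :: "real \<Rightarrow> real" and W :: real
  assumes \<Phi>: "\<Phi> \<in> L_tensor \<tau>" and w: "continuous_on {0..\<tau>} w" and W: "\<And>t. t \<in> {0..\<tau>} \<Longrightarrow> \<bar>w t\<bar> \<le> W"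
  shows "\<exists>I\<in>L_tensor \<tau>. l2_has_integral \<P> (\<lambda>t \<theta>. w t *\<^sub>R Gm t \<Phi> \<theta>) \<tau> I"
    and "l2_has_integral \<P> (\<lambda>t \<theta>. w t *\<^sub>R Gm t \<Phi> \<theta>) \<tau> I \<Longrightarrow> l2norm \<P> I \<le> \<tau> * W * GmK * l2norm \<P> \<Phi>"
proof -
  have GL: "Gm t \<Phi> \<in> L2 \<P>" if "0 \<le> t" for t by (rule L_tensor_L2[OF T.G_mem[OF that \<Phi>]])
  have "continuous_on {0..\<tau>} (\<lambda>t. w t *\<^sub>R emb \<P> (Gm t \<Phi>))"
    by (intro continuous_intros w continuous_on_subset[OF T.continuous_emb[OF \<Phi>]]) auto
  then have hi: "((\<lambda>t. w t *\<^sub>R emb \<P> (Gm t \<Phi>)) has_integral integral {0..\<tau>} (\<lambda>t. w t *\<^sub>R emb \<P> (Gm t \<Phi>))) {0..\<tau>}"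
    by (intro integrable_integral integrable_continuous_real)
  have "integral {0..\<tau>} (\<lambda>t. w t *\<^sub>R emb \<P> (Gm t \<Phi>)) \<in> emb \<P> ` L_tensor \<tau>"
    by (rule has_integral_in_closed_subspace[OF T.subspace_V T.closed_V hi])
      (use \<Phi> in \<open>auto intro!: T.V_simps(3) imageI T.G_mem\<close>)
  then obtain I0 where I: "I0 \<in> L_tensor \<tau>" "integral {0..\<tau>} (\<lambda>t. w t *\<^sub>R emb \<P> (Gm t \<Phi>)) = emb \<P> I0" by blast
  have "l2_has_integral \<P> (\<lambda>t \<theta>. w t *\<^sub>R Gm t \<Phi> \<theta>) \<tau> I0"
    unfolding l2_has_integral_iff
  proof (intro conjI ballI)
    show "((\<lambda>s. emb \<P> (\<lambda>\<theta>. w s *\<^sub>R Gm s \<Phi> \<theta>)) has_integral emb \<P> I0) {0..\<tau>}"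
      using hi unfolding I(2) by (rule has_integral_eq[rotated]) (simp add: emb_scaleR[OF GL])
  qed (use GL I L_tensor_L2 in \<open>auto intro!: L2_scaleR\<close>)
  with I show "\<exists>I\<in>L_tensor \<tau>. l2_has_integral \<P> (\<lambda>t \<theta>. w t *\<^sub>R Gm t \<Phi> \<theta>) \<tau> I" by blast
  assume "l2_has_integral \<P> (\<lambda>t \<theta>. w t *\<^sub>R Gm t \<Phi> \<theta>) \<tau> I"
  then have I: "I \<in> L2 \<P>" and hI: "((\<lambda>s. emb \<P> (\<lambda>\<theta>. w s *\<^sub>R Gm s \<Phi> \<theta>)) has_integral emb \<P> I) {0..\<tau>}"
    by (auto simp: l2_has_integral_iff)
  have W0: "0 \<le> W" using W[of 0] \<tau> by auto
  have "norm (emb \<P> I) \<le> (W * (GmK * l2norm \<P> \<Phi>)) * measure lborel (cbox 0 \<tau>)"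
  proof (rule has_integral_bound)
    show "0 \<le> W * (GmK * l2norm \<P> \<Phi>)" using W0 GmK_ge_1 by simp
    show "((\<lambda>s. emb \<P> (\<lambda>\<theta>. w s *\<^sub>R Gm s \<Phi> \<theta>)) has_integral emb \<P> I) (cbox 0 \<tau>)" using hI by simp
    fix s assume "s \<in> cbox 0 \<tau>"
    then have s: "s \<in> {0..\<tau>}" by simp
    have "norm (emb \<P> (\<lambda>\<theta>. w s *\<^sub>R Gm s \<Phi> \<theta>)) = \<bar>w s\<bar> * l2norm \<P> (Gm s \<Phi>)"
      using s by (simp add: norm_emb L2_scaleR GL l2norm_scaleR)
    also have "\<dots> \<le> W * (GmK * l2norm \<P> \<Phi>)" by (intro mult_mono W s Gm_bound \<Phi> W0) simp
    finally show "norm (emb \<P> (\<lambda>\<theta>. w s *\<^sub>R Gm s \<Phi> \<theta>)) \<le> W * (GmK * l2norm \<P> \<Phi>)" .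
  qed
  then show "l2norm \<P> I \<le> \<tau> * W * GmK * l2norm \<P> \<Phi>" using \<tau> by (simp add: norm_emb[OF I] mult_ac)
qed

definition traj_integral_fun :: "(real \<Rightarrow> real) \<Rightarrow> (real \<Rightarrow> ('m \<Rightarrow> real) \<Rightarrow> real^('m \<Rightarrow> 'n)) \<Rightarrow> ('m \<Rightarrow> real) \<Rightarrow> real^('m \<Rightarrow> 'n)" where
  "traj_integral_fun w \<Xi> \<theta> = (\<integral>t. w t *\<^sub>R \<Xi> t \<theta> \<partial>\<T>)"

text \<open>The factor \<tau> stems from Cauchy-Schwarz in time; the rest is the constant of
  \<open>trace_bound\<close>.\<close>

definition secC :: real where
  "secC = sqrt (\<tau> * ((GK\<^sup>2) ^ (CARD('m) - 1) * (2 * GK\<^sup>2)))"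

lemma secC_nonneg: "0 \<le> secC"
  unfolding secC_def using \<tau> by simp

context
  fixes w :: "real \<Rightarrow> real" and W :: real assumes w: "continuous_on {0..\<tau>} w" and W: "\<And>t. t \<in> {0..\<tau>} \<Longrightarrow> \<bar>w t\<bar> \<le> W"
begin

lemma W_nonneg: "0 \<le> W" using W[of 0] \<tau> by auto

lemma w_measurable: "w \<in> borel_measurable \<T>"
  using borel_measurable_continuous_on_restrict[OF w]
  by (subst measurable_cong_sets[OF _ refl]) (auto simp: sets_restrict_space)

lemma traj_tensor_time_measurable:
  fixes \<theta> :: "'m \<Rightarrow> real"
  assumes "traj_tensor \<Phi> \<Xi>" shows "(\<lambda>t. \<Xi> t \<theta>) \<in> borel_measurable \<T>"
  by (rule measurable_compose[OF borel_measurable_time borel_measurable_continuous_onI[OF traj_tensor_props(2)[OF assms]]]) simp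

lemma traj_integral_fun_measurable:
  assumes tr: "traj_tensor \<Phi> \<Xi>" shows "traj_integral_fun w \<Xi> \<in> borel_measurable \<P>"
proof -
  interpret T: sigma_finite_measure \<T> by (rule sigma_finite_time_measure)
  have "(\<lambda>p. w (fst p) *\<^sub>R \<Xi> (fst p) (snd p)) \<in> borel_measurable (\<T> \<Otimes>\<^sub>M \<P>)"
    by (intro borel_measurable_scaleR traj_tensor_props(4)[OF tr] measurable_compose[OF measurable_fst w_measurable])
  from measurable_compose[OF measurable_pair_swap' this]
  have "(\<lambda>(\<theta>, t). w t *\<^sub>R \<Xi> t \<theta>) \<in> borel_measurable (\<P> \<Otimes>\<^sub>M \<T>)"
    by (simp add: case_prod_beta')
  then show ?thesis unfolding traj_integral_fun_def by (rule T.borel_measurable_lebesgue_integral)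
qed

lemma traj_integral_fun_bounded:
  assumes tr: "traj_tensor \<Phi> \<Xi>" shows "\<exists>B\<ge>0. \<forall>\<theta>. norm (traj_integral_fun w \<Xi> \<theta>) \<le> B"
proof -
  obtain B where B: "B \<ge> 0" "\<And>t \<theta>. norm (\<Xi> t \<theta>) \<le> B" using traj_tensor_props(1)[OF tr] by blast
  have "norm (traj_integral_fun w \<Xi> \<theta>) \<le> W * B * \<tau>" for \<theta>
    unfolding traj_integral_fun_def
    by (rule integral_time_bound(3)[OF \<tau> traj_tensor_time_measurable[OF tr] B(2) w_measurable W])
  then show ?thesis using B(1) W_nonneg \<tau> by (intro exI[of _ "W * B * \<tau>"]) auto
qed

lemma traj_integral_fun_L2:
  assumes tr: "traj_tensor \<Phi> \<Xi>" shows "traj_integral_fun w \<Xi> \<in> L2 \<P>"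
  using traj_integral_fun_bounded[OF tr]
  by (auto intro: bounded_measurable_L2(1)[OF pow_finite_measure[OF \<tau>] traj_integral_fun_measurable[OF tr]])

lemma traj_integral_fun_diff:
  assumes "traj_tensor \<Phi> \<Xi>" "traj_tensor \<Phi>' \<Xi>'"
  shows "traj_integral_fun w (\<lambda>t \<theta>. \<Xi> t \<theta> - \<Xi>' t \<theta>) \<theta> = traj_integral_fun w \<Xi> \<theta> - traj_integral_fun w \<Xi>' \<theta>"
proof -
  have int: "integrable \<T> (\<lambda>t. w t *\<^sub>R Y t \<theta>)" if tr: "traj_tensor \<Psi> Y" for \<Psi> Y
  proof -
    obtain B where B: "B \<ge> 0" "\<And>t \<theta>. norm (Y t \<theta>) \<le> B" using traj_tensor_props(1)[OF tr] by blast
    show ?thesis by (rule integral_time_bound(1)[OF \<tau> traj_tensor_time_measurable[OF tr] B(2) w_measurable W])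
  qed
  show ?thesis unfolding traj_integral_fun_def scaleR_diff_right
    by (rule Bochner_Integration.integral_diff[OF int[OF assms(1)] int[OF assms(2)]])
qed

text \<open>The \<open>L\<^sub>2\<close>-valued integral is the pointwise one: both have the same inner products.\<close>

lemma traj_integral_fun_eq:
  assumes tr: "traj_tensor \<Phi> \<Xi>" and I: "l2_has_integral \<P> (\<lambda>t u. w t *\<^sub>R Gm t \<Phi> u) \<tau> I"
  shows "AE u in \<P>. I u = traj_integral_fun w \<Xi> u"
proof -
  let ?J = "traj_integral_fun w \<Xi>"
  have IL: "I \<in> L2 \<P>" and hI: "((\<lambda>s. emb \<P> (\<lambda>u. w s *\<^sub>R Gm s \<Phi> u)) has_integral emb \<P> I) {0..\<tau>}"
    using I by (auto simp: l2_has_integral_iff)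
  have JL: "?J \<in> L2 \<P>" by (rule traj_integral_fun_L2[OF tr])
  have \<Phi>: "\<Phi> \<in> L_tensor \<tau>" using traj_tensor_L2[OF tr] by (simp add: L_tensor_def)
  have GL: "Gm t \<Phi> \<in> L2 \<P>" if "0 \<le> t" for t by (rule L_tensor_L2[OF T.G_mem[OF that \<Phi>]])
  obtain B where B: "B \<ge> 0" "\<And>t u. norm (\<Xi> t u) \<le> B" using traj_tensor_props(1)[OF tr] by blast
  \<comment> \<open>The difference is tested against itself, so equality of the inner products with
    this single function is enough.\<close>
  define g where "g = (\<lambda>u. I u - ?J u)"
  have g: "g \<in> L2 \<P>" unfolding g_def by (rule L2_diff[OF IL JL])
  \<comment> \<open>The normalization that \<open>emb\<close> attaches to the functional given by g;
    it cancels at the end.\<close>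
  define c where "c = max 1 (l2norm \<P> g)"
  have c: "c > 0" by (simp add: c_def)
  have ev: "apply_bcontfun (emb \<P> f) (discrete g) = (\<integral>u. f u \<bullet> g u \<partial>\<P>) / c" if "f \<in> L2 \<P>" for f
    using emb_apply(1)[OF that, of "discrete g"] g by (simp add: discrete_inverse c_def)
  \<comment> \<open>Evaluation at one point is a bounded functional and may be pulled through the
    integral in the Banach space.\<close>
  have blin: "bounded_linear (\<lambda>y. apply_bcontfun y (discrete g))"
    by (rule bounded_linear_intro[of _ 1]) (use norm_bounded in auto)
  have h1: "((\<lambda>s. (\<integral>u. (w s *\<^sub>R \<Xi> s u) \<bullet> g u \<partial>\<P>) / c) has_integral (\<integral>u. I u \<bullet> g u \<partial>\<P>) / c) {0..\<tau>}"
  proof -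
    have "((\<lambda>s. apply_bcontfun (emb \<P> (\<lambda>u. w s *\<^sub>R Gm s \<Phi> u)) (discrete g)) has_integral (\<integral>u. I u \<bullet> g u \<partial>\<P>) / c) {0..\<tau>}"
      using has_integral_linear[OF hI blin] by (simp add: o_def ev[OF IL])
    then show ?thesis
    proof (rule has_integral_eq[rotated])
      fix s assume s: "s \<in> {0..\<tau>}"
      have "(\<integral>u. (w s *\<^sub>R Gm s \<Phi> u) \<bullet> g u \<partial>\<P>) = (\<integral>u. (w s *\<^sub>R \<Xi> s u) \<bullet> g u \<partial>\<P>)"
      proof (rule integral_cong_AE)
        show "AE u in \<P>. (w s *\<^sub>R Gm s \<Phi> u) \<bullet> g u = (w s *\<^sub>R \<Xi> s u) \<bullet> g u"
          using Gm_traj[OF tr s] by eventually_elim simp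
        have "Gm s \<Phi> \<in> borel_measurable \<P>" using s by (intro L2_measurable[OF GL]) simp
        then show "(\<lambda>u. (w s *\<^sub>R Gm s \<Phi> u) \<bullet> g u) \<in> borel_measurable \<P>" "(\<lambda>u. (w s *\<^sub>R \<Xi> s u) \<bullet> g u) \<in> borel_measurable \<P>"
          by (intro borel_measurable_inner borel_measurable_scaleR borel_measurable_const traj_tensor_props(5)[OF tr] L2_measurable[OF g]; assumption)+
      qed
      then show "apply_bcontfun (emb \<P> (\<lambda>u. w s *\<^sub>R Gm s \<Phi> u)) (discrete g) = (\<integral>u. (w s *\<^sub>R \<Xi> s u) \<bullet> g u \<partial>\<P>) / c"
        using ev[OF L2_scaleR[OF GL]] s by simp
    qed
  qed
  interpret fP: finite_measure \<P> by (rule pow_finite_measure[OF \<tau>])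
  interpret fT: finite_measure \<T> by (rule time_measure_finite)
  interpret PS: pair_sigma_finite \<T> \<P> ..
  let ?F = "\<lambda>p. (w (fst p) *\<^sub>R \<Xi> (fst p) (snd p)) \<bullet> g (snd p)"
  have mF: "?F \<in> borel_measurable (\<T> \<Otimes>\<^sub>M \<P>)"
    by (intro borel_measurable_inner borel_measurable_scaleR traj_tensor_props(4)[OF tr]
      measurable_compose[OF measurable_fst w_measurable] measurable_compose[OF measurable_snd L2_measurable[OF g]])
  have intg: "integrable \<P> (\<lambda>u. norm (g u))"
  proof -
    have "(\<lambda>_. 1::real) \<in> L2 \<P>" by (rule bounded_measurable_L2(1)[OF fP.finite_measure_axioms, of _ 1]) auto
    from L2_inner_integrable[OF L2_norm[OF g] this] show ?thesis by simp
  qed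
  \<comment> \<open>Absolute integrability for Fubini: the integrand is at most W B |g|, and |g| is
    integrable because the measure is finite.\<close>
  have intF: "integrable (\<T> \<Otimes>\<^sub>M \<P>) ?F"
  proof (rule integrableI_bounded[OF mF])
    have bd: "ennreal (norm (?F (t, u))) \<le> ennreal (W * B * norm (g u))" if "t \<in> {0..\<tau>}" for t u
    proof (rule ennreal_leI)
      have "norm (?F (t, u)) \<le> norm (w t *\<^sub>R \<Xi> t u) * norm (g u)" using Cauchy_Schwarz_ineq2[of "w t *\<^sub>R \<Xi> t u" "g u"] by simp
      also have "\<dots> \<le> (W * B) * norm (g u)"
        unfolding norm_scaleR by (intro mult_right_mono mult_mono W that B W_nonneg) simp_all
      finally show "norm (?F (t, u)) \<le> W * B * norm (g u)" .
    qed
    have "(\<integral>\<^sup>+p. ennreal (norm (?F p)) \<partial>(\<T> \<Otimes>\<^sub>M \<P>)) = (\<integral>\<^sup>+t. (\<integral>\<^sup>+u. ennreal (norm (?F (t, u))) \<partial>\<P>) \<partial>\<T>)"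
      by (rule fP.nn_integral_fst[symmetric]) (use mF in measurable)
    also have "\<dots> \<le> (\<integral>\<^sup>+t. (\<integral>\<^sup>+u. ennreal (W * B * norm (g u)) \<partial>\<P>) \<partial>\<T>)"
      by (intro nn_integral_mono bd) simp
    also have "\<dots> = (\<integral>\<^sup>+u. ennreal (W * B * norm (g u)) \<partial>\<P>) * emeasure \<T> (space \<T>)" by (rule nn_integral_const)
    also have "(\<integral>\<^sup>+u. ennreal (W * B * norm (g u)) \<partial>\<P>) = ennreal (\<integral>u. W * B * norm (g u) \<partial>\<P>)"
      using W_nonneg B(1) intg by (intro nn_integral_eq_integral) auto
    also have "\<dots> * emeasure \<T> (space \<T>) < \<infinity>"
      using fT.emeasure_finite[of "space \<T>"] unfolding infinity_ennreal_def ennreal_mult_less_top top.not_eq_extremum by simp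
    finally show "(\<integral>\<^sup>+p. ennreal (norm (?F p)) \<partial>(\<T> \<Otimes>\<^sub>M \<P>)) < \<infinity>" .
  qed
  let ?h = "\<lambda>t. \<integral>u. (w t *\<^sub>R \<Xi> t u) \<bullet> g u \<partial>\<P>"
  have inth: "integrable \<T> ?h"
    using PS.integrable_fst'[OF intF] by simp
  have "(\<integral>t. ?h t \<partial>\<T>) = (\<integral>u. (\<integral>t. (w t *\<^sub>R \<Xi> t u) \<bullet> g u \<partial>\<T>) \<partial>\<P>)"
    using PS.Fubini_integral[of "\<lambda>t u. (w t *\<^sub>R \<Xi> t u) \<bullet> g u"] intF by (simp add: case_prod_beta')
  also have "\<dots> = (\<integral>u. ?J u \<bullet> g u \<partial>\<P>)"
  proof (intro Bochner_Integration.integral_cong refl)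
    fix u
    have "integrable \<T> (\<lambda>t. w t *\<^sub>R \<Xi> t u)"
      by (rule integral_time_bound(1)[OF \<tau> traj_tensor_time_measurable[OF tr] B(2) w_measurable W])
    then show "(\<integral>t. (w t *\<^sub>R \<Xi> t u) \<bullet> g u \<partial>\<T>) = ?J u \<bullet> g u"
      unfolding traj_integral_fun_def by (intro integral_inner_left)
  qed
  finally have Jeq: "(\<integral>t. ?h t \<partial>\<T>) = (\<integral>u. ?J u \<bullet> g u \<partial>\<P>)" .
  have si: "set_integrable lborel {0..\<tau>} ?h"
    using inth unfolding set_integrable_def by (subst (asm) integrable_restrict_space) auto
  have "(?h has_integral (\<integral>t. ?h t \<partial>\<T>)) {0..\<tau>}"
  proof -
    have "(\<integral>t. ?h t \<partial>\<T>) = (LINT t:{0..\<tau>}|lborel. ?h t)"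
      unfolding set_lebesgue_integral_def by (subst integral_restrict_space) auto
    also have "\<dots> = integral {0..\<tau>} ?h" by (rule set_borel_integral_eq_integral(2)[OF si])
    finally show ?thesis using set_borel_integral_eq_integral(1)[OF si] by (simp add: integrable_integral)
  qed
  then have "((\<lambda>t. ?h t / c) has_integral (\<integral>u. ?J u \<bullet> g u \<partial>\<P>) / c) {0..\<tau>}"
    unfolding Jeq by (rule has_integral_divide)
  then have "(\<integral>u. ?J u \<bullet> g u \<partial>\<P>) / c = (\<integral>u. I u \<bullet> g u \<partial>\<P>) / c" using h1 by (rule has_integral_unique)
  then have "(\<integral>u. ?J u \<bullet> g u \<partial>\<P>) = (\<integral>u. I u \<bullet> g u \<partial>\<P>)" using c by simp
  then have "(\<integral>u. g u \<bullet> g u \<partial>\<P>) = 0"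
    using L2_inner_integrable[OF IL g] L2_inner_integrable[OF JL g] by (simp add: g_def inner_diff_left)
  then have "l2norm \<P> g = 0" by (simp add: l2norm_def power2_norm_eq_inner)
  then show ?thesis using l2norm_0_iff_AE[OF g] by (simp add: g_def)
qed

lemma section_measurable:
  assumes "traj_tensor \<Phi> \<Xi>" "s \<in> {-\<tau>..0}"
  shows "(\<lambda>x. traj_integral_fun w \<Xi> (x(j := s))) \<in> borel_measurable (slice_measure \<tau> j)"
  by (rule measurable_compose[OF measurable_slice[OF assms(2)] traj_integral_fun_measurable[OF assms(1)]])

text \<open>For a single t the slice of \<Xi> at s is in general not controlled by |\<Phi>|; after
  integration over t it is, uniformly in s. This uniformity is what lets sections pass to limits in
  \<Phi>.\<close>

lemma section_bound:
  assumes tr: "traj_tensor \<Phi> \<Xi>" and s: "s \<in> {-\<tau>..0}"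
  shows "(\<lambda>x. traj_integral_fun w \<Xi> (x(j := s))) \<in> L2 (slice_measure \<tau> j)"
    and "l2norm (slice_measure \<tau> j) (\<lambda>x. traj_integral_fun w \<Xi> (x(j := s))) \<le> secC * W * l2norm \<P> \<Phi>"
proof -
  obtain N \<phi> X where 1: "\<forall>i<N. \<forall>l. is_traj (\<phi> i l) (X i l)" "\<Phi> = tensor_sum N \<phi>" "\<Xi> = translate_sum N X" by (rule traj_tensorE[OF tr])
  have X: "\<And>i l. i < N \<Longrightarrow> is_traj (\<phi> i l) (X i l)" using 1(1) by blast
  have \<Phi>: "\<Phi> \<in> L2 \<P>" by (rule traj_tensor_L2[OF tr])
  obtain B where B: "B \<ge> 0" "\<And>t \<theta>. norm (\<Xi> t \<theta>) \<le> B" using traj_tensor_props(1)[OF tr] by blast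
  let ?S = "slice_measure \<tau> j" and ?K = "(GK\<^sup>2) ^ card (UNIV - {j}) * (2 * GK\<^sup>2)"
  interpret T: sigma_finite_measure \<T> by (rule sigma_finite_time_measure)
  have cardj: "card (UNIV - {j}) = CARD('m) - 1" by (simp add: card_Diff_singleton)
  have mX: "(\<lambda>x. \<integral>\<^sup>+t. ennreal ((norm (\<Xi> t (x(j := s))))\<^sup>2) \<partial>\<T>) \<in> borel_measurable ?S"
  proof (rule T.borel_measurable_nn_integral)
    have "(\<lambda>p. (snd p, (fst p)(j := s))) \<in> measurable (?S \<Otimes>\<^sub>M \<T>) (\<T> \<Otimes>\<^sub>M \<P>)"
      by (intro measurable_Pair measurable_snd measurable_compose[OF measurable_fst measurable_slice[OF s]])
    from measurable_compose[OF this traj_tensor_props(4)[OF tr]]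
    have [measurable]: "(\<lambda>p. \<Xi> (snd p) ((fst p)(j := s))) \<in> borel_measurable (?S \<Otimes>\<^sub>M \<T>)" by simp
    show "(\<lambda>(x, t). ennreal ((norm (\<Xi> t (x(j := s))))\<^sup>2)) \<in> borel_measurable (?S \<Otimes>\<^sub>M \<T>)"
      unfolding case_prod_beta' by measurable
  qed
  have "l2sq ?S (\<lambda>x. traj_integral_fun w \<Xi> (x(j := s)))
    \<le> (\<integral>\<^sup>+x. ennreal (W\<^sup>2 * \<tau>) * l2sq \<T> (\<lambda>t. \<Xi> t (x(j := s))) \<partial>?S)"
    unfolding traj_integral_fun_def
    by (intro nn_integral_mono integral_time_bound(2)[OF \<tau> traj_tensor_time_measurable[OF tr] B(2) w_measurable W])
  also have "\<dots> = ennreal (W\<^sup>2 * \<tau>) * (\<integral>\<^sup>+x. l2sq \<T> (\<lambda>t. \<Xi> t (x(j := s))) \<partial>?S)"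
    by (rule nn_integral_cmult[OF mX])
  also have "\<dots> \<le> ennreal (W\<^sup>2 * \<tau>) * (ennreal ?K * l2sq \<P> (\<lambda>\<theta>. \<Phi> \<theta>))"
    using trace_bound[OF X s, where j = j] unfolding 1(2,3) by (intro mult_left_mono) auto
  also have "\<dots> = ennreal ((secC * W * l2norm \<P> \<Phi>)\<^sup>2)"
    unfolding L2_nn_integral[OF \<Phi>] secC_def cardj using \<tau>
    by (simp add: ennreal_mult[symmetric] power_mult_distrib mult_ac)
  finally have le: "l2sq ?S (\<lambda>x. traj_integral_fun w \<Xi> (x(j := s))) \<le> ennreal ((secC * W * l2norm \<P> \<Phi>)\<^sup>2)" .
  show "(\<lambda>x. traj_integral_fun w \<Xi> (x(j := s))) \<in> L2 ?S" "l2norm ?S (\<lambda>x. traj_integral_fun w \<Xi> (x(j := s))) \<le> secC * W * l2norm \<P> \<Phi>"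
    using L2I_nn_integral[OF section_measurable[OF tr s] le] secC_nonneg W_nonneg by simp_all
qed

lemma section_continuous:
  assumes tr: "traj_tensor \<Phi> \<Xi>"
  shows "continuous_on {-\<tau>..0} (\<lambda>s. emb (slice_measure \<tau> j) (\<lambda>x. traj_integral_fun w \<Xi> (x(j := s))))"
  unfolding continuous_on_sequentially
proof (intro allI ballI impI)
  let ?S = "slice_measure \<tau> j" and ?b = "\<lambda>s x. traj_integral_fun w \<Xi> (x(j := s))"
  interpret finite_measure ?S by (rule slice_finite_measure[OF \<tau>])
  fix u :: "nat \<Rightarrow> real" and s
  assume s: "s \<in> {-\<tau>..0}" and u: "(\<forall>n. u n \<in> {-\<tau>..0}) \<and> u \<longlonglongrightarrow> s"
  then have un: "\<And>n. u n \<in> {-\<tau>..0}" and ul: "u \<longlonglongrightarrow> s" by auto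
  obtain B where B: "B \<ge> 0" "\<And>\<theta>. norm (traj_integral_fun w \<Xi> \<theta>) \<le> B" using traj_integral_fun_bounded[OF tr] by blast
  obtain B' where B': "B' \<ge> 0" "\<And>t \<theta>. norm (\<Xi> t \<theta>) \<le> B'" using traj_tensor_props(1)[OF tr] by blast
  interpret fT: finite_measure \<T> by (rule time_measure_finite)
  have "(\<lambda>n. l2norm ?S (\<lambda>x. ?b (u n) x - ?b s x)) \<longlonglongrightarrow> 0"
  proof (rule L2_dominated_limit[where g = "\<lambda>_. 2 * B"])
    show "(\<lambda>_. 2 * B) \<in> L2 ?S" by (rule bounded_measurable_L2(1)[OF finite_measure_axioms, of _ "2 * B"]) (use B in auto)
    show "AE x in ?S. norm (?b (u n) x - ?b s x) \<le> norm (2 * B)" for n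
    proof (rule AE_I2)
      fix x show "norm (?b (u n) x - ?b s x) \<le> norm (2 * B)"
        using norm_triangle_ineq4[of "?b (u n) x" "?b s x"] B(2)[of "x(j := u n)"] B(2)[of "x(j := s)"] B(1) by simp
    qed
    show "AE x in ?S. (\<lambda>n. ?b (u n) x) \<longlonglongrightarrow> ?b s x"
    proof (rule AE_I2)
      fix x
      show "(\<lambda>n. ?b (u n) x) \<longlonglongrightarrow> ?b s x" unfolding traj_integral_fun_def
      proof (rule integral_dominated_convergence[where w = "\<lambda>_. W * B'"])
        show "(\<lambda>t. w t *\<^sub>R \<Xi> t (x(j := s))) \<in> borel_measurable \<T>" "(\<lambda>t. w t *\<^sub>R \<Xi> t (x(j := u n))) \<in> borel_measurable \<T>" for n
          by (intro borel_measurable_scaleR w_measurable traj_tensor_time_measurable[OF tr])+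
        show "AE t in \<T>. (\<lambda>n. w t *\<^sub>R \<Xi> t (x(j := u n))) \<longlonglongrightarrow> w t *\<^sub>R \<Xi> t (x(j := s))"
        proof (rule AE_I2)
          fix t
          have "isCont (\<lambda>s. \<Xi> t (x(j := s))) s" using traj_tensor_props(3)[OF tr, of t x j] by (simp add: continuous_on_eq_continuous_at)
          then show "(\<lambda>n. w t *\<^sub>R \<Xi> t (x(j := u n))) \<longlonglongrightarrow> w t *\<^sub>R \<Xi> t (x(j := s))"
            by (intro tendsto_scaleR tendsto_const isCont_tendsto_compose[OF _ ul])
        qed
        show "AE t in \<T>. norm (w t *\<^sub>R \<Xi> t (x(j := u n))) \<le> W * B'" for n
          by (rule AE_I2) (use W B' W_nonneg in \<open>auto intro!: mult_mono\<close>)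
      qed simp
    qed
  qed (rule section_measurable[OF tr] un s)+
  then show "((\<lambda>s. emb ?S (?b s)) \<circ> u) \<longlonglongrightarrow> emb ?S (?b s)"
    by (subst tendsto_dist_iff) (simp add: l2norm_emb_diff[OF section_bound(1)[OF tr un] section_bound(1)[OF tr s]])
qed

lemma weighted_integral_diff:
  assumes \<Phi>: "\<Phi> \<in> L_tensor \<tau>" and \<Psi>: "\<Psi> \<in> L_tensor \<tau>"
    and I: "l2_has_integral \<P> (\<lambda>t x. w t *\<^sub>R Gm t \<Phi> x) \<tau> I"
    and J: "l2_has_integral \<P> (\<lambda>t x. w t *\<^sub>R Gm t \<Psi> x) \<tau> J"
  shows "l2_has_integral \<P> (\<lambda>t x. w t *\<^sub>R Gm t (\<lambda>x. \<Phi> x - \<Psi> x) x) \<tau> (\<lambda>x. I x - J x)"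
proof -
  have GL: "Gm t f \<in> L2 \<P>" if "0 \<le> t" "f \<in> L_tensor \<tau>" for t f by (rule L_tensor_L2[OF T.G_mem[OF that]])
  have D: "(\<lambda>x. \<Phi> x - \<Psi> x) \<in> L_tensor \<tau>" by (rule L2_subspaceD(5)[OF L_tensor_subspace \<Phi> \<Psi>])
  have IL: "I \<in> L2 \<P>" "J \<in> L2 \<P>" using I J by (auto simp: l2_has_integral_iff)
  have "((\<lambda>s. emb \<P> (\<lambda>x. w s *\<^sub>R Gm s \<Phi> x) - emb \<P> (\<lambda>x. w s *\<^sub>R Gm s \<Psi> x)) has_integral emb \<P> I - emb \<P> J) {0..\<tau>}"
    using I J by (intro has_integral_diff) (simp_all add: l2_has_integral_iff)
  then have "((\<lambda>s. emb \<P> (\<lambda>x. w s *\<^sub>R Gm s (\<lambda>x. \<Phi> x - \<Psi> x) x)) has_integral emb \<P> (\<lambda>x. I x - J x)) {0..\<tau>}"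
    unfolding emb_diff[OF IL]
  proof (rule has_integral_eq[rotated])
    fix s assume "s \<in> {0..\<tau>}"
    then have s: "0 \<le> s" by simp
    have "emb \<P> (Gm s (\<lambda>x. \<Phi> x - \<Psi> x)) = emb \<P> (\<lambda>x. Gm s \<Phi> x - Gm s \<Psi> x)"
      using bounded_op_diff[OF L_tensor_subspace Gm_op[OF s] \<Phi> \<Psi>]
      by (subst emb_eq_iff) (auto intro!: L2_diff GL s \<Phi> \<Psi> D)
    then show "emb \<P> (\<lambda>x. w s *\<^sub>R Gm s \<Phi> x) - emb \<P> (\<lambda>x. w s *\<^sub>R Gm s \<Psi> x) = emb \<P> (\<lambda>x. w s *\<^sub>R Gm s (\<lambda>x. \<Phi> x - \<Psi> x) x)"
      by (simp add: emb_scaleR emb_diff GL s \<Phi> \<Psi> D scaleR_diff_right)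
  qed
  then show ?thesis using IL by (auto simp: l2_has_integral_iff intro!: L2_scaleR L2_diff GL D)
qed

lemma sections_exist:
  fixes j :: 'm
  assumes \<Phi>: "\<Phi> \<in> L_tensor \<tau>" and I: "l2_has_integral \<P> (\<lambda>t \<theta>. w t *\<^sub>R Gm t \<Phi> \<theta>) \<tau> I"
  shows "\<exists>b. slice_section \<tau> j (secC * W * l2norm \<P> \<Phi>) I b"
proof -
  let ?S = "slice_measure \<tau> j"
  have "\<forall>k::nat. \<exists>\<Psi> \<Xi>. traj_tensor \<Psi> \<Xi> \<and> l2norm \<P> (\<lambda>\<theta>. \<Psi> \<theta> - \<Phi> \<theta>) < (1/2)^k"
    using traj_tensor_dense[OF \<Phi>] by simp
  then obtain F X where tr: "\<And>k::nat. traj_tensor (F k) (X k)" and cl: "\<And>k. l2norm \<P> (\<lambda>\<theta>. F k \<theta> - \<Phi> \<theta>) < (1/2)^k"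
    by metis
  have FL: "F k \<in> L2 \<P>" for k by (rule traj_tensor_L2[OF tr])
  have FT: "F k \<in> L_tensor \<tau>" for k using FL by (simp add: L_tensor_def)
  have \<Phi>L: "\<Phi> \<in> L2 \<P>" by (rule L_tensor_L2[OF \<Phi>])
  define Ic where "Ic k = traj_integral_fun w (X k)" for k
  define B where "B k s = (\<lambda>x. Ic k (x(j := s)))" for k s
  have BL: "B k s \<in> L2 ?S" if "s \<in> {-\<tau>..0}" for k s
    unfolding B_def Ic_def by (rule section_bound(1)[OF tr that])
  have IcL: "Ic k \<in> L2 \<P>" for k unfolding Ic_def by (rule traj_integral_fun_L2[OF tr])
  have IL: "I \<in> L2 \<P>" using I by (simp add: l2_has_integral_iff)
  define c where "c = secC * W"
  have c: "0 \<le> c" unfolding c_def using secC_nonneg W_nonneg by simp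
  have FF: "l2norm \<P> (\<lambda>\<theta>. F k \<theta> - F l \<theta>) \<le> (1/2)^k + (1/2)^l" for k l
  proof -
    have "l2norm \<P> (\<lambda>\<theta>. F k \<theta> - F l \<theta>) \<le> l2norm \<P> (\<lambda>\<theta>. F k \<theta> - \<Phi> \<theta>) + l2norm \<P> (\<lambda>\<theta>. F l \<theta> - \<Phi> \<theta>)"
      using dist_triangle2[of "emb \<P> (F k)" "emb \<P> (F l)" "emb \<P> \<Phi>"] by (simp add: l2norm_emb_diff FL \<Phi>L)
    then show ?thesis using cl[of k] cl[of l] by linarith
  qed
  have BB: "dist (emb ?S (B k s)) (emb ?S (B l s)) \<le> c * ((1/2)^k + (1/2)^l)" if s: "s \<in> {-\<tau>..0}" for k l s
  proof -
    have "dist (emb ?S (B k s)) (emb ?S (B l s)) = l2norm ?S (\<lambda>x. B k s x - B l s x)"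
      by (rule l2norm_emb_diff[OF BL[OF s] BL[OF s], symmetric])
    also have "\<dots> \<le> secC * W * l2norm \<P> (\<lambda>\<theta>. F k \<theta> - F l \<theta>)"
      using section_bound(2)[OF traj_tensor_diff[OF tr tr] s, of j k l] unfolding B_def Ic_def
      by (simp add: traj_integral_fun_diff[OF tr tr])
    also have "\<dots> \<le> c * ((1/2)^k + (1/2)^l)" unfolding c_def[symmetric] by (rule mult_left_mono[OF FF c])
    finally show ?thesis .
  qed
  have half0: "(\<lambda>k. a * (1/2::real)^k) \<longlonglongrightarrow> 0" for a by (rule tendsto_mult_right_zero[OF LIMSEQ_power_zero]) simp
  have "uniformly_Cauchy_on {-\<tau>..0} (\<lambda>k s. emb ?S (B k s))"
    unfolding uniformly_Cauchy_on_def
  proof (intro allI impI)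
    fix e :: real assume e: "0 < e"
    then obtain N where N: "\<And>k. k \<ge> N \<Longrightarrow> c * (1/2)^k < e / 2"
      using order_tendstoD(2)[OF half0[of c], of "e / 2"] by (auto simp: eventually_sequentially)
    show "\<exists>N. \<forall>s\<in>{-\<tau>..0}. \<forall>k\<ge>N. \<forall>l\<ge>N. dist (emb ?S (B k s)) (emb ?S (B l s)) < e"
    proof (intro exI[of _ N] ballI allI impI)
      fix s k l assume s: "s \<in> {-\<tau>..0}" and k: "N \<le> k" and l: "N \<le> l"
      have "dist (emb ?S (B k s)) (emb ?S (B l s)) \<le> c * (1/2)^k + c * (1/2)^l" using BB[OF s, of k l] by (simp add: distrib_left)
      then show "dist (emb ?S (B k s)) (emb ?S (B l s)) < e" using N[OF k] N[OF l] by linarith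
    qed
  qed
  then have "uniformly_convergent_on {-\<tau>..0} (\<lambda>k s. emb ?S (B k s))" by (rule Cauchy_uniformly_convergent)
  then obtain g where g: "uniform_limit {-\<tau>..0} (\<lambda>k s. emb ?S (B k s)) g sequentially"
    by (auto simp: uniformly_convergent_on_def)
  have gs: "(\<lambda>k. emb ?S (B k s)) \<longlonglongrightarrow> g s" if "s \<in> {-\<tau>..0}" for s by (rule tendsto_uniform_limitI[OF g that])
  \<comment> \<open>The limit lives in the Banach space; completeness of \<open>L2\<close> provides
    representatives.\<close>
  have "\<forall>s\<in>{-\<tau>..0}. \<exists>b. b \<in> L2 ?S \<and> emb ?S b = g s"
  proof
    fix s assume s: "s \<in> {-\<tau>..0}"
    have "Cauchy (\<lambda>k. emb ?S (B k s))" by (rule LIMSEQ_imp_Cauchy[OF gs[OF s]])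
    from Riesz_Fischer[OF BL[OF s] this] obtain b where "b \<in> L2 ?S" "(\<lambda>k. emb ?S (B k s)) \<longlonglongrightarrow> emb ?S b" by blast
    then show "\<exists>b. b \<in> L2 ?S \<and> emb ?S b = g s" using LIMSEQ_unique[OF gs[OF s]] by auto
  qed
  then obtain b where b: "\<And>s. s \<in> {-\<tau>..0} \<Longrightarrow> b s \<in> L2 ?S" "\<And>s. s \<in> {-\<tau>..0} \<Longrightarrow> emb ?S (b s) = g s"
    by metis
  have 1: "l2norm ?S (b s) \<le> secC * W * l2norm \<P> \<Phi>" if s: "s \<in> {-\<tau>..0}" for s
  proof -
    have "l2norm ?S (B k s) \<le> c * l2norm \<P> \<Phi> + c * (1/2)^k" for k
    proof -
      have "l2norm \<P> (F k) = l2norm \<P> (\<lambda>\<theta>. \<Phi> \<theta> + (F k \<theta> - \<Phi> \<theta>))" by simp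
      also have "\<dots> \<le> l2norm \<P> \<Phi> + l2norm \<P> (\<lambda>\<theta>. F k \<theta> - \<Phi> \<theta>)" by (intro l2norm_triangle L2_diff FL \<Phi>L)
      also have "\<dots> \<le> l2norm \<P> \<Phi> + (1/2)^k" using cl[of k] by simp
      finally have "c * l2norm \<P> (F k) \<le> c * (l2norm \<P> \<Phi> + (1/2)^k)" by (rule mult_left_mono[OF _ c])
      then show ?thesis using section_bound(2)[OF tr s, of j k] unfolding B_def Ic_def c_def[symmetric] distrib_left by linarith
    qed
    moreover have "(\<lambda>k. l2norm ?S (B k s)) \<longlonglongrightarrow> l2norm ?S (b s)"
      using tendsto_norm[OF gs[OF s]] by (simp add: norm_emb BL[OF s] b(2)[OF s, symmetric] b(1)[OF s])
    moreover have "(\<lambda>k. c * l2norm \<P> \<Phi> + c * (1/2)^k) \<longlonglongrightarrow> c * l2norm \<P> \<Phi> + 0" by (intro tendsto_add tendsto_const half0)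
    ultimately show ?thesis unfolding c_def[symmetric] by (intro LIMSEQ_le) auto
  qed
  have 2: "((\<lambda>s. l2norm ?S (\<lambda>x. b s x - b s0 x)) \<longlongrightarrow> 0) (at s0 within {-\<tau>..0})" if s0: "s0 \<in> {-\<tau>..0}" for s0
  proof -
    have "continuous_on {-\<tau>..0} g"
      by (rule uniform_limit_theorem[OF _ g]) (auto intro!: always_eventually section_continuous tr simp: B_def Ic_def)
    then have "(g \<longlongrightarrow> g s0) (at s0 within {-\<tau>..0})" using s0 by (simp add: continuous_on_def)
    then have "((\<lambda>s. dist (g s) (g s0)) \<longlongrightarrow> 0) (at s0 within {-\<tau>..0})" by (subst (asm) tendsto_dist_iff)
    moreover have "\<forall>\<^sub>F s in at s0 within {-\<tau>..0}. dist (g s) (g s0) = l2norm ?S (\<lambda>x. b s x - b s0 x)"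
      unfolding eventually_at_filter
      by (rule always_eventually) (simp add: l2norm_emb_diff b s0[unfolded atLeastAtMost_iff])
    ultimately show ?thesis by (rule Lim_transform_eventually)
  qed
  have 3: "AE s in \<D> \<tau>. AE x in ?S. I (x(j := s)) = b s x"
  proof -
    define C where "C = \<tau> * W * GmK"
    have C: "0 \<le> C" unfolding C_def using \<tau> W_nonneg GmK_ge_1 by simp
    have IIc: "l2norm \<P> (\<lambda>\<theta>. I \<theta> - Ic k \<theta>) \<le> C * (1/2)^k" for k
    proof -
      obtain J where J: "l2_has_integral \<P> (\<lambda>t \<theta>. w t *\<^sub>R Gm t (F k) \<theta>) \<tau> J"
        using weighted_integral(1)[OF FT w W] by blast
      have JL: "J \<in> L2 \<P>" using J by (simp add: l2_has_integral_iff)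
      have "AE \<theta> in \<P>. J \<theta> = Ic k \<theta>" unfolding Ic_def by (rule traj_integral_fun_eq[OF tr J])
      then have "l2norm \<P> (\<lambda>\<theta>. I \<theta> - Ic k \<theta>) = l2norm \<P> (\<lambda>\<theta>. I \<theta> - J \<theta>)"
        by (intro l2norm_cong_AE L2_measurable L2_diff IL IcL JL) auto
      also have "\<dots> \<le> C * l2norm \<P> (\<lambda>\<theta>. \<Phi> \<theta> - F k \<theta>)" unfolding C_def
        by (rule weighted_integral(2)[OF L2_subspaceD(5)[OF L_tensor_subspace \<Phi> FT] w W weighted_integral_diff[OF \<Phi> FT I J]])
      also have "\<dots> \<le> C * (1/2)^k"
        using cl[of k] by (intro mult_left_mono C) (simp add: l2norm_diff_commute[of \<P> \<Phi>])
      finally show ?thesis .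
    qed
    interpret S: sigma_finite_measure ?S by (rule sigma_finite_slice[OF \<tau>])
    \<comment> \<open>Squared distance between the slices at s of I and of its k-th approximation.
      Its integral over s decays like 4^-k, so the sum weighted by 2^k is finite for almost every s,
      which forces convergence of the slices without passing to a subsequence.\<close>
    define D where "D k s = l2sq ?S (\<lambda>x. I (x(j := s)) - Ic k (x(j := s)))" for k s
    have mIc: "(\<lambda>\<theta>. ennreal ((norm (I \<theta> - Ic k \<theta>))\<^sup>2)) \<in> borel_measurable \<P>" for k
      using L2_measurable[OF L2_diff[OF IL IcL]] by simp
    have Dm [measurable]: "D k \<in> borel_measurable (\<D> \<tau>)" for k
    proof -
      have "(\<lambda>(s, x). x(j := s)) \<in> measurable (\<D> \<tau> \<Otimes>\<^sub>M ?S) \<P>"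
        using measurable_compose[OF measurable_pair_swap' measurable_slice_pair[of j \<tau>]] by (simp add: case_prod_beta')
      from measurable_compose[OF this mIc[of k]] show ?thesis unfolding D_def
        by (intro S.borel_measurable_nn_integral) (simp add: case_prod_beta')
    qed
    have intD: "(\<integral>\<^sup>+s. D k s \<partial>\<D> \<tau>) \<le> ennreal (C\<^sup>2 * (1/4)^k)" for k
    proof -
      have "(\<integral>\<^sup>+s. D k s \<partial>\<D> \<tau>) = l2sq \<P> (\<lambda>\<theta>. I \<theta> - Ic k \<theta>)"
        unfolding D_def by (rule nn_integral_slice(2)[OF \<tau> mIc, symmetric])
      also have "\<dots> = ennreal ((l2norm \<P> (\<lambda>\<theta>. I \<theta> - Ic k \<theta>))\<^sup>2)" by (rule L2_nn_integral[OF L2_diff[OF IL IcL]])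
      also have "\<dots> \<le> ennreal ((C * (1/2)^k)\<^sup>2)" by (intro ennreal_leI power_mono IIc) simp
      also have "(C * (1/2)^k)\<^sup>2 = C\<^sup>2 * (1/4)^k" by (simp add: power_mult_distrib power_mult[symmetric] power_divide mult.commute[of k] power_mult)
      finally show ?thesis .
    qed
    have "(\<integral>\<^sup>+s. (\<Sum>k. ennreal (2^k) * D k s) \<partial>\<D> \<tau>) = (\<Sum>k. \<integral>\<^sup>+s. ennreal (2^k) * D k s \<partial>\<D> \<tau>)"
      by (rule nn_integral_suminf) measurable
    also have "\<dots> \<le> (\<Sum>k. ennreal (C\<^sup>2 * (1/2)^k))"
    proof (rule suminf_le)
      fix k
      have "(\<integral>\<^sup>+s. ennreal (2^k) * D k s \<partial>\<D> \<tau>) = ennreal (2^k) * (\<integral>\<^sup>+s. D k s \<partial>\<D> \<tau>)"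
        by (rule nn_integral_cmult[OF Dm])
      also have "\<dots> \<le> ennreal (2^k) * ennreal (C\<^sup>2 * (1/4)^k)" by (intro mult_left_mono intD) simp
      also have "\<dots> = ennreal (2^k * (C\<^sup>2 * (1/4)^k))" by (rule ennreal_mult[symmetric]) simp_all
      also have "2^k * (C\<^sup>2 * (1/4)^k) = C\<^sup>2 * (1/2)^k"
      proof -
        have "(2::real)^k * (1/4)^k = (1/2)^k" unfolding power_mult_distrib[symmetric] by simp
        then show ?thesis by (simp only: mult.left_commute)
      qed
      finally show "(\<integral>\<^sup>+s. ennreal (2^k) * D k s \<partial>\<D> \<tau>) \<le> ennreal (C\<^sup>2 * (1/2)^k)" .
    qed simp_all
    also have "\<dots> = ennreal (\<Sum>k. C\<^sup>2 * (1/2)^k)"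
      by (rule suminf_ennreal2) (simp_all add: summable_mult summable_geometric)
    finally have "(\<integral>\<^sup>+s. (\<Sum>k. ennreal (2^k) * D k s) \<partial>\<D> \<tau>) \<noteq> \<infinity>" 
      unfolding infinity_ennreal_def by (rule neq_top_trans[OF ennreal_neq_top])
    then have "AE s in \<D> \<tau>. (\<Sum>k. ennreal (2^k) * D k s) \<noteq> \<infinity>"
      by (intro nn_integral_noteq_infinite) measurable
    moreover have "AE s in \<D> \<tau>. s \<in> {-\<tau>..0}" by (rule AE_I2) simp
    ultimately show ?thesis
    proof eventually_elim
      fix s assume fin: "(\<Sum>k. ennreal (2^k) * D k s) \<noteq> \<infinity>" and s: "s \<in> {-\<tau>..0}"
      obtain r where r: "0 \<le> r" "(\<Sum>k. ennreal (2^k) * D k s) = ennreal r" using fin by (cases "\<Sum>k. ennreal (2^k) * D k s") auto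
      have Ism: "(\<lambda>x. I (x(j := s))) \<in> borel_measurable ?S"
        by (rule measurable_compose[OF measurable_slice[OF s] L2_measurable[OF IL]])
      have dk: "(\<lambda>x. I (x(j := s)) - B k s x) \<in> L2 ?S \<and> l2norm ?S (\<lambda>x. I (x(j := s)) - B k s x) \<le> sqrt (r * (1/2)^k)" for k
      proof -
        have "(\<Sum>i\<in>{k}. ennreal (2^i) * D i s) \<le> (\<Sum>k. ennreal (2^k) * D k s)" by (rule sum_le_suminf) auto
        then have "ennreal ((1/2)^k) * (ennreal (2^k) * D k s) \<le> ennreal ((1/2)^k) * ennreal r"
          unfolding r(2) by (intro mult_left_mono) auto
        also have "ennreal ((1/2)^k) * (ennreal (2^k) * D k s) = D k s"
        proof -
          have "ennreal ((1/2)^k) * ennreal (2^k) = 1" unfolding ennreal_mult[symmetric, of "(1/2)^k" "2^k", simplified] power_mult_distrib[symmetric] by simp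
          then show ?thesis by (simp add: mult.assoc[symmetric])
        qed
        also have "ennreal ((1/2)^k) * ennreal r = ennreal ((sqrt (r * (1/2)^k))\<^sup>2)"
          using r(1) by (simp add: ennreal_mult[symmetric] mult.commute)
        finally have le: "l2sq ?S (\<lambda>x. I (x(j := s)) - B k s x) \<le> ennreal ((sqrt (r * (1/2)^k))\<^sup>2)"
          unfolding D_def B_def .
        show ?thesis using L2I_nn_integral[OF borel_measurable_diff[OF Ism L2_measurable[OF BL[OF s]]] le] r(1) by simp
      qed
      have IsL: "(\<lambda>x. I (x(j := s))) \<in> L2 ?S"
        using L2_add[OF conjunct1[OF dk[of 0]] BL[OF s, of 0]] by simp
      have "(\<lambda>k. dist (emb ?S (B k s)) (emb ?S (\<lambda>x. I (x(j := s))))) \<longlonglongrightarrow> 0"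
      proof (rule tendsto_sandwich[OF _ _ tendsto_const])
        show "\<forall>\<^sub>F k in sequentially. 0 \<le> dist (emb ?S (B k s)) (emb ?S (\<lambda>x. I (x(j := s))))" by simp
        show "\<forall>\<^sub>F k in sequentially. dist (emb ?S (B k s)) (emb ?S (\<lambda>x. I (x(j := s)))) \<le> sqrt (r * (1/2)^k)"
          using dk l2norm_emb_diff[OF IsL BL[OF s]] by (auto simp: dist_commute)
        show "(\<lambda>k. sqrt (r * (1/2)^k)) \<longlonglongrightarrow> 0" using tendsto_real_sqrt[OF half0[of r]] by simp
      qed
      then have "(\<lambda>k. emb ?S (B k s)) \<longlonglongrightarrow> emb ?S (\<lambda>x. I (x(j := s)))" by (subst tendsto_dist_iff)
      then have "emb ?S (\<lambda>x. I (x(j := s))) = emb ?S (b s)" using LIMSEQ_unique gs[OF s] b(2)[OF s] by metis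
      then show "AE x in ?S. I (x(j := s)) = b s x" by (simp add: emb_eq_iff IsL b(1)[OF s])
    qed
  qed
  show ?thesis unfolding slice_section_def using b(1) 1 2 3 by blast
qed

end

end

section \<open>Stability of sections under null sets, sums and contractions\<close>

lemma has_sections_cong_AE:
  fixes I I' :: "('m::finite \<Rightarrow> real) \<Rightarrow> 'v::euclidean_space"
  assumes \<tau>: "0 < \<tau>" and s: "has_sections \<tau> c I" and eq: "AE \<theta> in pow_measure \<tau>. I \<theta> = I' \<theta>"
  shows "has_sections \<tau> c I'"
  unfolding has_sections_def
proof
  fix j :: 'm
  obtain b where b: "slice_section \<tau> j c I b" by (rule has_sectionsE[OF s])
  have "AE s in \<D> \<tau>. AE x in slice_measure \<tau> j. I' (x(j := s)) = b s x"
    using slice_sectionD(4)[OF b] AE_slice[OF \<tau> eq, of j]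
  proof eventually_elim
    case (elim s) then show ?case by eventually_elim simp
  qed
  with b show "\<exists>b. slice_section \<tau> j c I' b" by (auto simp: slice_section_def)
qed

lemma has_sections_add:
  fixes I I' :: "('m::finite \<Rightarrow> real) \<Rightarrow> 'v::euclidean_space"
  assumes s: "has_sections \<tau> c I" and s': "has_sections \<tau> c' I'"
  shows "has_sections \<tau> (c + c') (\<lambda>\<theta>. I \<theta> + I' \<theta>)"
  unfolding has_sections_def
proof
  fix j :: 'm
  let ?S = "slice_measure \<tau> j"
  obtain b where ss: "slice_section \<tau> j c I b" by (rule has_sectionsE[OF s])
  note b = slice_sectionD(1,2)[OF ss] and bc = slice_sectionD(3)[OF ss] and ae = slice_sectionD(4)[OF ss]
  obtain b' where ss': "slice_section \<tau> j c' I' b'" by (rule has_sectionsE[OF s'])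
  note b' = slice_sectionD(1,2)[OF ss'] and bc' = slice_sectionD(3)[OF ss'] and ae' = slice_sectionD(4)[OF ss']
  show "\<exists>b. slice_section \<tau> j (c + c') (\<lambda>\<theta>. I \<theta> + I' \<theta>) b"
    unfolding slice_section_def
  proof (intro exI[of _ "\<lambda>s x. b s x + b' s x"] conjI ballI)
    fix s assume s: "s \<in> {-\<tau>..0}"
    show "(\<lambda>x. b s x + b' s x) \<in> L2 ?S" using b(1) b'(1) s by (intro L2_add) auto
    have "l2norm ?S (\<lambda>x. b s x + b' s x) \<le> l2norm ?S (b s) + l2norm ?S (b' s)"
      using b(1) b'(1) s by (intro l2norm_triangle) auto
    also have "\<dots> \<le> c + c'" using b(2) b'(2) s by (intro add_mono) auto
    finally show "l2norm ?S (\<lambda>x. b s x + b' s x) \<le> c + c'" .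
  next
    fix s0 assume s0: "s0 \<in> {-\<tau>..0}"
    have lim: "((\<lambda>s. l2norm ?S (\<lambda>x. b s x - b s0 x) + l2norm ?S (\<lambda>x. b' s x - b' s0 x)) \<longlongrightarrow> 0) (at s0 within {-\<tau>..0})"
      using tendsto_add[OF bspec[OF bc s0] bspec[OF bc' s0]] by simp
    show "((\<lambda>s. l2norm ?S (\<lambda>x. b s x + b' s x - (b s0 x + b' s0 x))) \<longlongrightarrow> 0) (at s0 within {-\<tau>..0})"
    proof (rule l2norm_squeeze[OF lim])
      fix s assume s: "s \<in> {-\<tau>..0}"
      show "l2norm ?S (\<lambda>x. b s x + b' s x - (b s0 x + b' s0 x)) \<le> l2norm ?S (\<lambda>x. b s x - b s0 x) + l2norm ?S (\<lambda>x. b' s x - b' s0 x)"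
        using l2norm_triangle[OF L2_diff[OF bspec[OF b(1) s] bspec[OF b(1) s0]] L2_diff[OF bspec[OF b'(1) s] bspec[OF b'(1) s0]]]
        by (simp add: algebra_simps)
    qed
  next
    show "AE s in \<D> \<tau>. AE x in ?S. I (x(j := s)) + I' (x(j := s)) = b s x + b' s x"
      using ae ae'
    proof eventually_elim
      case (elim s) then show ?case by eventually_elim simp
    qed
  qed
qed

text \<open>Taking real and imaginary parts and embedding real vectors as one or the other are
  linear contractions; through these, estimates pass between the real and the complex
  setting.\<close>

lemma L2_contraction:
  fixes L :: "'v::euclidean_space \<Rightarrow> 'w::euclidean_space"
  assumes L: "linear L" and n: "\<And>x. norm (L x) \<le> norm x" and f: "f \<in> L2 M"
  shows "(\<lambda>x. L (f x)) \<in> L2 M" and "l2norm M (\<lambda>x. L (f x)) \<le> l2norm M f"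
proof -
  have m: "(\<lambda>x. L (f x)) \<in> borel_measurable M"
    by (rule borel_measurable_continuous_on[OF linear_continuous_on L2_measurable[OF f]]) (use L in \<open>simp add: linear_linear\<close>)
  have "l2sq M (\<lambda>x. L (f x)) \<le> l2sq M f"
    by (intro nn_integral_mono ennreal_leI power_mono n) simp
  then have "l2sq M (\<lambda>x. L (f x)) \<le> ennreal ((l2norm M f)\<^sup>2)" by (simp add: L2_nn_integral[OF f])
  from L2I_nn_integral[OF m this] show "(\<lambda>x. L (f x)) \<in> L2 M" "l2norm M (\<lambda>x. L (f x)) \<le> l2norm M f" by simp_all
qed

lemma has_sections_contraction:
  fixes L :: "'v::euclidean_space \<Rightarrow> 'w::euclidean_space" and I :: "('m::finite \<Rightarrow> real) \<Rightarrow> 'v"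
  assumes L: "linear L" and n: "\<And>x. norm (L x) \<le> norm x" and s: "has_sections \<tau> c I"
  shows "has_sections \<tau> c (\<lambda>\<theta>. L (I \<theta>))"
  unfolding has_sections_def
proof
  fix j :: 'm
  let ?S = "slice_measure \<tau> j"
  obtain b where ss: "slice_section \<tau> j c I b" by (rule has_sectionsE[OF s])
  note b = slice_sectionD(1,2)[OF ss] and bc = slice_sectionD(3)[OF ss] and ae = slice_sectionD(4)[OF ss]
  show "\<exists>b. slice_section \<tau> j c (\<lambda>\<theta>. L (I \<theta>)) b"
    unfolding slice_section_def
  proof (intro exI[of _ "\<lambda>s x. L (b s x)"] conjI ballI)
    fix s assume s: "s \<in> {-\<tau>..0}"
    show "(\<lambda>x. L (b s x)) \<in> L2 ?S" by (rule L2_contraction(1)[OF L n bspec[OF b(1) s]])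
    show "l2norm ?S (\<lambda>x. L (b s x)) \<le> c"
      by (rule order_trans[OF L2_contraction(2)[OF L n bspec[OF b(1) s]] bspec[OF b(2) s]])
  next
    fix s0 assume s0: "s0 \<in> {-\<tau>..0}"
    show "((\<lambda>s. l2norm ?S (\<lambda>x. L (b s x) - L (b s0 x))) \<longlongrightarrow> 0) (at s0 within {-\<tau>..0})"
    proof (rule l2norm_squeeze[OF bspec[OF bc s0]])
      fix s assume s: "s \<in> {-\<tau>..0}"
      show "l2norm ?S (\<lambda>x. L (b s x) - L (b s0 x)) \<le> l2norm ?S (\<lambda>x. b s x - b s0 x)"
        using L2_contraction(2)[OF L n L2_diff[OF bspec[OF b(1) s] bspec[OF b(1) s0]]] by (simp add: linear_diff[OF L])
    qed
  next
    show "AE s in \<D> \<tau>. AE x in ?S. L (I (x(j := s))) = L (b s x)"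
      using ae
    proof eventually_elim
      case (elim s) then show ?case by eventually_elim simp
    qed
  qed
qed

section \<open>Restrictions\<close>

text \<open>The norm does not grow because the product measure charges the face. All indices are
  taken for the restrictions themselves, and the index j is removed for their sections.\<close>

lemma L2_zero_ext:
  fixes f :: "('m \<Rightarrow> real) \<Rightarrow> 'v::euclidean_space"
  assumes \<tau>: "0 < \<tau>" and K: "finite K" and f: "f \<in> L2 (PiM K (\<lambda>_. \<D> \<tau>))" and KJ: "K \<inter> J = J'"
  shows "(\<lambda>y. f (zero_ext K J y)) \<in> L2 (leb_pow \<tau> J')"
    and "l2norm (leb_pow \<tau> J') (\<lambda>y. f (zero_ext K J y)) \<le> l2norm (PiM K (\<lambda>_. \<D> \<tau>)) f"
proof -
  let ?K = "PiM K (\<lambda>_. \<D> \<tau>)"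
  have m: "(\<lambda>y. f (zero_ext K J y)) \<in> borel_measurable (leb_pow \<tau> J')"
    unfolding leb_pow_def by (rule measurable_compose[OF measurable_zero_ext[OF \<tau>] L2_measurable[OF f]]) (use KJ in auto)
  have "l2sq (leb_pow \<tau> J') (\<lambda>y. f (zero_ext K J y)) \<le> l2sq ?K f"
    unfolding leb_pow_def KJ[symmetric]
    by (rule nn_integral_zero_ext_le[OF \<tau> K, of "\<lambda>x. ennreal ((norm (f x))\<^sup>2)"]) (use L2_measurable[OF f] in simp)
  also have "\<dots> = ennreal ((l2norm ?K f)\<^sup>2)" by (rule L2_nn_integral[OF f])
  finally have "l2sq (leb_pow \<tau> J') (\<lambda>y. f (zero_ext K J y)) \<le> ennreal ((l2norm ?K f)\<^sup>2)" .
  from L2I_nn_integral[OF m this]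
  show "(\<lambda>y. f (zero_ext K J y)) \<in> L2 (leb_pow \<tau> J')" "l2norm (leb_pow \<tau> J') (\<lambda>y. f (zero_ext K J y)) \<le> l2norm ?K f" by simp_all
qed

lemma restr_zero_ext: "restr J I y = I (zero_ext UNIV J y)"
  by (simp add: restr_def zero_ext_def restrict_UNIV)

lemma restr_slice: "j \<in> J \<Longrightarrow> restr J I (y(j := s)) = I ((zero_ext (UNIV - {j}) J y)(j := s))"
  unfolding restr_def zero_ext_def by (rule arg_cong[where f = I]) (auto simp: fun_eq_iff)

lemma restr_L2:
  fixes I :: "('m::finite \<Rightarrow> real) \<Rightarrow> 'v::euclidean_space"
  assumes \<tau>: "0 < \<tau>" and I: "I \<in> L2 (pow_measure \<tau>)"
  shows "restr J I \<in> L2 (leb_pow \<tau> J)" and "l2norm (leb_pow \<tau> J) (restr J I) \<le> l2norm (pow_measure \<tau>) I"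
  using L2_zero_ext[OF \<tau> finite_class.finite_UNIV I[unfolded pow_measure_def], of J J]
  by (simp_all add: restr_zero_ext[abs_def] pow_measure_def)

text \<open>As j belongs to J, freezing j commutes with setting the coordinates outside J to 0.
  Hence a restricted section is a section of the restriction, with the same constant.\<close>

lemma restr_section:
  fixes I :: "('m::finite \<Rightarrow> real) \<Rightarrow> 'v::euclidean_space"
  assumes \<tau>: "0 < \<tau>" and s: "has_sections \<tau> c I" and j: "j \<in> J"
  shows "\<exists>b. is_section \<tau> J j (restr J I) b \<and> (\<forall>s\<in>{-\<tau>..0}. l2norm (leb_pow \<tau> (J - {j})) (b s) \<le> c)"
proof -
  let ?S = "slice_measure \<tau> j" and ?L = "leb_pow \<tau> (J - {j})" and ?z = "zero_ext (UNIV - {j}) J"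
  obtain b where ss: "slice_section \<tau> j c I b" by (rule has_sectionsE[OF s])
  note b = slice_sectionD(1,2)[OF ss] and bc = slice_sectionD(3)[OF ss] and ae = slice_sectionD(4)[OF ss]
  have KJ: "(UNIV - {j}) \<inter> J = J - {j}" by auto
  have fin: "finite (UNIV - {j})" by simp
  note ze = L2_zero_ext[OF \<tau> fin _ KJ]
  show ?thesis unfolding is_section_def
  proof (intro exI[of _ "\<lambda>s y. b s (?z y)"] conjI ballI)
    fix s assume s: "s \<in> {-\<tau>..0}"
    show "(\<lambda>y. b s (?z y)) \<in> L2 ?L" by (rule ze(1)[OF bspec[OF b(1) s]])
    show "l2norm ?L (\<lambda>y. b s (?z y)) \<le> c" by (rule order_trans[OF ze(2)[OF bspec[OF b(1) s]] bspec[OF b(2) s]])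
  next
    fix s0 assume s0: "s0 \<in> {-\<tau>..0}"
    show "((\<lambda>s. l2norm ?L (\<lambda>y. b s (?z y) - b s0 (?z y))) \<longlongrightarrow> 0) (at s0 within {-\<tau>..0})"
    proof (rule l2norm_squeeze[OF bspec[OF bc s0]])
      fix s assume s: "s \<in> {-\<tau>..0}"
      show "l2norm ?L (\<lambda>y. b s (?z y) - b s0 (?z y)) \<le> l2norm ?S (\<lambda>x. b s x - b s0 x)"
        by (rule ze(2)[OF L2_diff[OF bspec[OF b(1) s] bspec[OF b(1) s0]]])
    qed
  next
    have "AE s in leb \<tau>. AE x in ?S. I (x(j := s)) = b s x" using ae by (simp add: AE_delay_iff[OF \<tau>])
    then show "AE s in leb \<tau>. AE y in ?L. restr J I (y(j := s)) = b s (?z y)"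
    proof eventually_elim
      case (elim s)
      from AE_zero_ext[OF \<tau> fin elim, of J] show ?case unfolding leb_pow_def KJ by (simp add: restr_slice[OF j])
    qed
  qed
qed

text \<open>Two sections agree for almost every s, and their distance is continuous in s. An open
  null set is empty, so they agree on the open interval and by continuity at its end points. This
  frees \<open>E_norm\<close> from its arbitrary choice of a section.\<close>

lemma is_section_unique:
  fixes b b' :: "real \<Rightarrow> ('m \<Rightarrow> real) \<Rightarrow> 'v::euclidean_space"
  assumes \<tau>: "0 < \<tau>" and b: "is_section \<tau> J j \<Psi> b" and b': "is_section \<tau> J j \<Psi> b'" and s: "s \<in> {-\<tau>..0}"
  shows "l2norm (leb_pow \<tau> (J - {j})) (b s) = l2norm (leb_pow \<tau> (J - {j})) (b' s)"
proof -
  let ?L = "leb_pow \<tau> (J - {j})"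
  have L2: "\<And>s. s \<in> {-\<tau>..0} \<Longrightarrow> b s \<in> L2 ?L" "\<And>s. s \<in> {-\<tau>..0} \<Longrightarrow> b' s \<in> L2 ?L"
    using b b' by (auto simp: is_section_def)
  have cont: "continuous_on {-\<tau>..0} (\<lambda>s. emb ?L (d s))"
    if d: "is_section \<tau> J j \<Psi> d" for d :: "real \<Rightarrow> ('m \<Rightarrow> real) \<Rightarrow> 'v"
    unfolding continuous_on_def
  proof
    fix s0 assume s0: "s0 \<in> {-\<tau>..0}"
    have dL: "\<And>s. s \<in> {-\<tau>..0} \<Longrightarrow> d s \<in> L2 ?L" using d by (auto simp: is_section_def)
    have "((\<lambda>s. l2norm ?L (\<lambda>y. d s y - d s0 y)) \<longlongrightarrow> 0) (at s0 within {-\<tau>..0})" using d s0 by (auto simp: is_section_def)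
    moreover have "\<forall>\<^sub>F s in at s0 within {-\<tau>..0}. l2norm ?L (\<lambda>y. d s y - d s0 y) = dist (emb ?L (d s)) (emb ?L (d s0))"
      unfolding eventually_at_filter
      by (rule always_eventually) (simp add: l2norm_emb_diff dL s0[unfolded atLeastAtMost_iff])
    ultimately have "((\<lambda>s. dist (emb ?L (d s)) (emb ?L (d s0))) \<longlongrightarrow> 0) (at s0 within {-\<tau>..0})" by (rule Lim_transform_eventually)
    then show "((\<lambda>s. emb ?L (d s)) \<longlongrightarrow> emb ?L (d s0)) (at s0 within {-\<tau>..0})" by (subst tendsto_dist_iff)
  qed
  define f where "f s = dist (emb ?L (b s)) (emb ?L (b' s))" for s
  have fc: "continuous_on {-\<tau>..0} f" unfolding f_def by (intro continuous_intros cont b b')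
  have "AE s in leb \<tau>. f s = 0"
  proof -
    have "AE s in leb \<tau>. AE y in ?L. \<Psi> (y(j := s)) = b s y" "AE s in leb \<tau>. AE y in ?L. \<Psi> (y(j := s)) = b' s y"
      using b b' by (auto simp: is_section_def)
    moreover have "AE s in leb \<tau>. s \<in> {-\<tau>..0}" by (rule AE_I2) simp
    ultimately show ?thesis
    proof eventually_elim
      case (elim s)
      from elim(1,2) have "AE y in ?L. b s y = b' s y" by eventually_elim simp
      then show ?case unfolding f_def by (simp add: emb_eq_iff L2 elim(3)[unfolded atLeastAtMost_iff])
    qed
  qed
  then have ae: "AE s in lborel. s \<in> {-\<tau><..<0} \<longrightarrow> f s = 0" unfolding leb_def by (subst (asm) AE_restrict_space_iff) auto
  have op: "open {s \<in> {-\<tau><..<0}. f s \<noteq> 0}"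
  proof -
    have "open ({-\<tau><..<0} \<inter> f -` (- {0}))"
      by (rule continuous_open_preimage[OF continuous_on_subset[OF fc]]) auto
    then show ?thesis by (simp add: vimage_def Int_def)
  qed
  have f0: "f s = 0" if "s \<in> {-\<tau><..<0}" for s
  proof -
    let ?U = "{s \<in> {-\<tau><..<0}. f s \<noteq> 0}"
    have "?U \<in> null_sets lborel"
      using ae op by (subst AE_iff_null_sets) (auto elim!: AE_mp)
    then have "negligible ?U" by (simp add: negligible_iff_null_sets null_sets_completionI)
    then have "?U = {}" using op open_not_negligible by blast
    then show ?thesis using that by auto
  qed
  have "closure {-\<tau><..<0} = {-\<tau>..0}" using \<tau> by simp
  then have "f s = 0" using continuous_constant_on_closure[of "{-\<tau><..<0}" f 0 s] fc f0 s by simp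
  then have "norm (emb ?L (b s)) = norm (emb ?L (b' s))" by (simp add: f_def)
  then show ?thesis using s by (simp add: norm_emb L2)
qed

lemma restr_E_space:
  fixes I :: "('m::finite \<Rightarrow> real) \<Rightarrow> 'v::euclidean_space"
  assumes \<tau>: "0 < \<tau>" and I: "I \<in> L2 (pow_measure \<tau>)" and s: "has_sections \<tau> c I"
  shows "restr J I \<in> E_space \<tau> J"
  unfolding E_space_def using restr_L2(1)[OF \<tau> I, of J] restr_section[OF \<tau> s, of _ J] by blast

text \<open>The second summand serves the empty J, where the norm is that of the value at (0,...,0),
  a point of mass one.\<close>

lemma restr_E_norm:
  fixes I :: "('m::finite \<Rightarrow> real) \<Rightarrow> 'v::euclidean_space"
  assumes \<tau>: "0 < \<tau>" and I: "I \<in> L2 (pow_measure \<tau>)" and s: "has_sections \<tau> c I"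
  shows "E_norm \<tau> J (restr J I) \<le> c + l2norm (pow_measure \<tau>) I"
proof (cases "J = {}")
  case True
  have "norm (restr {} I (\<lambda>_. undefined)) = l2norm (leb_pow \<tau> {}) (restr {} I)"
    by (simp add: l2norm_def leb_pow_def PiM_empty lebesgue_integral_count_space_finite)
  also have "\<dots> \<le> l2norm (pow_measure \<tau>) I" by (rule restr_L2(2)[OF \<tau> I])
  finally have "norm (restr {} I (\<lambda>_. undefined)) \<le> l2norm (pow_measure \<tau>) I" .
  \<comment> \<open>The constant bounds the norm of a section, so it cannot be negative.\<close>
  moreover have "0 \<le> c"
  proof -
    obtain b where "slice_section \<tau> undefined c I b" by (rule has_sectionsE[OF s])
    note slice_sectionD(2)[OF this]
    then have "l2norm (slice_measure \<tau> (undefined::'m)) (b 0) \<le> c" using \<tau> by simp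
    then show ?thesis by (rule order_trans[OF l2norm_nonneg])
  qed
  ultimately show ?thesis using True by (simp add: E_norm_def)
next
  case False
  have "(SUP \<theta>\<in>{-\<tau>..0}. l2norm (leb_pow \<tau> (J - {j})) ((SOME b. is_section \<tau> J j (restr J I) b) \<theta>)) \<le> c" if j: "j \<in> J" for j
  proof (rule cSUP_least)
    show "{-\<tau>..0} \<noteq> {}" using \<tau> by simp
    fix \<theta> assume \<theta>: "\<theta> \<in> {-\<tau>..0}"
    obtain b where b: "is_section \<tau> J j (restr J I) b" "\<forall>s\<in>{-\<tau>..0}. l2norm (leb_pow \<tau> (J - {j})) (b s) \<le> c"
      using restr_section[OF \<tau> s j] by blast
    have "l2norm (leb_pow \<tau> (J - {j})) ((SOME b. is_section \<tau> J j (restr J I) b) \<theta>) = l2norm (leb_pow \<tau> (J - {j})) (b \<theta>)"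
      by (rule is_section_unique[OF \<tau> someI[of "is_section \<tau> J j (restr J I)", OF b(1)] b(1) \<theta>])
    then show "l2norm (leb_pow \<tau> (J - {j})) ((SOME b. is_section \<tau> J j (restr J I) b) \<theta>) \<le> c" using b(2) \<theta> by simp
  qed
  then have "E_norm \<tau> J (restr J I) \<le> c" unfolding E_norm_def if_not_P[OF False] by (rule cSUP_least[OF False])
  then show ?thesis using l2norm_nonneg[of "pow_measure \<tau>" I] by linarith
qed

lemma E_tensor_norm_le:
  fixes I :: "('m::finite \<Rightarrow> real) \<Rightarrow> 'v::euclidean_space"
  assumes \<tau>: "0 < \<tau>" and I: "I \<in> L2 (pow_measure \<tau>)" and s: "has_sections \<tau> c I"
  shows "E_tensor_norm \<tau> I \<le> real CARD('m set) * (c + l2norm (pow_measure \<tau>) I)"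
  unfolding E_tensor_norm_def by (rule sum_bounded_above[where A = UNIV, simplified of_nat_mult]) (rule restr_E_norm[OF \<tau> I s])

lemma E_tensorI:
  assumes "0 < \<tau>" "I \<in> L_tensor \<tau>" "has_sections \<tau> c I"
  shows "I \<in> E_tensor \<tau>"
  using restr_E_space[OF assms(1) _ assms(3)] assms(2) by (simp add: E_tensor_def L_tensor_def)

section \<open>Complexification\<close>

text \<open>This and the next two are pointwise counterparts of \<open>re_fun\<close>,
  \<open>im_fun\<close> and \<open>cx_op\<close>, stated as maps between Euclidean spaces so that
  the results on linear contractions apply.\<close>

definition cx_re :: "complex^'k \<Rightarrow> real^'k" where "cx_re v = (\<chi> i. Re (v $ i))"
definition cx_im :: "complex^'k \<Rightarrow> real^'k" where "cx_im v = (\<chi> i. Im (v $ i))"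
definition cx_of :: "real^'k \<Rightarrow> real^'k \<Rightarrow> complex^'k" where "cx_of u v = (\<chi> i. Complex (u $ i) (v $ i))"

lemma re_fun_cx_re: "re_fun \<Phi> = (\<lambda>x. cx_re (\<Phi> x))" and im_fun_cx_im: "im_fun \<Phi> = (\<lambda>x. cx_im (\<Phi> x))"
  by (simp_all add: re_fun_def im_fun_def cx_re_def cx_im_def)

lemma cx_op_cx_of: "cx_op T \<Phi> = (\<lambda>x. cx_of (T (re_fun \<Phi>) x) (T (im_fun \<Phi>) x))"
  by (simp add: cx_op_def cx_of_def)

lemma cx_re_im [simp]:
  shows "cx_re (cx_of u v) = u" and "cx_im (cx_of u v) = v" and "cx_of (cx_re z) (cx_im z) = z"
    and "cx_re (y + z) = cx_re y + cx_re z" and "cx_im (y + z) = cx_im y + cx_im z"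
    and "cx_re (y - z) = cx_re y - cx_re z" and "cx_im (y - z) = cx_im y - cx_im z"
    and "cx_re (c *\<^sub>R z) = c *\<^sub>R cx_re z" and "cx_im (c *\<^sub>R z) = c *\<^sub>R cx_im z"
    and "cx_re (q *s z) = Re q *\<^sub>R cx_re z - Im q *\<^sub>R cx_im z"
    and "cx_im (q *s z) = Re q *\<^sub>R cx_im z + Im q *\<^sub>R cx_re z"
  by (simp_all add: cx_re_def cx_im_def cx_of_def vec_eq_iff)

lemma cx_eq_iff: "y = z \<longleftrightarrow> cx_re y = cx_re z \<and> cx_im y = cx_im z"
  by (metis cx_re_im(3))

lemma norm_cx_sq: "(norm (z :: complex^'k::finite))\<^sup>2 = (norm (cx_re z))\<^sup>2 + (norm (cx_im z))\<^sup>2"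
proof -
  have "(norm z)\<^sup>2 = (\<Sum>i\<in>UNIV. (cmod (z $ i))\<^sup>2)"
    unfolding norm_vec_def L2_set_def by (rule real_sqrt_pow2) (simp add: sum_nonneg)
  then show ?thesis unfolding norm_vec_sq cmod_power2 by (simp add: cx_re_def cx_im_def sum.distrib)
qed

lemma norm_cx_re_le: "norm (cx_re z) \<le> norm (z :: complex^'k::finite)" and norm_cx_im_le: "norm (cx_im z) \<le> norm (z :: complex^'k::finite)"
  by (rule power2_le_imp_le; simp add: norm_cx_sq)+

lemma norm_cx_of: "norm (cx_of u 0) = norm (u :: real^'k::finite)" "norm (cx_of 0 u) = norm (u :: real^'k::finite)"
  by (rule power2_eq_imp_eq; simp add: norm_cx_sq)+

lemma linear_cx: "linear cx_re" "linear cx_im" "linear (\<lambda>u. cx_of u 0)" "linear (cx_of 0)"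
  by (rule linearI; simp add: cx_eq_iff)+

lemma norm_smult: "norm (q *s z) = cmod q * norm (z :: complex^'k::finite)"
proof (rule power2_eq_imp_eq)
  have "(norm (q *s z))\<^sup>2 = (norm (Re q *\<^sub>R cx_re z - Im q *\<^sub>R cx_im z))\<^sup>2 + (norm (Re q *\<^sub>R cx_im z + Im q *\<^sub>R cx_re z))\<^sup>2"
    by (simp add: norm_cx_sq)
  also have "\<dots> = ((Re q)\<^sup>2 + (Im q)\<^sup>2) * ((norm (cx_re z))\<^sup>2 + (norm (cx_im z))\<^sup>2)"
    unfolding power2_norm_eq_inner by (simp add: inner_diff inner_add inner_commute algebra_simps power2_eq_square)
  finally show "(norm (q *s z))\<^sup>2 = (cmod q * norm z)\<^sup>2"
    by (simp add: power_mult_distrib norm_cx_sq cmod_power2)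
qed simp_all

lemma L2_cx_iff: "\<Phi> \<in> L2 M \<longleftrightarrow> re_fun \<Phi> \<in> L2 M \<and> im_fun \<Phi> \<in> L2 M"
  for \<Phi> :: "'a \<Rightarrow> complex^'k::finite"
proof (intro iffI conjI)
  assume "\<Phi> \<in> L2 M"
  then show "re_fun \<Phi> \<in> L2 M" "im_fun \<Phi> \<in> L2 M" unfolding re_fun_cx_re im_fun_cx_im
    by (intro L2_contraction(1)[OF linear_cx(1) norm_cx_re_le] L2_contraction(1)[OF linear_cx(2) norm_cx_im_le]; assumption)+
next
  assume a: "re_fun \<Phi> \<in> L2 M \<and> im_fun \<Phi> \<in> L2 M"
  have "(\<lambda>x. cx_of (re_fun \<Phi> x) 0 + cx_of 0 (im_fun \<Phi> x)) \<in> L2 M"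
    using a by (intro L2_add L2_contraction(1)[OF linear_cx(3)] L2_contraction(1)[OF linear_cx(4)]) (auto simp: norm_cx_of)
  also have "(\<lambda>x. cx_of (re_fun \<Phi> x) 0 + cx_of 0 (im_fun \<Phi> x)) = \<Phi>"
    by (simp add: fun_eq_iff cx_eq_iff re_fun_cx_re im_fun_cx_im)
  finally show "\<Phi> \<in> L2 M" .
qed

lemma l2norm_cx:
  fixes \<Phi> :: "'a \<Rightarrow> complex^'k::finite"
  assumes "\<Phi> \<in> L2 M"
  shows "(l2norm M \<Phi>)\<^sup>2 = (l2norm M (re_fun \<Phi>))\<^sup>2 + (l2norm M (im_fun \<Phi>))\<^sup>2"
    and "l2norm M (re_fun \<Phi>) \<le> l2norm M \<Phi>" and "l2norm M (im_fun \<Phi>) \<le> l2norm M \<Phi>"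
    and "l2norm M \<Phi> \<le> l2norm M (re_fun \<Phi>) + l2norm M (im_fun \<Phi>)"
proof -
  have "re_fun \<Phi> \<in> L2 M" "im_fun \<Phi> \<in> L2 M" using assms by (auto simp: L2_cx_iff)
  then show 1: "(l2norm M \<Phi>)\<^sup>2 = (l2norm M (re_fun \<Phi>))\<^sup>2 + (l2norm M (im_fun \<Phi>))\<^sup>2"
    unfolding l2norm_sq norm_cx_sq by (simp add: L2_integrable re_fun_cx_re im_fun_cx_im)
  show "l2norm M (re_fun \<Phi>) \<le> l2norm M \<Phi>" "l2norm M (im_fun \<Phi>) \<le> l2norm M \<Phi>"
    by (rule power2_le_imp_le; simp add: 1)+
  show "l2norm M \<Phi> \<le> l2norm M (re_fun \<Phi>) + l2norm M (im_fun \<Phi>)"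
    by (rule power2_le_imp_le) (simp_all add: 1 power2_sum)
qed

lemma L2_smult:
  fixes \<Phi> :: "'a \<Rightarrow> complex^'k::finite"
  assumes "\<Phi> \<in> L2 M" shows "(\<lambda>x. q *s \<Phi> x) \<in> L2 M" and "l2norm M (\<lambda>x. q *s \<Phi> x) = cmod q * l2norm M \<Phi>"
proof -
  have "re_fun \<Phi> \<in> L2 M" "im_fun \<Phi> \<in> L2 M" using assms by (auto simp: L2_cx_iff)
  then show "(\<lambda>x. q *s \<Phi> x) \<in> L2 M"
    unfolding L2_cx_iff by (auto simp: re_fun_cx_re im_fun_cx_im intro!: L2_add L2_diff L2_scaleR)
  show "l2norm M (\<lambda>x. q *s \<Phi> x) = cmod q * l2norm M \<Phi>"
    unfolding l2norm_def norm_smult power_mult_distrib by (simp add: real_sqrt_mult)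
qed

lemma re_im_cx_op [simp]: "re_fun (cx_op T \<Phi>) = T (re_fun \<Phi>)" "im_fun (cx_op T \<Phi>) = T (im_fun \<Phi>)"
  by (simp_all add: re_fun_def im_fun_def cx_op_def vec_eq_iff fun_eq_iff)

text \<open>With q = -p this is the rescaled complexified semigroup; passing to it moves the
  resolvent at p to the resolvent at 0, the case treated by the orbit sum.\<close>

definition cx_semigroup ::
    "complex \<Rightarrow> (real \<Rightarrow> ('a \<Rightarrow> real^'k) \<Rightarrow> 'a \<Rightarrow> real^'k) \<Rightarrow> real \<Rightarrow> ('a \<Rightarrow> complex^'k) \<Rightarrow> 'a \<Rightarrow> complex^'k" where
  "cx_semigroup q G t \<Phi> = (\<lambda>x. exp (q * of_real t) *s cx_op (G t) \<Phi> x)"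

lemma exp_quotient_limit: "((\<lambda>h::real. (exp (q * of_real h) - 1) /\<^sub>R h) \<longlongrightarrow> q) (at_right 0)" for q :: complex
proof (cases "q = 0")
  case False
  have l0: "((\<lambda>h::real. q * of_real h) \<longlongrightarrow> q * of_real 0) (at_right 0)" by (intro tendsto_intros)
  have "filterlim (\<lambda>h::real. q * of_real h) (at 0) (at_right 0)"
    unfolding filterlim_at using l0 False by (auto intro: eventually_mono[OF eventually_right_pos])
  from filterlim_compose[OF lim_exp_minus_1 this]
  have "((\<lambda>h::real. q * ((exp (q * of_real h) - 1) / (q * of_real h))) \<longlongrightarrow> q * 1) (at_right 0)"
    by (intro tendsto_mult tendsto_const)
  then have lim: "((\<lambda>h::real. q * ((exp (q * of_real h) - 1) / (q * of_real h))) \<longlongrightarrow> q) (at_right 0)" by simp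
  show ?thesis
  proof (rule Lim_transform_eventually[OF lim])
    show "\<forall>\<^sub>F h in at_right 0. q * ((exp (q * of_real h) - 1) / (q * of_real h)) = (exp (q * of_real h) - 1) /\<^sub>R (h::real)"
    proof (intro always_eventually allI)
      fix h :: real
      have "q * ((exp (q * of_real h) - 1) / (q * of_real h)) = (exp (q * of_real h) - 1) / of_real h"
        unfolding times_divide_eq_right using False by (rule nonzero_mult_divide_mult_cancel_left)
      then show "q * ((exp (q * of_real h) - 1) / (q * of_real h)) = (exp (q * of_real h) - 1) /\<^sub>R h"
        by (simp add: scaleR_conv_of_real divide_inverse mult.commute)
    qed
  qed
qed simp

text \<open>With e = exp(q h), the quotient minus its limit equals e ((U - \<Psi>)/h - \<Xi>) + ((e
  - 1)/h - q) \<Psi> + (e - 1) \<Xi>, and each term tends to 0. U is left arbitrary so that a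
  rescaling can also be undone.\<close>

lemma quotient_twist:
  fixes U :: "real \<Rightarrow> 'a \<Rightarrow> complex^'k::finite"
  assumes U: "\<And>h. 0 < h \<Longrightarrow> U h \<in> L2 M" and \<Psi>: "\<Psi> \<in> L2 M" and \<Xi>: "\<Xi> \<in> L2 M"
    and lim: "((\<lambda>h. l2norm M (\<lambda>x. (U h x - \<Psi> x) /\<^sub>R h - \<Xi> x)) \<longlongrightarrow> 0) (at_right 0)"
  shows "((\<lambda>h. l2norm M (\<lambda>x. (exp (q * of_real h) *s U h x - \<Psi> x) /\<^sub>R h - (\<Xi> x + q *s \<Psi> x))) \<longlongrightarrow> 0) (at_right 0)"
proof -
  let ?e = "\<lambda>h::real. exp (q * of_real h)"
  let ?b = "\<lambda>h. cmod (?e h) * l2norm M (\<lambda>x. (U h x - \<Psi> x) /\<^sub>R h - \<Xi> x)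
    + (cmod ((?e h - 1) /\<^sub>R h - q) * l2norm M \<Psi> + cmod (?e h - 1) * l2norm M \<Xi>)"
  have e0: "(?e \<longlongrightarrow> 1) (at_right 0)"
  proof -
    have "(?e \<longlongrightarrow> exp (q * of_real 0)) (at_right 0)" by (intro tendsto_intros)
    then show ?thesis by simp
  qed
  have "(?b \<longlongrightarrow> cmod 1 * 0 + (cmod (q - q) * l2norm M \<Psi> + cmod (1 - 1) * l2norm M \<Xi>)) (at_right 0)"
    by (intro tendsto_add tendsto_mult tendsto_norm tendsto_diff tendsto_const e0 lim exp_quotient_limit)
  then have b0: "(?b \<longlongrightarrow> 0) (at_right 0)" by simp
  show ?thesis
  proof (rule l2norm_squeeze[OF b0])
    fix h :: real assume "h \<in> {0<..}"
    then have h: "0 < h" by simp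
    have dL: "(\<lambda>x. (U h x - \<Psi> x) /\<^sub>R h - \<Xi> x) \<in> L2 M" by (intro L2_diff L2_scaleR U h \<Psi> \<Xi>)
    have "l2norm M (\<lambda>x. (?e h *s U h x - \<Psi> x) /\<^sub>R h - (\<Xi> x + q *s \<Psi> x)) =
      l2norm M (\<lambda>x. ?e h *s ((U h x - \<Psi> x) /\<^sub>R h - \<Xi> x) + (((?e h - 1) /\<^sub>R h - q) *s \<Psi> x + (?e h - 1) *s \<Xi> x))"
    proof (rule arg_cong[where f = "l2norm M"], rule ext)
      fix x
      show "(?e h *s U h x - \<Psi> x) /\<^sub>R h - (\<Xi> x + q *s \<Psi> x) =
        ?e h *s ((U h x - \<Psi> x) /\<^sub>R h - \<Xi> x) + (((?e h - 1) /\<^sub>R h - q) *s \<Psi> x + (?e h - 1) *s \<Xi> x)"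
      proof (subst vec_eq_iff, rule allI)
        fix i
        show "((?e h *s U h x - \<Psi> x) /\<^sub>R h - (\<Xi> x + q *s \<Psi> x)) $ i =
          (?e h *s ((U h x - \<Psi> x) /\<^sub>R h - \<Xi> x) + (((?e h - 1) /\<^sub>R h - q) *s \<Psi> x + (?e h - 1) *s \<Xi> x)) $ i"
          by (simp add: algebra_simps)
      qed
    qed
    also have "\<dots> \<le> l2norm M (\<lambda>x. ?e h *s ((U h x - \<Psi> x) /\<^sub>R h - \<Xi> x)) + l2norm M (\<lambda>x. ((?e h - 1) /\<^sub>R h - q) *s \<Psi> x + (?e h - 1) *s \<Xi> x)"
      by (intro l2norm_triangle L2_add L2_smult(1) dL \<Psi> \<Xi>)
    also have "l2norm M (\<lambda>x. ((?e h - 1) /\<^sub>R h - q) *s \<Psi> x + (?e h - 1) *s \<Xi> x)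
      \<le> l2norm M (\<lambda>x. ((?e h - 1) /\<^sub>R h - q) *s \<Psi> x) + l2norm M (\<lambda>x. (?e h - 1) *s \<Xi> x)"
      by (intro l2norm_triangle L2_smult(1) \<Psi> \<Xi>)
    finally show "l2norm M (\<lambda>x. (?e h *s U h x - \<Psi> x) /\<^sub>R h - (\<Xi> x + q *s \<Psi> x)) \<le> ?b h"
      by (simp only: L2_smult(2)[OF dL] L2_smult(2)[OF \<Psi>] L2_smult(2)[OF \<Xi>])
  qed
qed

context
  fixes M :: "'a measure" and X :: "('a \<Rightarrow> real^'k::finite) set" assumes X: "L2_subspace M X"
begin

lemma cx_space_L2: "\<Phi> \<in> cx_space X \<Longrightarrow> \<Phi> \<in> L2 M"
  using L2_subspaceD(1)[OF X] by (auto simp: cx_space_def L2_cx_iff)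

lemma cx_space_smult: "\<Phi> \<in> cx_space X \<Longrightarrow> (\<lambda>x. q *s \<Phi> x) \<in> cx_space X"
  by (auto simp: cx_space_def re_fun_cx_re im_fun_cx_im intro!: L2_subspaceD(3,4,5)[OF X])

lemma cx_subspace: "L2_subspace M (cx_space X)"
  unfolding L2_subspace_def
proof (intro conjI ballI allI impI)
  show "cx_space X \<subseteq> L2 M" using cx_space_L2 by auto
  show "(\<lambda>x. 0) \<in> cx_space X"
    using L2_subspaceD(2)[OF X] by (simp add: cx_space_def re_fun_def im_fun_def vec_eq_iff zero_vec_def)
  show "(\<lambda>x. f x + g x) \<in> cx_space X" if "f \<in> cx_space X" "g \<in> cx_space X" for f g
    using that by (auto simp: cx_space_def re_fun_cx_re im_fun_cx_im intro!: L2_subspaceD(3)[OF X])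
  show "(\<lambda>x. c *\<^sub>R f x) \<in> cx_space X" if "f \<in> cx_space X" for f c
    using that by (auto simp: cx_space_def re_fun_cx_re im_fun_cx_im intro!: L2_subspaceD(4)[OF X])
next
  fix f g assume a: "(\<forall>n. f n \<in> cx_space X) \<and> g \<in> L2 M \<and> (\<lambda>n. l2norm M (\<lambda>x. f n x - g x)) \<longlonglongrightarrow> 0"
  then have fX: "\<And>n. f n \<in> cx_space X" and g: "g \<in> L2 M" and lim: "(\<lambda>n. l2norm M (\<lambda>x. f n x - g x)) \<longlonglongrightarrow> 0" by auto
  have fg: "(\<lambda>x. f n x - g x) \<in> L2 M" for n by (rule L2_diff[OF cx_space_L2[OF fX] g])
  have "(\<lambda>n. l2norm M (\<lambda>x. re_fun (f n) x - re_fun g x)) \<longlonglongrightarrow> 0"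
    by (rule tendsto_sandwich[OF _ _ tendsto_const lim]) (use l2norm_cx(2)[OF fg] in \<open>simp_all add: re_fun_cx_re\<close>)
  moreover have "(\<lambda>n. l2norm M (\<lambda>x. im_fun (f n) x - im_fun g x)) \<longlonglongrightarrow> 0"
    by (rule tendsto_sandwich[OF _ _ tendsto_const lim]) (use l2norm_cx(3)[OF fg] in \<open>simp_all add: im_fun_cx_im\<close>)
  ultimately show "g \<in> cx_space X"
    using fX g L2_subspaceD(6)[OF X, of "\<lambda>n. re_fun (f n)" "re_fun g"] L2_subspaceD(6)[OF X, of "\<lambda>n. im_fun (f n)" "im_fun g"]
    by (simp add: cx_space_def L2_cx_iff)
qed

lemma cx_op_mem: "bounded_op M X T \<Longrightarrow> \<Phi> \<in> cx_space X \<Longrightarrow> cx_op T \<Phi> \<in> cx_space X"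
  by (simp add: cx_space_def bounded_opD(1))

text \<open>The squared norms of real and imaginary parts add up, so K is not enlarged: decay
  constants on the real space remain valid on its complexification.\<close>

lemma cx_op_bound:
  assumes T: "bounded_op M X T" and \<Phi>: "\<Phi> \<in> cx_space X"
    and K: "\<And>f. f \<in> X \<Longrightarrow> l2norm M (T f) \<le> K * l2norm M f" and K0: "0 \<le> K"
  shows "l2norm M (cx_op T \<Phi>) \<le> K * l2norm M \<Phi>"
proof (rule power2_le_imp_le)
  have \<Phi>X: "re_fun \<Phi> \<in> X" "im_fun \<Phi> \<in> X" using \<Phi> by (auto simp: cx_space_def)
  have "(l2norm M (cx_op T \<Phi>))\<^sup>2 = (l2norm M (T (re_fun \<Phi>)))\<^sup>2 + (l2norm M (T (im_fun \<Phi>)))\<^sup>2"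
    using l2norm_cx(1)[OF cx_space_L2[OF cx_op_mem[OF T \<Phi>]]] by simp
  also have "\<dots> \<le> (K * l2norm M (re_fun \<Phi>))\<^sup>2 + (K * l2norm M (im_fun \<Phi>))\<^sup>2"
    by (intro add_mono power_mono K \<Phi>X l2norm_nonneg)
  also have "\<dots> = (K * l2norm M \<Phi>)\<^sup>2" by (simp add: power_mult_distrib l2norm_cx(1)[OF cx_space_L2[OF \<Phi>]] distrib_left)
  finally show "(l2norm M (cx_op T \<Phi>))\<^sup>2 \<le> (K * l2norm M \<Phi>)\<^sup>2" .
qed (use K0 in simp)

lemma cx_op_add:
  assumes T: "bounded_op M X T" and \<Phi>: "\<Phi> \<in> cx_space X" and \<Psi>: "\<Psi> \<in> cx_space X"
  shows "AE x in M. cx_op T (\<lambda>y. \<Phi> y + \<Psi> y) x = cx_op T \<Phi> x + cx_op T \<Psi> x"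
proof -
  have m: "re_fun \<Phi> \<in> X" "im_fun \<Phi> \<in> X" "re_fun \<Psi> \<in> X" "im_fun \<Psi> \<in> X" using \<Phi> \<Psi> by (auto simp: cx_space_def)
  have e: "re_fun (\<lambda>y. \<Phi> y + \<Psi> y) = (\<lambda>y. re_fun \<Phi> y + re_fun \<Psi> y)" "im_fun (\<lambda>y. \<Phi> y + \<Psi> y) = (\<lambda>y. im_fun \<Phi> y + im_fun \<Psi> y)"
    by (simp_all add: re_fun_cx_re im_fun_cx_im)
  show ?thesis using bounded_opD(2)[OF T m(1,3)] bounded_opD(2)[OF T m(2,4)]
    by eventually_elim (simp add: cx_op_cx_of e cx_eq_iff)
qed

lemma cx_op_smult:
  assumes T: "bounded_op M X T" and \<Phi>: "\<Phi> \<in> cx_space X"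
  shows "AE x in M. cx_op T (\<lambda>y. q *s \<Phi> y) x = q *s cx_op T \<Phi> x"
proof -
  have m: "re_fun \<Phi> \<in> X" "im_fun \<Phi> \<in> X" using \<Phi> by (auto simp: cx_space_def)
  have sm: "(\<lambda>y. c *\<^sub>R re_fun \<Phi> y) \<in> X" "(\<lambda>y. c *\<^sub>R im_fun \<Phi> y) \<in> X" for c by (intro L2_subspaceD(4)[OF X] m)+
  have e: "re_fun (\<lambda>y. q *s \<Phi> y) = (\<lambda>y. Re q *\<^sub>R re_fun \<Phi> y - Im q *\<^sub>R im_fun \<Phi> y)"
    "im_fun (\<lambda>y. q *s \<Phi> y) = (\<lambda>y. Re q *\<^sub>R im_fun \<Phi> y + Im q *\<^sub>R re_fun \<Phi> y)"
    by (simp_all add: re_fun_cx_re im_fun_cx_im)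
  note AE1 = bounded_op_diff[OF X T sm(1)[of "Re q"] sm(2)[of "Im q"]]
  note AE2 = bounded_opD(2)[OF T sm(2)[of "Re q"] sm(1)[of "Im q"]]
  show ?thesis using AE1 AE2 bounded_opD(3)[OF T m(1), of "Re q"] bounded_opD(3)[OF T m(2), of "Re q"]
      bounded_opD(3)[OF T m(1), of "Im q"] bounded_opD(3)[OF T m(2), of "Im q"]
    by eventually_elim (simp add: cx_op_cx_of e cx_eq_iff)
qed

lemma cx_semigroup_mem: "bounded_op M X (G t) \<Longrightarrow> \<Phi> \<in> cx_space X \<Longrightarrow> cx_semigroup q G t \<Phi> \<in> cx_space X"
  unfolding cx_semigroup_def by (intro cx_space_smult cx_op_mem)

lemma cx_semigroup_norm:
  assumes "bounded_op M X (G t)" "\<Phi> \<in> cx_space X"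
  shows "l2norm M (cx_semigroup q G t \<Phi>) = exp (Re q * t) * l2norm M (cx_op (G t) \<Phi>)"
  unfolding cx_semigroup_def L2_smult(2)[OF cx_space_L2[OF cx_op_mem[OF assms]]] by simp

lemma cx_semigroup_bounded_op:
  assumes T: "bounded_op M X (G t)" shows "bounded_op M (cx_space X) (cx_semigroup q G t)"
  unfolding bounded_op_def
proof (intro conjI ballI allI)
  show "cx_semigroup q G t f \<in> cx_space X" if "f \<in> cx_space X" for f by (rule cx_semigroup_mem[where G = G, OF T that])
  show "AE x in M. cx_semigroup q G t (\<lambda>y. f y + g y) x = cx_semigroup q G t f x + cx_semigroup q G t g x"
    if "f \<in> cx_space X" "g \<in> cx_space X" for f g
    using cx_op_add[OF T that] unfolding cx_semigroup_def by eventually_elim (simp add: vector_add_ldistrib)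
  show "AE x in M. cx_semigroup q G t (\<lambda>y. c *\<^sub>R f y) x = c *\<^sub>R cx_semigroup q G t f x"
    if "f \<in> cx_space X" for f c
  proof -
    have e: "of_real c *s z = c *\<^sub>R z" for z :: "complex^'k" by (simp add: cx_eq_iff)
    show ?thesis using cx_op_smult[OF T that, of "of_real c"] unfolding cx_semigroup_def e
      by eventually_elim (simp add: vec_eq_iff)
  qed
  obtain K where K: "K \<ge> 0" "\<And>f. f \<in> X \<Longrightarrow> l2norm M (G t f) \<le> K * l2norm M f" using bounded_op_bound[OF T] by blast
  show "\<exists>K. \<forall>f\<in>cx_space X. l2norm M (cx_semigroup q G t f) \<le> K * l2norm M f"
    by (intro exI[of _ "exp (Re q * t) * K"] ballI)
      (simp add: cx_semigroup_norm[where G = G, OF T] mult.assoc cx_op_bound[OF T _ K(2,1)])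
qed

lemma cx_semigroup_c0:
  assumes G: "c0_semigroup M X G" shows "c0_semigroup M (cx_space X) (cx_semigroup q G)"
proof -
  have T: "bounded_op M X (G t)" if "0 \<le> t" for t using G that by (simp add: c0_semigroup_def)
  show ?thesis unfolding c0_semigroup_def
  proof (intro conjI ballI allI impI)
    show "bounded_op M (cx_space X) (cx_semigroup q G t)" if "0 \<le> t" for t by (rule cx_semigroup_bounded_op[where G = G, OF T[OF that]])
  next
    fix f assume f: "f \<in> cx_space X"
    then have m: "re_fun f \<in> X" "im_fun f \<in> X" by (auto simp: cx_space_def)
    have "AE x in M. G 0 (re_fun f) x = re_fun f x" "AE x in M. G 0 (im_fun f) x = im_fun f x"
      using G m by (auto simp: c0_semigroup_def)
    then show "AE x in M. cx_semigroup q G 0 f x = f x"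
      by eventually_elim (simp add: cx_semigroup_def cx_op_cx_of, simp add: cx_eq_iff re_fun_cx_re im_fun_cx_im)
  next
    fix s t :: real and f assume s: "0 \<le> s" and t: "0 \<le> t" and f: "f \<in> cx_space X"
    then have m: "re_fun f \<in> X" "im_fun f \<in> X" by (auto simp: cx_space_def)
    have "AE x in M. G (s + t) (re_fun f) x = G s (G t (re_fun f)) x" "AE x in M. G (s + t) (im_fun f) x = G s (G t (im_fun f)) x"
      using G m s t by (auto simp: c0_semigroup_def)
    moreover have "AE x in M. cx_op (G s) (cx_semigroup q G t f) x = exp (q * of_real t) *s cx_op (G s) (cx_op (G t) f) x"
      unfolding cx_semigroup_def by (rule cx_op_smult[OF T[OF s] cx_op_mem[OF T[OF t] f]])
    ultimately show "AE x in M. cx_semigroup q G (s + t) f x = cx_semigroup q G s (cx_semigroup q G t f) x"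
    proof eventually_elim
      case (elim x)
      have "cx_op (G (s + t)) f x = cx_op (G s) (cx_op (G t) f) x" using elim(1,2) by (simp add: cx_op_cx_of[of "G (s + t)"] cx_op_cx_of[of "G s"])
      then show ?case unfolding cx_semigroup_def[of _ _ s] cx_semigroup_def[of _ _ "s + t"] elim(3)
        by (simp add: distrib_left exp_add vector_smult_assoc)
    qed
  next
    fix f assume f: "f \<in> cx_space X"
    then have m: "re_fun f \<in> X" "im_fun f \<in> X" by (auto simp: cx_space_def)
    have fL: "f \<in> L2 M" by (rule cx_space_L2[OF f])
    define a where "a t = l2norm M (\<lambda>x. G t (re_fun f) x - re_fun f x) + l2norm M (\<lambda>x. G t (im_fun f) x - im_fun f x)" for t
    have a0: "(a \<longlongrightarrow> 0) (at_right 0)"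
      unfolding a_def using G m by (intro tendsto_add_zero) (auto simp: c0_semigroup_def)
    have e0: "((\<lambda>t. exp (q * of_real t)) \<longlongrightarrow> 1) (at_right 0)"
    proof -
      have "((\<lambda>t. exp (q * of_real t)) \<longlongrightarrow> exp (q * of_real 0)) (at_right 0)" by (intro tendsto_intros)
      then show ?thesis by simp
    qed
    have lim: "((\<lambda>t. cmod (exp (q * of_real t)) * a t + cmod (exp (q * of_real t) - 1) * l2norm M f) \<longlongrightarrow> cmod 1 * 0 + cmod (1 - 1) * l2norm M f) (at_right 0)"
      by (intro tendsto_intros e0 a0)
    show "((\<lambda>t. l2norm M (\<lambda>x. cx_semigroup q G t f x - f x)) \<longlongrightarrow> 0) (at_right 0)"
    proof (rule l2norm_squeeze)
      show "((\<lambda>t. cmod (exp (q * of_real t)) * a t + cmod (exp (q * of_real t) - 1) * l2norm M f) \<longlongrightarrow> 0) (at_right 0)" using lim by simp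
      fix t :: real assume "t \<in> {0<..}"
      then have t: "0 \<le> t" by simp
      have uL: "cx_op (G t) f \<in> L2 M" by (rule cx_space_L2[OF cx_op_mem[OF T[OF t] f]])
      have dL: "(\<lambda>x. cx_op (G t) f x - f x) \<in> L2 M" by (rule L2_diff[OF uL fL])
      have d: "l2norm M (\<lambda>x. cx_op (G t) f x - f x) \<le> a t"
        using l2norm_cx(4)[OF dL] unfolding a_def by (simp add: re_fun_cx_re im_fun_cx_im cx_op_cx_of)
      have "l2norm M (\<lambda>x. cx_semigroup q G t f x - f x)
        = l2norm M (\<lambda>x. exp (q * of_real t) *s (cx_op (G t) f x - f x) + (exp (q * of_real t) - 1) *s f x)"
        by (simp add: cx_semigroup_def vec_eq_iff algebra_simps)
      also have "\<dots> \<le> cmod (exp (q * of_real t)) * l2norm M (\<lambda>x. cx_op (G t) f x - f x) + cmod (exp (q * of_real t) - 1) * l2norm M f"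
        unfolding L2_smult(2)[OF dL, symmetric] L2_smult(2)[OF fL, symmetric] by (intro l2norm_triangle L2_smult(1) dL fL)
      also have "\<dots> \<le> cmod (exp (q * of_real t)) * a t + cmod (exp (q * of_real t) - 1) * l2norm M f"
        by (intro add_right_mono mult_left_mono d) simp
      finally show "l2norm M (\<lambda>x. cx_semigroup q G t f x - f x) \<le> \<dots>" .
    qed
  qed
qed

text \<open>A complex difference quotient converges exactly when its real and imaginary parts do. In
  this form a complex exponential factor can be multiplied in.\<close>

lemma cx_graph_generator_iff:
  assumes G: "c0_semigroup M X G"
  shows "(\<Psi>, \<Xi>) \<in> cx_graph (generator M X G) \<longleftrightarrow> \<Psi> \<in> cx_space X \<and> \<Xi> \<in> cx_space X \<and>
    ((\<lambda>h. l2norm M (\<lambda>x. (cx_op (G h) \<Psi> x - \<Psi> x) /\<^sub>R h - \<Xi> x)) \<longlongrightarrow> 0) (at_right 0)"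
proof (cases "\<Psi> \<in> cx_space X \<and> \<Xi> \<in> cx_space X")
  case False
  then show ?thesis by (auto simp: cx_graph_def generator_def cx_space_def)
next
  case True
  have T: "bounded_op M X (G t)" if "0 \<le> t" for t using G that by (simp add: c0_semigroup_def)
  let ?D = "\<lambda>h x. (cx_op (G h) \<Psi> x - \<Psi> x) /\<^sub>R h - \<Xi> x"
  let ?r = "\<lambda>h. l2norm M (\<lambda>x. (G h (re_fun \<Psi>) x - re_fun \<Psi> x) /\<^sub>R h - re_fun \<Xi> x)"
  let ?i = "\<lambda>h. l2norm M (\<lambda>x. (G h (im_fun \<Psi>) x - im_fun \<Psi> x) /\<^sub>R h - im_fun \<Xi> x)"
  have DL: "?D h \<in> L2 M" if "0 < h" for h
    using that True by (intro L2_diff L2_scaleR cx_space_L2 cx_op_mem T) auto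
  have e: "re_fun (?D h) = (\<lambda>x. (G h (re_fun \<Psi>) x - re_fun \<Psi> x) /\<^sub>R h - re_fun \<Xi> x)"
    "im_fun (?D h) = (\<lambda>x. (G h (im_fun \<Psi>) x - im_fun \<Psi> x) /\<^sub>R h - im_fun \<Xi> x)" for h
    by (simp_all add: re_fun_cx_re im_fun_cx_im cx_op_cx_of)
  have b: "?r h \<le> l2norm M (?D h)" "?i h \<le> l2norm M (?D h)" "l2norm M (?D h) \<le> ?r h + ?i h" if "0 < h" for h
    using l2norm_cx(2-4)[OF DL[OF that]] unfolding e by auto
  have "((\<lambda>h. l2norm M (?D h)) \<longlongrightarrow> 0) (at_right 0) \<longleftrightarrow> (?r \<longlongrightarrow> 0) (at_right 0) \<and> (?i \<longlongrightarrow> 0) (at_right 0)"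
  proof (intro iffI conjI)
    assume lim: "((\<lambda>h. l2norm M (?D h)) \<longlongrightarrow> 0) (at_right 0)"
    show "(?r \<longlongrightarrow> 0) (at_right 0)" "(?i \<longlongrightarrow> 0) (at_right 0)"
      by (rule l2norm_squeeze[OF lim], simp add: b)+
  next
    assume "(?r \<longlongrightarrow> 0) (at_right 0) \<and> (?i \<longlongrightarrow> 0) (at_right 0)"
    then have lim: "((\<lambda>h. ?r h + ?i h) \<longlongrightarrow> 0) (at_right 0)" by (intro tendsto_add_zero) auto
    show "((\<lambda>h. l2norm M (?D h)) \<longlongrightarrow> 0) (at_right 0)"
      by (rule l2norm_squeeze[OF lim]) (simp add: b)
  qed
  then show ?thesis using True by (auto simp: cx_graph_def generator_def cx_space_def)
qed

text \<open>Rescaling by exp(q t) adds q to the generator. One direction multiplies by exp(q h), the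
  other multiplies back by exp(-q h); both are instances of the same limit.\<close>

lemma cx_semigroup_generator:
  assumes G: "c0_semigroup M X G"
  shows "(\<Psi>, \<Xi>) \<in> cx_graph (generator M X G) \<longleftrightarrow>
    (\<Psi>, \<lambda>x. \<Xi> x + q *s \<Psi> x) \<in> generator M (cx_space X) (cx_semigroup q G)"
proof -
  have T: "bounded_op M X (G t)" if "0 \<le> t" for t using G that by (simp add: c0_semigroup_def)
  note XD = L2_subspaceD[OF cx_subspace]
  have mem: "\<Xi> \<in> cx_space X \<longleftrightarrow> (\<lambda>x. \<Xi> x + q *s \<Psi> x) \<in> cx_space X" if \<Psi>: "\<Psi> \<in> cx_space X"
  proof
    assume "(\<lambda>x. \<Xi> x + q *s \<Psi> x) \<in> cx_space X"
    from XD(5)[OF this cx_space_smult[OF \<Psi>, of q]] show "\<Xi> \<in> cx_space X" by simp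
  qed (intro XD(3) cx_space_smult \<Psi>)
  have "((\<lambda>h. l2norm M (\<lambda>x. (cx_op (G h) \<Psi> x - \<Psi> x) /\<^sub>R h - \<Xi> x)) \<longlongrightarrow> 0) (at_right 0) \<longleftrightarrow>
    ((\<lambda>h. l2norm M (\<lambda>x. (cx_semigroup q G h \<Psi> x - \<Psi> x) /\<^sub>R h - (\<Xi> x + q *s \<Psi> x))) \<longlongrightarrow> 0) (at_right 0)"
    if \<Psi>: "\<Psi> \<in> cx_space X" and \<Xi>: "\<Xi> \<in> cx_space X"
  proof
    assume lim: "((\<lambda>h. l2norm M (\<lambda>x. (cx_op (G h) \<Psi> x - \<Psi> x) /\<^sub>R h - \<Xi> x)) \<longlongrightarrow> 0) (at_right 0)"
    show "((\<lambda>h. l2norm M (\<lambda>x. (cx_semigroup q G h \<Psi> x - \<Psi> x) /\<^sub>R h - (\<Xi> x + q *s \<Psi> x))) \<longlongrightarrow> 0) (at_right 0)"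
      unfolding cx_semigroup_def
      by (rule quotient_twist[OF _ cx_space_L2[OF \<Psi>] cx_space_L2[OF \<Xi>] lim]) (intro cx_space_L2 cx_op_mem T \<Psi>, simp)
  next
    assume lim: "((\<lambda>h. l2norm M (\<lambda>x. (cx_semigroup q G h \<Psi> x - \<Psi> x) /\<^sub>R h - (\<Xi> x + q *s \<Psi> x))) \<longlongrightarrow> 0) (at_right 0)"
    have "((\<lambda>h. l2norm M (\<lambda>x. (exp (- q * of_real h) *s cx_semigroup q G h \<Psi> x - \<Psi> x) /\<^sub>R h - ((\<Xi> x + q *s \<Psi> x) + (- q) *s \<Psi> x))) \<longlongrightarrow> 0) (at_right 0)"
      by (rule quotient_twist[OF _ cx_space_L2[OF \<Psi>] cx_space_L2[OF iffD1[OF mem[OF \<Psi>] \<Xi>]] lim])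
        (intro cx_space_L2 cx_semigroup_mem T \<Psi>, simp)
    moreover have "exp (- q * of_real h) *s cx_semigroup q G h \<Psi> x = cx_op (G h) \<Psi> x" for h x
      by (simp add: cx_semigroup_def vector_smult_assoc exp_minus)
    moreover have "(\<Xi> x + q *s \<Psi> x) + (- q) *s \<Psi> x = \<Xi> x" for x by (simp add: vec_eq_iff)
    ultimately show "((\<lambda>h. l2norm M (\<lambda>x. (cx_op (G h) \<Psi> x - \<Psi> x) /\<^sub>R h - \<Xi> x)) \<longlongrightarrow> 0) (at_right 0)" by simp
  qed
  then show ?thesis unfolding cx_graph_generator_iff[OF G] unfolding generator_def using mem by auto
qed

end

section \<open>Time integrals with complex exponential weights\<close>

lemma has_sections_mono: "has_sections \<tau> c I \<Longrightarrow> c \<le> c' \<Longrightarrow> has_sections \<tau> c' I"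
  unfolding has_sections_def slice_section_def by (meson order_trans)

lemma l2_has_integral_contraction:
  fixes L :: "'v::euclidean_space \<Rightarrow> 'w::euclidean_space" and f :: "real \<Rightarrow> 'a \<Rightarrow> 'v"
  assumes L: "linear L" and n: "\<And>x. norm (L x) \<le> norm x" and I: "l2_has_integral M f T I"
  shows "l2_has_integral M (\<lambda>s x. L (f s x)) T (\<lambda>x. L (I x))"
proof -
  have f: "\<And>s. s \<in> {0..T} \<Longrightarrow> f s \<in> L2 M" and IL: "I \<in> L2 M" using I by (auto simp: l2_has_integral_def)
  show ?thesis unfolding l2_has_integral_def
  proof (intro conjI ballI allI impI)
    show "(\<lambda>x. L (f s x)) \<in> L2 M" if "s \<in> {0..T}" for s by (rule L2_contraction(1)[OF L n f[OF that]])
    show "(\<lambda>x. L (I x)) \<in> L2 M" by (rule L2_contraction(1)[OF L n IL])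
    fix e :: real assume e: "0 < e"
    from I e have "\<exists>\<gamma>. gauge \<gamma> \<and> (\<forall>D. D tagged_division_of {0..T} \<and> \<gamma> fine D \<longrightarrow>
           l2norm M (\<lambda>x. (\<Sum>(s, K)\<in>D. measure lborel K *\<^sub>R f s x) - I x) < e)"
      by (simp add: l2_has_integral_def)
    then obtain \<gamma> where \<gamma>: "gauge \<gamma>" "\<forall>D. D tagged_division_of {0..T} \<and> \<gamma> fine D \<longrightarrow>
           l2norm M (\<lambda>x. (\<Sum>(s, K)\<in>D. measure lborel K *\<^sub>R f s x) - I x) < e"
      by (elim exE conjE)
    show "\<exists>\<gamma>. gauge \<gamma> \<and> (\<forall>D. D tagged_division_of {0..T} \<and> \<gamma> fine D \<longrightarrow>
           l2norm M (\<lambda>x. (\<Sum>(s, K)\<in>D. measure lborel K *\<^sub>R L (f s x)) - L (I x)) < e)"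
    proof (intro exI[of _ \<gamma>] conjI allI impI \<gamma>(1), elim conjE)
      fix D assume D: "D tagged_division_of {0..T}" "\<gamma> fine D"
      have "(\<lambda>x. (\<Sum>(s, K)\<in>D. measure lborel K *\<^sub>R f s x) - I x) \<in> L2 M"
        unfolding case_prod_beta'
        by (intro L2_diff L2_sum L2_scaleR f IL) (use tag_in_interval[OF D(1)] in auto)
      from L2_contraction(2)[OF L n this]
      have "l2norm M (\<lambda>x. (\<Sum>(s, K)\<in>D. measure lborel K *\<^sub>R L (f s x)) - L (I x)) \<le> l2norm M (\<lambda>x. (\<Sum>(s, K)\<in>D. measure lborel K *\<^sub>R f s x) - I x)"
        by (simp add: linear_diff[OF L] linear_sum[OF L] linear_scale[OF L] case_prod_beta')
      then show "l2norm M (\<lambda>x. (\<Sum>(s, K)\<in>D. measure lborel K *\<^sub>R L (f s x)) - L (I x)) < e"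
        using spec[OF \<gamma>(2), of D] D by (auto intro: le_less_trans)
    qed
  qed
qed

lemma l2_has_integral_add:
  fixes f g :: "real \<Rightarrow> 'a \<Rightarrow> 'v::euclidean_space"
  assumes "l2_has_integral M f T I" "l2_has_integral M g T J"
  shows "l2_has_integral M (\<lambda>s x. f s x + g s x) T (\<lambda>x. I x + J x)"
proof -
  have f: "\<And>s. s \<in> {0..T} \<Longrightarrow> f s \<in> L2 M" "\<And>s. s \<in> {0..T} \<Longrightarrow> g s \<in> L2 M" "I \<in> L2 M" "J \<in> L2 M"
    using assms by (auto simp: l2_has_integral_def)
  have "((\<lambda>s. emb M (f s) + emb M (g s)) has_integral emb M I + emb M J) {0..T}"
    using assms by (intro has_integral_add) (simp_all add: l2_has_integral_iff)
  then have "((\<lambda>s. emb M (\<lambda>x. f s x + g s x)) has_integral emb M (\<lambda>x. I x + J x)) {0..T}"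
    unfolding emb_add[OF f(3,4)] by (rule has_integral_eq[rotated]) (simp add: emb_add f)
  then show ?thesis using f by (auto simp: l2_has_integral_iff intro!: L2_add)
qed

lemma l2_has_integral_unique:
  fixes f :: "real \<Rightarrow> 'a \<Rightarrow> 'v::euclidean_space"
  assumes "l2_has_integral M f T I" "l2_has_integral M f T J" shows "AE x in M. I x = J x"
  using assms has_integral_unique[of "\<lambda>s. emb M (f s)" "emb M I" "{0..T}" "emb M J"]
  by (auto simp: l2_has_integral_iff emb_eq_iff)

context delay_tensor
begin

text \<open>L will embed real vectors as real or as imaginary parts, and w will be the real or
  imaginary part of an exponential up to sign. N allows a common norm bound for all these
  pieces.\<close>

lemma weighted_contraction:
  fixes w :: "real \<Rightarrow> real" and W :: real and L :: "real^('m \<Rightarrow> 'n) \<Rightarrow> complex^('m \<Rightarrow> 'n)"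
  assumes f: "f \<in> L_tensor \<tau>" and w: "continuous_on {0..\<tau>} w" and W: "\<And>t. t \<in> {0..\<tau>} \<Longrightarrow> \<bar>w t\<bar> \<le> W"
    and L: "linear L" and n: "\<And>x. norm (L x) \<le> norm x"
    and N: "l2norm \<P> f \<le> N"
  shows "\<exists>I. l2_has_integral \<P> (\<lambda>t x. L (w t *\<^sub>R Gm t f x)) \<tau> I \<and> has_sections \<tau> (secC * W * N) I \<and> l2norm \<P> I \<le> \<tau> * W * GmK * N"
proof -
  obtain I where I: "l2_has_integral \<P> (\<lambda>t x. w t *\<^sub>R Gm t f x) \<tau> I" using weighted_integral(1)[OF f w W] by blast
  have W0: "0 \<le> W" using W[of 0] \<tau> by auto
  have IL: "I \<in> L2 \<P>" using I by (simp add: l2_has_integral_def)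
  have "has_sections \<tau> (secC * W * l2norm \<P> f) I" unfolding has_sections_def by (rule allI) (rule sections_exist[OF w W f I])
  then have "has_sections \<tau> (secC * W * N) I"
    by (rule has_sections_mono) (intro mult_left_mono N mult_nonneg_nonneg secC_nonneg W0)
  then have "has_sections \<tau> (secC * W * N) (\<lambda>x. L (I x))" by (rule has_sections_contraction[OF L n])
  moreover have "l2norm \<P> (\<lambda>x. L (I x)) \<le> \<tau> * W * GmK * N"
  proof -
    have "l2norm \<P> (\<lambda>x. L (I x)) \<le> l2norm \<P> I" by (rule L2_contraction(2)[OF L n IL])
    also have "\<dots> \<le> \<tau> * W * GmK * l2norm \<P> f" by (rule weighted_integral(2)[OF f w W I])
    also have "\<dots> \<le> \<tau> * W * GmK * N" using \<tau> W0 GmK_ge_1 by (intro mult_left_mono N) simp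
    finally show ?thesis .
  qed
  ultimately show ?thesis using l2_has_integral_contraction[OF L n I] by blast
qed

abbreviation "\<Y> \<equiv> cx_space (L_wedge \<tau> :: (('m \<Rightarrow> real) \<Rightarrow> real^('m \<Rightarrow> 'n)) set)"

text \<open>exp(q t) (u + i v) has four real summands, with weights exp(Re q t) times the cosine or
  sine of Im q t; hence the factor 4. Im q occurs only inside cosine and sine, so the bound W
  depends on Re q alone.\<close>

lemma cx_integral_sections:
  assumes \<Phi>: "\<Phi> \<in> \<Y>" and W: "\<And>t. t \<in> {0..\<tau>} \<Longrightarrow> exp (Re q * t) \<le> W"
    and I: "l2_has_integral \<P> (\<lambda>t. cx_semigroup q Gm t \<Phi>) \<tau> I"
  shows "has_sections \<tau> (4 * (secC * W * l2norm \<P> \<Phi>)) I" and "l2norm \<P> I \<le> 4 * (\<tau> * W * GmK * l2norm \<P> \<Phi>)"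
proof -
  define w1 where "w1 t = exp (Re q * t) * cos (Im q * t)" for t
  define w2 where "w2 t = exp (Re q * t) * sin (Im q * t)" for t
  have wc: "continuous_on {0..\<tau>} w1" "continuous_on {0..\<tau>} w2" "continuous_on {0..\<tau>} (\<lambda>t. - w2 t)"
    unfolding w1_def w2_def by (intro continuous_intros)+
  have "\<bar>w1 t\<bar> \<le> exp (Re q * t)" "\<bar>w2 t\<bar> \<le> exp (Re q * t)" for t
    unfolding w1_def w2_def by (simp_all add: abs_mult mult_left_le)
  then have wW: "\<And>t. t \<in> {0..\<tau>} \<Longrightarrow> \<bar>w1 t\<bar> \<le> W" "\<And>t. t \<in> {0..\<tau>} \<Longrightarrow> \<bar>w2 t\<bar> \<le> W" "\<And>t. t \<in> {0..\<tau>} \<Longrightarrow> \<bar>- w2 t\<bar> \<le> W"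
    using W by (auto intro: order_trans)
  have \<Phi>L: "\<Phi> \<in> L2 \<P>" by (rule cx_space_L2[OF L_wedge_subspace[OF \<tau>] \<Phi>])
  have m: "re_fun \<Phi> \<in> L_tensor \<tau>" "im_fun \<Phi> \<in> L_tensor \<tau>" using \<Phi> by (auto simp: cx_space_def L_wedge_def)
  have re: "linear (\<lambda>u. cx_of u 0 :: complex^('m \<Rightarrow> 'n))" "\<And>u :: real^('m \<Rightarrow> 'n). norm (cx_of u 0) \<le> norm u"
    and im: "linear (cx_of 0 :: _ \<Rightarrow> complex^('m \<Rightarrow> 'n))" "\<And>u :: real^('m \<Rightarrow> 'n). norm (cx_of 0 u) \<le> norm u"
    by (simp_all add: linear_cx norm_cx_of)
  obtain I1 where I1: "l2_has_integral \<P> (\<lambda>t x. cx_of (w1 t *\<^sub>R Gm t (re_fun \<Phi>) x) 0) \<tau> I1"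
    "has_sections \<tau> (secC * W * l2norm \<P> \<Phi>) I1" "l2norm \<P> I1 \<le> \<tau> * W * GmK * l2norm \<P> \<Phi>"
    using weighted_contraction[OF m(1) wc(1) wW(1) re l2norm_cx(2)[OF \<Phi>L]] by blast
  obtain I2 where I2: "l2_has_integral \<P> (\<lambda>t x. cx_of (- w2 t *\<^sub>R Gm t (im_fun \<Phi>) x) 0) \<tau> I2"
    "has_sections \<tau> (secC * W * l2norm \<P> \<Phi>) I2" "l2norm \<P> I2 \<le> \<tau> * W * GmK * l2norm \<P> \<Phi>"
    using weighted_contraction[OF m(2) wc(3) wW(3) re l2norm_cx(3)[OF \<Phi>L]] by blast
  obtain I3 where I3: "l2_has_integral \<P> (\<lambda>t x. cx_of 0 (w1 t *\<^sub>R Gm t (im_fun \<Phi>) x)) \<tau> I3"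
    "has_sections \<tau> (secC * W * l2norm \<P> \<Phi>) I3" "l2norm \<P> I3 \<le> \<tau> * W * GmK * l2norm \<P> \<Phi>"
    using weighted_contraction[OF m(2) wc(1) wW(1) im l2norm_cx(3)[OF \<Phi>L]] by blast
  obtain I4 where I4: "l2_has_integral \<P> (\<lambda>t x. cx_of 0 (w2 t *\<^sub>R Gm t (re_fun \<Phi>) x)) \<tau> I4"
    "has_sections \<tau> (secC * W * l2norm \<P> \<Phi>) I4" "l2norm \<P> I4 \<le> \<tau> * W * GmK * l2norm \<P> \<Phi>"
    using weighted_contraction[OF m(1) wc(2) wW(2) im l2norm_cx(2)[OF \<Phi>L]] by blast
  have L: "I1 \<in> L2 \<P>" "I2 \<in> L2 \<P>" "I3 \<in> L2 \<P>" "I4 \<in> L2 \<P>" "I \<in> L2 \<P>"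
    using I1(1) I2(1) I3(1) I4(1) I by (auto simp: l2_has_integral_def)
  let ?J = "\<lambda>x. (I1 x + I2 x) + (I3 x + I4 x)"
  have "l2_has_integral \<P> (\<lambda>t x. (cx_of (w1 t *\<^sub>R Gm t (re_fun \<Phi>) x) 0 + cx_of (- w2 t *\<^sub>R Gm t (im_fun \<Phi>) x) 0) +
      (cx_of 0 (w1 t *\<^sub>R Gm t (im_fun \<Phi>) x) + cx_of 0 (w2 t *\<^sub>R Gm t (re_fun \<Phi>) x))) \<tau> ?J"
    by (intro l2_has_integral_add I1(1) I2(1) I3(1) I4(1))
  moreover have "(cx_of (w1 t *\<^sub>R Gm t (re_fun \<Phi>) x) 0 + cx_of (- w2 t *\<^sub>R Gm t (im_fun \<Phi>) x) 0) +
      (cx_of 0 (w1 t *\<^sub>R Gm t (im_fun \<Phi>) x) + cx_of 0 (w2 t *\<^sub>R Gm t (re_fun \<Phi>) x)) = cx_semigroup q Gm t \<Phi> x" for t x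
    unfolding cx_semigroup_def cx_op_cx_of w1_def w2_def by (simp add: cx_eq_iff Re_exp Im_exp)
  ultimately have J: "l2_has_integral \<P> (\<lambda>t. cx_semigroup q Gm t \<Phi>) \<tau> ?J" by simp
  have ae: "AE x in \<P>. ?J x = I x" by (rule l2_has_integral_unique[OF J I])
  have "has_sections \<tau> ((secC * W * l2norm \<P> \<Phi> + secC * W * l2norm \<P> \<Phi>) + (secC * W * l2norm \<P> \<Phi> + secC * W * l2norm \<P> \<Phi>)) ?J"
    by (intro has_sections_add I1(2) I2(2) I3(2) I4(2))
  then have "has_sections \<tau> (4 * (secC * W * l2norm \<P> \<Phi>)) ?J" by (rule has_sections_mono) simp
  then show "has_sections \<tau> (4 * (secC * W * l2norm \<P> \<Phi>)) I" by (rule has_sections_cong_AE[OF \<tau> _ ae])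
  have "l2norm \<P> I = l2norm \<P> ?J" using ae by (intro l2norm_cong_AE L2_measurable L2_add L) auto
  also have "\<dots> \<le> l2norm \<P> (\<lambda>x. I1 x + I2 x) + l2norm \<P> (\<lambda>x. I3 x + I4 x)" by (intro l2norm_triangle L2_add L)
  also have "\<dots> \<le> (l2norm \<P> I1 + l2norm \<P> I2) + (l2norm \<P> I3 + l2norm \<P> I4)" by (intro add_mono l2norm_triangle L)
  also have "\<dots> \<le> 4 * (\<tau> * W * GmK * l2norm \<P> \<Phi>)" using I1(3) I2(3) I3(3) I4(3) by simp
  finally show "l2norm \<P> I \<le> 4 * (\<tau> * W * GmK * l2norm \<P> \<Phi>)" .
qed

end

context delay_tensor
begin

abbreviation lift_cx :: "complex \<Rightarrow> real \<Rightarrow> ((('m \<Rightarrow> real) \<Rightarrow> complex^('m \<Rightarrow> 'n)) discrete \<Rightarrow>\<^sub>C real) \<Rightarrow> ((('m \<Rightarrow> real) \<Rightarrow> complex^('m \<Rightarrow> 'n)) discrete \<Rightarrow>\<^sub>C real)"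
  where "lift_cx p t \<equiv> lift_op \<P> \<Y> (cx_semigroup (- p) Gm t)"

text \<open>On classes this is minus the resolvent at p. The orbit sum involves the operators but
  not their decay constants, so the definition precedes any choice of these and is common to all of
  them.\<close>

definition resolvent_orbit :: "complex \<Rightarrow> ((('m \<Rightarrow> real) \<Rightarrow> complex^('m \<Rightarrow> 'n)) discrete \<Rightarrow>\<^sub>C real) \<Rightarrow> ((('m \<Rightarrow> real) \<Rightarrow> complex^('m \<Rightarrow> 'n)) discrete \<Rightarrow>\<^sub>C real)"
  where "resolvent_orbit p x = integral {0..\<tau>} (\<lambda>s. lift_cx p s (stable_semigroup.orbit_sum (lift_cx p) \<tau> x))"

end

section \<open>The resolvent\<close>

text \<open>D and \<kappa> certify decay of the rescaled semigroup. The growth estimate involves p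
  through its real part alone, so one pair serves every p on a vertical line.\<close>

locale wedge_resolvent = delay_tensor \<tau> At G Gm
  for \<tau> and At :: "(real \<Rightarrow> real^'n::finite) \<Rightarrow> real^'n" and G
    and Gm :: "real \<Rightarrow> (('m::finite \<Rightarrow> real) \<Rightarrow> real^('m \<Rightarrow> 'n)) \<Rightarrow> ('m \<Rightarrow> real) \<Rightarrow> real^('m \<Rightarrow> 'n)" +
  fixes p :: complex and D \<kappa> :: real
  assumes wedge_decay: "0 \<le> t \<Longrightarrow> f \<in> L_wedge \<tau> \<Longrightarrow>
      l2norm (pow_measure \<tau>) (Gm t f) \<le> D * exp ((Re p - \<kappa>) * t) * l2norm (pow_measure \<tau>) f"
    and D: "0 \<le> D" and \<kappa>: "0 < \<kappa>"
begin

lemma Y_L2: "f \<in> \<Y> \<Longrightarrow> f \<in> L2 \<P>"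
  by (rule cx_space_L2[OF L_wedge_subspace[OF \<tau>]])

sublocale S: L2_semigroup \<P> \<Y> "cx_semigroup (- p) Gm"
  by standard (rule cx_subspace[OF L_wedge_subspace[OF \<tau>]], rule cx_semigroup_c0[OF L_wedge_subspace[OF \<tau>] c0_wedge])

lemma cx_decay:
  assumes t: "0 \<le> t" and f: "f \<in> \<Y>"
  shows "l2norm \<P> (cx_semigroup (- p) Gm t f) \<le> D * exp (- \<kappa> * t) * l2norm \<P> f"
proof -
  have "l2norm \<P> (cx_semigroup (- p) Gm t f) = exp (Re (- p) * t) * l2norm \<P> (cx_op (Gm t) f)"
    by (rule cx_semigroup_norm[where G = Gm, OF L_wedge_subspace[OF \<tau>] bounded_op_wedge[OF t] f])
  also have "\<dots> \<le> exp (Re (- p) * t) * (D * exp ((Re p - \<kappa>) * t) * l2norm \<P> f)"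
    by (intro mult_left_mono cx_op_bound[OF L_wedge_subspace[OF \<tau>] bounded_op_wedge[OF t] f] wedge_decay t) (use D in auto)
  also have "\<dots> = D * (exp (Re (- p) * t) * exp ((Re p - \<kappa>) * t)) * l2norm \<P> f" by simp
  also have "exp (Re (- p) * t) * exp ((Re p - \<kappa>) * t) = exp (- \<kappa> * t)"
    unfolding exp_add[symmetric] by (simp add: algebra_simps)
  finally show ?thesis .
qed

sublocale S: stable_semigroup "emb \<P> ` \<Y>" "lift_cx p" D \<kappa>
proof
  fix t :: real and x assume t: "0 \<le> t" and "x \<in> emb \<P> ` \<Y>"
  then obtain f where f: "f \<in> \<Y>" "x = emb \<P> f" by blast
  show "norm (lift_cx p t x) \<le> D * exp (- \<kappa> * t) * norm x"
    unfolding f(2) S.lift_emb[OF t f(1)] using cx_decay[OF t f(1)] by (simp add: norm_emb Y_L2 S.G_mem t f(1))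
qed (rule \<kappa>)

text \<open>Subtracting p from the compound gives the generator of the rescaled semigroup, so
  statements at p become statements at 0.\<close>

lemma wedge_generator_iff:
  "(\<Psi>, \<Xi>) \<in> wedge_generator \<tau> Gm \<longleftrightarrow> (\<Psi>, \<lambda>x. \<Xi> x - p *s \<Psi> x) \<in> generator \<P> \<Y> (cx_semigroup (- p) Gm)"
proof -
  have "(\<lambda>x. \<Xi> x + (- p) *s \<Psi> x) = (\<lambda>x. \<Xi> x - p *s \<Psi> x)" by (simp add: fun_eq_iff vec_eq_iff)
  then show ?thesis unfolding wedge_generator_def cx_semigroup_generator[OF L_wedge_subspace[OF \<tau>] c0_wedge, of \<Psi> \<Xi> "- p"] by simp
qed

lemma orbit_gen: "x \<in> emb \<P> ` \<Y> \<Longrightarrow> (resolvent_orbit p x, - x) \<in> S.gen"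
  unfolding resolvent_orbit_def by (rule S.orbit_sum_gen[OF \<tau>])

text \<open>Injectivity of the generator, set against \<open>orbit_gen\<close> at -x: the orbit
  integral inverts the generator up to sign.\<close>

lemma gen_orbit_eq:
  assumes "(y, x) \<in> S.gen" shows "y = resolvent_orbit p (- x)"
  using S.gen_inj[OF assms, of "resolvent_orbit p (- x)"] orbit_gen[of "- x"] S.genD(2)[OF assms] S.V_simps(5) by simp

text \<open>Bounds |exp(-p t)| for t in [0,\<tau>] whichever sign Re p has, and is independent of Im
  p.\<close>

definition "W = max 1 (exp (- Re p * \<tau>))"

lemma exp_le_W: "t \<in> {0..\<tau>} \<Longrightarrow> exp (Re (- p) * t) \<le> W"
proof (cases "0 \<le> Re p")
  case True
  assume "t \<in> {0..\<tau>}"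
  then have "exp (Re (- p) * t) \<le> 1" using True by simp
  then show ?thesis unfolding W_def by (rule max.coboundedI1)
next
  case False
  assume "t \<in> {0..\<tau>}"
  then have "(- Re p) * t \<le> (- Re p) * \<tau>" using False by (intro mult_left_mono) auto
  then have "exp (Re (- p) * t) \<le> exp (- Re p * \<tau>)" by simp
  then show ?thesis unfolding W_def by (rule max.coboundedI2)
qed

text \<open>Norm bound of the orbit sum with step \<tau>, from the geometric series with ratio
  exp(-\<kappa> \<tau>).\<close>

definition "N = D / (1 - exp (- \<kappa> * \<tau>))"

lemma N_nonneg: "0 \<le> N"
  unfolding N_def using D \<kappa> \<tau> by (intro divide_nonneg_nonneg) auto

text \<open>R is the integral over [0,\<tau>] of the rescaled orbit starting at the orbit sum of x.
  The orbit sum has norm at most \<open>N * norm x\<close>, and the integral has sections controlled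
  by that norm.\<close>

lemma orbit_bound:
  assumes x: "x \<in> emb \<P> ` \<Y>" and R: "R \<in> \<Y>" and eq: "emb \<P> R = resolvent_orbit p x"
  shows "has_sections \<tau> (4 * (secC * W * (N * norm x))) R" and "l2norm \<P> R \<le> 4 * (\<tau> * W * GmK * (N * norm x))"
proof -
  obtain \<Psi> where \<Psi>: "\<Psi> \<in> \<Y>" "emb \<P> \<Psi> = S.orbit_sum \<tau> x" using S.orbit_sum(1)[OF \<tau> x] by auto
  have int: "l2_has_integral \<P> (\<lambda>t. cx_semigroup (- p) Gm t \<Psi>) \<tau> R"
    by (rule S.has_integral_orbit[OF \<Psi>(1) R]) (simp add: eq resolvent_orbit_def \<Psi>(2))
  have n: "l2norm \<P> \<Psi> \<le> N * norm x"
    using S.orbit_sum(2)[OF \<tau> x] unfolding \<Psi>(2)[symmetric] N_def by (simp add: norm_emb[OF Y_L2[OF \<Psi>(1)]])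
  have W0: "0 \<le> W" by (simp add: W_def)
  have "4 * (secC * W * l2norm \<P> \<Psi>) \<le> 4 * (secC * W * (N * norm x))"
    using secC_nonneg W0 by (intro mult_left_mono n mult_nonneg_nonneg) auto
  with cx_integral_sections(1)[OF \<Psi>(1) exp_le_W int] show "has_sections \<tau> (4 * (secC * W * (N * norm x))) R"
    by (rule has_sections_mono)
  have "l2norm \<P> R \<le> 4 * (\<tau> * W * GmK * l2norm \<P> \<Psi>)" by (rule cx_integral_sections(2)[OF \<Psi>(1) exp_le_W int])
  also have "\<dots> \<le> 4 * (\<tau> * W * GmK * (N * norm x))"
    using \<tau> W0 GmK_ge_1 by (intro mult_left_mono n) auto
  finally show "l2norm \<P> R \<le> 4 * (\<tau> * W * GmK * (N * norm x))" .
qed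

lemma in_resolvent: "in_resolvent_set \<P> \<Y> (wedge_generator \<tau> Gm) p"
  unfolding in_resolvent_set_def
proof (intro conjI ballI)
  fix \<Phi> assume \<Phi>: "\<Phi> \<in> \<Y>"
  have "- emb \<P> \<Phi> \<in> emb \<P> ` \<Y>" by (rule S.V_simps(5)) (use \<Phi> in simp)
  \<comment> \<open>The orbit integral inverts the negative of the generator, hence the minus sign
    in the argument.\<close>
  from orbit_gen[OF this] have "(resolvent_orbit p (- emb \<P> \<Phi>), emb \<P> \<Phi>) \<in> S.gen" by simp
  then obtain f g where fg: "(f, g) \<in> generator \<P> \<Y> (cx_semigroup (- p) Gm)" and g: "emb \<P> \<Phi> = emb \<P> g"
    by (rule S.gen_ex)
  have gY: "g \<in> \<Y>" using fg by (simp add: generator_def)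
  have e: "(\<lambda>x. (g x + p *s f x) - p *s f x) = g" by (simp add: fun_eq_iff)
  have mem: "(f, \<lambda>x. g x + p *s f x) \<in> wedge_generator \<tau> Gm" unfolding wedge_generator_iff e by (rule fg)
  have ae: "AE x in \<P>. (g x + p *s f x) - p *s f x = \<Phi> x"
    using g[symmetric] unfolding emb_eq_iff[OF Y_L2[OF gY] Y_L2[OF \<Phi>]] by simp
  show "\<exists>(\<Psi>, \<Xi>)\<in>wedge_generator \<tau> Gm. AE x in \<P>. \<Xi> x - p *s \<Psi> x = \<Phi> x"
    by (rule bexI[OF _ mem]) (simp only: prod.case ae)
next
  show "\<exists>K. \<forall>(\<Psi>, \<Xi>)\<in>wedge_generator \<tau> Gm. l2norm \<P> \<Psi> \<le> K * l2norm \<P> (\<lambda>x. \<Xi> x - p *s \<Psi> x)"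
  proof (intro exI[of _ "4 * (\<tau> * W * GmK * N)"] ballI, clarify)
    fix \<Psi> \<Xi> assume "(\<Psi>, \<Xi>) \<in> wedge_generator \<tau> Gm"
    then have g: "(\<Psi>, \<lambda>x. \<Xi> x - p *s \<Psi> x) \<in> generator \<P> \<Y> (cx_semigroup (- p) Gm)" by (simp only: wedge_generator_iff)
    then have m: "\<Psi> \<in> \<Y>" "(\<lambda>x. \<Xi> x - p *s \<Psi> x) \<in> \<Y>" and
      gen: "(emb \<P> \<Psi>, emb \<P> (\<lambda>x. \<Xi> x - p *s \<Psi> x)) \<in> S.gen" by (auto simp: S.generator_iff)
    have V: "- emb \<P> (\<lambda>x. \<Xi> x - p *s \<Psi> x) \<in> emb \<P> ` \<Y>" by (rule S.V_simps(5)) (rule imageI[OF m(2)])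
    show "l2norm \<P> \<Psi> \<le> 4 * (\<tau> * W * GmK * N) * l2norm \<P> (\<lambda>x. \<Xi> x - p *s \<Psi> x)"
      using orbit_bound(2)[OF V m(1) gen_orbit_eq[OF gen]] by (simp add: norm_emb[OF Y_L2[OF m(2)]] mult.assoc)
  qed
qed

text \<open>A domain element is recovered by the orbit integral from its image under the generator
  of the rescaled semigroup, and orbit integrals have sections for every frozen variable. Taking
  real and imaginary parts preserves sections.\<close>

lemma Domain_E_wedge: "Domain (wedge_generator \<tau> Gm) \<subseteq> cx_space (E_wedge \<tau>)"
proof
  fix \<Psi> assume "\<Psi> \<in> Domain (wedge_generator \<tau> Gm)"
  then obtain \<Xi> where "(\<Psi>, \<Xi>) \<in> wedge_generator \<tau> Gm" by blast
  then have "(\<Psi>, \<lambda>x. \<Xi> x - p *s \<Psi> x) \<in> generator \<P> \<Y> (cx_semigroup (- p) Gm)" by (simp only: wedge_generator_iff)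
  then have m: "\<Psi> \<in> \<Y>" "(\<lambda>x. \<Xi> x - p *s \<Psi> x) \<in> \<Y>" and
    gen: "(emb \<P> \<Psi>, emb \<P> (\<lambda>x. \<Xi> x - p *s \<Psi> x)) \<in> S.gen" by (auto simp: S.generator_iff)
  have V: "- emb \<P> (\<lambda>x. \<Xi> x - p *s \<Psi> x) \<in> emb \<P> ` \<Y>" by (rule S.V_simps(5)) (rule imageI[OF m(2)])
  note hs = orbit_bound(1)[OF V m(1) gen_orbit_eq[OF gen]]
  have w: "re_fun \<Psi> \<in> L_wedge \<tau>" "im_fun \<Psi> \<in> L_wedge \<tau>" using m(1) by (auto simp: cx_space_def)
  have "\<exists>c. has_sections \<tau> c (re_fun \<Psi>)" unfolding re_fun_cx_re
    by (rule exI, rule has_sections_contraction[OF linear_cx(1) norm_cx_re_le hs])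
  then have "re_fun \<Psi> \<in> E_tensor \<tau>" using w E_tensorI[OF \<tau>] by (auto simp: L_wedge_def)
  moreover have "\<exists>c. has_sections \<tau> c (im_fun \<Psi>)" unfolding im_fun_cx_im
    by (rule exI, rule has_sections_contraction[OF linear_cx(2) norm_cx_im_le hs])
  then have "im_fun \<Psi> \<in> E_tensor \<tau>" using w E_tensorI[OF \<tau>] by (auto simp: L_wedge_def)
  ultimately show "\<Psi> \<in> cx_space (E_wedge \<tau>)" using w by (simp add: cx_space_def E_wedge_def)
qed

lemma remainder_Domain:
  assumes x: "x \<in> emb \<P> ` \<Y>" and R: "R \<in> \<Y>" and eq: "emb \<P> R = resolvent_orbit p x"
  shows "R \<in> Domain (wedge_generator \<tau> Gm)"
proof -
  have "- x \<in> emb \<P> ` \<Y>" by (rule S.V_simps(5)[OF x])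
  then obtain g where g: "g \<in> \<Y>" "- x = emb \<P> g" by blast
  have e: "(\<lambda>x. (g x + p *s R x) - p *s R x) = g" by (simp add: fun_eq_iff)
  have "(R, g) \<in> generator \<P> \<Y> (cx_semigroup (- p) Gm)"
    using orbit_gen[OF x] R g by (simp add: S.generator_iff eq)
  then have "(R, \<lambda>x. g x + p *s R x) \<in> wedge_generator \<tau> Gm" unfolding wedge_generator_iff e .
  then show ?thesis by (rule DomainI)
qed

text \<open>The full orbit integral of \<Phi> is the truncated integral plus the orbit integral of
  the state at time T, by \<open>orbit_sum_split\<close>. The left side is minus the resolvent
  because injectivity determines the solution of the resolvent equation.\<close>

lemma resolvent_split:
  assumes \<Phi>: "\<Phi> \<in> \<Y>" and T: "0 \<le> T" and R: "R \<in> \<Y>"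
    and eq: "emb \<P> R = resolvent_orbit p (emb \<P> (cx_semigroup (- p) Gm T \<Phi>))"
  shows "\<exists>I. l2_has_integral \<P> (\<lambda>t. cx_semigroup (- p) Gm t \<Phi>) T I \<and>
     (AE \<theta> in \<P>. - resolvent \<P> (wedge_generator \<tau> Gm) p \<Phi> \<theta> = I \<theta> + R \<theta>)"
proof -
  have x: "emb \<P> \<Phi> \<in> emb \<P> ` \<Y>" using \<Phi> by simp
  let ?res = "resolvent \<P> (wedge_generator \<tau> Gm) p \<Phi>"
  have "\<exists>(\<Psi>, \<Xi>)\<in>wedge_generator \<tau> Gm. AE x in \<P>. \<Xi> x - p *s \<Psi> x = \<Phi> x"
    by (rule bspec[OF conjunct1[OF in_resolvent[unfolded in_resolvent_set_def]] \<Phi>])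
  then have "\<exists>\<Psi>. \<exists>\<Xi>. (\<Psi>, \<Xi>) \<in> wedge_generator \<tau> Gm \<and> (AE x in \<P>. \<Xi> x - p *s \<Psi> x = \<Phi> x)"
    by (simp only: Bex_def split_paired_Ex prod.case)
  \<comment> \<open>Existence of a solution makes the choice inside \<open>resolvent\<close>
    meaningful.\<close>
  then have "\<exists>\<Xi>. (?res, \<Xi>) \<in> wedge_generator \<tau> Gm \<and> (AE x in \<P>. \<Xi> x - p *s ?res x = \<Phi> x)"
    unfolding resolvent_def by (rule someI_ex)
  then obtain \<Xi> where \<Xi>: "(?res, \<Xi>) \<in> wedge_generator \<tau> Gm" "AE x in \<P>. \<Xi> x - p *s ?res x = \<Phi> x" by (elim exE conjE)
  from \<Xi>(1) have m: "?res \<in> \<Y>" "(\<lambda>x. \<Xi> x - p *s ?res x) \<in> \<Y>" and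
    gen: "(emb \<P> ?res, emb \<P> (\<lambda>x. \<Xi> x - p *s ?res x)) \<in> S.gen" by (auto simp: S.generator_iff wedge_generator_iff)
  have "emb \<P> (\<lambda>x. \<Xi> x - p *s ?res x) = emb \<P> \<Phi>" using \<Xi>(2) by (simp add: emb_eq_iff Y_L2 m(2) \<Phi>)
  with gen have "(emb \<P> ?res, emb \<P> \<Phi>) \<in> S.gen" by simp
  from S.gen_scale[OF this, of "-1"] have "(- emb \<P> ?res, - emb \<P> \<Phi>) \<in> S.gen" by simp
  then have res: "- emb \<P> ?res = resolvent_orbit p (emb \<P> \<Phi>)" using gen_orbit_eq by fastforce
  have "integral {0..T} (\<lambda>s. lift_cx p s (emb \<P> \<Phi>)) \<in> emb \<P> ` \<Y>" by (rule S.orbit_integral_mem[OF x])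
  then obtain I where I: "I \<in> \<Y>" "emb \<P> I = integral {0..T} (\<lambda>s. lift_cx p s (emb \<P> \<Phi>))" by auto
  have int: "l2_has_integral \<P> (\<lambda>t. cx_semigroup (- p) Gm t \<Phi>) T I" by (rule S.has_integral_orbit[OF \<Phi> I])
  have "resolvent_orbit p (emb \<P> \<Phi>) = emb \<P> I + emb \<P> R"
    using S.orbit_sum_split[OF \<tau> x T] unfolding I(2) eq unfolding resolvent_orbit_def S.lift_emb[OF T \<Phi>] .
  then have "emb \<P> (\<lambda>\<theta>. (-1) *\<^sub>R ?res \<theta>) = emb \<P> (\<lambda>\<theta>. I \<theta> + R \<theta>)"
    using res by (subst emb_scaleR[OF Y_L2[OF m(1)]], subst emb_add[OF Y_L2[OF I(1)] Y_L2[OF R]]) simp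
  then have "AE \<theta> in \<P>. (-1) *\<^sub>R ?res \<theta> = I \<theta> + R \<theta>"
    by (subst (asm) emb_eq_iff) (intro L2_scaleR L2_add Y_L2 m(1) I(1) R)+
  then show ?thesis using int by auto
qed

text \<open>R arises from the state at time T as minus the resolvent arises from \<Phi>, and the
  decay of that state is the whole factor exp(-\<kappa> T). One constant D comes from this decay,
  another sits inside N; the leading cardinality counts the restrictions.\<close>

lemma remainder_bound:
  assumes \<Phi>: "\<Phi> \<in> \<Y>" and T: "0 \<le> T" and R: "R \<in> \<Y>"
    and eq: "emb \<P> R = resolvent_orbit p (emb \<P> (cx_semigroup (- p) Gm T \<Phi>))"
  shows "E_tensor_norm \<tau> R \<le> real CARD('m set) * (4 * (secC + \<tau> * GmK) * W * N * D) * exp (- \<kappa> * T) * l2norm \<P> \<Phi>"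
proof -
  have ST: "cx_semigroup (- p) Gm T \<Phi> \<in> \<Y>" by (rule S.G_mem[OF T \<Phi>])
  let ?n = "l2norm \<P> (cx_semigroup (- p) Gm T \<Phi>)"
  have W0: "0 \<le> W" by (simp add: W_def)
  note b = orbit_bound[OF imageI[OF ST] R eq, unfolded norm_emb[OF Y_L2[OF ST]]]
  have "E_tensor_norm \<tau> R \<le> real CARD('m set) * (4 * (secC * W * (N * ?n)) + l2norm \<P> R)"
    by (rule E_tensor_norm_le[OF \<tau> Y_L2[OF R] b(1)])
  also have "\<dots> \<le> real CARD('m set) * (4 * (secC * W * (N * ?n)) + 4 * (\<tau> * W * GmK * (N * ?n)))"
    by (intro mult_left_mono add_left_mono b(2)) simp
  also have "\<dots> = (real CARD('m set) * (4 * (secC + \<tau> * GmK) * W * N)) * ?n" by (simp add: algebra_simps)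
  also have "\<dots> \<le> (real CARD('m set) * (4 * (secC + \<tau> * GmK) * W * N)) * (D * exp (- \<kappa> * T) * l2norm \<P> \<Phi>)"
    using secC_nonneg W0 N_nonneg \<tau> GmK_ge_1 by (intro mult_left_mono cx_decay[OF T \<Phi>] mult_nonneg_nonneg add_nonneg_nonneg) auto
  finally show ?thesis by (simp only: mult.assoc)
qed

end

text \<open>An infimum strictly below b is undercut by an admissible rate w < b, also when it is
  minus infinity. The constant is made nonnegative for use in products of bounds.\<close>

lemma growth_bound_decay:
  assumes g: "growth_bound M X G < ereal b"
  shows "\<exists>w D. w < b \<and> 0 \<le> D \<and> (\<forall>t\<ge>0. \<forall>f\<in>X. l2norm M (G t f) \<le> D * exp (w * t) * l2norm M f)"
proof -
  have "\<exists>w C. w < b \<and> (\<forall>t\<ge>0. \<forall>f\<in>X. l2norm M (G t f) \<le> C * exp (w * t) * l2norm M f)"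
    using g unfolding growth_bound_def Inf_less_iff by (elim bexE CollectE exE conjE) (intro exI conjI, simp_all)
  then obtain w C where w: "w < b" and C: "\<forall>t\<ge>0. \<forall>f\<in>X. l2norm M (G t f) \<le> C * exp (w * t) * l2norm M f"
    by (elim exE conjE)
  show ?thesis
  proof (rule exI[of _ w], rule exI[of _ "max C 0"], intro conjI allI ballI impI)
    fix t :: real and f assume "0 \<le> t" "f \<in> X"
    then have "l2norm M (G t f) \<le> C * exp (w * t) * l2norm M f" using C by simp
    also have "\<dots> \<le> max C 0 * exp (w * t) * l2norm M f" by (intro mult_right_mono) auto
    finally show "l2norm M (G t f) \<le> max C 0 * exp (w * t) * l2norm M f" .
  qed (use w in auto)
qed

theorem theorem4p2:
  fixes \<tau> \<nu>\<^sub>0 :: real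
    and At :: "(real \<Rightarrow> real^'n::finite) \<Rightarrow> real^'n"
    and G :: "real \<Rightarrow> (real \<Rightarrow> real^'n) \<Rightarrow> real \<Rightarrow> real^'n"
    and Gm :: "real \<Rightarrow> (('m::finite \<Rightarrow> real) \<Rightarrow> real^('m \<Rightarrow> 'n)) \<Rightarrow> ('m \<Rightarrow> real) \<Rightarrow> real^('m \<Rightarrow> 'n)"
  assumes "\<tau> > 0"
    and "bounded_linear_C \<tau> At"
    and "c0_semigroup (delay_measure \<tau>) (L2 (delay_measure \<tau>)) G"
    and "generator (delay_measure \<tau>) (L2 (delay_measure \<tau>)) G = delay_op \<tau> At"
    and "\<forall>t\<ge>0. is_tensor_power \<tau> (G t) (Gm t)"
    and "growth_bound (pow_measure \<tau>) (L_wedge \<tau>) Gm < ereal (-\<nu>\<^sub>0)"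
  shows "(\<forall>\<omega>. in_resolvent_set (pow_measure \<tau>) (cx_space (L_wedge \<tau>)) (wedge_generator \<tau> Gm)
            (Complex (-\<nu>\<^sub>0) \<omega>)) \<and>
    Domain (wedge_generator \<tau> Gm) \<subseteq> cx_space (E_wedge \<tau>) \<and>
    (\<exists>R :: real \<Rightarrow> complex \<Rightarrow> (('m \<Rightarrow> real) \<Rightarrow> complex^('m \<Rightarrow> 'n)) \<Rightarrow> ('m \<Rightarrow> real) \<Rightarrow> complex^('m \<Rightarrow> 'n).
      (\<forall>\<omega>. \<forall>\<Phi>\<in>cx_space (L_wedge \<tau>). \<forall>T\<ge>0.
        let p = Complex (-\<nu>\<^sub>0) \<omega> in
          R T p \<Phi> \<in> Domain (wedge_generator \<tau> Gm) \<and>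
          (\<exists>I. l2_has_integral (pow_measure \<tau>)
                 (\<lambda>t \<theta>. exp (- p * of_real t) *s cx_op (Gm t) \<Phi> \<theta>) T I \<and>
               (AE \<theta> in pow_measure \<tau>.
                 - resolvent (pow_measure \<tau>) (wedge_generator \<tau> Gm) p \<Phi> \<theta> = I \<theta> + R T p \<Phi> \<theta>))) \<and>
      (\<forall>\<kappa>. 0 < \<kappa> \<and> ereal \<kappa> < ereal (-\<nu>\<^sub>0) - growth_bound (pow_measure \<tau>) (L_wedge \<tau>) Gm \<longrightarrow>
        (\<exists>C>0. \<forall>\<omega>. \<forall>\<Phi>\<in>cx_space (L_wedge \<tau>). \<forall>T\<ge>0.
          E_tensor_norm \<tau> (R T (Complex (-\<nu>\<^sub>0) \<omega>) \<Phi>)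
            \<le> C * exp (- \<kappa> * T) * l2norm (pow_measure \<tau>) \<Phi>)))"
proof -
  have \<tau>: "0 < \<tau>" by (rule assms(1))
  interpret delay_tensor \<tau> At G Gm
    by unfold_locales (use assms(1,3,4,5) in auto)
  \<comment> \<open>A rate w at most \<open>-\<nu>\<^sub>0 - \<kappa>\<close> is weakened to that
    value, the form required on the line where the real part of p is
    \<open>-\<nu>\<^sub>0\<close>.\<close>
  have wr: "wedge_resolvent \<tau> At G Gm (Complex (-\<nu>\<^sub>0) \<omega>) D \<kappa>"
    if "w \<le> - \<nu>\<^sub>0 - \<kappa>" "0 \<le> D" "0 < \<kappa>"
      "\<forall>t\<ge>0. \<forall>f\<in>L_wedge \<tau>. l2norm \<P> (Gm t f) \<le> D * exp (w * t) * l2norm \<P> f" for w D \<kappa> \<omega>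
  proof
    fix t :: real and f :: "('m \<Rightarrow> real) \<Rightarrow> real^('m \<Rightarrow> 'n)" assume t: "0 \<le> t" and f: "f \<in> L_wedge \<tau>"
    have "D * exp (w * t) * l2norm \<P> f \<le> D * exp ((- \<nu>\<^sub>0 - \<kappa>) * t) * l2norm \<P> f"
      using that(1) t \<open>0 \<le> D\<close> by (intro mult_right_mono mult_left_mono) (auto intro: mult_right_mono)
    then show "l2norm \<P> (Gm t f) \<le> D * exp ((Re (Complex (-\<nu>\<^sub>0) \<omega>) - \<kappa>) * t) * l2norm \<P> f"
      using bspec[OF spec[OF that(4), THEN mp, OF t] f] by simp
  qed (use that in auto)
  \<comment> \<open>One admissible rate below \<open>-\<nu>\<^sub>0\<close>; its gap plays the part
    of \<kappa> in all the claims in which no \<kappa> is given.\<close>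
  obtain w0 D0 where w0: "w0 < - \<nu>\<^sub>0" "0 \<le> D0"
    "\<forall>t\<ge>0. \<forall>f\<in>L_wedge \<tau>. l2norm \<P> (Gm t f) \<le> D0 * exp (w0 * t) * l2norm \<P> f"
    using growth_bound_decay[OF assms(6)] by (elim exE conjE)
  have wr0: "wedge_resolvent \<tau> At G Gm (Complex (-\<nu>\<^sub>0) \<omega>) D0 (- \<nu>\<^sub>0 - w0)" for \<omega>
    by (rule wr[OF _ w0(2) _ w0(3)]) (use w0(1) in auto)
  let ?orb = "\<lambda>T p \<Phi>. resolvent_orbit p (emb \<P> (cx_semigroup (- p) Gm T \<Phi>))"
  \<comment> \<open>Chosen from p, T and \<Phi> alone, before any \<kappa>; the different decay
    constants used afterwards only provide estimates for this same function.\<close>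
  define R where "R T p \<Phi> = (SOME R. R \<in> \<Y> \<and> emb \<P> R = ?orb T p \<Phi>)" for T p \<Phi>
  have R: "R T (Complex (-\<nu>\<^sub>0) \<omega>) \<Phi> \<in> \<Y> \<and> emb \<P> (R T (Complex (-\<nu>\<^sub>0) \<omega>) \<Phi>) = ?orb T (Complex (-\<nu>\<^sub>0) \<omega>) \<Phi>"
    if \<Phi>: "\<Phi> \<in> \<Y>" and T: "0 \<le> T" for T \<omega> \<Phi>
  proof -
    interpret wr: wedge_resolvent \<tau> At G Gm "Complex (-\<nu>\<^sub>0) \<omega>" D0 "- \<nu>\<^sub>0 - w0" by (rule wr0)
    have "?orb T (Complex (-\<nu>\<^sub>0) \<omega>) \<Phi> \<in> emb \<P> ` \<Y>"
      by (rule wr.S.genD(1)[OF wr.orbit_gen[OF imageI[OF wr.S.G_mem[OF T \<Phi>]]]])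
    then have "\<exists>R. R \<in> \<Y> \<and> emb \<P> R = ?orb T (Complex (-\<nu>\<^sub>0) \<omega>) \<Phi>" by auto
    then show ?thesis unfolding R_def by (rule someI_ex)
  qed
  show ?thesis
  proof (intro conjI allI exI[of _ R] ballI impI)
    fix \<omega>
    interpret wr: wedge_resolvent \<tau> At G Gm "Complex (-\<nu>\<^sub>0) \<omega>" D0 "- \<nu>\<^sub>0 - w0" by (rule wr0)
    show "in_resolvent_set \<P> \<Y> (wedge_generator \<tau> Gm) (Complex (-\<nu>\<^sub>0) \<omega>)" by (rule wr.in_resolvent)
  next
    interpret wr: wedge_resolvent \<tau> At G Gm "Complex (-\<nu>\<^sub>0) 0" D0 "- \<nu>\<^sub>0 - w0" by (rule wr0)
    show "Domain (wedge_generator \<tau> Gm) \<subseteq> cx_space (E_wedge \<tau>)" by (rule wr.Domain_E_wedge)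
  next
    fix \<omega> T :: real and \<Phi> assume \<Phi>: "\<Phi> \<in> \<Y>" and T: "0 \<le> T"
    interpret wr: wedge_resolvent \<tau> At G Gm "Complex (-\<nu>\<^sub>0) \<omega>" D0 "- \<nu>\<^sub>0 - w0" by (rule wr0)
    note R' = conjunct1[OF R[OF \<Phi> T, of \<omega>]] conjunct2[OF R[OF \<Phi> T, of \<omega>]]
    show "let p = Complex (-\<nu>\<^sub>0) \<omega> in R T p \<Phi> \<in> Domain (wedge_generator \<tau> Gm) \<and>
          (\<exists>I. l2_has_integral \<P> (\<lambda>t \<theta>. exp (- p * of_real t) *s cx_op (Gm t) \<Phi> \<theta>) T I \<and>
               (AE \<theta> in \<P>. - resolvent \<P> (wedge_generator \<tau> Gm) p \<Phi> \<theta> = I \<theta> + R T p \<Phi> \<theta>))"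
      unfolding Let_def
      by (intro conjI wr.remainder_Domain[OF imageI[OF wr.S.G_mem[OF T \<Phi>]] R']
        wr.resolvent_split[OF \<Phi> T R', unfolded cx_semigroup_def])
  next
    fix \<kappa> :: real
    assume \<kappa>: "0 < \<kappa> \<and> ereal \<kappa> < ereal (-\<nu>\<^sub>0) - growth_bound \<P> (L_wedge \<tau>) Gm"
    then have "growth_bound \<P> (L_wedge \<tau>) Gm < ereal (- \<nu>\<^sub>0 - \<kappa>)"
      \<comment> \<open>The growth bound may be minus infinity, so the subtraction is one of
        extended reals.\<close>
      by (cases "growth_bound \<P> (L_wedge \<tau>) Gm") auto
    from growth_bound_decay[OF this] obtain w D where w: "w < - \<nu>\<^sub>0 - \<kappa>" "0 \<le> D"
      "\<forall>t\<ge>0. \<forall>f\<in>L_wedge \<tau>. l2norm \<P> (Gm t f) \<le> D * exp (w * t) * l2norm \<P> f"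
      by (elim exE conjE)
    have wr\<kappa>: "wedge_resolvent \<tau> At G Gm (Complex (-\<nu>\<^sub>0) \<omega>) D \<kappa>" for \<omega>
      by (rule wr[OF _ w(2) _ w(3)]) (use w(1) \<kappa> in auto)
    \<comment> \<open>The constant of \<open>remainder_bound\<close> with W and N written out for
      real part \<open>-\<nu>\<^sub>0\<close>; no \<omega> occurs in it.\<close>
    define C where "C = real CARD('m set) * (4 * (secC + \<tau> * GmK) * max 1 (exp (\<nu>\<^sub>0 * \<tau>)) * (D / (1 - exp (- \<kappa> * \<tau>))) * D)"
    have C: "0 \<le> C"
    proof -
      interpret wr: wedge_resolvent \<tau> At G Gm "Complex (-\<nu>\<^sub>0) 0" D \<kappa> by (rule wr\<kappa>)
      show ?thesis unfolding C_def
        using secC_nonneg \<tau> GmK_ge_1 w(2) wr.N_nonneg[unfolded wr.N_def] by (intro mult_nonneg_nonneg add_nonneg_nonneg) auto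
    qed
    show "\<exists>C>0. \<forall>\<omega>. \<forall>\<Phi>\<in>\<Y>. \<forall>T\<ge>0. E_tensor_norm \<tau> (R T (Complex (-\<nu>\<^sub>0) \<omega>) \<Phi>) \<le> C * exp (- \<kappa> * T) * l2norm \<P> \<Phi>"
    \<comment> \<open>C vanishes when D does, whereas a positive constant is required.\<close>
    proof (intro exI[of _ "C + 1"] conjI allI ballI impI)
      show "0 < C + 1" using C by simp
      fix \<omega> T :: real and \<Phi> assume \<Phi>: "\<Phi> \<in> \<Y>" and T: "0 \<le> T"
      interpret wr: wedge_resolvent \<tau> At G Gm "Complex (-\<nu>\<^sub>0) \<omega>" D \<kappa> by (rule wr\<kappa>)
      note R' = conjunct1[OF R[OF \<Phi> T, of \<omega>]] conjunct2[OF R[OF \<Phi> T, of \<omega>]]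
      have "E_tensor_norm \<tau> (R T (Complex (-\<nu>\<^sub>0) \<omega>) \<Phi>) \<le> C * exp (- \<kappa> * T) * l2norm \<P> \<Phi>"
        using wr.remainder_bound[OF \<Phi> T R'] unfolding C_def wr.W_def wr.N_def by simp
      also have "\<dots> \<le> (C + 1) * exp (- \<kappa> * T) * l2norm \<P> \<Phi>" by (intro mult_right_mono) auto
      finally show "E_tensor_norm \<tau> (R T (Complex (-\<nu>\<^sub>0) \<omega>) \<Phi>) \<le> (C + 1) * exp (- \<kappa> * T) * l2norm \<P> \<Phi>" .
    qed
  qed
qed

end
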